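(* Let $(\varphi_n)_{n\ge0}\subset\mathcal H$ be a sequence of unit vectors and let $m>0$. There exists $\delta_0=\delta_0(m)>0$ such that for every $\delta\in(0,\delta_0)$, setting $\varphi_{n;\mathrm{out}}=P_\delta(W_{n,m;\mathrm{out}})\varphi_n$, $\varphi_{n;\mathrm{in}}=P_\delta(W_{n,m;\mathrm{in}})\varphi_n$, $\varphi_{n;\mathrm{sur}}=P_\delta(W_{n,m;\mathrm{sur}})\varphi_n$, one has $\varphi_n=\varphi_{n;\mathrm{out}}+\varphi_{n;\mathrm{in}}+\varphi_{n;\mathrm{sur}}$, $P_\delta(W_{n,m;\mathrm{far}})\varphi_n=\varphi_{n;\mathrm{out}}+\varphi_{n;\mathrm{in}}$, and $$\lim_{n\to\infty}\|(\Omega^--\mathrm{id})\varphi_{n;\mathrm{out}}\|=\lim_{n\to\infty}\|(\Omega^+-\mathrm{id})\varphi_{n;\mathrm{in}}\|=0.$$ If additionally $\varphi_n=e^{-it_nH}\varphi$ for some $\varphi\in\mathcal H$ and some sequence of positive times $(t_n)$, then also $\lim_{n\to\infty}\|\varphi_{n;\mathrm{in}}\|=0$.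
   Context: Setting: integers $d\ge2$, $1\le k<d$; $x=(x^\parallel,x^\perp)\in\mathbb R^k\times\mathbb R^{d-k}$; $\mathcal H=L^2(\mathbb R^d)$; $H_0=-\Delta$; $S_R=\{x:\|x^\perp\|\le R\}$; $V$ real, measurable, $\sup|V|=M<\infty$, $\operatorname{supp}V\subset S_{r_0}$ for some $r_0>0$; $H=H_0+V$; $\Omega^\pm=\operatorname{s-lim}_{t\to\mp\infty}e^{itH}e^{-itH_0}$ (these exist). $B_r$ denotes the closed ball of radius $r$ about $0$ in the relevant Euclidean space. Phase-space observables: Fourier transform $\hat f(\xi)=(2\pi)^{-d/2}\int f(x)e^{-ix\cdot\xi}dx$. Fix $\eta=\eta^\parallel\otimes\eta^\perp$ with $\eta^\parallel\in\mathcal S(\mathbb R^k)$, $\eta^\perp\in\mathcal S(\mathbb R^{d-k})$, $\|\eta^\parallel\|=\|\eta^\perp\|=1$, $\operatorname{supp}\hat\eta\subset B_1$. For $\delta>0$ let $\hat\eta_\delta(p)=\delta^{-d/2}\hat\eta(p/\delta)$ and for $(x,p)\in\mathbb R^d\times\mathbb R^d$ let $\eta_{x,p;\delta}(y)=e^{ip\cdot(y-x)}\eta_\delta(y-x)$. For a Borel set $E\subset\mathbb R^{2d}$, $P_\delta(E)\psi=(2\pi)^{-d}\iint_E\langle\eta_{x,p;\delta},\psi\rangle\,\eta_{x,p;\delta}\,dx\,dp$ (weak integral). Points of $\mathbb R^{2d}$ are written $(x^\parallel,p^\parallel,x^\perp,p^\perp)\in\mathbb R^k\times\mathbb R^k\times\mathbb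 R^{d-k}\times\mathbb R^{d-k}$. Define $W_{n,m;\mathrm{far}}=\{\|x^\perp\|>n,\ \|p^\perp\|>m\}$, $W_{n,m;\mathrm{sur}}=\mathbb R^{2d}\setminus W_{n,m;\mathrm{far}}$, $W_{n,m;\mathrm{out}}=\{(x^\parallel,p^\parallel,x^\perp,p^\perp)\in W_{n,m;\mathrm{far}}:\langle x^\perp,p^\perp\rangle\ge0\}$, $W_{n,m;\mathrm{in}}=\{(x^\parallel,p^\parallel,x^\perp,p^\perp)\in W_{n,m;\mathrm{far}}:\langle x^\perp,p^\perp\rangle<0\}$. *)

theory Defs
  imports "HOL-Analysis.Analysis"
begin

section \<open>L^2 functions (handled through representatives, modulo a.e. equality)\<close>

definition sq_int :: "('a::euclidean_space \<Rightarrow> complex) \<Rightarrow> bool" where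
  "sq_int f \<longleftrightarrow> f \<in> borel_measurable lebesgue \<and> integrable lebesgue (\<lambda>x. (cmod (f x))\<^sup>2)"

definition l2norm :: "('a::euclidean_space \<Rightarrow> complex) \<Rightarrow> real" where
  "l2norm f = sqrt (\<integral>x. (cmod (f x))\<^sup>2 \<partial>lebesgue)"

definition l2inner :: "('a::euclidean_space \<Rightarrow> complex) \<Rightarrow> ('a \<Rightarrow> complex) \<Rightarrow> complex" where
  "l2inner f g = (\<integral>x. cnj (f x) * g x \<partial>lebesgue)"

definition l2eq :: "('a::euclidean_space \<Rightarrow> complex) \<Rightarrow> ('a \<Rightarrow> complex) \<Rightarrow> bool" where
  "l2eq f g \<longleftrightarrow> (AE x in lebesgue. f x = g x)"

definition fourier :: "('a::euclidean_space \<Rightarrow> complex) \<Rightarrow> 'a \<Rightarrow> complex" where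
  "fourier f \<xi> = complex_of_real ((2 * pi) powr (- real DIM('a) / 2)) *
     (\<integral>x. exp (- \<i> * complex_of_real (x \<bullet> \<xi>)) * f x \<partial>lebesgue)"

definition ifourier :: "('a::euclidean_space \<Rightarrow> complex) \<Rightarrow> 'a \<Rightarrow> complex" where
  "ifourier f x = complex_of_real ((2 * pi) powr (- real DIM('a) / 2)) *
     (\<integral>\<xi>. exp (\<i> * complex_of_real (x \<bullet> \<xi>)) * f \<xi> \<partial>lebesgue)"

definition fourierL2 :: "('a::euclidean_space \<Rightarrow> complex) \<Rightarrow> 'a \<Rightarrow> complex" where
  "fourierL2 f = (SOME g. sq_int g \<and>
     ((\<lambda>R::real. l2norm (\<lambda>\<xi>. fourier (\<lambda>x. indicator (ball 0 R) x * f x) \<xi> - g \<xi>)) \<longlongrightarrow> 0) at_top)"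

definition ifourierL2 :: "('a::euclidean_space \<Rightarrow> complex) \<Rightarrow> 'a \<Rightarrow> complex" where
  "ifourierL2 f = (SOME g. sq_int g \<and>
     ((\<lambda>R::real. l2norm (\<lambda>x. ifourier (\<lambda>\<xi>. indicator (ball 0 R) \<xi> * f \<xi>) x - g x)) \<longlongrightarrow> 0) at_top)"

text \<open>Free evolution e^{-itH_0}, H_0 = -Laplacian (Fourier multiplier e^{-it|xi|^2}).\<close>
definition free_evol :: "real \<Rightarrow> ('a::euclidean_space \<Rightarrow> complex) \<Rightarrow> 'a \<Rightarrow> complex" where
  "free_evol t f = ifourierL2 (\<lambda>\<xi>. exp (- \<i> * complex_of_real (t * (norm \<xi>)\<^sup>2)) * fourierL2 f \<xi>)"

text \<open>Full evolution e^{-itH}, H = H_0 + V (V bounded), given by the Trotter product formula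
  e^{-itH} = s-lim (e^{-itH_0/n} e^{-itV/n})^n.\<close>
definition schr_evol :: "('a::euclidean_space \<Rightarrow> real) \<Rightarrow> real \<Rightarrow> ('a \<Rightarrow> complex) \<Rightarrow> 'a \<Rightarrow> complex" where
  "schr_evol V t f = (SOME g. sq_int g \<and>
     (\<lambda>n. l2norm (\<lambda>x. ((\<lambda>h. free_evol (t / real n)
           (\<lambda>y. exp (- \<i> * complex_of_real (t / real n * V y)) * h y)) ^^ n) f x - g x)) \<longlonglongrightarrow> 0)"

definition wave_minus :: "('a::euclidean_space \<Rightarrow> real) \<Rightarrow> ('a \<Rightarrow> complex) \<Rightarrow> 'a \<Rightarrow> complex" where
  "wave_minus V f = (SOME g. sq_int g \<and>
     ((\<lambda>t. l2norm (\<lambda>x. schr_evol V (- t) (free_evol t f) x - g x)) \<longlongrightarrow> 0) at_top)"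

definition wave_plus :: "('a::euclidean_space \<Rightarrow> real) \<Rightarrow> ('a \<Rightarrow> complex) \<Rightarrow> 'a \<Rightarrow> complex" where
  "wave_plus V f = (SOME g. sq_int g \<and>
     ((\<lambda>t. l2norm (\<lambda>x. schr_evol V (- t) (free_evol t f) x - g x)) \<longlongrightarrow> 0) at_bot)"

inductive_set pderivs :: "('a::euclidean_space \<Rightarrow> complex) \<Rightarrow> ('a \<Rightarrow> complex) set"
  for f :: "'a \<Rightarrow> complex" where
  base: "f \<in> pderivs f"
| step: "g \<in> pderivs f \<Longrightarrow> b \<in> Basis \<Longrightarrow>
         (\<And>x. ((\<lambda>t. g (x + t *\<^sub>R b)) has_vector_derivative h x) (at 0)) \<Longrightarrow> h \<in> pderivs f"

definition schwartz :: "('a::euclidean_space \<Rightarrow> complex) \<Rightarrow> bool" where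
  "schwartz f \<longleftrightarrow>
     (\<forall>g\<in>pderivs f. \<forall>b\<in>Basis. \<forall>x. (\<lambda>t::real. g (x + t *\<^sub>R b)) differentiable (at 0)) \<and>
     (\<forall>g\<in>pderivs f. \<forall>N::nat. bounded (range (\<lambda>x. (1 + norm x) ^ N *\<^sub>R g x)))"

definition tensor :: "('k \<Rightarrow> complex) \<Rightarrow> ('m \<Rightarrow> complex) \<Rightarrow> 'k \<times> 'm \<Rightarrow> complex" where
  "tensor f g x = f (fst x) * g (snd x)"

definition eta_delta :: "('a::euclidean_space \<Rightarrow> complex) \<Rightarrow> real \<Rightarrow> 'a \<Rightarrow> complex" where
  "eta_delta \<eta> \<delta> = ifourier (\<lambda>p. complex_of_real (\<delta> powr (- real DIM('a) / 2)) * fourier \<eta> ((1 / \<delta>) *\<^sub>R p))"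

definition coh :: "('a::euclidean_space \<Rightarrow> complex) \<Rightarrow> real \<Rightarrow> 'a \<times> 'a \<Rightarrow> 'a \<Rightarrow> complex" where
  "coh \<eta> \<delta> z y = exp (\<i> * complex_of_real (snd z \<bullet> (y - fst z))) * eta_delta \<eta> \<delta> (y - fst z)"

definition P_delta :: "('a::euclidean_space \<Rightarrow> complex) \<Rightarrow> real \<Rightarrow> ('a \<times> 'a) set \<Rightarrow> ('a \<Rightarrow> complex) \<Rightarrow> 'a \<Rightarrow> complex" where
  "P_delta \<eta> \<delta> E \<psi> = (SOME chi. sq_int chi \<and> (\<forall>\<phi>. sq_int \<phi> \<longrightarrow>
     l2inner \<phi> chi = complex_of_real ((2 * pi) powr (- real DIM('a))) *
       (\<integral>z. indicator E z * (l2inner (coh \<eta> \<delta> z) \<psi> * l2inner \<phi> (coh \<eta> \<delta> z)) \<partial>lebesgue)))"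

text \<open>Phase-space regions; a point is ((x_par, x_perp), (p_par, p_perp)).\<close>
definition W_far :: "nat \<Rightarrow> real \<Rightarrow> (('k::euclidean_space \<times> 'm::euclidean_space) \<times> ('k \<times> 'm)) set" where
  "W_far n m = {z. norm (snd (fst z)) > real n \<and> norm (snd (snd z)) > m}"

definition W_sur :: "nat \<Rightarrow> real \<Rightarrow> (('k::euclidean_space \<times> 'm::euclidean_space) \<times> ('k \<times> 'm)) set" where
  "W_sur n m = UNIV - W_far n m"

definition W_out :: "nat \<Rightarrow> real \<Rightarrow> (('k::euclidean_space \<times> 'm::euclidean_space) \<times> ('k \<times> 'm)) set" where
  "W_out n m = {z \<in> W_far n m. snd (fst z) \<bullet> snd (snd z) \<ge> 0}"

definition W_in :: "nat \<Rightarrow> real \<Rightarrow> (('k::euclidean_space \<times> 'm::euclidean_space) \<times> ('k \<times> 'm)) set" where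
  "W_in n m = {z \<in> W_far n m. snd (fst z) \<bullet> snd (snd z) < 0}"

end

theory Submission
  imports Defs "HOL-Probability.Probability"
begin

text \<open>Let B(t) be the free and U(t) the full evolution. Pairing the Trotter product with a fixed
  vector h identifies it in the limit with the interaction-picture equation v' = K(t) v, v(0) = h, so that
  U(-t) B(t) f moves by at most the integral of the norm of V B(s) f (Cook's argument). For f = P(E) w, with E
  the outgoing region, this norm is bounded by a Hilbert-Schmidt estimate: integrating out the parallel variables
  with the resolution of the identity leaves the perpendicular coherent states, and on the support of V
  nonstationary phase makes these decay rapidly in position, momentum and time, because their momenta stay
  above m - r for a window of bandwidth r. The resulting bound is integrable in time and tends to 0 as
  n grows, uniformly over unit vectors w. The incoming case is the time reversal of this. For the last
  claim, taking adjoints compares P(in) U(t) with P(in) B(t), and the latter tends to 0 strongly as n grows,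
  uniformly in t > 0.\<close>

subsection \<open>Trotter products and the interaction picture\<close>

text \<open>The smallness of \<open>\<delta>\<close> has one source. With q in the support of the
  window's transform, the phase gradient is y - x - 2 s (p + q). In an outgoing configuration its
  part without q has norm at least |s| |p| > |s| m, while 2 s q is at most 2 |s|
  \<open>\<delta>\<close>. Integrating by parts along one coordinate costs the perpendicular
  dimension, whence \<open>\<delta>0 = m / (8 * DIM)\<close>.

  The Hilbert-Schmidt bound behaves like s^(-2 DIM) and is not integrable at s = 0. Short times
  [0, e] are covered by boundedness of V alone at the price M e; e is fixed first and n enlarged
  afterwards.

  No unbounded operator H occurs: \<open>schr_evol\<close> is a Trotter limit, and the generator
  K(t) = -i B(-t) V B(t) is bounded, so its equation is solved by a Dyson series. Evolutions, wave
  operators and \<open>P_delta\<close> are representatives picked by \<open>SOME\<close>; they are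
  carried to a quotient space \<open>l2\<close>, where limits are unique.\<close>

lemma riesz_representation:
  fixes l :: "'h::{real_inner,banach} \<Rightarrow> real"
  assumes "bounded_linear l"
  shows "\<exists>x. \<forall>y. l y = inner y x"
proof -
  interpret l: bounded_linear l by fact
  obtain K where K: "\<And>x. norm (l x) \<le> norm x * K"
    using l.bounded by blast
  \<comment> \<open>The representing vector is the minimizer of this functional: the parallelogram
    law makes minimizing sequences Cauchy, and the first variation at the minimum is the
    claim.\<close>
  define J where "J u = (norm u)\<^sup>2 / 2 - l u" for u
  have Jlow: "J u \<ge> - K\<^sup>2 / 2" for u
  proof -
    have "l u \<le> norm u * K" using K[of u] by simp
    moreover have "0 \<le> (norm u - K)\<^sup>2" by simp
    ultimately show ?thesis unfolding J_def power2_diff by (simp add: field_simps)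
  qed
  define I where "I = Inf (range J)"
  have bdd: "bdd_below (range J)" using Jlow by (intro bdd_belowI2) auto
  have I: "I \<le> J u" for u unfolding I_def by (rule cInf_lower[OF _ bdd]) simp
  have "\<exists>u. J u < I + inverse (real (Suc n))" for n
    using cInf_lessD[of "range J" "I + inverse (real (Suc n))"] unfolding I_def by fastforce
  then obtain X where X: "\<And>n. J (X n) < I + inverse (real (Suc n))" by metis
  \<comment> \<open>Parallelogram identity at the midpoint of x and y, where \<open>J\<close> is
    still at least the infimum \<open>I\<close>.\<close>
  have par: "(norm (x - y))\<^sup>2 \<le> 4 * (J x + J y - 2 * I)" for x y
  proof -
    have "J ((1/2) *\<^sub>R (x + y)) = (J x + J y) / 2 - (norm (x - y))\<^sup>2 / 8"
      unfolding J_def power2_norm_eq_inner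
      by (simp add: l.scaleR l.add inner_add_left inner_add_right inner_diff_left inner_diff_right
          inner_commute field_simps)
    with I[of "(1/2) *\<^sub>R (x + y)"] show ?thesis by (simp add: field_simps)
  qed
  have "Cauchy X"
  proof (rule CauchyI)
    fix e :: real assume "0 < e"
    then have "e\<^sup>2 / 8 > 0" by simp
    then obtain N where N: "inverse (real (Suc N)) < e\<^sup>2 / 8" using reals_Archimedean by blast
    show "\<exists>M. \<forall>m\<ge>M. \<forall>n\<ge>M. norm (X m - X n) < e"
    proof (intro exI allI impI)
      fix m n assume mn: "N \<le> m" "N \<le> n"
      have "inverse (real (Suc m)) \<le> inverse (real (Suc N))" "inverse (real (Suc n)) \<le> inverse (real (Suc N))"
        using mn by (auto intro!: le_imp_inverse_le)
      then have "J (X m) + J (X n) - 2 * I < e\<^sup>2 / 4" using X[of m] X[of n] N by linarith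
      then have "4 * (J (X m) + J (X n) - 2 * I) < e\<^sup>2" by simp
      then have "(norm (X m - X n))\<^sup>2 < e\<^sup>2" by (rule le_less_trans[OF par])
      then show "norm (X m - X n) < e" using \<open>0 < e\<close> by (simp add: power_less_imp_less_base)
    qed
  qed
  then obtain x where x: "X \<longlonglongrightarrow> x" using Cauchy_convergent convergent_def by blast
  have "(\<lambda>n. J (X n)) \<longlonglongrightarrow> J x"
    unfolding J_def by (auto intro!: tendsto_intros l.tendsto x)
  moreover have "(\<lambda>n. I + inverse (real (Suc n))) \<longlonglongrightarrow> I + 0"
    by (intro tendsto_intros LIMSEQ_inverse_real_of_nat)
  ultimately have "J x \<le> I + 0"
    using X by (intro LIMSEQ_le) (auto intro: less_imp_le)
  then have min: "J x \<le> J u" for u using I[of u] by simp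
  have "l y = inner y x" for y
  proof -
    define d where "d = inner y x - l y"
    have *: "0 \<le> t * d + t\<^sup>2 * (norm y)\<^sup>2 / 2" for t
      using min[of "x + t *\<^sub>R y"] unfolding J_def d_def power2_norm_eq_inner
      by (simp add: l.scaleR l.add inner_add_left inner_add_right inner_commute field_simps power2_eq_square)
    have "d = 0"
    proof (rule ccontr)
      assume "d \<noteq> 0"
      define a where "a = (norm y)\<^sup>2 + 1"
      have a: "a > 0" "(norm y)\<^sup>2 \<le> a" unfolding a_def by (auto intro: add_nonneg_pos)
      \<comment> \<open>The step t = - d / a is close to the minimizer of the quadratic; the summand
        1 in \<open>a\<close> covers y = 0.\<close>
      have "0 \<le> (- d / a) * d + (- d / a)\<^sup>2 * (norm y)\<^sup>2 / 2" by (rule *)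
      also have "\<dots> \<le> (- d / a) * d + (- d / a)\<^sup>2 * a / 2"
        using a by (intro add_left_mono divide_right_mono mult_left_mono) auto
      also have "\<dots> = - d\<^sup>2 / (2 * a)" using a by (simp add: field_simps power2_eq_square)
      also have "\<dots> < 0" using a \<open>d \<noteq> 0\<close> by (simp add: field_simps)
      finally show False by simp
    qed
    then show ?thesis unfolding d_def by simp
  qed
  then show ?thesis by blast
qed

text \<open>\<open>K\<close> is continuous only strongly, not in operator norm. So the value at r is
  split as K(r) d(s) + K(r) (d(r) - d(s)): strong continuity handles the first summand, the uniform
  bound \<open>M\<close> the second.\<close>

lemma continuous_on_strong_apply:
  fixes K :: "real \<Rightarrow> 'h::real_normed_vector \<Rightarrow> 'g::real_normed_vector"
  assumes lin: "\<And>s. bounded_linear (K s)" and bd: "\<And>s u. norm (K s u) \<le> M * norm u"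
    and cont: "\<And>u. continuous_on UNIV (\<lambda>s. K s u)" and d: "continuous_on A d"
  shows "continuous_on A (\<lambda>s. K s (d s))"
  unfolding continuous_on_def
proof
  fix s assume s: "s \<in> A"
  have 1: "((\<lambda>r. K r (d s)) \<longlongrightarrow> K s (d s)) (at s within A)"
    using cont[of "d s"] continuous_on_subset[OF _ subset_UNIV] s unfolding continuous_on_def
    by (meson UNIV_I tendsto_within_subset subset_UNIV)
  have 2: "((\<lambda>r. K r (d r - d s)) \<longlongrightarrow> 0) (at s within A)"
  proof (rule Lim_null_comparison)
    show "\<forall>\<^sub>F r in at s within A. norm (K r (d r - d s)) \<le> M * norm (d r - d s)"
      using bd by simp
    have "((\<lambda>r. d r - d s) \<longlongrightarrow> 0) (at s within A)"
      using d s unfolding continuous_on_def by (simp add: LIM_zero)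
    then have "((\<lambda>r. M * norm (d r - d s)) \<longlongrightarrow> M * norm (0::'h)) (at s within A)"
      by (intro tendsto_intros)
    then show "((\<lambda>r. M * norm (d r - d s)) \<longlongrightarrow> 0) (at s within A)" by simp
  qed
  have "((\<lambda>r. K r (d s) + K r (d r - d s)) \<longlongrightarrow> K s (d s) + 0) (at s within A)"
    by (intro tendsto_add 1 2)
  moreover have "K r (d s) + K r (d r - d s) = K r (d r)" for r
    using lin[of r] by (simp add: bounded_linear_def linear_diff)
  ultimately show "((\<lambda>r. K r (d r)) \<longlongrightarrow> K s (d s)) (at s within A)" by simp
qed

text \<open>Dyson series. The iterated integrals \<open>d k\<close> are bounded by norm h (M t)^k /
  k!, so their sum converges uniformly on bounded intervals and gives a single solution on the whole
  half-line.\<close>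

lemma linear_ode_solution:
  fixes K :: "real \<Rightarrow> 'h::banach \<Rightarrow> 'h"
  assumes lin: "\<And>s. bounded_linear (K s)" and bd: "\<And>s u. norm (K s u) \<le> M * norm u"
    and M: "0 \<le> M"
    and cont: "\<And>u. continuous_on UNIV (\<lambda>s. K s u)"
  shows "\<exists>v. v 0 = h \<and> (\<forall>t\<ge>0. (v has_vector_derivative K t (v t)) (at t within {0..}))"
proof -
  define d where "d = rec_nat (\<lambda>t::real. h) (\<lambda>k dk t. integral {0..t} (\<lambda>s. K s (dk s)))"
  have d0: "d 0 t = h" and dS: "d (Suc k) t = integral {0..t} (\<lambda>s. K s (d k s))" for t k
    by (simp_all add: d_def)
  note ca = continuous_on_strong_apply[OF lin bd cont]
  have dcont: "continuous_on {0..T} (d k)" for k T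
  proof (induction k)
    case 0 then show ?case by (simp add: d0[abs_def])
  next
    case (Suc k)
    have "(\<lambda>s. K s (d k s)) integrable_on {0..T}"
      by (intro integrable_continuous_real ca Suc)
    then show ?case unfolding dS[abs_def] by (rule indefinite_integral_continuous_1)
  qed
  have dder: "(d (Suc k) has_vector_derivative K t (d k t)) (at t within {0..T})" if "t \<in> {0..T}" for k t T
    unfolding dS[abs_def] by (intro integral_has_vector_derivative ca dcont that)
  have dbd: "norm (d k t) \<le> norm h * (M * t) ^ k / fact k" if "0 \<le> t" for k t
    using that
  proof (induction k arbitrary: t)
    case 0 then show ?case by (simp add: d0)
  next
    case (Suc k)
    show ?case
    proof (cases "t = 0")
      case True then show ?thesis by (simp add: dS)
    next
      case False
      with Suc have t: "0 < t" by simp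
      let ?p = "\<lambda>x. norm h * (M * x) ^ Suc k / fact (Suc k)"
      have "norm (d (Suc k) t - d (Suc k) 0) \<le> ?p t - ?p 0"
      proof (rule differentiable_bound_general[OF t dcont])
        show "continuous_on {0..t} ?p" by (intro continuous_intros) auto
        fix x assume x: "0 < x" "x < t"
        have "(d (Suc k) has_vector_derivative K x (d k x)) (at x within {0..t})"
          using x by (intro dder) auto
        then show "(d (Suc k) has_vector_derivative K x (d k x)) (at x)"
          using x by (metis at_within_Icc_at)
        define c where "c = norm h * M ^ Suc k / fact (Suc k)"
        have "((\<lambda>y. c * y ^ Suc k) has_real_derivative c * (real (Suc k) * x ^ k)) (at x)"
          using DERIV_cmult[OF DERIV_pow[of "Suc k" x]] by simp
        moreover have "?p = (\<lambda>y. c * y ^ Suc k)"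
          by (rule ext) (simp add: c_def power_mult_distrib)
        moreover have "c * (real (Suc k) * x ^ k) = M * (norm h * (M * x) ^ k / fact k)"
          unfolding c_def fact_Suc by (simp add: power_mult_distrib)
        ultimately show "(?p has_vector_derivative M * (norm h * (M * x) ^ k / fact k)) (at x)"
          by (simp only: has_real_derivative_iff_has_vector_derivative)
        show "norm (K x (d k x)) \<le> M * (norm h * (M * x) ^ k / fact k)"
          using order_trans[OF bd[of x "d k x"] mult_left_mono[OF Suc.IH[of x] M]] x by simp
      qed
      moreover have "d (Suc k) 0 = 0" by (simp add: dS)
      ultimately show ?thesis by simp
    qed
  qed
  define v where "v t = (\<Sum>k. d k t)" for t
  have unif: "uniform_limit {0..T} (\<lambda>n t. \<Sum>k<n. d k t) v sequentially" if "0 \<le> T" for T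
    unfolding v_def
  proof (rule Weierstrass_m_test)
    fix n t assume "t \<in> {0..T}"
    then have t: "0 \<le> t" "t \<le> T" by auto
    have "norm h * (M * t) ^ n / fact n \<le> norm h * (M * T) ^ n / fact n"
      using t M by (intro divide_right_mono mult_left_mono power_mono) auto
    then show "norm (d n t) \<le> norm h * (M * T) ^ n / fact n"
      using dbd[OF t(1), of n] by linarith
  next
    have "summable (\<lambda>n. norm h * (inverse (fact n) * (M * T) ^ n))"
      by (intro summable_mult summable_exp)
    then show "summable (\<lambda>n. norm h * (M * T) ^ n / fact n)"
      by (simp add: field_simps)
  qed
  have vcont: "continuous_on {0..T} v" if "0 \<le> T" for T
    by (rule uniform_limit_theorem[OF _ unif[OF that]]) (auto intro!: continuous_on_sum dcont always_eventually)
  \<comment> \<open>Partial sums satisfy the integral equation with an index shift;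
    \<open>veq\<close> passes to the limit in it, using the bound \<open>M\<close> and uniform
    convergence.\<close>
  have S: "(\<Sum>k<Suc n. d k t) = h + integral {0..t} (\<lambda>s. K s (\<Sum>k<n. d k s))" if "0 \<le> t" for n t
  proof -
    have "integral {0..t} (\<lambda>s. K s (\<Sum>k<n. d k s)) = integral {0..t} (\<lambda>s. \<Sum>k<n. K s (d k s))"
      using lin by (simp add: bounded_linear_def linear_sum)
    also have "\<dots> = (\<Sum>k<n. integral {0..t} (\<lambda>s. K s (d k s)))"
      by (intro integral_sum integrable_continuous_real ca dcont) auto
    also have "\<dots> = (\<Sum>k<n. d (Suc k) t)" by (simp add: dS)
    finally show ?thesis unfolding sum.lessThan_Suc_shift by (simp add: d0)
  qed
  have veq: "v t = h + integral {0..t} (\<lambda>s. K s (v s))" if t: "0 \<le> t" for t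
  proof -
    have 1: "(\<lambda>n. \<Sum>k<Suc n. d k t) \<longlonglongrightarrow> v t"
      using tendsto_uniform_limitI[OF unif[OF t], of t] t by (subst filterlim_sequentially_Suc) auto
    have "(\<lambda>n. integral {0..t} (\<lambda>s. K s (\<Sum>k<n. d k s)) - integral {0..t} (\<lambda>s. K s (v s))) \<longlonglongrightarrow> 0"
    proof (rule LIMSEQ_I)
      fix e :: real assume e: "0 < e"
      define e' where "e' = e / (M * t + 1)"
      have Mt: "0 < M * t + 1" using M t by (simp add: add_nonneg_pos)
      then have e': "0 < e'" using e by (simp add: e'_def)
      obtain N where N: "\<And>n s. n \<ge> N \<Longrightarrow> s \<in> {0..t} \<Longrightarrow> dist (\<Sum>k<n. d k s) (v s) < e'"
        using uniform_limitD[OF unif[OF t] e'] unfolding eventually_sequentially by blast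
      show "\<exists>no. \<forall>n\<ge>no. norm (integral {0..t} (\<lambda>s. K s (\<Sum>k<n. d k s)) - integral {0..t} (\<lambda>s. K s (v s)) - 0) < e"
      proof (intro exI allI impI)
        fix n assume n: "N \<le> n"
        have c1: "continuous_on {0..t} (\<lambda>s. K s (\<Sum>k<n. d k s))"
          by (intro ca continuous_on_sum dcont)
        have c2: "continuous_on {0..t} (\<lambda>s. K s (v s))" by (intro ca vcont t)
        have "norm (integral {0..t} (\<lambda>s. K s (\<Sum>k<n. d k s)) - integral {0..t} (\<lambda>s. K s (v s)))
           = norm (integral {0..t} (\<lambda>s. K s (\<Sum>k<n. d k s) - K s (v s)))"
          by (subst integral_diff) (auto intro!: integrable_continuous_real c1 c2)
        also have "\<dots> \<le> M * e' * (t - 0)"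
        proof (rule integral_bound[OF t])
          show "continuous_on {0..t} (\<lambda>s. K s (\<Sum>k<n. d k s) - K s (v s))"
            by (intro continuous_intros c1 c2)
          fix s assume s: "s \<in> {0..t}"
          have "norm (K s (\<Sum>k<n. d k s) - K s (v s)) = norm (K s ((\<Sum>k<n. d k s) - v s))"
            using lin[of s] by (simp add: bounded_linear_def linear_diff)
          also have "\<dots> \<le> M * norm ((\<Sum>k<n. d k s) - v s)" by (rule bd)
          also have "\<dots> \<le> M * e'" using N[OF n s] M by (intro mult_left_mono) (auto simp: dist_norm)
          finally show "norm (K s (\<Sum>k<n. d k s) - K s (v s)) \<le> M * e'" .
        qed
        also have "\<dots> = e' * (M * t)" by simp
        also have "\<dots> < e' * (M * t + 1)" using e' by (intro mult_strict_left_mono) auto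
        also have "\<dots> = e" using Mt by (simp add: e'_def)
        finally show "norm (integral {0..t} (\<lambda>s. K s (\<Sum>k<n. d k s)) - integral {0..t} (\<lambda>s. K s (v s)) - 0) < e"
          by simp
      qed
    qed
    then have "(\<lambda>n. integral {0..t} (\<lambda>s. K s (\<Sum>k<n. d k s))) \<longlonglongrightarrow> integral {0..t} (\<lambda>s. K s (v s))"
      by (rule LIM_zero_cancel)
    then have "(\<lambda>n. h + integral {0..t} (\<lambda>s. K s (\<Sum>k<n. d k s))) \<longlonglongrightarrow> h + integral {0..t} (\<lambda>s. K s (v s))"
      by (intro tendsto_intros)
    then have 2: "(\<lambda>n. \<Sum>k<Suc n. d k t) \<longlonglongrightarrow> h + integral {0..t} (\<lambda>s. K s (v s))"
      by (subst S[OF t])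
    show ?thesis by (rule LIMSEQ_unique[OF 1 2])
  qed
  have "(v has_vector_derivative K t (v t)) (at t within {0..})" if t: "t \<ge> 0" for t
  proof -
    have "((\<lambda>u. integral {0..u} (\<lambda>s. K s (v s))) has_vector_derivative K t (v t)) (at t within {0..t+1})"
      using t by (intro integral_has_vector_derivative ca vcont) auto
    then have "((\<lambda>u. h + integral {0..u} (\<lambda>s. K s (v s))) has_vector_derivative 0 + K t (v t)) (at t within {0..t+1})"
      by (intro derivative_intros)
    then have "((\<lambda>u. h + integral {0..u} (\<lambda>s. K s (v s))) has_vector_derivative K t (v t)) (at t within {0..t+1})"
      by simp
    then have "(v has_vector_derivative K t (v t)) (at t within {0..t+1})"
      by (rule has_vector_derivative_transform[rotated 2]) (use t veq in auto)
    moreover have "at t within {0..t+1} = at t within {0..}"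
      by (rule at_within_nhd[of _ "{t-1<..<t+1}"]) auto
    ultimately show ?thesis by simp
  qed
  moreover have "v 0 = h" using veq[of 0] by simp
  ultimately show ?thesis by blast
qed

text \<open>\<open>B\<close> stands for the free group, \<open>X t\<close> for multiplication by
  exp(-i t V) and \<open>J\<close> for -i V; \<open>X_J\<close> is a second-order Taylor bound,
  uniform over unit vectors. The abstraction pays off because reversing time turns one instance into
  another, see \<open>neg\<close>.\<close>

locale trotter_data =
  fixes B X :: "real \<Rightarrow> 'h::{real_inner,banach} \<Rightarrow> 'h" and J :: "'h \<Rightarrow> 'h" and M C :: real
  assumes B_lin: "\<And>t. bounded_linear (B t)" and B_norm: "\<And>t u. norm (B t u) = norm u"
    and B_add: "\<And>s t u. B (s + t) u = B s (B t u)" and B_0: "\<And>u. B 0 u = u"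
    and B_cont: "\<And>u. continuous_on UNIV (\<lambda>t. B t u)"
    and X_lin: "\<And>t. bounded_linear (X t)" and X_norm: "\<And>t u. norm (X t u) = norm u"
    and X_inv: "\<And>t u. X (- t) (X t u) = u"
    and J_lin: "bounded_linear J" and J_bd: "\<And>u. norm (J u) \<le> M * norm u"
    and J_skew: "\<And>u v. inner (J u) v = - inner u (J v)"
    and M0: "0 \<le> M" and C0: "0 \<le> C"
    and X_J: "\<And>t u. norm (X t u - u - t *\<^sub>R J u) \<le> C * t\<^sup>2 * norm u"
begin

lemma B_inv: "B (- t) (B t u) = u" "B t (B (- t) u) = u"
  using B_add[of "- t" t u] B_add[of t "- t" u] B_0 by simp_all

lemma isometry_inner:
  assumes "bounded_linear A" "\<And>u. norm (A u) = norm (u::'h)"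
  shows "inner (A u) (A v) = inner u v"
proof -
  interpret A: bounded_linear A by fact
  have "(norm (A (u + v)))\<^sup>2 = (norm (u + v))\<^sup>2" by (simp add: assms)
  then have "inner (A u) (A u) + 2 * inner (A u) (A v) + inner (A v) (A v) = inner u u + 2 * inner u v + inner v v"
    unfolding power2_norm_eq_inner A.add by (simp add: inner_add_left inner_add_right inner_commute)
  moreover have "inner (A w) (A w) = inner w w" for w
    by (simp add: assms power2_norm_eq_inner[symmetric])
  ultimately show ?thesis by simp
qed

lemma B_adj: "inner (B t u) v = inner u (B (- t) v)"
  using isometry_inner[OF B_lin B_norm, of t u "B (- t) v"] by (simp add: B_inv)

lemma X_adj: "inner (X t u) v = inner u (X (- t) v)"
  using isometry_inner[OF X_lin X_norm, of t u "X (- t) v"] X_inv[of "- t" v] by simp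

definition step where "step t w = B t (X t w)"
definition trot where "trot n t u = (step (t / real n) ^^ n) u"
definition K where "K s u = B (- s) (J (B s u))"
text \<open>\<open>lim\<close> acquires its content through \<open>trot_lim\<close>, which proves
  convergence for every time.\<close>

definition U where "U t u = lim (\<lambda>n. trot n t u)"

lemma K_lin: "bounded_linear (K s)"
  unfolding K_def by (intro bounded_linear_compose[OF B_lin] bounded_linear_compose[OF J_lin] B_lin)

lemma K_bd: "norm (K s u) \<le> M * norm u"
  unfolding K_def B_norm using J_bd[of "B s u"] B_norm by simp

lemma K_cont: "continuous_on UNIV (\<lambda>s. K s u)"
proof -
  interpret J: bounded_linear J by (rule J_lin)
  have "continuous_on UNIV (\<lambda>s. B (- s) w)" for w
    by (rule continuous_on_compose2[OF B_cont]) (auto intro!: continuous_intros)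
  then show ?thesis unfolding K_def
    using continuous_on_strong_apply[where K="\<lambda>s. B (- s)" and M=1, OF B_lin _ _ J.continuous_on[OF B_cont[of u]]]
    by (simp add: B_norm)
qed

lemma step_lin: "bounded_linear (step t)"
  unfolding step_def by (intro bounded_linear_compose[OF B_lin] X_lin)

lemma funpow_lin: "bounded_linear A \<Longrightarrow> bounded_linear (A ^^ n)" for A :: "'h \<Rightarrow> 'h"
  by (induction n) (auto simp: id_def comp_def intro: bounded_linear_compose bounded_linear_ident)

lemma trot_lin: "bounded_linear (trot n t)"
  unfolding trot_def by (intro funpow_lin step_lin)

lemma trot_norm: "norm (trot n t u) = norm u"
proof -
  have "norm ((step s ^^ k) u) = norm u" for s k
    by (induction k) (auto simp: step_def B_norm X_norm)
  then show ?thesis by (simp add: trot_def)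
qed

definition "is_sol h v \<longleftrightarrow> v 0 = h \<and> (\<forall>t\<ge>0. (v has_vector_derivative K t (v t)) (at t within {0..}))"

lemma sol_ex: "\<exists>v. is_sol h v"
  unfolding is_sol_def by (intro linear_ode_solution[OF K_lin K_bd M0 K_cont])

lemma sol_cont: "is_sol h v \<Longrightarrow> continuous_on {0..T} v"
  unfolding is_sol_def
  by (rule continuous_on_subset[of "{0..}"])
     (auto simp: continuous_on_eq_continuous_within intro: has_vector_derivative_continuous)

lemma sol_deriv: "is_sol h v \<Longrightarrow> 0 < t \<Longrightarrow> (v has_vector_derivative K t (v t)) (at t)"
  unfolding is_sol_def using at_within_interior[of t "{0::real..}"]
  by (metis interior_real_atLeast greaterThan_iff less_imp_le)

text \<open>In the interaction picture one step becomes E(r) = B(-r) X(tau) B(r), which differs from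
  1 + tau K(r) by O(tau^2). The solution moves by tau K(r) v(r) up to tau \<open>e1\<close>, by
  uniform continuity of K(r) v(r) in r. Each E(r) is an isometry, so the n local errors merely add
  up.\<close>

lemma trot_conv_sol:
  assumes v: "is_sol h v" and t: "0 \<le> t"
  shows "(\<lambda>n. trot n t h) \<longlonglongrightarrow> B t (v t)"
proof (rule LIMSEQ_I)
  fix e :: real assume e: "0 < e"
  define F where "F s = K s (v s)" for s
  have Fc: "continuous_on {0..t} F" unfolding F_def
    by (intro continuous_on_strong_apply[OF K_lin K_bd K_cont] sol_cont[OF v])
  have "bounded (v ` {0..t})"
    by (intro compact_imp_bounded compact_continuous_image sol_cont[OF v]) auto
  then obtain b where b: "b > 0" "\<And>s. s \<in> {0..t} \<Longrightarrow> norm (v s) \<le> b"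
    unfolding bounded_pos by blast
  \<comment> \<open>\<open>e1\<close> keeps the accumulated drift error t \<open>e1\<close> below e
    / 2. \<open>N1\<close> makes the step shorter than the modulus \<open>dd\<close>, and
    \<open>N2\<close> pushes the accumulated Taylor error C t^2 b / n below e / 2.\<close>
  define e1 where "e1 = e / (2 * (t + 1))"
  have e1: "0 < e1" using e t by (simp add: e1_def)
  have "uniformly_continuous_on {0..t} F" by (intro compact_uniformly_continuous Fc) auto
  then obtain dd where dd: "dd > 0"
    "\<And>r s. r \<in> {0..t} \<Longrightarrow> s \<in> {0..t} \<Longrightarrow> dist s r < dd \<Longrightarrow> dist (F s) (F r) < e1"
    unfolding uniformly_continuous_on_def using e1 by metis
  obtain N1 where N1: "t / dd < real N1" using reals_Archimedean2 by blast
  obtain N2 where N2: "2 * C * t\<^sup>2 * b / e < real N2" using reals_Archimedean2 by blast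
  show "\<exists>no. \<forall>n\<ge>no. norm (trot n t h - B t (v t)) < e"
  proof (intro exI allI impI)
    fix n assume n: "max (max N1 N2) 1 \<le> n"
    then have n0: "0 < real n" by simp
    define \<tau> where "\<tau> = t / real n"
    have nt: "real n * \<tau> = t" using n0 by (simp add: \<tau>_def)
    have \<tau>0: "0 \<le> \<tau>" using t by (simp add: \<tau>_def)
    have "t / dd < real n" using N1 n by linarith
    then have \<tau>d: "\<tau> < dd" using n0 dd(1) by (simp add: \<tau>_def field_simps)
    define E where "E r w = B (- r) (X \<tau> (B r w))" for r w
    have E1: "E r w - E r w' = E r (w - w')" for r w w'
      unfolding E_def using B_lin X_lin by (simp add: bounded_linear_def linear_diff)
    have E2: "norm (E r w) = norm w" for r w unfolding E_def by (simp add: B_norm X_norm)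
    have E3: "norm (E r w - w - \<tau> *\<^sub>R K r w) \<le> C * \<tau>\<^sup>2 * norm w" for r w
    proof -
      have "E r w - w - \<tau> *\<^sub>R K r w = B (- r) (X \<tau> (B r w) - B r w - \<tau> *\<^sub>R J (B r w))"
        unfolding E_def K_def using B_lin[of "- r"] by (simp add: bounded_linear_def linear_diff linear_scale B_inv)
      then show ?thesis using X_J[of \<tau> "B r w"] by (simp add: B_norm)
    qed
    have loc: "norm (v (r + \<tau>) - E r (v r)) \<le> \<tau> * e1 + C * \<tau>\<^sup>2 * b" if r: "0 \<le> r" "r + \<tau> \<le> t" for r
    proof -
      have 1: "norm (v (r + \<tau>) - v r - \<tau> *\<^sub>R F r) \<le> \<tau> * e1"
      proof (cases "\<tau> = 0")
        case True then show ?thesis by simp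
      next
        case False
        then have "\<tau> > 0" using \<tau>0 by simp
        have "norm ((v (r + \<tau>) - (r + \<tau>) *\<^sub>R F r) - (v r - r *\<^sub>R F r)) \<le> (\<lambda>x. e1 * x) (r + \<tau>) - (\<lambda>x. e1 * x) r"
        proof (rule differentiable_bound_general[where f="\<lambda>x. v x - x *\<^sub>R F r" and f'="\<lambda>x. F x - F r" and \<phi>'="\<lambda>x. e1"])
          show "r < r + \<tau>" using \<open>\<tau> > 0\<close> by simp
          show "continuous_on {r..r + \<tau>} (\<lambda>x. v x - x *\<^sub>R F r)"
            using r by (intro continuous_intros continuous_on_subset[OF sol_cont[OF v, of t]]) auto
          show "continuous_on {r..r + \<tau>} (\<lambda>x. e1 * x)" by (intro continuous_intros)
          fix x assume x: "r < x" "x < r + \<tau>"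
          have "((\<lambda>x. v x - x *\<^sub>R F r) has_vector_derivative F x - 1 *\<^sub>R F r) (at x)"
            unfolding F_def[of x] using x r
            by (intro derivative_intros sol_deriv[OF v]) (auto intro!: derivative_eq_intros)
          then show "((\<lambda>x. v x - x *\<^sub>R F r) has_vector_derivative F x - F r) (at x)" by simp
          show "((\<lambda>x. e1 * x) has_vector_derivative e1) (at x)"
            by (auto intro!: derivative_eq_intros simp: has_real_derivative_iff_has_vector_derivative[symmetric])
          have "dist (F x) (F r) < e1" using x r \<tau>d \<tau>0 by (intro dd(2)) (auto simp: dist_real_def)
          then show "norm (F x - F r) \<le> e1" by (simp add: dist_norm)
        qed
        then show ?thesis by (simp add: algebra_simps)
      qed
      have "norm (v r) \<le> b" using r \<tau>0 by (intro b(2)) auto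
      then have 2: "norm (E r (v r) - v r - \<tau> *\<^sub>R F r) \<le> C * \<tau>\<^sup>2 * b"
        unfolding F_def by (intro order_trans[OF E3] mult_left_mono) (use C0 in auto)
      have "v (r + \<tau>) - E r (v r) = (v (r + \<tau>) - v r - \<tau> *\<^sub>R F r) - (E r (v r) - v r - \<tau> *\<^sub>R F r)" by simp
      then have "norm (v (r + \<tau>) - E r (v r)) \<le> norm (v (r + \<tau>) - v r - \<tau> *\<^sub>R F r) + norm (E r (v r) - v r - \<tau> *\<^sub>R F r)"
        by (metis norm_triangle_ineq4)
      then show ?thesis using 1 2 by linarith
    qed
    have main: "norm (B (- (real j * \<tau>)) ((step \<tau> ^^ j) h) - v (real j * \<tau>)) \<le> real j * (\<tau> * e1 + C * \<tau>\<^sup>2 * b)"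
      if "j \<le> n" for j
      using that
    proof (induction j)
      case 0 then show ?case using v by (simp add: B_0 is_sol_def)
    next
      case (Suc j)
      define r where "r = real j * \<tau>"
      define x where "x = B (- r) ((step \<tau> ^^ j) h)"
      have "real (Suc j) * \<tau> \<le> real n * \<tau>" using Suc(2) \<tau>0 by (intro mult_right_mono) auto
      then have r: "0 \<le> r" "r + \<tau> \<le> t" using \<tau>0 nt by (auto simp: r_def algebra_simps)
      have Sr: "real (Suc j) * \<tau> = r + \<tau>" by (simp add: r_def algebra_simps)
      have "B (- (r + \<tau>)) (B \<tau> w) = B (- r) w" for w
        using B_add[of "- (r + \<tau>)" \<tau> w] by simp
      then have "B (- (r + \<tau>)) ((step \<tau> ^^ Suc j) h) = E r x"
        unfolding x_def E_def by (simp add: step_def B_inv)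
      then have "B (- (r + \<tau>)) ((step \<tau> ^^ Suc j) h) - v (r + \<tau>) = E r (x - v r) - (v (r + \<tau>) - E r (v r))"
        using E1[of r x "v r"] by (simp add: algebra_simps)
      then have "norm (B (- (r + \<tau>)) ((step \<tau> ^^ Suc j) h) - v (r + \<tau>)) \<le> norm (E r (x - v r)) + norm (v (r + \<tau>) - E r (v r))"
        by (metis norm_triangle_ineq4)
      also have "\<dots> \<le> real j * (\<tau> * e1 + C * \<tau>\<^sup>2 * b) + (\<tau> * e1 + C * \<tau>\<^sup>2 * b)"
        using Suc loc[OF r] E2 unfolding r_def x_def by (intro add_mono) auto
      finally show ?case unfolding Sr by (simp add: algebra_simps)
    qed
    have "trot n t h - B t (v t) = B t (B (- (real n * \<tau>)) ((step \<tau> ^^ n) h) - v (real n * \<tau>))"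
      using B_lin[of t] unfolding nt trot_def \<tau>_def[symmetric]
      by (simp only: bounded_linear_def linear_diff B_inv)
    then have "norm (trot n t h - B t (v t)) \<le> real n * (\<tau> * e1 + C * \<tau>\<^sup>2 * b)"
      using main[of n] B_norm by simp
    also have "\<dots> = t * e1 + C * t\<^sup>2 * b / real n"
      using n0 by (simp add: \<tau>_def field_simps power2_eq_square)
    also have "\<dots> < e / 2 + e / 2"
    proof (rule add_le_less_mono)
      show "t * e1 \<le> e / 2" using t e unfolding e1_def by (simp add: field_simps)
      have "2 * C * t\<^sup>2 * b / e < real n" using N2 n by linarith
      then show "C * t\<^sup>2 * b / real n < e / 2" using n0 e by (simp add: field_simps)
    qed
    finally show "norm (trot n t h - B t (v t)) < e" by simp
  qed
qed

lemma U_sol: "is_sol h v \<Longrightarrow> 0 \<le> t \<Longrightarrow> U t h = B t (v t)"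
  unfolding U_def using trot_conv_sol limI by blast

lemma trot_lim_nonneg: "0 \<le> t \<Longrightarrow> (\<lambda>n. trot n t u) \<longlonglongrightarrow> U t u"
  using sol_ex[of u] trot_conv_sol U_sol by metis

text \<open>Time reversal is again an instance. Negative times are obtained from positive ones
  through it, and so is the limit in \<open>incoming_wave\<close>.\<close>

lemma neg: "trotter_data (\<lambda>t. B (- t)) (\<lambda>t. X (- t)) (\<lambda>u. - J u) M C"
proof (rule trotter_data.intro)
  fix s t u v
  show "B (- (s + t)) u = B (- s) (B (- t) u)" using B_add[of "- s" "- t" u] by simp
  show "continuous_on UNIV (\<lambda>t. B (- t) u)"
    by (rule continuous_on_compose2[OF B_cont]) (auto intro!: continuous_intros)
  show "X (- (- t)) (X (- t) u) = u" using X_inv[of "- t" u] by simp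
  show "norm (X (- t) u - u - t *\<^sub>R - J u) \<le> C * t\<^sup>2 * norm u" using X_J[of "- t" u] by simp
  show "inner (- J u) v = - inner u (- J v)" using J_skew by simp
qed (auto simp: B_norm X_norm B_0 X_lin B_lin bounded_linear_minus[OF J_lin] J_bd M0 C0)

lemma neg_trot: "trotter_data.trot (\<lambda>t. B (- t)) (\<lambda>t. X (- t)) n t u = trot n (- t) u"
  unfolding trotter_data.trot_def[OF neg] trot_def trotter_data.step_def[OF neg] step_def[abs_def] by simp

lemma neg_U: "trotter_data.U (\<lambda>t. B (- t)) (\<lambda>t. X (- t)) t u = U (- t) u"
  unfolding trotter_data.U_def[OF neg] U_def neg_trot ..

lemma trot_lim: "(\<lambda>n. trot n t u) \<longlonglongrightarrow> U t u"
proof (cases "0 \<le> t")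
  case True then show ?thesis by (rule trot_lim_nonneg)
next
  case False
  then show ?thesis
    using trotter_data.trot_lim_nonneg[OF neg, of "- t" u] by (simp add: neg_trot neg_U)
qed

lemma U_norm: "norm (U t u) = norm u"
  using LIMSEQ_unique[OF tendsto_norm[OF trot_lim[of t u]]] trot_norm by simp

lemma X_near: "norm (X t u - u) \<le> (M * \<bar>t\<bar> + C * t\<^sup>2) * norm u"
proof -
  have "norm (X t u - u) \<le> norm (X t u - u - t *\<^sub>R J u) + norm (t *\<^sub>R J u)"
    using norm_triangle_ineq[of "X t u - u - t *\<^sub>R J u" "t *\<^sub>R J u"] by simp
  also have "\<dots> \<le> C * t\<^sup>2 * norm u + \<bar>t\<bar> * (M * norm u)"
    using J_bd[of u] X_J by (intro add_mono) (auto intro: mult_left_mono)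
  finally show ?thesis by (simp add: algebra_simps)
qed

text \<open>Taking adjoints reverses the order of the two factors in every step. Conjugation with a
  single factor \<open>X\<close> restores the order, at the cost of one outer factor on each
  side.\<close>

lemma trot_adj: "inner (trot n t u) v = inner u (X (- t / real n) (trot n (- t) (X (t / real n) v)))"
proof -
  define \<tau> where "\<tau> = t / real n"
  have 1: "inner ((step \<tau> ^^ k) u) v = inner u (((\<lambda>w. X (- \<tau>) (B (- \<tau>) w)) ^^ k) v)" for k u v
  proof (induction k arbitrary: u)
    case 0 then show ?case by simp
  next
    case (Suc k)
    have "inner ((step \<tau> ^^ Suc k) u) v = inner (step \<tau> u) (((\<lambda>w. X (- \<tau>) (B (- \<tau>) w)) ^^ k) v)"
      by (simp only: funpow_Suc_right comp_apply Suc)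
    also have "\<dots> = inner u (X (- \<tau>) (B (- \<tau>) (((\<lambda>w. X (- \<tau>) (B (- \<tau>) w)) ^^ k) v)))"
      unfolding step_def by (simp only: X_adj B_adj)
    finally show ?case by simp
  qed
  have 2: "((\<lambda>w. X (- \<tau>) (B (- \<tau>) w)) ^^ k) (X (- \<tau>) w) = X (- \<tau>) ((step (- \<tau>) ^^ k) w)" for k w
    by (induction k) (auto simp: step_def)
  have "v = X (- \<tau>) (X \<tau> v)" by (simp add: X_inv)
  then have "inner (trot n t u) v = inner u (X (- \<tau>) ((step (- \<tau>) ^^ n) (X \<tau> v)))"
    unfolding trot_def \<tau>_def[symmetric] 1 using 2 by metis
  then show ?thesis by (simp add: trot_def \<tau>_def)
qed

text \<open>The outer factors of \<open>trot_adj\<close> tend strongly to the identity by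
  \<open>X_near\<close>; since everything in between is isometric, the limit passes through the
  composition.\<close>

lemma U_adj: "inner (U t u) v = inner u (U (- t) v)"
proof -
  have t0: "(\<lambda>n. s / real n) \<longlonglongrightarrow> 0" for s by (rule lim_const_over_n)
  have Xv: "(\<lambda>n. X (s / real n) w) \<longlonglongrightarrow> w" for s w
  proof (rule LIM_zero_cancel, rule Lim_null_comparison)
    show "\<forall>\<^sub>F n in sequentially. norm (X (s / real n) w - w) \<le> (M * \<bar>s / real n\<bar> + C * (s / real n)\<^sup>2) * norm w"
      by (intro always_eventually allI X_near)
    have "(\<lambda>n. (M * \<bar>s / real n\<bar> + C * (s / real n)\<^sup>2) * norm w) \<longlonglongrightarrow> (M * \<bar>0\<bar> + C * 0\<^sup>2) * norm w"
      by (intro tendsto_intros t0)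
    then show "(\<lambda>n. (M * \<bar>s / real n\<bar> + C * (s / real n)\<^sup>2) * norm w) \<longlonglongrightarrow> 0" by simp
  qed
  have iso: "(\<lambda>n. A n (w n)) \<longlonglongrightarrow> z" if "\<And>n. bounded_linear (A n)" "\<And>n u. norm (A n u) = norm u"
    "w \<longlonglongrightarrow> w0" "(\<lambda>n. A n w0) \<longlonglongrightarrow> z" for A :: "nat \<Rightarrow> 'h \<Rightarrow> 'h" and w w0 z
  proof -
    have "(\<lambda>n. A n (w n) - A n w0) \<longlonglongrightarrow> 0"
    proof (rule Lim_null_comparison)
      show "\<forall>\<^sub>F n in sequentially. norm (A n (w n) - A n w0) \<le> norm (w n - w0)"
      proof (rule always_eventually, rule allI)
        fix n
        have "A n (w n) - A n w0 = A n (w n - w0)"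
          using that(1)[of n] by (simp add: bounded_linear_def linear_diff)
        then show "norm (A n (w n) - A n w0) \<le> norm (w n - w0)" by (simp add: that(2))
      qed
      show "(\<lambda>n. norm (w n - w0)) \<longlonglongrightarrow> 0" using that(3) by (simp add: LIM_zero tendsto_norm_zero)
    qed
    from tendsto_add[OF this that(4)] show ?thesis by simp
  qed
  have "(\<lambda>n. X (- t / real n) (trot n (- t) (X (t / real n) v))) \<longlonglongrightarrow> U (- t) v"
    by (rule iso[OF X_lin X_norm _ Xv], rule iso[OF trot_lin trot_norm Xv trot_lim])
  then have "(\<lambda>n. inner (trot n t u) v) \<longlonglongrightarrow> inner u (U (- t) v)"
    unfolding trot_adj by (intro tendsto_intros)
  moreover have "(\<lambda>n. inner (trot n t u) v) \<longlonglongrightarrow> inner (U t u) v"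
    by (intro tendsto_intros trot_lim)
  ultimately show ?thesis using LIMSEQ_unique by blast
qed

text \<open>Testing against h, the Trotter limit drops out: <h, U(-t) B(t) f> = <v(t), f>, where v solves
  the interaction-picture equation v' = K(t) v with v(0) = h and has constant norm.\<close>

lemma cook_bound:
  assumes st: "0 \<le> s" "s < t"
    and \<phi>c: "continuous_on {s..t} \<phi>"
    and \<phi>: "\<And>r. s < r \<Longrightarrow> r < t \<Longrightarrow> (\<phi> has_vector_derivative \<phi>' r) (at r)"
    and bd: "\<And>r. s < r \<Longrightarrow> r < t \<Longrightarrow> norm (J (B r f)) \<le> \<phi>' r"
  shows "norm (U (- t) (B t f) - U (- s) (B s f)) \<le> \<phi> t - \<phi> s"
proof -
  define w where "w = U (- t) (B t f) - U (- s) (B s f)"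
  \<comment> \<open>The test vector is the difference \<open>w\<close> itself. The estimate then
    bounds (norm w)^2 by norm w times the increment of \<open>\<phi>\<close>, and one factor
    cancels.\<close>
  obtain v where v: "is_sol w v" using sol_ex by blast
  have vn: "norm (v r) = norm w" if "0 \<le> r" for r
    using U_sol[OF v that] U_norm[of r w] B_norm by metis
  have Uv: "inner w (U (- r) (B r f)) = inner (v r) f" if "0 \<le> r" for r
    using U_adj[of r w "B r f"] U_sol[OF v that] isometry_inner[OF B_lin B_norm] by metis
  have "inner w w = inner (v t) f - inner (v s) f"
    unfolding w_def[symmetric] using Uv[of t] Uv[of s] st by (subst (2) w_def) (simp add: inner_diff_right)
  also have "\<dots> \<le> norm (inner (v t) f - inner (v s) f)" by simp
  also have "\<dots> \<le> norm w * \<phi> t - norm w * \<phi> s"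
  proof (rule differentiable_bound_general[where f="\<lambda>r. inner (v r) f" and f'="\<lambda>r. inner (K r (v r)) f"
        and \<phi>'="\<lambda>r. norm w * \<phi>' r"])
    show "s < t" by (rule st)
    show "continuous_on {s..t} (\<lambda>r. inner (v r) f)"
      using st by (intro continuous_intros continuous_on_subset[OF sol_cont[OF v, of t]]) auto
    show "continuous_on {s..t} (\<lambda>x. norm w * \<phi> x)" by (intro continuous_intros \<phi>c)
    fix r assume r: "s < r" "r < t"
    show "((\<lambda>r. inner (v r) f) has_vector_derivative inner (K r (v r)) f) (at r)"
      using r st by (intro bounded_linear.has_vector_derivative[OF bounded_linear_inner_left] sol_deriv[OF v]) auto
    show "((\<lambda>x. norm w * \<phi> x) has_vector_derivative norm w * \<phi>' r) (at r)"
      using bounded_linear.has_vector_derivative[OF bounded_linear_mult_right \<phi>[OF r], of "norm w"] .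
    have "inner (K r (v r)) f = - inner (B r (v r)) (J (B r f))"
      unfolding K_def using B_adj[of "- r" "J (B r (v r))" f] J_skew by simp
    then have "norm (inner (K r (v r)) f) \<le> norm (B r (v r)) * norm (J (B r f))"
      by (metis Cauchy_Schwarz_ineq2 norm_minus_cancel real_norm_def)
    also have "\<dots> \<le> norm w * \<phi>' r"
      using vn[of r] bd[OF r] r st B_norm by (intro mult_mono) auto
    finally show "norm (inner (K r (v r)) f) \<le> norm w * \<phi>' r" .
  qed
  finally have "norm w * norm w \<le> norm w * (\<phi> t - \<phi> s)"
    by (simp add: power2_norm_eq_inner[symmetric] power2_eq_square algebra_simps)
  \<comment> \<open>For w = 0 there is nothing to cancel, and the claim reduces to this
    monotonicity.\<close>
  moreover have "0 \<le> \<phi> t - \<phi> s"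
  proof -
    have "norm ((\<lambda>_. 0::real) t - (\<lambda>_. 0) s) \<le> \<phi> t - \<phi> s"
      by (rule differentiable_bound_general[where f'="\<lambda>_. 0" and \<phi>'=\<phi>'])
         (auto intro!: \<phi> \<phi>c st order_trans[OF norm_ge_zero bd])
    then show ?thesis by simp
  qed
  ultimately show ?thesis unfolding w_def[symmetric]
    by (cases "norm w = 0") (auto simp: mult_le_cancel_left)
qed

lemma U_0: "U 0 u = u"
  using sol_ex[of u] U_sol[of u _ 0] by (auto simp: is_sol_def B_0)

end

subsection \<open>The Hilbert space L2\<close>

lemma borel_measurable_cnj [measurable (raw)]:
  "f \<in> borel_measurable M \<Longrightarrow> (\<lambda>x. cnj (f x)) \<in> borel_measurable M"
  by (rule borel_measurable_continuous_on[OF continuous_on_cnj[OF continuous_on_id]])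

lemma cnj_mult_self: "cnj z * z = complex_of_real ((cmod z)\<^sup>2)"
  by (metis complex_norm_square mult.commute)

lemma sq_int_measurable [measurable_dest]: "sq_int f \<Longrightarrow> f \<in> borel_measurable lebesgue"
  by (simp add: sq_int_def)

lemma sq_int_integrable: "sq_int f \<Longrightarrow> integrable lebesgue (\<lambda>x. (cmod (f x))\<^sup>2)"
  by (simp add: sq_int_def)

lemma borel_measurable_lebesgueI: "f \<in> borel_measurable borel \<Longrightarrow> f \<in> borel_measurable (lebesgue :: 'a::euclidean_space measure)"
  by (intro measurable_completion) simp

lemma lebesgue_borel_rep_complex:
  fixes f :: "'a::euclidean_space \<Rightarrow> complex"
  assumes "f \<in> borel_measurable lebesgue"
  shows "\<exists>g. g \<in> borel_measurable borel \<and> (AE x in lebesgue. f x = g x)"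
proof -
  have "(\<lambda>x. Re (f x)) \<in> borel_measurable lebesgue" "(\<lambda>x. Im (f x)) \<in> borel_measurable lebesgue"
    using assms by measurable
  then obtain a b where a: "a \<in> borel_measurable lborel" "AE x in lborel. Re (f x) = a x"
    and b: "b \<in> borel_measurable lborel" "AE x in lborel. Im (f x) = b x"
    using completion_ex_borel_measurable_real by metis
  have "(\<lambda>x. Complex (a x) (b x)) \<in> borel_measurable borel"
    using a(1) b(1) unfolding Complex_eq by simp
  moreover have "AE x in lborel. f x = Complex (a x) (b x)"
    using a(2) b(2) by eventually_elim (simp add: complex_eq_iff)
  ultimately show ?thesis using AE_completion by blast
qed

lemma sq_int_cong_AE:
  assumes "sq_int f" "g \<in> borel_measurable lebesgue" "AE x in lebesgue. f x = g x"
  shows "sq_int g"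
proof -
  have "integrable lebesgue (\<lambda>x. (cmod (f x))\<^sup>2) = integrable lebesgue (\<lambda>x. (cmod (g x))\<^sup>2)"
    using assms by (intro integrable_cong_AE) (auto simp: sq_int_def)
  then show ?thesis using assms by (simp add: sq_int_def)
qed

lemma sq_int_borel_rep:
  assumes "sq_int f"
  shows "\<exists>g. g \<in> borel_measurable borel \<and> sq_int g \<and> l2eq f g"
  using lebesgue_borel_rep_complex[OF sq_int_measurable[OF assms]] sq_int_cong_AE[OF assms]
    borel_measurable_lebesgueI unfolding l2eq_def by blast

lemma sq_int_bound:
  assumes "g \<in> borel_measurable lebesgue" "integrable lebesgue h" "AE x in lebesgue. (cmod (g x))\<^sup>2 \<le> h x"
  shows "sq_int g"
  unfolding sq_int_def
proof
  show "integrable lebesgue (\<lambda>x. (cmod (g x))\<^sup>2)"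
    by (rule Bochner_Integration.integrable_bound[OF assms(2)]) (use assms(1,3) in auto)
qed fact

lemma sq_int_0: "sq_int (\<lambda>x. 0)" by (simp add: sq_int_def)

lemma cmod_add_sq_le: "(cmod (a + b))\<^sup>2 \<le> 2 * (cmod a)\<^sup>2 + 2 * (cmod b)\<^sup>2"
proof -
  have "(cmod (a + b))\<^sup>2 \<le> (cmod a + cmod b)\<^sup>2" by (intro power_mono norm_triangle_ineq) auto
  also have "\<dots> \<le> 2 * (cmod a)\<^sup>2 + 2 * (cmod b)\<^sup>2"
    using zero_le_power2[of "cmod a - cmod b"] unfolding power2_sum power2_diff by simp
  finally show ?thesis .
qed

lemma sq_int_add:
  assumes "sq_int f" "sq_int g" shows "sq_int (\<lambda>x. f x + g x)"
proof (rule sq_int_bound)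
  show "(\<lambda>x. f x + g x) \<in> borel_measurable lebesgue" using assms by (auto simp: sq_int_def)
  show "integrable lebesgue (\<lambda>x. 2 * (cmod (f x))\<^sup>2 + 2 * (cmod (g x))\<^sup>2)"
    using assms by (auto simp: sq_int_def)
qed (simp add: cmod_add_sq_le)

lemma sq_int_mult_bdd:
  assumes "sq_int f" "m \<in> borel_measurable lebesgue" "\<And>x. cmod (m x) \<le> K"
  shows "sq_int (\<lambda>x. m x * f x)"
proof (rule sq_int_bound)
  show "(\<lambda>x. m x * f x) \<in> borel_measurable lebesgue" using assms by (auto simp: sq_int_def)
  show "integrable lebesgue (\<lambda>x. K\<^sup>2 * (cmod (f x))\<^sup>2)" using assms by (auto simp: sq_int_def)
  show "AE x in lebesgue. (cmod (m x * f x))\<^sup>2 \<le> K\<^sup>2 * (cmod (f x))\<^sup>2"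
    using assms(3) by (auto simp: norm_mult power_mult_distrib intro!: mult_right_mono power_mono)
qed

lemma sq_int_cmult: "sq_int f \<Longrightarrow> sq_int (\<lambda>x. c * f x)"
  by (rule sq_int_mult_bdd[where K="cmod c"]) auto

lemma sq_int_uminus: "sq_int f \<Longrightarrow> sq_int (\<lambda>x. - f x)"
  using sq_int_cmult[of f "-1"] by simp

lemma sq_int_diff: "sq_int f \<Longrightarrow> sq_int g \<Longrightarrow> sq_int (\<lambda>x. f x - g x)"
  using sq_int_add[OF _ sq_int_uminus] by fastforce

lemma sq_int_cnj: "sq_int f \<Longrightarrow> sq_int (\<lambda>x. cnj (f x))"
  by (auto simp: sq_int_def)

lemma sq_int_scaleR: "sq_int f \<Longrightarrow> sq_int (\<lambda>x. r *\<^sub>R f x)"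
  using sq_int_cmult[of f "complex_of_real r"] by (simp add: scaleR_conv_of_real)

lemma sq_int_prod_integrable:
  assumes "sq_int f" "sq_int g" shows "integrable lebesgue (\<lambda>x. cnj (f x) * g x)"
proof (rule Bochner_Integration.integrable_bound)
  show "integrable lebesgue (\<lambda>x. (cmod (f x))\<^sup>2 + (cmod (g x))\<^sup>2)" using assms by (auto simp: sq_int_def)
  show "(\<lambda>x. cnj (f x) * g x) \<in> borel_measurable lebesgue" using assms by (auto simp: sq_int_def)
  show "AE x in lebesgue. norm (cnj (f x) * g x) \<le> norm ((cmod (f x))\<^sup>2 + (cmod (g x))\<^sup>2)"
  proof (rule AE_I2)
    fix x
    have "2 * (cmod (f x) * cmod (g x)) \<le> (cmod (f x))\<^sup>2 + (cmod (g x))\<^sup>2"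
      using zero_le_power2[of "cmod (f x) - cmod (g x)"] unfolding power2_diff by simp
    moreover have "0 \<le> cmod (f x) * cmod (g x)" by simp
    ultimately have "cmod (f x) * cmod (g x) \<le> (cmod (f x))\<^sup>2 + (cmod (g x))\<^sup>2" by linarith
    then show "norm (cnj (f x) * g x) \<le> norm ((cmod (f x))\<^sup>2 + (cmod (g x))\<^sup>2)"
      by (simp add: norm_mult)
  qed
qed

section \<open>Classes of square-integrable functions\<close>

definition l2rel :: "('a::euclidean_space \<Rightarrow> complex) \<Rightarrow> ('a \<Rightarrow> complex) \<Rightarrow> bool" where
  "l2rel f g \<longleftrightarrow> sq_int f \<and> sq_int g \<and> l2eq f g"

\<comment> \<open>A partial quotient: only square-integrable functions have a class. Classes form a
  type that can carry \<open>real_inner\<close> and \<open>banach\<close>, as the Trotter locale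
  demands, while the definitions speak of representatives.\<close>
quotient_type (overloaded) 'a l2 = "'a::euclidean_space \<Rightarrow> complex" / partial: l2rel
proof (rule part_equivpI)
  show "\<exists>x. l2rel x x" using sq_int_0 by (auto simp: l2rel_def l2eq_def)
  show "symp l2rel" by (auto simp: symp_def l2rel_def l2eq_def)
  show "transp l2rel" unfolding transp_def l2rel_def l2eq_def
    by (auto elim: AE_mp intro: AE_I2)
qed

lemma l2inner_cong:
  assumes "l2rel f f'" "l2rel g g'" shows "l2inner f g = l2inner f' g'"
  unfolding l2inner_def
proof (rule integral_cong_AE)
  show "(\<lambda>x. cnj (f x) * g x) \<in> borel_measurable lebesgue" "(\<lambda>x. cnj (f' x) * g' x) \<in> borel_measurable lebesgue"
    using assms by (auto simp: l2rel_def sq_int_def)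
  show "AE x in lebesgue. cnj (f x) * g x = cnj (f' x) * g' x"
    using assms unfolding l2rel_def l2eq_def by (fastforce elim: eventually_elim2)
qed

lift_definition cinner :: "'a::euclidean_space l2 \<Rightarrow> 'a l2 \<Rightarrow> complex" is l2inner
  by (rule l2inner_cong)

lift_definition smc :: "complex \<Rightarrow> 'a::euclidean_space l2 \<Rightarrow> 'a l2" is "\<lambda>c f x. c * f x"
  by (auto simp: l2rel_def l2eq_def sq_int_cmult elim: AE_mp)

lemma l2inner_add_left: "sq_int f \<Longrightarrow> sq_int g \<Longrightarrow> sq_int h \<Longrightarrow> l2inner (\<lambda>x. f x + g x) h = l2inner f h + l2inner g h"
  unfolding l2inner_def by (simp add: distrib_right Bochner_Integration.integral_add sq_int_prod_integrable)

lemma l2inner_cnj: "l2inner f g = cnj (l2inner g f)"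
proof -
  have "cnj (l2inner g f) = (\<integral>x. cnj (cnj (g x) * f x) \<partial>lebesgue)"
    unfolding l2inner_def by (rule Bochner_Integration.integral_cnj[symmetric])
  then show ?thesis by (simp add: l2inner_def mult.commute)
qed

lemma l2inner_cmult_left: "l2inner (\<lambda>x. c * f x) h = cnj c * l2inner f h"
  unfolding l2inner_def by (simp add: mult.assoc)

lemma l2inner_self: "l2inner f f = complex_of_real (\<integral>x. (cmod (f x))\<^sup>2 \<partial>lebesgue)"
  unfolding l2inner_def cnj_mult_self by (rule integral_complex_of_real)

instantiation l2 :: (euclidean_space) real_vector
begin

lift_definition zero_l2 :: "'a l2" is "\<lambda>x. 0"
  by (simp add: l2rel_def l2eq_def sq_int_0)
lift_definition plus_l2 :: "'a l2 \<Rightarrow> 'a l2 \<Rightarrow> 'a l2" is "\<lambda>f g x. f x + g x"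
  by (fastforce simp: l2rel_def l2eq_def sq_int_add elim: eventually_elim2)
lift_definition uminus_l2 :: "'a l2 \<Rightarrow> 'a l2" is "\<lambda>f x. - f x"
  by (auto simp: l2rel_def l2eq_def sq_int_uminus)
lift_definition minus_l2 :: "'a l2 \<Rightarrow> 'a l2 \<Rightarrow> 'a l2" is "\<lambda>f g x. f x - g x"
  by (fastforce simp: l2rel_def l2eq_def sq_int_diff elim: eventually_elim2)
lift_definition scaleR_l2 :: "real \<Rightarrow> 'a l2 \<Rightarrow> 'a l2" is "\<lambda>r f x. r *\<^sub>R f x"
  by (auto simp: l2rel_def l2eq_def sq_int_scaleR elim!: AE_mp intro!: AE_I2)

instance
proof
  fix a b c :: "'a l2" and r s :: real
  show "a + b + c = a + (b + c)"
    by transfer (auto simp: l2rel_def l2eq_def sq_int_add algebra_simps)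
  show "a + b = b + a"
    by transfer (auto simp: l2rel_def l2eq_def sq_int_add algebra_simps)
  show "0 + a = a"
    by transfer (auto simp: l2rel_def l2eq_def sq_int_add)
  show "- a + a = 0"
    by transfer (auto simp: l2rel_def l2eq_def sq_int_0)
  show "a - b = a + - b"
    by transfer (auto simp: l2rel_def l2eq_def sq_int_diff)
  show "r *\<^sub>R (a + b) = r *\<^sub>R a + r *\<^sub>R b"
    by transfer (use sq_int_add sq_int_scaleR in \<open>auto simp: l2rel_def l2eq_def scaleR_add_right\<close>)
  show "(r + s) *\<^sub>R a = r *\<^sub>R a + s *\<^sub>R a"
    by transfer (use sq_int_add sq_int_scaleR in \<open>auto simp: l2rel_def l2eq_def scaleR_add_left\<close>)
  show "r *\<^sub>R s *\<^sub>R a = (r * s) *\<^sub>R a"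
    by transfer (use sq_int_scaleR in \<open>auto simp: l2rel_def l2eq_def mult.assoc\<close>)
  show "1 *\<^sub>R a = a"
    by transfer (auto simp: l2rel_def l2eq_def)
qed

end

text \<open>The class is over the reals, so the real part of the complex product is taken;
  \<open>cinner_eq_inner\<close> recovers the complex product by testing with i u as well.\<close>

instantiation l2 :: (euclidean_space) real_inner
begin

definition inner_l2 :: "'a l2 \<Rightarrow> 'a l2 \<Rightarrow> real" where "inner_l2 u v = Re (cinner u v)"
definition norm_l2 :: "'a l2 \<Rightarrow> real" where "norm_l2 u = sqrt (inner u u)"
definition dist_l2 :: "'a l2 \<Rightarrow> 'a l2 \<Rightarrow> real" where "dist_l2 u v = norm (u - v)"
definition sgn_l2 :: "'a l2 \<Rightarrow> 'a l2" where "sgn_l2 u = u /\<^sub>R norm u"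
definition uniformity_l2 :: "('a l2 \<times> 'a l2) filter" where
  "uniformity_l2 = (INF e\<in>{0 <..}. principal {(x, y). dist x y < e})"
definition open_l2 :: "'a l2 set \<Rightarrow> bool" where
  "open_l2 U = (\<forall>x\<in>U. eventually (\<lambda>(x', y). x' = x \<longrightarrow> y \<in> U) uniformity)"

instance
proof
  fix x y z :: "'a l2" and r :: real and U :: "'a l2 set"
  show "dist x y = norm (x - y)" by (rule dist_l2_def)
  show "sgn x = x /\<^sub>R norm x" by (rule sgn_l2_def)
  show "uniformity = (INF e\<in>{0 <..}. principal {(x, y::'a l2). dist x y < e})" by (rule uniformity_l2_def)
  show "open U = (\<forall>x\<in>U. eventually (\<lambda>(x', y). x' = x \<longrightarrow> y \<in> U) uniformity)" by (rule open_l2_def)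
  show "inner x y = inner y x" unfolding inner_l2_def
    by transfer (metis l2inner_cnj complex_cnj(1) complex.sel(1) complex_surj)
  show "inner (x + y) z = inner x z + inner y z" unfolding inner_l2_def
    by transfer (simp add: l2rel_def l2inner_add_left)
  show "inner (r *\<^sub>R x) y = r * inner x y" unfolding inner_l2_def
    by transfer (simp add: scaleR_conv_of_real l2inner_cmult_left)
  show "0 \<le> inner x x" unfolding inner_l2_def
    by transfer (simp add: l2inner_self)
  show "(inner x x = 0) = (x = 0)" unfolding inner_l2_def
    by transfer (auto simp: l2inner_self l2rel_def l2eq_def sq_int_0 sq_int_integrable integral_nonneg_eq_0_iff_AE)
  show "norm x = sqrt (inner x x)" by (rule norm_l2_def)
qed

end

definition L2 :: "('a::euclidean_space \<Rightarrow> complex) \<Rightarrow> 'a l2" where "L2 = abs_l2"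

lemma L2_eq_iff: "sq_int f \<Longrightarrow> sq_int g \<Longrightarrow> L2 f = L2 g \<longleftrightarrow> l2eq f g"
  unfolding L2_def using Quotient_rel[OF Quotient_l2, of f g] by (auto simp: l2rel_def l2eq_def)

lemma sq_int_rep: "sq_int (rep_l2 u)"
  using Quotient_rep_reflp[OF Quotient_l2, of u] by (simp add: l2rel_def)

lemma L2_rep: "L2 (rep_l2 u) = u"
  unfolding L2_def by (rule Quotient_abs_rep[OF Quotient_l2])

lemma rep_L2: "sq_int f \<Longrightarrow> l2eq (rep_l2 (L2 f)) f"
  using L2_eq_iff[OF sq_int_rep] L2_rep by blast

text \<open>Borel representatives matter because Fubini is applied to products of
  \<open>lborel\<close>, whereas the definitions integrate over the completed measure.\<close>

lemma L2_cases:
  obtains f where "sq_int f" "f \<in> borel_measurable borel" "u = L2 f"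
  using sq_int_borel_rep[OF sq_int_rep[of u]] L2_eq_iff[OF sq_int_rep] L2_rep by metis

lemma l2rel_refl: "sq_int f \<Longrightarrow> l2rel f f" by (simp add: l2rel_def l2eq_def)

lemma cinner_L2: "sq_int f \<Longrightarrow> sq_int g \<Longrightarrow> cinner (L2 f) (L2 g) = l2inner f g"
  unfolding L2_def by (rule cinner.abs_eq) (simp_all add: l2rel_refl)

lemma L2_add: "sq_int f \<Longrightarrow> sq_int g \<Longrightarrow> L2 f + L2 g = L2 (\<lambda>x. f x + g x)"
  unfolding L2_def by (rule plus_l2.abs_eq) (simp_all add: l2rel_refl)

lemma L2_diff: "sq_int f \<Longrightarrow> sq_int g \<Longrightarrow> L2 f - L2 g = L2 (\<lambda>x. f x - g x)"
  unfolding L2_def by (rule minus_l2.abs_eq) (simp_all add: l2rel_refl)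

lemma L2_uminus: "sq_int f \<Longrightarrow> - L2 f = L2 (\<lambda>x. - f x)"
  unfolding L2_def by (rule uminus_l2.abs_eq) (simp_all add: l2rel_refl)

lemma L2_smc: "sq_int f \<Longrightarrow> smc c (L2 f) = L2 (\<lambda>x. c * f x)"
  unfolding L2_def by (rule smc.abs_eq) (simp_all add: l2rel_refl)

lemma L2_zero: "L2 (\<lambda>x. 0) = 0"
  unfolding L2_def zero_l2_def ..

lemma norm_L2: "sq_int f \<Longrightarrow> norm (L2 f) = l2norm f"
  unfolding norm_l2_def inner_l2_def by (simp add: cinner_L2 l2inner_self l2norm_def)

lemma norm_L2_sq: "sq_int f \<Longrightarrow> (norm (L2 f))\<^sup>2 = (\<integral>x. (cmod (f x))\<^sup>2 \<partial>lebesgue)"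
  by (simp add: norm_L2 l2norm_def)

lemma l2norm_diff: "sq_int f \<Longrightarrow> sq_int g \<Longrightarrow> l2norm (\<lambda>x. f x - g x) = norm (L2 f - L2 g)"
  by (simp add: L2_diff norm_L2 sq_int_diff)

lemma nn_norm_L2_sq:
  assumes "sq_int f" "f \<in> borel_measurable borel"
  shows "(\<integral>\<^sup>+x. ennreal ((cmod (f x))\<^sup>2) \<partial>lborel) = ennreal ((norm (L2 f))\<^sup>2)"
proof -
  have "(\<integral>\<^sup>+x. ennreal ((cmod (f x))\<^sup>2) \<partial>lebesgue) = ennreal (\<integral>x. (cmod (f x))\<^sup>2 \<partial>lebesgue)"
    using assms by (intro nn_integral_eq_integral) (auto simp: sq_int_def)
  then show ?thesis using assms by (simp add: norm_L2_sq nn_integral_completion)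
qed

lemma sq_int_iff_nn:
  assumes [measurable]: "f \<in> borel_measurable borel"
  shows "sq_int f \<longleftrightarrow> (\<integral>\<^sup>+x. ennreal ((cmod (f x))\<^sup>2) \<partial>lborel) < \<infinity>"
proof -
  have "integrable lebesgue (\<lambda>x. (cmod (f x))\<^sup>2) \<longleftrightarrow> integrable lborel (\<lambda>x. (cmod (f x))\<^sup>2)"
    by (intro integrable_completion) simp
  then show ?thesis
    using borel_measurable_lebesgueI[OF assms] by (simp add: sq_int_def integrable_iff_bounded)
qed

lemma cinner_commute: "cinner u v = cnj (cinner v u)"
  by transfer (rule l2inner_cnj)

lemma cinner_add_left: "cinner (u + v) w = cinner u w + cinner v w"
  by transfer (simp add: l2rel_def l2inner_add_left)

lemma cinner_add_right: "cinner w (u + v) = cinner w u + cinner w v"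
  using cinner_add_left[of u v w] cinner_commute by (metis complex_cnj_add)

lemma cinner_smc_left: "cinner (smc c u) w = cnj c * cinner u w"
  by transfer (simp add: l2inner_cmult_left)

lemma cinner_smc_right: "cinner w (smc c u) = c * cinner w u"
  using cinner_smc_left[of c u w] cinner_commute by (metis complex_cnj_mult complex_cnj_cnj)

lemma scaleR_smc: "r *\<^sub>R u = smc (complex_of_real r) u"
  by transfer (simp add: scaleR_conv_of_real l2rel_def sq_int_cmult l2eq_def)

lemma smc_add_right: "smc c (u + v) = smc c u + smc c v"
  by transfer (simp add: l2rel_def sq_int_cmult sq_int_add l2eq_def distrib_left)

lemma smc_smc: "smc c (smc d u) = smc (c * d) u"
  by transfer (use sq_int_cmult in \<open>auto simp: l2rel_def l2eq_def mult.assoc\<close>)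

lemma cinner_uminus_right: "cinner w (- u) = - cinner w u"
  using cinner_smc_right[of w "-1" u] scaleR_smc[of "-1" u] by simp

lemma cinner_diff_right: "cinner w (u - v) = cinner w u - cinner w v"
  using cinner_add_right[of w u "- v"] by (simp add: cinner_uminus_right)

lemma cinner_self: "cinner u u = complex_of_real ((norm u)\<^sup>2)"
proof -
  have "Im (cinner u u) = 0" using cinner_commute[of u u]
    by (metis Reals_cnj_iff complex_is_Real_iff)
  moreover have "0 \<le> Re (cinner u u)" using inner_ge_zero[of u] by (simp add: inner_l2_def)
  ultimately show ?thesis by (simp add: complex_eq_iff norm_l2_def inner_l2_def)
qed

lemma cinner_eq_inner: "cinner u v = Complex (inner u v) (inner (smc \<i> u) v)"
  by (simp add: complex_eq_iff inner_l2_def cinner_smc_left)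

lemma norm_smc: "norm (smc c u) = cmod c * norm u"
proof -
  have "complex_of_real ((norm (smc c u))\<^sup>2) = complex_of_real ((cmod c * norm u)\<^sup>2)"
    unfolding cinner_self[symmetric] cinner_smc_left cinner_smc_right
    unfolding mult.assoc[symmetric] mult.commute[of c] cnj_mult_self
    by (simp add: cinner_self cnj_mult_self power_mult_distrib flip: mult.assoc)
  then have "(norm (smc c u))\<^sup>2 = (cmod c * norm u)\<^sup>2" by (simp only: of_real_eq_iff)
  then show ?thesis by (simp add: power2_eq_iff_nonneg)
qed

lemma cmod_cinner_le: "cmod (cinner u v) \<le> norm u * norm v"
proof (cases "cinner u v = 0")
  case False
  define c where "c = cinner u v / complex_of_real (cmod (cinner u v))"
  have c: "cmod c = 1" using False by (simp add: c_def norm_divide)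
  have "cnj c * cinner u v = complex_of_real (cmod (cinner u v))"
    using False unfolding c_def by (simp add: complex_norm_square[symmetric] mult.commute power2_eq_square)
  then have "cmod (cinner u v) = inner (smc c u) v"
    by (simp add: inner_l2_def cinner_smc_left)
  also have "\<dots> \<le> norm (smc c u) * norm v" by (rule norm_cauchy_schwarz)
  finally show ?thesis by (simp add: norm_smc c)
qed simp

lemma l2_eqI: "(\<And>w. cinner w u = cinner w v) \<Longrightarrow> u = v"
proof -
  assume "\<And>w. cinner w u = cinner w v"
  then have "cinner (u - v) (u - v) = 0" by (simp add: cinner_diff_right)
  then show ?thesis by (simp add: cinner_self)
qed

lemma L2_norm_le_pointwise:
  assumes "sq_int f" "sq_int g" "\<And>x. cmod (f x) \<le> cmod (g x)"
  shows "norm (L2 f) \<le> norm (L2 g)"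
proof -
  have "(norm (L2 f))\<^sup>2 \<le> (norm (L2 g))\<^sup>2"
    unfolding norm_L2_sq[OF assms(1)] norm_L2_sq[OF assms(2)]
    by (rule integral_mono[OF sq_int_integrable[OF assms(1)] sq_int_integrable[OF assms(2)]])
       (intro power_mono assms(3) norm_ge_zero)
  then show ?thesis by (rule power2_le_imp_le) simp
qed

lemma L2_dominated_convergence:
  fixes g :: "'a::euclidean_space \<Rightarrow> complex"
  assumes "\<And>n. f n \<in> borel_measurable lebesgue" "g \<in> borel_measurable lebesgue" "sq_int h"
    and bd: "\<And>n x. cmod (f n x) \<le> cmod (h x)"
    and lim: "AE x in lebesgue. (\<lambda>n. f n x) \<longlonglongrightarrow> g x"
  shows "sq_int g" "\<And>n. sq_int (f n)" "(\<lambda>n. L2 (f n)) \<longlonglongrightarrow> L2 g"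
proof -
  show f: "sq_int (f n)" for n
    by (rule sq_int_bound[OF assms(1) sq_int_integrable[OF assms(3)]]) (use bd in \<open>auto intro: power_mono\<close>)
  have gbd: "AE x in lebesgue. cmod (g x) \<le> cmod (h x)"
    using lim
  proof eventually_elim
    case (elim x)
    show ?case by (rule LIMSEQ_le_const2[OF tendsto_norm[OF elim]]) (use bd in auto)
  qed
  show g: "sq_int g"
    by (rule sq_int_bound[OF assms(2) sq_int_integrable[OF assms(3)]])
       (use gbd in \<open>auto elim!: AE_mp intro!: AE_I2 power_mono\<close>)
  have "(\<lambda>n. \<integral>x. (cmod (f n x - g x))\<^sup>2 \<partial>lebesgue) \<longlonglongrightarrow> (\<integral>x. 0 \<partial>(lebesgue :: 'a measure))"
  proof (rule Bochner_Integration.integral_dominated_convergence[where w="\<lambda>x. 4 * (cmod (h x))\<^sup>2"])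
    show "integrable lebesgue (\<lambda>x. 4 * (cmod (h x))\<^sup>2)" using assms(3) by (auto simp: sq_int_def)
    show "AE x in lebesgue. (\<lambda>n. (cmod (f n x - g x))\<^sup>2) \<longlonglongrightarrow> 0"
      using lim by eventually_elim (auto simp: LIM_zero_iff tendsto_norm_zero_iff intro!: tendsto_null_power)
    fix n
    show "AE x in lebesgue. norm ((cmod (f n x - g x))\<^sup>2) \<le> 4 * (cmod (h x))\<^sup>2"
      using gbd
    proof eventually_elim
      case (elim x)
      have "cmod (f n x - g x) \<le> 2 * cmod (h x)"
        using norm_triangle_ineq4[of "f n x" "g x"] bd[of n x] elim by linarith
      then have "(cmod (f n x - g x))\<^sup>2 \<le> (2 * cmod (h x))\<^sup>2" by (intro power_mono) auto
      then show ?case by (simp add: power_mult_distrib)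
    qed
  qed (use assms in auto)
  then have "(\<lambda>n. (norm (L2 (f n) - L2 g))\<^sup>2) \<longlonglongrightarrow> 0"
    by (simp add: L2_diff f g norm_L2_sq sq_int_diff)
  then have "(\<lambda>n. sqrt ((norm (L2 (f n) - L2 g))\<^sup>2)) \<longlonglongrightarrow> sqrt 0" by (intro tendsto_intros)
  then show "(\<lambda>n. L2 (f n)) \<longlonglongrightarrow> L2 g"
    by (simp add: tendsto_norm_zero_iff LIM_zero_iff)
qed

text \<open>If a exceeds 2^(-k), then 2^k a >= 1 and so a <= 2^k a^2. Hence summability of the
  weighted squares forces absolute summability.\<close>

lemma le_geometric_plus_square: "(a::real) \<le> (1/2)^k + 2^k * a\<^sup>2"
proof (cases "a \<le> (1/2)^k")
  case True then show ?thesis by (simp add: add_increasing2)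
next
  case False
  then have "(1/2)^k < a" by simp
  moreover have "0 < (1/2::real)^k" by simp
  ultimately have "(1/2)^k * a \<le> a * a" by (intro mult_right_mono) linarith+
  then have "2^k * ((1/2)^k * a) \<le> 2^k * (a * a)" by (intro mult_left_mono) auto
  then have "a \<le> 2^k * a\<^sup>2" by (simp add: power2_eq_square power_one_over)
  then show ?thesis by (simp add: add_increasing)
qed

text \<open>Riesz-Fischer. Along a subsequence with consecutive distances at most 2^(-k), the sum of
  2^k |f (k+1) - f k|^2 has integral at most the sum of 2^(-k). It is therefore finite almost
  everywhere, and the subsequence converges there. Fatou turns the pointwise limit into an L2
  limit.\<close>

instance l2 :: (euclidean_space) banach
proof
  fix X :: "nat \<Rightarrow> 'a l2"
  assume X: "Cauchy X"
  have "\<exists>N. \<forall>m\<ge>N. \<forall>n\<ge>N. norm (X m - X n) < (1/2)^k" for k :: nat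
    using X unfolding Cauchy_def dist_norm by simp
  then obtain N where N: "\<And>k m n. m \<ge> N k \<Longrightarrow> n \<ge> N k \<Longrightarrow> norm (X m - X n) < (1/2)^k" by metis
  \<comment> \<open>The \<open>max\<close> makes \<open>s\<close> strictly increasing and keeps
    \<open>s k\<close> beyond the Cauchy index \<open>N k\<close>.\<close>
  define s where "s = rec_nat (N 0) (\<lambda>k sk. max (Suc sk) (N (Suc k)))"
  have s0: "s 0 = N 0" and sSuc: "s (Suc k) = max (Suc (s k)) (N (Suc k))" for k by (simp_all add: s_def)
  have sS: "s k < s (Suc k)" for k unfolding sSuc by (simp add: less_max_iff_disj)
  have sN: "N k \<le> s k" for k by (cases k) (simp_all add: s0 sSuc)
  have sm: "strict_mono s" using sS by (simp add: strict_mono_Suc_iff)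
  have "\<exists>f. sq_int f \<and> f \<in> borel_measurable borel \<and> X (s k) = L2 f" for k
    using L2_cases by metis
  then obtain f where f: "\<And>k. sq_int (f k)" and [measurable]: "\<And>k. f k \<in> borel_measurable borel"
    and Xf: "\<And>k. X (s k) = L2 (f k)" by metis
  have d: "norm (L2 (f (Suc k)) - L2 (f k)) \<le> (1/2)^k" for k
    unfolding Xf[symmetric] using N[of k "s (Suc k)" "s k"] sS[of k] sN[of k] by simp
  have "(\<integral>\<^sup>+x. (\<Sum>k. ennreal (2^k * (cmod (f (Suc k) x - f k x))\<^sup>2)) \<partial>lborel)
      = (\<Sum>k. \<integral>\<^sup>+x. ennreal (2^k * (cmod (f (Suc k) x - f k x))\<^sup>2) \<partial>lborel)"
    by (rule nn_integral_suminf) measurable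
  also have "\<dots> \<le> (\<Sum>k. ennreal ((1/2)^k))"
  proof (rule suminf_le)
    fix k
    have "(\<integral>\<^sup>+x. ennreal (2^k * (cmod (f (Suc k) x - f k x))\<^sup>2) \<partial>lborel)
        = ennreal (2^k) * (\<integral>\<^sup>+x. ennreal ((cmod (f (Suc k) x - f k x))\<^sup>2) \<partial>lborel)"
      by (subst nn_integral_cmult[symmetric]) (auto simp: ennreal_mult)
    also have "\<dots> = ennreal (2^k * (norm (L2 (f (Suc k)) - L2 (f k)))\<^sup>2)"
      using f by (subst nn_norm_L2_sq) (auto simp: sq_int_diff L2_diff ennreal_mult)
    also have "\<dots> \<le> ennreal ((1/2)^k)"
    proof (rule ennreal_leI)
      have "(norm (L2 (f (Suc k)) - L2 (f k)))\<^sup>2 \<le> ((1/2)^k)\<^sup>2" using d by (intro power_mono) auto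
      then have "2^k * (norm (L2 (f (Suc k)) - L2 (f k)))\<^sup>2 \<le> 2^k * ((1/2)^k)\<^sup>2" by (intro mult_left_mono) auto
      then show "2^k * (norm (L2 (f (Suc k)) - L2 (f k)))\<^sup>2 \<le> (1/2)^k"
        by (simp add: power2_eq_square power_one_over)
    qed
    finally show "(\<integral>\<^sup>+x. ennreal (2^k * (cmod (f (Suc k) x - f k x))\<^sup>2) \<partial>lborel) \<le> ennreal ((1/2)^k)" .
  qed auto
  also have "\<dots> = ennreal (\<Sum>k. (1/2)^k)"
    by (rule suminf_ennreal2) (auto intro: summable_geometric)
  finally have fin: "(\<integral>\<^sup>+x. (\<Sum>k. ennreal (2^k * (cmod (f (Suc k) x - f k x))\<^sup>2)) \<partial>lborel) \<noteq> \<infinity>"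
    by (auto simp: top_unique)
  have "AE x in lborel. (\<Sum>k. ennreal (2^k * (cmod (f (Suc k) x - f k x))\<^sup>2)) \<noteq> \<infinity>"
    by (rule nn_integral_PInf_AE[OF _ fin]) measurable
  then have conv: "AE x in lborel. convergent (\<lambda>n. f n x)"
  proof eventually_elim
    case (elim x)
    have "summable (\<lambda>k. 2^k * (cmod (f (Suc k) x - f k x))\<^sup>2)"
      by (rule summable_suminf_not_top) (use elim in auto)
    then have "summable (\<lambda>k. (1/2)^k + 2^k * (cmod (f (Suc k) x - f k x))\<^sup>2)"
      by (intro summable_add summable_geometric) auto
    then have "summable (\<lambda>k. f (Suc k) x - f k x)"
      by (rule summable_comparison_test') (rule le_geometric_plus_square)
    then have "convergent (\<lambda>n. \<Sum>k<n. f (Suc k) x - f k x)" by (simp add: summable_iff_convergent)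
    then have "convergent (\<lambda>n. f n x - f 0 x)" by (simp add: sum_lessThan_telescope[of "\<lambda>k. f k x"])
    then show ?case using convergent_add_const_right_iff[of "\<lambda>n. f n x" "- f 0 x"] by simp
  qed
  define g where "g x = lim (\<lambda>n. f n x)" for x
  have [measurable]: "g \<in> borel_measurable borel" unfolding g_def by measurable
  have lim: "AE x in lborel. (\<lambda>n. f n x) \<longlonglongrightarrow> g x"
    using conv by eventually_elim (simp add: g_def convergent_LIMSEQ_iff)
  have fat: "(\<integral>\<^sup>+x. ennreal ((cmod (f j x - g x))\<^sup>2) \<partial>lborel) \<le> ennreal (e\<^sup>2)"
    if e: "0 \<le> e" "\<And>n. n \<ge> j \<Longrightarrow> norm (L2 (f j) - L2 (f n)) \<le> e" for j e
  proof -
    have "(\<integral>\<^sup>+x. ennreal ((cmod (f j x - g x))\<^sup>2) \<partial>lborel)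
        = (\<integral>\<^sup>+x. liminf (\<lambda>n. ennreal ((cmod (f j x - f n x))\<^sup>2)) \<partial>lborel)"
    proof (rule nn_integral_cong_AE)
      show "AE x in lborel. ennreal ((cmod (f j x - g x))\<^sup>2) = liminf (\<lambda>n. ennreal ((cmod (f j x - f n x))\<^sup>2))"
        using lim
      proof eventually_elim
        case (elim x)
        have "(\<lambda>n. ennreal ((cmod (f j x - f n x))\<^sup>2)) \<longlonglongrightarrow> ennreal ((cmod (f j x - g x))\<^sup>2)"
          using elim by (intro tendsto_ennrealI tendsto_intros)
        then show ?case by (intro lim_imp_Liminf[symmetric]) simp_all
      qed
    qed
    also have "\<dots> \<le> liminf (\<lambda>n. \<integral>\<^sup>+x. ennreal ((cmod (f j x - f n x))\<^sup>2) \<partial>lborel)"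
      by (rule nn_integral_liminf) measurable
    also have "\<dots> = liminf (\<lambda>n. ennreal ((norm (L2 (f j) - L2 (f n)))\<^sup>2))"
      using f by (subst nn_norm_L2_sq) (auto simp: sq_int_diff L2_diff)
    also have "\<dots> \<le> ennreal (e\<^sup>2)"
    proof -
      have "eventually (\<lambda>n. ennreal ((norm (L2 (f j) - L2 (f n)))\<^sup>2) \<le> ennreal (e\<^sup>2)) sequentially"
        using eventually_ge_at_top[of j]
        by eventually_elim (auto intro!: ennreal_leI power_mono e)
      then show ?thesis
        by (intro order_trans[OF Liminf_le_Limsup Limsup_bounded]) simp_all
    qed
    finally show ?thesis .
  qed
  have close: "norm (L2 (f j) - L2 (f n)) \<le> (1/2)^k" if "k \<le> j" "k \<le> n" for j n k
  proof -
    have "N k \<le> s j" "N k \<le> s n"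
      using that sN[of k] strict_mono_less_eq[OF sm] by (auto intro: order_trans)
    then show ?thesis using N[of k "s j" "s n"] by (simp add: Xf)
  qed
  have sq: "sq_int (\<lambda>x. f j x - g x)" for j
    using fat[of 1 j] close[of 0 j] by (subst sq_int_iff_nn) (auto simp: le_less_trans)
  have g: "sq_int g" using sq_int_diff[OF f[of 0] sq[of 0]] by simp
  have "norm (L2 (f j) - L2 g) \<le> (1/2)^j" for j
  proof -
    have "ennreal ((norm (L2 (f j) - L2 g))\<^sup>2) \<le> ennreal (((1/2)^j)\<^sup>2)"
      using fat[of "(1/2)^j" j] close[of j j] f g by (simp add: nn_norm_L2_sq[OF sq] L2_diff)
    then have "(norm (L2 (f j) - L2 g))\<^sup>2 \<le> ((1/2)^j)\<^sup>2" by (simp add: ennreal_le_iff)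
    then show ?thesis by (rule power2_le_imp_le) simp
  qed
  then have "(\<lambda>j. norm (L2 (f j) - L2 g)) \<longlonglongrightarrow> 0"
    by (intro tendsto_sandwich[OF _ _ tendsto_const LIMSEQ_power_zero[of "1/2::real"]]) auto
  then have "(X \<circ> s) \<longlonglongrightarrow> L2 g" by (simp add: Xf comp_def tendsto_norm_zero_iff LIM_zero_iff)
  then show "convergent X" using X sm Cauchy_def
    by (metis Cauchy_converges_subseq convergentI)
qed

subsection \<open>Multiplication operators\<close>

definition mulop :: "('a::euclidean_space \<Rightarrow> complex) \<Rightarrow> 'a l2 \<Rightarrow> 'a l2" where
  "mulop m u = L2 (\<lambda>x. m x * rep_l2 u x)"

definition bddm :: "('a::euclidean_space \<Rightarrow> complex) \<Rightarrow> bool" where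
  "bddm m \<longleftrightarrow> m \<in> borel_measurable lebesgue \<and> (\<exists>K. \<forall>x. cmod (m x) \<le> K)"

lemma sq_int_bddm: "bddm m \<Longrightarrow> sq_int f \<Longrightarrow> sq_int (\<lambda>x. m x * f x)"
  unfolding bddm_def using sq_int_mult_bdd by blast

lemma mulop_L2: "bddm m \<Longrightarrow> sq_int f \<Longrightarrow> mulop m (L2 f) = L2 (\<lambda>x. m x * f x)"
  unfolding mulop_def using rep_L2[of f]
  by (subst L2_eq_iff) (auto simp: sq_int_bddm sq_int_rep l2eq_def elim: AE_mp)

lemma mulop_norm:
  assumes "m \<in> borel_measurable lebesgue" "\<And>x. cmod (m x) \<le> K"
  shows "norm (mulop m u) \<le> K * norm u"
proof -
  obtain f where f: "sq_int f" "u = L2 f" by (rule L2_cases)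
  have "bddm m" using assms by (auto simp: bddm_def)
  have K: "0 \<le> K" using norm_ge_zero[of "m undefined"] assms(2)[of undefined] by linarith
  have "norm (L2 (\<lambda>x. m x * f x)) \<le> norm (L2 (\<lambda>x. complex_of_real K * f x))"
    using assms f K \<open>bddm m\<close>
    by (intro L2_norm_le_pointwise sq_int_bddm sq_int_cmult) (auto simp: norm_mult intro!: mult_right_mono)
  also have "\<dots> = K * norm u" using f K by (simp flip: L2_smc add: norm_smc)
  finally show ?thesis using \<open>bddm m\<close> f by (simp add: mulop_L2)
qed

lemma mulop_add: "bddm m \<Longrightarrow> mulop m (u + v) = mulop m u + mulop m v"
  by (rule L2_cases[of u], rule L2_cases[of v])
     (simp add: L2_add mulop_L2 sq_int_add sq_int_bddm distrib_left)

lemma mulop_smc: "bddm m \<Longrightarrow> mulop m (smc c u) = smc c (mulop m u)"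
  by (rule L2_cases[of u]) (simp add: L2_smc mulop_L2 sq_int_cmult sq_int_bddm mult.left_commute)

lemma mulop_linear:
  assumes m: "bddm m" shows "bounded_linear (mulop m)"
proof -
  obtain K where K: "m \<in> borel_measurable lebesgue" "\<And>x. cmod (m x) \<le> K"
    using m by (auto simp: bddm_def)
  show ?thesis
    by (rule bounded_linear_intro[where K=K])
       (use mulop_norm[OF K] m in \<open>simp_all add: mulop_add scaleR_smc mulop_smc mult.commute\<close>)
qed

lemma bddm_mult: "bddm m \<Longrightarrow> bddm m' \<Longrightarrow> bddm (\<lambda>x. m x * m' x)"
  unfolding bddm_def
proof (safe intro!: borel_measurable_times)
  fix K K' assume "\<forall>x. cmod (m x) \<le> K" "\<forall>x. cmod (m' x) \<le> K'"
  then have "cmod (m x * m' x) \<le> K * K'" for x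
    by (simp add: norm_mult) (meson mult_mono norm_ge_zero order_trans)
  then show "\<exists>K. \<forall>x. cmod (m x * m' x) \<le> K" by blast
qed

lemma mulop_mulop: "bddm m \<Longrightarrow> bddm m' \<Longrightarrow> mulop m (mulop m' u) = mulop (\<lambda>x. m x * m' x) u"
  by (rule L2_cases[of u]) (simp add: mulop_L2 sq_int_bddm bddm_mult mult.assoc)

lemma bddm_cnj: "bddm m \<Longrightarrow> bddm (\<lambda>x. cnj (m x))"
  by (auto simp: bddm_def)

lemma cinner_mulop: "bddm m \<Longrightarrow> cinner (mulop m u) v = cinner u (mulop (\<lambda>x. cnj (m x)) v)"
  by (rule L2_cases[of u], rule L2_cases[of v])
     (simp add: mulop_L2 bddm_cnj sq_int_bddm cinner_L2, simp add: l2inner_def mult_ac)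

lemma mulop_unimodular_norm:
  assumes "m \<in> borel_measurable lebesgue" "\<And>x. cmod (m x) = 1"
  shows "norm (mulop m u) = norm u"
proof -
  obtain f where f: "sq_int f" "u = L2 f" by (rule L2_cases)
  have "bddm m" using assms by (auto simp: bddm_def)
  then show ?thesis using f assms by (simp add: mulop_L2 norm_L2 sq_int_bddm l2norm_def norm_mult)
qed

lemma mulop_1: "mulop (\<lambda>x. 1) u = u"
  by (simp add: mulop_def L2_rep)

lemma mulop_tendsto:
  assumes "\<And>n. m n \<in> borel_measurable lebesgue" "\<And>n x. cmod (m n x) \<le> K" "m0 \<in> borel_measurable lebesgue"
    and "\<And>x. (\<lambda>n. m n x) \<longlonglongrightarrow> m0 x"
  shows "(\<lambda>n. mulop (m n) u) \<longlonglongrightarrow> mulop m0 u"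
proof -
  obtain f where f: "sq_int f" "u = L2 f" by (rule L2_cases)
  have K: "0 \<le> K" using norm_ge_zero[of "m 0 undefined"] assms(2)[of 0 undefined] by linarith
  have b: "bddm (m n)" for n using assms by (auto simp: bddm_def)
  have "cmod (m0 x) \<le> K" for x
    by (rule LIMSEQ_le_const2[OF tendsto_norm[OF assms(4)]]) (use assms(2) in auto)
  then have b0: "bddm m0" using assms by (auto simp: bddm_def)
  have "(\<lambda>n. L2 (\<lambda>x. m n x * f x)) \<longlonglongrightarrow> L2 (\<lambda>x. m0 x * f x)"
    by (rule L2_dominated_convergence(3)[where h="\<lambda>x. complex_of_real K * f x"])
       (use assms f K in \<open>auto simp: norm_mult sq_int_cmult sq_int_measurable intro!: mult_right_mono tendsto_intros\<close>)
  then show ?thesis using f b b0 by (simp add: mulop_L2)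
qed

lemma isCont_cinner_right: "bounded_linear (cinner w)"
  by (rule bounded_linear_intro[where K="norm w"])
     (auto simp: cinner_add_right scaleR_smc cinner_smc_right scaleR_conv_of_real cmod_cinner_le[THEN order_trans] mult.commute)

subsection \<open>Affine changes of variables\<close>

lemma nn_integral_lborel_affine:
  fixes f :: "'a::euclidean_space \<Rightarrow> ennreal"
  assumes [measurable]: "f \<in> borel_measurable borel" and c: "c \<noteq> 0"
  shows "(\<integral>\<^sup>+x. f x \<partial>lborel) = ennreal (\<bar>c\<bar> ^ DIM('a)) * (\<integral>\<^sup>+x. f (t + c *\<^sub>R x) \<partial>lborel)"
  by (subst lborel_affine[OF c, of t]) (simp add: nn_integral_density nn_integral_distr nn_integral_cmult)

lemma integral_lborel_affine:
  fixes f :: "'a::euclidean_space \<Rightarrow> 'b::{banach, second_countable_topology}"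
  assumes [measurable]: "f \<in> borel_measurable borel" and c: "c \<noteq> 0"
  shows "(\<integral>x. f x \<partial>lborel) = (\<bar>c\<bar> ^ DIM('a)) *\<^sub>R (\<integral>x. f (t + c *\<^sub>R x) \<partial>lborel)"
  by (subst lborel_affine[OF c, of t]) (simp add: integral_density integral_distr)

lemma integrable_lborel_affine:
  fixes f :: "'a::euclidean_space \<Rightarrow> 'b::{banach, second_countable_topology}"
  assumes f: "integrable lborel f" and c: "c \<noteq> 0"
  shows "integrable lborel (\<lambda>x. f (t + c *\<^sub>R x))"
proof -
  have [measurable]: "f \<in> borel_measurable borel" using f by simp
  have "ennreal (\<bar>c\<bar> ^ DIM('a)) * (\<integral>\<^sup>+x. norm (f (t + c *\<^sub>R x)) \<partial>lborel) < \<infinity>"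
    using f by (subst nn_integral_lborel_affine[OF _ c, of "\<lambda>x. ennreal (norm (f x))" t, symmetric])
      (auto simp: integrable_iff_bounded)
  then have "(\<integral>\<^sup>+x. norm (f (t + c *\<^sub>R x)) \<partial>lborel) < \<infinity>"
  proof -
    assume a: "ennreal (\<bar>c\<bar> ^ DIM('a)) * (\<integral>\<^sup>+x. norm (f (t + c *\<^sub>R x)) \<partial>lborel) < \<infinity>"
    have "0 < \<bar>c\<bar> ^ DIM('a)" using c by simp
    then have "ennreal (\<bar>c\<bar> ^ DIM('a)) \<noteq> 0" by (simp only: ennreal_eq_0_iff not_le)
    then show ?thesis using a unfolding ennreal_mult_less_top infinity_ennreal_def by (metis ennreal_zero_less_top)
  qed
  then show ?thesis by (auto simp: integrable_iff_bounded)
qed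

lemma nn_integral_lborel_translate:
  fixes f :: "'a::euclidean_space \<Rightarrow> ennreal"
  assumes "f \<in> borel_measurable borel"
  shows "(\<integral>\<^sup>+x. f (t + x) \<partial>lborel) = (\<integral>\<^sup>+x. f x \<partial>lborel)"
  using nn_integral_lborel_affine[OF assms, of 1 t] by simp

lemma integral_lborel_translate:
  fixes f :: "'a::euclidean_space \<Rightarrow> 'b::{banach, second_countable_topology}"
  assumes "f \<in> borel_measurable borel"
  shows "(\<integral>x. f (t + x) \<partial>lborel) = (\<integral>x. f x \<partial>lborel)"
  using integral_lborel_affine[OF assms, of 1 t] by simp

subsection \<open>The Fourier transform of a Gaussian\<close>

definition gauss :: "'a::euclidean_space \<Rightarrow> real" where "gauss x = exp (- (norm x)\<^sup>2 / 2)"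

lemma gauss_real: "gauss (x::real) = sqrt (2 * pi) * std_normal_density x"
  by (simp add: gauss_def std_normal_density_def)

lemma gauss_meas [measurable]: "gauss \<in> borel_measurable borel"
  unfolding gauss_def by measurable

lemma gauss_cont: "continuous_on UNIV gauss"
  unfolding gauss_def by (intro continuous_intros) auto

lemma gauss_le1: "gauss x \<le> 1" and gauss_nn: "0 \<le> gauss x"
  by (auto simp: gauss_def)

text \<open>Read off from the characteristic function of the standard normal distribution.\<close>

lemma gauss_fourier_real:
  "integrable lborel (\<lambda>x. iexp (t * x) * complex_of_real (gauss (x::real)))"
  "(\<integral>x. iexp (t * x) * complex_of_real (gauss (x::real)) \<partial>lborel) = complex_of_real (sqrt (2 * pi) * exp (- t\<^sup>2 / 2))"
proof -
  have i: "integrable lborel (\<lambda>x. gauss (x::real))"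
    unfolding gauss_real[abs_def] by (intro integrable_mult_right integrable_normal_density) simp
  show 1: "integrable lborel (\<lambda>x. iexp (t * x) * complex_of_real (gauss (x::real)))"
    by (rule Bochner_Integration.integrable_bound[OF i]) (auto simp: norm_mult gauss_nn)
  have "complex_of_real (exp (- t\<^sup>2 / 2)) = char std_normal_distribution t"
    by (simp add: char_std_normal_distribution)
  also have "\<dots> = (\<integral>x. std_normal_density x *\<^sub>R iexp (t * x) \<partial>lborel)"
    unfolding char_def by (rule integral_density) auto
  finally have "(\<integral>x. complex_of_real (std_normal_density x) * iexp (t * x) \<partial>lborel) = complex_of_real (exp (- t\<^sup>2 / 2))"
    by (simp add: scaleR_conv_of_real)
  then have "complex_of_real (sqrt (2 * pi)) * (\<integral>x. complex_of_real (std_normal_density x) * iexp (t * x) \<partial>lborel)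
    = complex_of_real (sqrt (2 * pi)) * complex_of_real (exp (- t\<^sup>2 / 2))" by simp
  then show "(\<integral>x. iexp (t * x) * complex_of_real (gauss (x::real)) \<partial>lborel) = complex_of_real (sqrt (2 * pi) * exp (- t\<^sup>2 / 2))"
    by (simp add: gauss_real mult_ac flip: Bochner_Integration.integral_mult_right_zero)
qed

lemma norm_sq_Basis: "(norm (x::'a::euclidean_space))\<^sup>2 = (\<Sum>b\<in>Basis. (x \<bullet> b)\<^sup>2)"
  unfolding power2_norm_eq_inner by (subst euclidean_inner) (simp add: power2_eq_square)

lemma gauss_prod: "gauss (x::'a::euclidean_space) = (\<Prod>b\<in>Basis. gauss (x \<bullet> b))"
  by (simp add: gauss_def norm_sq_Basis exp_sum[symmetric] sum_negf sum_divide_distrib)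

lemma Basis_sum_inner: "b \<in> Basis \<Longrightarrow> (\<Sum>b'\<in>Basis. f b' *\<^sub>R b') \<bullet> b = (f b :: real)"
  by (simp add: inner_sum_left inner_Basis if_distrib[of "\<lambda>x. _ * x"] cong: if_cong)

interpretation lborel_PiM: product_sigma_finite "\<lambda>b::'a::euclidean_space. (lborel :: real measure)"
  by standard

lemma integral_lborel_prod_Basis:
  fixes f :: "'a::euclidean_space \<Rightarrow> real \<Rightarrow> complex"
  assumes "\<And>b. b \<in> Basis \<Longrightarrow> integrable lborel (f b)"
  shows "(\<integral>x. (\<Prod>b\<in>Basis. f b (x \<bullet> b)) \<partial>lborel) = (\<Prod>b\<in>Basis. \<integral>x. f b x \<partial>lborel)"
proof -
  have [measurable]: "\<And>b. b \<in> Basis \<Longrightarrow> f b \<in> borel_measurable borel" using assms by auto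
  have "(\<integral>x. (\<Prod>b\<in>Basis. f b (x \<bullet> b)) \<partial>lborel)
     = (\<integral>x. (\<Prod>b\<in>Basis. f b ((\<Sum>b\<in>Basis. x b *\<^sub>R b) \<bullet> b)) \<partial>(\<Pi>\<^sub>M b\<in>(Basis::'a set). lborel))"
    by (subst lborel_eq) (rule integral_distr; measurable)
  also have "\<dots> = (\<integral>x. (\<Prod>b\<in>Basis. f b (x b)) \<partial>(\<Pi>\<^sub>M b\<in>(Basis::'a set). lborel))"
    by (intro Bochner_Integration.integral_cong refl prod.cong) (simp add: Basis_sum_inner)
  also have "\<dots> = (\<Prod>b\<in>Basis. \<integral>x. f b x \<partial>lborel)"
    by (rule lborel_PiM.product_integral_prod) (auto simp: assms)
  finally show ?thesis .
qed

lemma integrable_lborel_prod_Basis: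
  fixes f :: "'a::euclidean_space \<Rightarrow> real \<Rightarrow> real"
  assumes "\<And>b. b \<in> Basis \<Longrightarrow> integrable lborel (f b)" "\<And>b x. b \<in> Basis \<Longrightarrow> 0 \<le> f b x"
  shows "integrable lborel (\<lambda>x. \<Prod>b\<in>Basis. f b (x \<bullet> b))"
proof -
  have [measurable]: "\<And>b. b \<in> Basis \<Longrightarrow> f b \<in> borel_measurable borel" using assms by auto
  have "(\<integral>\<^sup>+x. ennreal (norm (\<Prod>b\<in>Basis. f b (x \<bullet> b))) \<partial>lborel) = (\<integral>\<^sup>+x. (\<Prod>b\<in>Basis. ennreal (f b (x \<bullet> b))) \<partial>lborel)"
    using assms by (intro nn_integral_cong) (simp add: prod_ennreal prod_nonneg)
  also have "\<dots> = (\<Prod>b\<in>Basis. \<integral>\<^sup>+x. ennreal (f b x) \<partial>lborel)"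
    by (rule nn_integral_lborel_prod) auto
  also have "\<dots> < \<infinity>"
  proof -
    have "(\<Prod>b\<in>B. g b) < \<infinity>" if "finite B" "\<And>b. b \<in> B \<Longrightarrow> g b < \<infinity>" for B :: "'a set" and g :: "'a \<Rightarrow> ennreal"
      using that by (induction B) (auto simp: ennreal_mult_less_top)
    moreover have "(\<integral>\<^sup>+x. ennreal (f b x) \<partial>lborel) < \<infinity>" if "b \<in> Basis" for b
      using assms(1)[OF that] assms(2)[OF that] by (simp add: integrable_iff_bounded)
    ultimately show ?thesis by (simp add: prod_ennreal)
  qed
  finally show ?thesis by (auto simp: integrable_iff_bounded)
qed

lemma gauss_integrable: "integrable lborel (gauss :: 'a::euclidean_space \<Rightarrow> real)"
proof -
  have i: "integrable lborel (\<lambda>x. gauss (x::real))"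
    unfolding gauss_real[abs_def] by (intro integrable_mult_right integrable_normal_density) simp
  have "integrable lborel (\<lambda>x::'a. \<Prod>b\<in>Basis. gauss (x \<bullet> b))"
    by (rule integrable_lborel_prod_Basis[OF i gauss_nn])
  moreover have "gauss = (\<lambda>x::'a. \<Prod>b\<in>Basis. gauss (x \<bullet> b))" by (rule ext) (rule gauss_prod)
  ultimately show ?thesis by metis
qed

text \<open>Gaussian and character both factor over the basis, so the integral is a product of
  one-dimensional ones.\<close>

lemma gauss_fourier:
  "(\<integral>x. exp (- \<i> * complex_of_real (x \<bullet> \<xi>)) * complex_of_real (gauss (x::'a::euclidean_space)) \<partial>lborel)
    = complex_of_real ((2 * pi) powr (real DIM('a) / 2) * gauss \<xi>)"
proof -
  have "exp (- \<i> * complex_of_real (x \<bullet> \<xi>)) = (\<Prod>b\<in>Basis. iexp ((- (\<xi> \<bullet> b)) * (x \<bullet> b)))" for x :: 'a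
    by (subst euclidean_inner) (simp add: exp_sum[symmetric] sum_distrib_left sum_negf mult_ac)
  then have "(\<integral>x. exp (- \<i> * complex_of_real (x \<bullet> \<xi>)) * complex_of_real (gauss (x::'a)) \<partial>lborel)
    = (\<integral>x. (\<Prod>b\<in>Basis. iexp ((- (\<xi> \<bullet> b)) * (x \<bullet> b)) * complex_of_real (gauss (x \<bullet> b))) \<partial>lborel)"
    by (simp add: gauss_prod[of "_::'a"] prod.distrib)
  also have "\<dots> = (\<Prod>b\<in>Basis. complex_of_real (sqrt (2 * pi) * exp (- (- (\<xi> \<bullet> b))\<^sup>2 / 2)))"
    by (subst integral_lborel_prod_Basis[OF gauss_fourier_real(1)]) (simp only: gauss_fourier_real(2))
  also have "\<dots> = complex_of_real (sqrt (2 * pi) ^ DIM('a) * gauss \<xi>)"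
  proof -
    have "gauss \<xi> = (\<Prod>b\<in>Basis. exp (- (\<xi> \<bullet> b)\<^sup>2 / 2))" by (subst gauss_prod) (simp add: gauss_def)
    then show ?thesis by (simp add: prod.distrib)
  qed
  also have "sqrt (2 * pi) ^ DIM('a) = (2 * pi) powr (real DIM('a) / 2)"
    by (simp add: powr_half_sqrt[symmetric] powr_powr powr_realpow[symmetric])
  finally show ?thesis .
qed

subsection \<open>The Fourier integral\<close>

definition cD :: "'a::euclidean_space itself \<Rightarrow> real" where "cD _ = (2 * pi) powr (- real DIM('a) / 2)"

lemma cD_pos: "0 < cD TYPE('a::euclidean_space)" by (simp add: cD_def)

lemma cD_gauss: "cD TYPE('a::euclidean_space) * (2 * pi) powr (real DIM('a) / 2) = 1"
  unfolding cD_def by (simp add: powr_add[symmetric])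

lemma fourier_cong_AE:
  fixes f g :: "'a::euclidean_space \<Rightarrow> complex"
  assumes [measurable]: "f \<in> borel_measurable lebesgue" "g \<in> borel_measurable lebesgue"
    and ae: "AE x in lebesgue. f x = g x"
  shows "fourier f = fourier g"
proof
  fix \<xi> :: 'a
  have [measurable]: "(\<lambda>x. exp (- \<i> * complex_of_real (x \<bullet> \<xi>))) \<in> borel_measurable lebesgue"
    by (intro borel_measurable_lebesgueI) measurable
  show "fourier f \<xi> = fourier g \<xi>" unfolding fourier_def
  proof (intro arg_cong2[where f="(*)"] refl integral_cong_AE)
    show "AE x in lebesgue. exp (- \<i> * complex_of_real (x \<bullet> \<xi>)) * f x = exp (- \<i> * complex_of_real (x \<bullet> \<xi>)) * g x"
      using ae by eventually_elim simp
  qed measurable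
qed

lemma fourier_borel:
  fixes f :: "'a::euclidean_space \<Rightarrow> complex"
  assumes [measurable]: "f \<in> borel_measurable borel"
  shows "fourier f \<xi> = complex_of_real (cD TYPE('a)) * (\<integral>x. exp (- \<i> * complex_of_real (x \<bullet> \<xi>)) * f x \<partial>lborel)"
  unfolding fourier_def cD_def by (subst integral_completion) measurable

lemma ifourier_cnj: "ifourier f x = cnj (fourier (\<lambda>\<xi>. cnj (f \<xi>)) x)"
proof -
  have "cnj (\<integral>\<xi>. exp (- \<i> * complex_of_real (\<xi> \<bullet> x)) * cnj (f \<xi>) \<partial>lebesgue)
     = (\<integral>\<xi>. cnj (exp (- \<i> * complex_of_real (\<xi> \<bullet> x)) * cnj (f \<xi>)) \<partial>lebesgue)"
    by (rule Bochner_Integration.integral_cnj[symmetric])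
  also have "\<dots> = (\<integral>\<xi>. exp (\<i> * complex_of_real (x \<bullet> \<xi>)) * f \<xi> \<partial>lebesgue)"
    by (simp add: exp_cnj inner_commute)
  finally show ?thesis unfolding ifourier_def fourier_def by simp
qed

lemma fourier_integrand_integrable:
  fixes f :: "'a::euclidean_space \<Rightarrow> complex"
  assumes "integrable lborel f"
  shows "integrable lborel (\<lambda>x. exp (- \<i> * complex_of_real (x \<bullet> \<xi>)) * f x)"
  by (rule Bochner_Integration.integrable_bound[OF assms]) (use assms in \<open>auto simp: norm_mult\<close>)

lemma cont_fourier_integral:
  fixes f :: "'a::euclidean_space \<Rightarrow> complex"
  assumes f: "integrable lborel f"
  shows "continuous_on UNIV (\<lambda>\<xi>. \<integral>x. exp (- \<i> * complex_of_real (x \<bullet> \<xi>)) * f x \<partial>lborel)"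
proof (rule continuous_on_sequentiallyI)
  fix u :: "nat \<Rightarrow> 'a" and a assume u: "u \<longlonglongrightarrow> a"
  have [measurable]: "f \<in> borel_measurable borel" using f by simp
  show "(\<lambda>n. \<integral>x. exp (- \<i> * complex_of_real (x \<bullet> u n)) * f x \<partial>lborel)
     \<longlonglongrightarrow> (\<integral>x. exp (- \<i> * complex_of_real (x \<bullet> a)) * f x \<partial>lborel)"
  proof (rule integral_dominated_convergence[where w="\<lambda>x. cmod (f x)"])
    show "AE x in lborel. (\<lambda>i. exp (- \<i> * complex_of_real (x \<bullet> u i)) * f x) \<longlonglongrightarrow> exp (- \<i> * complex_of_real (x \<bullet> a)) * f x"
      using u by (intro AE_I2 tendsto_intros)
  qed (use f in \<open>auto simp: norm_mult\<close>)
qed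

lemma fourier_cont:
  fixes f :: "'a::euclidean_space \<Rightarrow> complex"
  assumes "f \<in> borel_measurable lebesgue" "integrable lebesgue f"
  shows "continuous_on UNIV (fourier f)"
proof -
  obtain g where g: "g \<in> borel_measurable borel" "AE x in lebesgue. f x = g x"
    using lebesgue_borel_rep_complex[OF assms(1)] by blast
  have "integrable lebesgue g"
    using integrable_cong_AE[OF assms(1) borel_measurable_lebesgueI[OF g(1)] g(2)] assms(2) by simp
  then have gi: "integrable lborel g" using g integrable_completion[of g lborel] by simp
  have "fourier f = fourier g" by (rule fourier_cong_AE[OF assms(1) borel_measurable_lebesgueI[OF g(1)] g(2)])
  moreover have "fourier g = (\<lambda>\<xi>. complex_of_real (cD TYPE('a)) * (\<integral>x. exp (- \<i> * complex_of_real (x \<bullet> \<xi>)) * g x \<partial>lborel))"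
    by (rule ext) (rule fourier_borel[OF g(1)])
  ultimately show ?thesis
    by (simp only:) (intro continuous_intros cont_fourier_integral gi)
qed

lemma fourier_le:
  fixes f :: "'a::euclidean_space \<Rightarrow> complex"
  assumes "f \<in> borel_measurable borel"
  shows "cmod (fourier f \<xi>) \<le> cD TYPE('a) * (\<integral>x. cmod (f x) \<partial>lborel)"
proof -
  have "cmod (\<integral>x. exp (- \<i> * complex_of_real (x \<bullet> \<xi>)) * f x \<partial>lborel)
    \<le> (\<integral>x. cmod (exp (- \<i> * complex_of_real (x \<bullet> \<xi>)) * f x) \<partial>lborel)"
    by (rule integral_norm_bound)
  then show ?thesis using cD_pos[where 'a='a]
    by (simp add: fourier_borel[OF assms] norm_mult)
qed

lemma integrable_pair_mult:
  fixes f :: "'a::euclidean_space \<Rightarrow> complex" and g :: "'b::euclidean_space \<Rightarrow> complex"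
  assumes f: "integrable lborel f" and g: "integrable lborel g"
  shows "integrable (lborel \<Otimes>\<^sub>M lborel) (\<lambda>(x, y). f x * g y)"
proof -
  have [measurable]: "f \<in> borel_measurable borel" "g \<in> borel_measurable borel" using f g by simp_all
  show ?thesis
  proof (rule lborel_pair.Fubini_integrable)
    show "integrable lborel (\<lambda>x. \<integral>y. norm (case (x, y) of (x, y) \<Rightarrow> f x * g y) \<partial>lborel)"
      using f by (simp add: norm_mult)
    show "AE x in lborel. integrable lborel (\<lambda>y. case (x, y) of (x, y) \<Rightarrow> f x * g y)"
      using g by simp
  qed measurable
qed

text \<open>The multiplication formula. It is the Fubini core of both Plancherel and
  \<open>IFT_adj\<close>.\<close>

lemma fourier_swap:
  fixes f g :: "'a::euclidean_space \<Rightarrow> complex"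
  assumes f: "integrable lborel f" and g: "integrable lborel g"
  shows "(\<integral>\<xi>. (\<integral>x. exp (- \<i> * complex_of_real (x \<bullet> \<xi>)) * f x \<partial>lborel) * g \<xi> \<partial>lborel)
       = (\<integral>x. f x * (\<integral>\<xi>. exp (- \<i> * complex_of_real (\<xi> \<bullet> x)) * g \<xi> \<partial>lborel) \<partial>lborel)"
proof -
  have [measurable]: "f \<in> borel_measurable borel" "g \<in> borel_measurable borel" using f g by simp_all
  have "integrable (lborel \<Otimes>\<^sub>M lborel) (\<lambda>(x, \<xi>). exp (- \<i> * complex_of_real (x \<bullet> \<xi>)) * f x * g \<xi>)"
    by (rule Bochner_Integration.integrable_bound[OF integrable_pair_mult[OF f g]]) (auto simp: norm_mult)
  note F = lborel_pair.Fubini_integral[OF this]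
  have e1: "(\<integral>x. exp (- \<i> * complex_of_real (x \<bullet> \<xi>)) * f x * g \<xi> \<partial>lborel)
     = (\<integral>x. exp (- \<i> * complex_of_real (x \<bullet> \<xi>)) * f x \<partial>lborel) * g \<xi>" for \<xi>
    by (rule Bochner_Integration.integral_mult_left_zero)
  have e2: "(\<integral>\<xi>. exp (- \<i> * complex_of_real (x \<bullet> \<xi>)) * f x * g \<xi> \<partial>lborel)
     = f x * (\<integral>\<xi>. exp (- \<i> * complex_of_real (\<xi> \<bullet> x)) * g \<xi> \<partial>lborel)" for x
    by (subst Bochner_Integration.integral_mult_right_zero[symmetric]) (simp add: inner_commute mult_ac)
  show ?thesis using F unfolding e1 e2 .
qed

subsection \<open>Plancherel\<close>

lemma lebesgue_integrable_iff:
  fixes f :: "'a::euclidean_space \<Rightarrow> 'b::{banach, second_countable_topology}"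
  shows "f \<in> borel_measurable borel \<Longrightarrow> integrable lebesgue f = integrable lborel f"
  by (rule integrable_completion) simp

lemma gauss_dilated_fourier:
  fixes z :: "'a::euclidean_space"
  assumes h: "0 < h"
  shows "(\<integral>\<xi>. exp (- \<i> * complex_of_real (\<xi> \<bullet> z)) * complex_of_real (gauss (h *\<^sub>R \<xi>)) \<partial>lborel)
    = complex_of_real ((2 * pi) powr (real DIM('a) / 2) * (1/h) ^ DIM('a) * gauss ((1/h) *\<^sub>R z))"
proof -
  have "(\<integral>\<xi>. exp (- \<i> * complex_of_real (\<xi> \<bullet> z)) * complex_of_real (gauss (h *\<^sub>R \<xi>)) \<partial>lborel)
    = (\<bar>1/h\<bar> ^ DIM('a)) *\<^sub>R (\<integral>\<xi>. exp (- \<i> * complex_of_real ((0 + (1/h) *\<^sub>R \<xi>) \<bullet> z)) * complex_of_real (gauss (h *\<^sub>R (0 + (1/h) *\<^sub>R \<xi>))) \<partial>lborel)"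
    using h by (intro integral_lborel_affine) auto
  also have "\<dots> = (\<bar>1/h\<bar> ^ DIM('a)) *\<^sub>R (\<integral>\<xi>. exp (- \<i> * complex_of_real (\<xi> \<bullet> ((1/h) *\<^sub>R z))) * complex_of_real (gauss \<xi>) \<partial>lborel)"
    using h by simp
  finally show ?thesis unfolding gauss_fourier using h by (simp add: scaleR_conv_of_real)
qed

text \<open>The Gaussian factor makes every double integral absolutely convergent. Two applications
  of \<open>fourier_swap\<close> remove both transforms of f, and the transform of the dilated
  Gaussian is an approximate identity of width h and mass one.\<close>

lemma smoothed_plancherel:
  fixes f :: "'a::euclidean_space \<Rightarrow> complex"
  assumes f: "integrable lborel f" and h: "0 < h"
  shows "integrable lborel (\<lambda>\<xi>. (cmod (fourier f \<xi>))\<^sup>2 * gauss (h *\<^sub>R \<xi>))"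
    and "complex_of_real (\<integral>\<xi>. (cmod (fourier f \<xi>))\<^sup>2 * gauss (h *\<^sub>R \<xi>) \<partial>lborel)
       = (\<integral>y. f y * cnj (\<integral>z. f (y + h *\<^sub>R z) * complex_of_real (cD TYPE('a) * gauss z) \<partial>lborel) \<partial>lborel)"
proof -
  let ?c = "cD TYPE('a)"
  have fm [measurable]: "f \<in> borel_measurable borel" using f by simp
  have Fc: "continuous_on UNIV (fourier f)"
    using f lebesgue_integrable_iff[OF fm] borel_measurable_lebesgueI[OF fm] by (intro fourier_cont) auto
  have [measurable]: "fourier f \<in> borel_measurable borel"
    by (rule borel_measurable_continuous_onI[OF Fc])
  define K where "K = ?c * (\<integral>x. cmod (f x) \<partial>lborel)"
  have FK: "cmod (fourier f \<xi>) \<le> K" for \<xi> unfolding K_def by (rule fourier_le[OF fm])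
  have K0: "0 \<le> K" using FK[of 0] norm_ge_zero order_trans by blast
  have gh: "integrable lborel (\<lambda>\<xi>::'a. gauss (h *\<^sub>R \<xi>))"
    using integrable_lborel_affine[OF gauss_integrable, of h 0] h by simp
  have ghc: "integrable lborel (\<lambda>\<xi>::'a. complex_of_real (gauss (h *\<^sub>R \<xi>)))"
    using gh by (rule integrable_of_real)
  have "integrable lborel (\<lambda>\<xi>. K\<^sup>2 * gauss (h *\<^sub>R \<xi> :: 'a))" using gh by simp
  then show int: "integrable lborel (\<lambda>\<xi>. (cmod (fourier f \<xi>))\<^sup>2 * gauss (h *\<^sub>R \<xi>))"
    by (rule Bochner_Integration.integrable_bound)
       (use FK gauss_nn in \<open>auto simp: abs_mult intro!: mult_right_mono power_mono\<close>)
  define G where "G \<xi> = cnj (fourier f \<xi>) * complex_of_real (gauss (h *\<^sub>R \<xi>))" for \<xi>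
  have [measurable]: "G \<in> borel_measurable borel" unfolding G_def by measurable
  have Gi: "integrable lborel G"
  proof (rule Bochner_Integration.integrable_bound)
    show "integrable lborel (\<lambda>\<xi>. K * gauss (h *\<^sub>R \<xi> :: 'a))" using gh by simp
    show "AE x in lborel. cmod (G x) \<le> norm (K * gauss (h *\<^sub>R x))"
      using FK gauss_nn K0 by (auto simp: G_def norm_mult abs_mult intro!: mult_right_mono)
  qed measurable
  have "complex_of_real (\<integral>\<xi>. (cmod (fourier f \<xi>))\<^sup>2 * gauss (h *\<^sub>R \<xi>) \<partial>lborel) = (\<integral>\<xi>. fourier f \<xi> * G \<xi> \<partial>lborel)"
  proof -
    have "fourier f \<xi> * G \<xi> = complex_of_real ((cmod (fourier f \<xi>))\<^sup>2 * gauss (h *\<^sub>R \<xi>))" for \<xi>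
      unfolding G_def of_real_mult cnj_mult_self[symmetric] by simp
    then show ?thesis by (simp only: integral_complex_of_real)
  qed
  also have "\<dots> = ?c * (\<integral>\<xi>. (\<integral>x. exp (- \<i> * complex_of_real (x \<bullet> \<xi>)) * f x \<partial>lborel) * G \<xi> \<partial>lborel)"
    by (simp add: fourier_borel mult.assoc)
  also have "\<dots> = ?c * (\<integral>y. f y * (\<integral>\<xi>. exp (- \<i> * complex_of_real (\<xi> \<bullet> y)) * G \<xi> \<partial>lborel) \<partial>lborel)"
    by (simp only: fourier_swap[OF f Gi])
  also have "\<dots> = (\<integral>y. f y * (?c * (\<integral>\<xi>. exp (- \<i> * complex_of_real (\<xi> \<bullet> y)) * G \<xi> \<partial>lborel)) \<partial>lborel)"
    by (simp flip: Bochner_Integration.integral_mult_right_zero add: mult_ac)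
  also have "\<dots> = (\<integral>y. f y * cnj (\<integral>z. f (y + h *\<^sub>R z) * complex_of_real (?c * gauss z) \<partial>lborel) \<partial>lborel)"
  proof (intro Bochner_Integration.integral_cong refl arg_cong2[where f="(*)"])
    fix y
    \<comment> \<open>With this factor the inner integral becomes, up to conjugation, a second
      instance of the multiplication formula.\<close>
    define g where "g \<xi> = exp (- \<i> * complex_of_real (\<xi> \<bullet> (- y))) * complex_of_real (gauss (h *\<^sub>R \<xi>))" for \<xi> :: 'a
    have gi: "integrable lborel g" unfolding g_def by (rule fourier_integrand_integrable[OF ghc])
    have "(\<integral>\<xi>. exp (- \<i> * complex_of_real (\<xi> \<bullet> y)) * G \<xi> \<partial>lborel)
        = (\<integral>\<xi>. cnj (fourier f \<xi> * g \<xi>) \<partial>lborel)"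
      unfolding G_def g_def by (intro Bochner_Integration.integral_cong) (simp_all add: exp_cnj mult_ac)
    also have "\<dots> = cnj (\<integral>\<xi>. fourier f \<xi> * g \<xi> \<partial>lborel)" by (rule Bochner_Integration.integral_cnj)
    also have "(\<integral>\<xi>. fourier f \<xi> * g \<xi> \<partial>lborel) = ?c * (\<integral>\<xi>. (\<integral>x. exp (- \<i> * complex_of_real (x \<bullet> \<xi>)) * f x \<partial>lborel) * g \<xi> \<partial>lborel)"
      by (simp add: fourier_borel mult.assoc)
    also have "\<dots> = ?c * (\<integral>x. f x * (\<integral>\<xi>. exp (- \<i> * complex_of_real (\<xi> \<bullet> x)) * g \<xi> \<partial>lborel) \<partial>lborel)"
      by (simp only: fourier_swap[OF f gi])
    also have "(\<lambda>x. \<integral>\<xi>. exp (- \<i> * complex_of_real (\<xi> \<bullet> x)) * g \<xi> \<partial>lborel)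
       = (\<lambda>x. complex_of_real ((2 * pi) powr (real DIM('a) / 2) * (1/h) ^ DIM('a) * gauss ((1/h) *\<^sub>R (x - y))))"
    proof
      fix x
      have "exp (- \<i> * complex_of_real (\<xi> \<bullet> x)) * g \<xi> = exp (- \<i> * complex_of_real (\<xi> \<bullet> (x - y))) * complex_of_real (gauss (h *\<^sub>R \<xi>))" for \<xi>
        unfolding g_def by (simp add: exp_add[symmetric] inner_diff_right algebra_simps flip: mult.assoc)
      then show "(\<integral>\<xi>. exp (- \<i> * complex_of_real (\<xi> \<bullet> x)) * g \<xi> \<partial>lborel) = complex_of_real ((2 * pi) powr (real DIM('a) / 2) * (1/h) ^ DIM('a) * gauss ((1/h) *\<^sub>R (x - y)))"
        by (simp only: gauss_dilated_fourier[OF h])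
    qed
    also have "complex_of_real ?c * (\<integral>x. f x * complex_of_real ((2 * pi) powr (real DIM('a) / 2) * (1/h) ^ DIM('a) * gauss ((1/h) *\<^sub>R (x - y))) \<partial>lborel)
        = complex_of_real (?c * (2 * pi) powr (real DIM('a) / 2) * (1/h) ^ DIM('a)) * (\<integral>x. f x * complex_of_real (gauss ((1/h) *\<^sub>R (x - y))) \<partial>lborel)"
      by (simp flip: Bochner_Integration.integral_mult_right_zero add: mult_ac)
    also have "\<dots> = complex_of_real ((1/h) ^ DIM('a)) * (\<integral>x. f x * complex_of_real (gauss ((1/h) *\<^sub>R (x - y))) \<partial>lborel)"
      by (simp only: cD_gauss mult_1)
    also have "(\<integral>x. f x * complex_of_real (gauss ((1/h) *\<^sub>R (x - y))) \<partial>lborel)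
       = (\<bar>h\<bar> ^ DIM('a)) *\<^sub>R (\<integral>z. f (y + h *\<^sub>R z) * complex_of_real (gauss ((1/h) *\<^sub>R (y + h *\<^sub>R z - y))) \<partial>lborel)"
      using h by (intro integral_lborel_affine) auto
    finally have "(\<integral>\<xi>. exp (- \<i> * complex_of_real (\<xi> \<bullet> y)) * G \<xi> \<partial>lborel) = cnj (\<integral>z. f (y + h *\<^sub>R z) * complex_of_real (gauss z) \<partial>lborel)"
      using h by (simp add: scaleR_conv_of_real power_one_over)
    moreover have "(\<integral>z. f (y + h *\<^sub>R z) * complex_of_real (?c * gauss z) \<partial>lborel)
      = complex_of_real ?c * (\<integral>z. f (y + h *\<^sub>R z) * complex_of_real (gauss z) \<partial>lborel)"
      by (subst Bochner_Integration.integral_mult_right_zero[symmetric]) (simp add: mult_ac)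
    ultimately show "complex_of_real ?c * (\<integral>\<xi>. exp (- \<i> * complex_of_real (\<xi> \<bullet> y)) * G \<xi> \<partial>lborel)
       = cnj (\<integral>z. f (y + h *\<^sub>R z) * complex_of_real (?c * gauss z) \<partial>lborel)"
      by simp
  qed
  finally show "complex_of_real (\<integral>\<xi>. (cmod (fourier f \<xi>))\<^sup>2 * gauss (h *\<^sub>R \<xi>) \<partial>lborel)
       = (\<integral>y. f y * cnj (\<integral>z. f (y + h *\<^sub>R z) * complex_of_real (?c * gauss z) \<partial>lborel) \<partial>lborel)" .
qed

lemma cD_gauss_integral: "(\<integral>z. cD TYPE('a) * gauss (z::'a::euclidean_space) \<partial>lborel) = 1"
proof -
  have "complex_of_real (\<integral>z. gauss (z::'a) \<partial>lborel) = complex_of_real ((2 * pi) powr (real DIM('a) / 2))"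
    using gauss_fourier[of "0::'a"] by (simp add: gauss_def)
  then show ?thesis using cD_gauss[where 'a='a] by (simp only: of_real_eq_iff Bochner_Integration.integral_mult_right_zero)
qed

lemma cD_gauss_nn_integral: "(\<integral>\<^sup>+z. ennreal (cD TYPE('a) * gauss (z::'a::euclidean_space)) \<partial>lborel) = 1"
proof -
  have "(\<integral>\<^sup>+z. ennreal (cD TYPE('a) * gauss (z::'a)) \<partial>lborel) = ennreal (\<integral>z. cD TYPE('a) * gauss (z::'a) \<partial>lborel)"
    by (intro nn_integral_eq_integral integrable_mult_right gauss_integrable AE_I2 mult_nonneg_nonneg gauss_nn less_imp_le cD_pos)
  then show ?thesis by (simp only: cD_gauss_integral ennreal_1)
qed

text \<open>Half of Plancherel. The average against a probability density is estimated by 2ab <= a^2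
  + b^2 and translation invariance, uniformly in h; Fatou then removes the Gaussian. Equality
  requires f(y + h z) to tend to f(y), which is why continuous f are treated separately.\<close>

lemma fourier_contraction_nn:
  fixes f :: "'a::euclidean_space \<Rightarrow> complex"
  assumes f: "integrable lborel f" and sf: "sq_int f"
  shows "(\<integral>\<^sup>+\<xi>. ennreal ((cmod (fourier f \<xi>))\<^sup>2) \<partial>lborel) \<le> (\<integral>\<^sup>+x. ennreal ((cmod (f x))\<^sup>2) \<partial>lborel)"
proof -
  have fm [measurable]: "f \<in> borel_measurable borel" using f by simp
  have [measurable]: "fourier f \<in> borel_measurable borel"
    using f lebesgue_integrable_iff[OF fm] borel_measurable_lebesgueI[OF fm]
    by (intro borel_measurable_continuous_onI fourier_cont) auto
  define I where "I = (\<integral>\<^sup>+x. ennreal ((cmod (f x))\<^sup>2) \<partial>lborel)"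
  define N where "N z = cD TYPE('a) * gauss z" for z :: 'a
  have N0: "0 \<le> N z" for z using gauss_nn[of z] cD_pos[where 'a='a] by (simp add: N_def)
  have [measurable]: "N \<in> borel_measurable borel" unfolding N_def by measurable
  have bound: "(\<integral>\<^sup>+\<xi>. ennreal ((cmod (fourier f \<xi>))\<^sup>2 * gauss (h *\<^sub>R \<xi>)) \<partial>lborel) \<le> I" if h: "0 < h" for h
  proof -
    have "(\<integral>\<^sup>+\<xi>. ennreal ((cmod (fourier f \<xi>))\<^sup>2 * gauss (h *\<^sub>R \<xi>)) \<partial>lborel)
       = ennreal (\<integral>\<xi>. (cmod (fourier f \<xi>))\<^sup>2 * gauss (h *\<^sub>R \<xi>) \<partial>lborel)"
      by (rule nn_integral_eq_integral[OF smoothed_plancherel(1)[OF f h]]) (simp add: gauss_nn)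
    also have "\<dots> = ennreal (cmod (\<integral>y. f y * cnj (\<integral>z. f (y + h *\<^sub>R z) * complex_of_real (N z) \<partial>lborel) \<partial>lborel))"
      unfolding N_def smoothed_plancherel(2)[OF f h, symmetric] by (simp add: integral_nonneg gauss_nn)
    also have "\<dots> \<le> (\<integral>\<^sup>+y. ennreal (cmod (f y * cnj (\<integral>z. f (y + h *\<^sub>R z) * complex_of_real (N z) \<partial>lborel))) \<partial>lborel)"
    proof (cases "integrable lborel (\<lambda>y. f y * cnj (\<integral>z. f (y + h *\<^sub>R z) * complex_of_real (N z) \<partial>lborel))")
      case True then show ?thesis by (rule integral_norm_bound_ennreal)
    next
      case False then show ?thesis by (simp add: not_integrable_integral_eq)
    qed
    also have "\<dots> \<le> (\<integral>\<^sup>+y. \<integral>\<^sup>+z. ennreal (cmod (f y) * (cmod (f (y + h *\<^sub>R z)) * N z)) \<partial>lborel \<partial>lborel)"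
    proof (rule nn_integral_mono)
      fix y
      have "ennreal (cmod (\<integral>z. f (y + h *\<^sub>R z) * complex_of_real (N z) \<partial>lborel))
         \<le> (\<integral>\<^sup>+z. ennreal (cmod (f (y + h *\<^sub>R z)) * N z) \<partial>lborel)"
      proof (cases "integrable lborel (\<lambda>z. f (y + h *\<^sub>R z) * complex_of_real (N z))")
        case True from integral_norm_bound_ennreal[OF this] show ?thesis by (simp add: norm_mult N0)
      next
        case False then show ?thesis by (simp add: not_integrable_integral_eq)
      qed
      then have "ennreal (cmod (f y)) * ennreal (cmod (\<integral>z. f (y + h *\<^sub>R z) * complex_of_real (N z) \<partial>lborel))
         \<le> ennreal (cmod (f y)) * (\<integral>\<^sup>+z. ennreal (cmod (f (y + h *\<^sub>R z)) * N z) \<partial>lborel)"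
        by (rule mult_left_mono) simp
      then show "ennreal (cmod (f y * cnj (\<integral>z. f (y + h *\<^sub>R z) * complex_of_real (N z) \<partial>lborel)))
        \<le> (\<integral>\<^sup>+z. ennreal (cmod (f y) * (cmod (f (y + h *\<^sub>R z)) * N z)) \<partial>lborel)"
        by (simp add: norm_mult ennreal_mult N0 nn_integral_cmult)
    qed
    also have "\<dots> \<le> (\<integral>\<^sup>+y. \<integral>\<^sup>+z. (ennreal (1/2) * (ennreal ((cmod (f y))\<^sup>2) + ennreal ((cmod (f (y + h *\<^sub>R z)))\<^sup>2))) * ennreal (N z) \<partial>lborel \<partial>lborel)"
    proof (intro nn_integral_mono)
      fix y z
      have "2 * (cmod (f y) * cmod (f (y + h *\<^sub>R z))) \<le> (cmod (f y))\<^sup>2 + (cmod (f (y + h *\<^sub>R z)))\<^sup>2"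
        using zero_le_power2[of "cmod (f y) - cmod (f (y + h *\<^sub>R z))"] unfolding power2_diff by simp
      then have "cmod (f y) * cmod (f (y + h *\<^sub>R z)) * N z \<le> (1/2 * ((cmod (f y))\<^sup>2 + (cmod (f (y + h *\<^sub>R z)))\<^sup>2)) * N z"
        by (intro mult_right_mono N0) simp
      then have "ennreal (cmod (f y) * cmod (f (y + h *\<^sub>R z)) * N z) \<le> ennreal ((1/2 * ((cmod (f y))\<^sup>2 + (cmod (f (y + h *\<^sub>R z)))\<^sup>2)) * N z)"
        by (rule ennreal_leI)
      also have "\<dots> = (ennreal (1/2) * (ennreal ((cmod (f y))\<^sup>2) + ennreal ((cmod (f (y + h *\<^sub>R z)))\<^sup>2))) * ennreal (N z)"
        by (simp only: ennreal_mult' N0 ennreal_plus zero_le_power2 ennreal_mult'' add_nonneg_nonneg)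
      finally show "ennreal (cmod (f y) * (cmod (f (y + h *\<^sub>R z)) * N z)) \<le> (ennreal (1/2) * (ennreal ((cmod (f y))\<^sup>2) + ennreal ((cmod (f (y + h *\<^sub>R z)))\<^sup>2))) * ennreal (N z)"
        by (simp add: mult.assoc)
    qed
    also have "\<dots> = (\<integral>\<^sup>+z. \<integral>\<^sup>+y. (ennreal (1/2) * (ennreal ((cmod (f y))\<^sup>2) + ennreal ((cmod (f (y + h *\<^sub>R z)))\<^sup>2))) * ennreal (N z) \<partial>lborel \<partial>lborel)"
      by (rule lborel_pair.Fubini') measurable
    also have "\<dots> = (\<integral>\<^sup>+z. (ennreal (1/2) * (I + I)) * ennreal (N z) \<partial>lborel)"
    proof (intro nn_integral_cong)
      fix z :: 'a
      have "(\<integral>\<^sup>+y. ennreal ((cmod (f (y + h *\<^sub>R z)))\<^sup>2) \<partial>lborel) = I"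
        unfolding I_def using nn_integral_lborel_translate[of "\<lambda>x. ennreal ((cmod (f x))\<^sup>2)" "h *\<^sub>R z"] by (simp add: add.commute)
      then show "(\<integral>\<^sup>+y. (ennreal (1/2) * (ennreal ((cmod (f y))\<^sup>2) + ennreal ((cmod (f (y + h *\<^sub>R z)))\<^sup>2))) * ennreal (N z) \<partial>lborel)
        = (ennreal (1/2) * (I + I)) * ennreal (N z)"
        by (simp add: nn_integral_multc nn_integral_cmult nn_integral_add I_def[symmetric])
    qed
    also have "\<dots> = ennreal (1/2) * (I + I)"
      unfolding N_def by (simp add: nn_integral_cmult cD_gauss_nn_integral)
    also have "\<dots> = I"
    proof -
      have "ennreal (1/2) * (I + I) = (ennreal (1/2) + ennreal (1/2)) * I" by (simp only: distrib_left distrib_right)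
      also have "ennreal (1/2) + ennreal (1/2) = 1" by (subst ennreal_plus[symmetric]) auto
      finally show ?thesis by simp
    qed
    finally show ?thesis .
  qed
  have "(\<integral>\<^sup>+\<xi>. ennreal ((cmod (fourier f \<xi>))\<^sup>2) \<partial>lborel)
     = (\<integral>\<^sup>+\<xi>. liminf (\<lambda>n. ennreal ((cmod (fourier f \<xi>))\<^sup>2 * gauss ((1 / real (Suc n)) *\<^sub>R \<xi>))) \<partial>lborel)"
  proof (rule nn_integral_cong)
    fix \<xi> :: 'a
    have "(\<lambda>n. (1 / real (Suc n)) *\<^sub>R \<xi>) \<longlonglongrightarrow> 0 *\<^sub>R \<xi>"
      unfolding inverse_eq_divide[symmetric] by (intro tendsto_intros LIMSEQ_inverse_real_of_nat)
    then have "(\<lambda>n. gauss ((1 / real (Suc n)) *\<^sub>R \<xi>)) \<longlonglongrightarrow> gauss (0 *\<^sub>R \<xi>)"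
      by (rule continuous_on_tendsto_compose[OF gauss_cont]) auto
    then have "(\<lambda>n. ennreal ((cmod (fourier f \<xi>))\<^sup>2 * gauss ((1 / real (Suc n)) *\<^sub>R \<xi>))) \<longlonglongrightarrow> ennreal ((cmod (fourier f \<xi>))\<^sup>2 * gauss (0 *\<^sub>R \<xi>))"
      by (intro tendsto_ennrealI tendsto_mult tendsto_const)
    then have "(\<lambda>n. ennreal ((cmod (fourier f \<xi>))\<^sup>2 * gauss ((1 / real (Suc n)) *\<^sub>R \<xi>))) \<longlonglongrightarrow> ennreal ((cmod (fourier f \<xi>))\<^sup>2)"
      by (simp add: gauss_def)
    then show "ennreal ((cmod (fourier f \<xi>))\<^sup>2) = liminf (\<lambda>n. ennreal ((cmod (fourier f \<xi>))\<^sup>2 * gauss ((1 / real (Suc n)) *\<^sub>R \<xi>)))"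
      by (intro lim_imp_Liminf[symmetric]) simp_all
  qed
  also have "\<dots> \<le> liminf (\<lambda>n. \<integral>\<^sup>+\<xi>. ennreal ((cmod (fourier f \<xi>))\<^sup>2 * gauss ((1 / real (Suc n)) *\<^sub>R \<xi>)) \<partial>lborel)"
    by (rule nn_integral_liminf) measurable
  also have "\<dots> \<le> I"
    by (intro order_trans[OF Liminf_le_Limsup Limsup_bounded] always_eventually allI bound) simp_all
  finally show ?thesis unfolding I_def .
qed

definition L12 :: "('a::euclidean_space \<Rightarrow> complex) \<Rightarrow> bool" where
  "L12 f \<longleftrightarrow> sq_int f \<and> integrable lebesgue f"

lemma L12_borel_rep:
  assumes "L12 f"
  shows "\<exists>g. g \<in> borel_measurable borel \<and> L12 g \<and> integrable lborel g \<and> L2 f = L2 g \<and> fourier f = fourier g"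
proof -
  have f: "f \<in> borel_measurable lebesgue" "sq_int f" "integrable lebesgue f" using assms by (auto simp: L12_def sq_int_def)
  obtain g where g: "g \<in> borel_measurable borel" "sq_int g" "l2eq f g"
    using sq_int_borel_rep[OF f(2)] by blast
  note gl = borel_measurable_lebesgueI[OF g(1)]
  have gi: "integrable lebesgue g"
    using integrable_cong_AE[OF f(1) gl] g(3) f(3) by (simp add: l2eq_def)
  have "fourier f = fourier g" using fourier_cong_AE[OF f(1) gl] g(3) by (simp add: l2eq_def)
  moreover have "L2 f = L2 g" using f g by (simp add: L2_eq_iff)
  ultimately show ?thesis using g gi lebesgue_integrable_iff[OF g(1)] by (intro exI[of _ g]) (simp add: L12_def)
qed

lemma L12_cont: "L12 f \<Longrightarrow> continuous_on UNIV (fourier f)"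
  by (rule fourier_cont) (auto simp: L12_def sq_int_def)

lemma L12_fourier_meas: "L12 f \<Longrightarrow> fourier f \<in> borel_measurable borel"
  by (rule borel_measurable_continuous_onI[OF L12_cont])

lemma fourier_contraction:
  assumes "L12 f" shows "sq_int (fourier f)" "norm (L2 (fourier f)) \<le> norm (L2 f)"
proof -
  obtain g where g: "g \<in> borel_measurable borel" "L12 g" "integrable lborel g" and e: "L2 f = L2 g" "fourier f = fourier g"
    using L12_borel_rep[OF assms] by blast
  have sg: "sq_int g" using g by (simp add: L12_def)
  note * = fourier_contraction_nn[OF g(3) sg]
  have m: "fourier g \<in> borel_measurable borel" by (rule L12_fourier_meas[OF g(2)])
  show 1: "sq_int (fourier f)" unfolding e using sg * g by (simp add: sq_int_iff_nn m)
  have "ennreal ((norm (L2 (fourier g)))\<^sup>2) \<le> ennreal ((norm (L2 g))\<^sup>2)"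
    using * nn_norm_L2_sq[OF sg g(1)] nn_norm_L2_sq[OF 1[unfolded e] m] by simp
  then have "(norm (L2 (fourier g)))\<^sup>2 \<le> (norm (L2 g))\<^sup>2" by (simp add: ennreal_le_iff)
  then show "norm (L2 (fourier f)) \<le> norm (L2 f)" unfolding e by (rule power2_le_imp_le) simp
qed

text \<open>For bounded continuous f the smoothed averages converge pointwise to f, so the damped
  identity tends to (norm f)^2, while its Fourier side never exceeds the squared norm of the
  transform. Together with \<open>fourier_contraction\<close> this is equality;
  \<open>FT_norm\<close> extends it by density.\<close>

lemma fourier_isometry_cont:
  fixes f :: "'a::euclidean_space \<Rightarrow> complex"
  assumes f: "L12 f" and c: "continuous_on UNIV f" and bd: "\<And>x. cmod (f x) \<le> K"
  shows "norm (L2 (fourier f)) = norm (L2 f)"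
proof -
  have fm [measurable]: "f \<in> borel_measurable borel" by (rule borel_measurable_continuous_onI[OF c])
  have fi: "integrable lborel f" and sf: "sq_int f"
    using f lebesgue_integrable_iff[OF fm] by (auto simp: L12_def)
  have Fm [measurable]: "fourier f \<in> borel_measurable borel" by (rule L12_fourier_meas[OF f])
  have sF: "sq_int (fourier f)" by (rule fourier_contraction(1)[OF f])
  define N where "N z = cD TYPE('a) * gauss z" for z :: 'a
  have N0: "0 \<le> N z" for z using gauss_nn[of z] cD_pos[where 'a='a] by (simp add: N_def)
  have Ni: "integrable lborel N" unfolding N_def by (intro integrable_mult_right gauss_integrable)
  have [measurable]: "N \<in> borel_measurable borel" using Ni by simp
  define h where "h n = 1 / real (Suc n)" for n
  have h0: "h n > 0" for n by (simp add: h_def)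
  have hl: "h \<longlonglongrightarrow> 0" unfolding h_def[abs_def] using LIMSEQ_inverse_real_of_nat by (simp add: inverse_eq_divide)
  define A where "A n y = (\<integral>z. f (y + h n *\<^sub>R z) * complex_of_real (N z) \<partial>lborel)" for n y
  have [measurable]: "A n \<in> borel_measurable borel" for n unfolding A_def by measurable
  have inner: "(\<lambda>n. A n y) \<longlonglongrightarrow> f y" for y
  proof -
    have "(\<lambda>n. \<integral>z. f (y + h n *\<^sub>R z) * complex_of_real (N z) \<partial>lborel) \<longlonglongrightarrow> (\<integral>z. f y * complex_of_real (N z) \<partial>lborel)"
    proof (rule integral_dominated_convergence[where w="\<lambda>z. K * N z"])
      show "integrable lborel (\<lambda>z. K * N z)" using Ni by simp
      show "AE z in lborel. (\<lambda>n. f (y + h n *\<^sub>R z) * complex_of_real (N z)) \<longlonglongrightarrow> f y * complex_of_real (N z)"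
      proof (intro AE_I2 tendsto_mult tendsto_const)
        fix z
        have "(\<lambda>n. y + h n *\<^sub>R z) \<longlonglongrightarrow> y + 0 *\<^sub>R z" by (intro tendsto_intros hl)
        then show "(\<lambda>n. f (y + h n *\<^sub>R z)) \<longlonglongrightarrow> f y"
          using c by (intro continuous_on_tendsto_compose[OF c]) auto
      qed
      show "AE z in lborel. norm (f (y + h n *\<^sub>R z) * complex_of_real (N z)) \<le> K * N z" for n
        using bd N0 by (auto simp: norm_mult intro!: mult_right_mono)
    qed measurable
    moreover have "(\<integral>z. N z \<partial>lborel) = 1" unfolding N_def by (rule cD_gauss_integral)
    ultimately show ?thesis unfolding A_def by simp
  qed
  have Abd: "cmod (A n y) \<le> K" for n y
  proof -
    have "cmod (A n y) \<le> (\<integral>z. cmod (f (y + h n *\<^sub>R z) * complex_of_real (N z)) \<partial>lborel)"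
      unfolding A_def by (rule integral_norm_bound)
    also have "\<dots> \<le> (\<integral>z. K * N z \<partial>lborel)"
    proof (rule integral_mono')
      show "integrable lborel (\<lambda>z. K * N z)" using Ni by simp
      fix z show "cmod (f (y + h n *\<^sub>R z) * complex_of_real (N z)) \<le> K * N z"
        using bd N0 by (auto simp: norm_mult intro!: mult_right_mono)
      show "0 \<le> K * N z" using N0[of z] bd[of 0] norm_ge_zero[of "f 0"] by (intro mult_nonneg_nonneg) linarith+
    qed
    also have "\<dots> = K" using cD_gauss_integral[where 'a='a] by (simp add: N_def)
    finally show ?thesis .
  qed
  have "(\<lambda>n. \<integral>y. f y * cnj (A n y) \<partial>lborel) \<longlonglongrightarrow> (\<integral>y. f y * cnj (f y) \<partial>lborel)"
  proof (rule integral_dominated_convergence[where w="\<lambda>y. cmod (f y) * K"])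
    show "integrable lborel (\<lambda>y. cmod (f y) * K)" using fi by simp
    show "AE y in lborel. (\<lambda>n. f y * cnj (A n y)) \<longlonglongrightarrow> f y * cnj (f y)"
      by (intro AE_I2 tendsto_intros inner)
    show "AE y in lborel. cmod (f y * cnj (A n y)) \<le> cmod (f y) * K" for n
      using Abd by (auto simp: norm_mult intro!: mult_left_mono)
  qed measurable
  then have "(\<lambda>n. cmod (\<integral>y. f y * cnj (A n y) \<partial>lborel)) \<longlonglongrightarrow> cmod (\<integral>y. f y * cnj (f y) \<partial>lborel)"
    by (rule tendsto_norm)
  moreover have "cmod (\<integral>y. f y * cnj (f y) \<partial>lborel) = (norm (L2 f))\<^sup>2"
  proof -
    have "(\<integral>y. f y * cnj (f y) \<partial>lborel) = complex_of_real (\<integral>y. (cmod (f y))\<^sup>2 \<partial>lborel)"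
      unfolding mult.commute[of "f _"] cnj_mult_self by (rule integral_complex_of_real)
    then show ?thesis by (simp add: norm_L2_sq[OF sf] integral_completion integral_nonneg)
  qed
  moreover have "cmod (\<integral>y. f y * cnj (A n y) \<partial>lborel) \<le> (norm (L2 (fourier f)))\<^sup>2" for n
  proof -
    have "cmod (\<integral>y. f y * cnj (A n y) \<partial>lborel) = (\<integral>\<xi>. (cmod (fourier f \<xi>))\<^sup>2 * gauss (h n *\<^sub>R \<xi>) \<partial>lborel)"
      unfolding A_def N_def smoothed_plancherel(2)[OF fi h0, symmetric] by (simp add: integral_nonneg gauss_nn)
    also have "\<dots> \<le> (\<integral>\<xi>. (cmod (fourier f \<xi>))\<^sup>2 \<partial>lborel)"
      using sF by (intro integral_mono smoothed_plancherel(1)[OF fi h0])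
        (auto simp: sq_int_def lebesgue_integrable_iff intro!: mult_left_le gauss_le1)
    also have "\<dots> = (norm (L2 (fourier f)))\<^sup>2" by (simp add: norm_L2_sq[OF sF] integral_completion)
    finally show ?thesis .
  qed
  ultimately have "(norm (L2 f))\<^sup>2 \<le> (norm (L2 (fourier f)))\<^sup>2"
    by (intro LIMSEQ_le_const2) auto
  then have "norm (L2 f) \<le> norm (L2 (fourier f))" by (rule power2_le_imp_le) simp
  then show ?thesis using fourier_contraction(2)[OF f] by simp
qed

lemma integrable_bounded_support:
  fixes f :: "'a::euclidean_space \<Rightarrow> complex"
  assumes [measurable]: "f \<in> borel_measurable borel" and bd: "\<And>x. cmod (f x) \<le> K" and supp: "\<And>x. r < norm x \<Longrightarrow> f x = 0"
  shows "integrable lborel f" "L12 f"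
proof -
  have b: "integrable lborel (\<lambda>x. K * indicator (cball (0::'a) r) x)"
    by (intro integrable_mult_right integrable_real_indicator emeasure_bounded_finite) auto
  show 1: "integrable lborel f"
    by (rule Bochner_Integration.integrable_bound[OF b])
       (use bd supp in \<open>auto simp: indicator_def not_le intro: order_trans[OF _ abs_ge_self]\<close>)
  have b2: "integrable lborel (\<lambda>x. K\<^sup>2 * indicator (cball (0::'a) r) x)"
    by (intro integrable_mult_right integrable_real_indicator emeasure_bounded_finite) auto
  have "integrable lborel (\<lambda>x. (cmod (f x))\<^sup>2)"
    by (rule Bochner_Integration.integrable_bound[OF b2])
       (use bd supp in \<open>auto simp: indicator_def not_le intro!: AE_I2 power_mono\<close>)
  then show "L12 f" using 1 borel_measurable_lebesgueI[of f]
    by (simp add: L12_def sq_int_def lebesgue_integrable_iff)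
qed

text \<open>Truncate u in size and position, approximate the result almost everywhere by continuous
  functions, then impose bounds on these without losing continuity: values are projected to a disc
  by \<open>closest_point\<close>, positions are cut off by \<open>ct\<close>. Dominated convergence
  serves both stages.\<close>

lemma cont_bdd_dense:
  fixes u :: "'a::euclidean_space l2"
  assumes e: "0 < e"
  shows "\<exists>f K. L12 f \<and> continuous_on UNIV f \<and> (\<forall>x. cmod (f x) \<le> K) \<and> norm (L2 f - u) < e"
proof -
  obtain f where f: "sq_int f" and fm [measurable]: "f \<in> borel_measurable borel" and u: "u = L2 f" by (rule L2_cases)
  define g where "g n x = (if norm x \<le> real n \<and> cmod (f x) \<le> real n then f x else 0)" for n :: nat and x
  have [measurable]: "g n \<in> borel_measurable borel" for n unfolding g_def by measurable
  have "(\<lambda>n. L2 (g n)) \<longlonglongrightarrow> L2 f"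
  proof (rule L2_dominated_convergence(3)[OF _ _ f])
    show "AE x in lebesgue. (\<lambda>n. g n x) \<longlonglongrightarrow> f x"
    proof (rule AE_I2)
      fix x
      obtain N :: nat where "max (norm x) (cmod (f x)) \<le> real N" using real_arch_simple by blast
      then have "\<forall>n\<ge>N. g n x = f x" by (auto simp: g_def)
      then show "(\<lambda>n. g n x) \<longlonglongrightarrow> f x"
        by (intro tendsto_eventually) (auto simp: eventually_sequentially)
    qed
  qed (auto simp: borel_measurable_lebesgueI g_def)
  then have "\<forall>\<^sub>F n in sequentially. dist (L2 (g n)) u < e / 2" unfolding u
    using e by (intro tendstoD) auto
  then obtain n where n: "dist (L2 (g n)) u < e / 2" by (auto simp: eventually_sequentially)
  define r where "r = real n"
  have "g n measurable_on UNIV"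
    by (intro lebesgue_measurable_imp_measurable_on borel_measurable_lebesgueI) auto
  then obtain N h where N: "negligible N" and h: "\<And>k. continuous_on UNIV (h k)"
    "\<And>x. x \<notin> N \<Longrightarrow> (\<lambda>k. h k x) \<longlonglongrightarrow> g n x"
    unfolding measurable_on_def by auto
  define ct where "ct x = max 0 (min 1 (r + 1 - norm x))" for x :: 'a
  have ct: "0 \<le> ct x" "ct x \<le> 1" "norm x \<le> r \<Longrightarrow> ct x = 1" "r + 1 < norm x \<Longrightarrow> ct x = 0" for x
    by (auto simp: ct_def)
  have ctc: "continuous_on UNIV ct" unfolding ct_def by (intro continuous_intros)
  define c where "c = closest_point (cball (0::complex) r)"
  have r0: "0 \<le> r" by (simp add: r_def)
  have cc: "continuous_on UNIV c" unfolding c_def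
    by (rule continuous_on_closest_point) (use r0 in auto)
  have cb: "cmod (c z) \<le> r" for z
    using closest_point_in_set[of "cball (0::complex) r" z] r0 by (auto simp: c_def)
  have cid: "cmod z \<le> r \<Longrightarrow> c z = z" for z
    unfolding c_def by (rule closest_point_self) auto
  define G where "G k x = complex_of_real (ct x) * c (h k x)" for k x
  have Gc: "continuous_on UNIV (G k)" for k unfolding G_def
    by (intro continuous_intros ctc continuous_on_compose2[OF cc h(1)]) auto
  have Gm [measurable]: "G k \<in> borel_measurable borel" for k by (rule borel_measurable_continuous_onI[OF Gc])
  have Gb: "cmod (G k x) \<le> r" for k x
    using mult_mono[OF ct(2)[of x] cb[of "h k x"]] ct(1)[of x] by (simp add: G_def norm_mult)
  have Gs: "r + 1 < norm x \<Longrightarrow> G k x = 0" for k x by (simp add: G_def ct)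
  have GL: "L12 (G k)" for k by (rule integrable_bounded_support(2)[OF Gm Gb Gs])
  define w where "w x = (if norm x \<le> r + 1 then complex_of_real r else 0)" for x :: 'a
  have w: "sq_int w"
    using integrable_bounded_support(2)[of w r "r + 1"] r0 unfolding w_def by (auto simp: L12_def)
  have "(\<lambda>k. L2 (G k)) \<longlonglongrightarrow> L2 (g n)"
  proof (rule L2_dominated_convergence(3)[OF _ _ w])
    show "cmod (G k x) \<le> cmod (w x)" for k x
      using Gb[of k x] Gs[of x k] r0 by (auto simp: w_def not_le)
    have "AE x in lebesgue. x \<notin> N"
      using N by (simp add: negligible_iff_null_sets AE_not_in)
    then show "AE x in lebesgue. (\<lambda>k. G k x) \<longlonglongrightarrow> g n x"
    proof eventually_elim
      case (elim x)
      have "(\<lambda>k. c (h k x)) \<longlonglongrightarrow> c (g n x)"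
        by (intro continuous_on_tendsto_compose[OF cc h(2)[OF elim]]) auto
      then have "(\<lambda>k. G k x) \<longlonglongrightarrow> complex_of_real (ct x) * c (g n x)"
        unfolding G_def by (intro tendsto_intros)
      moreover have "complex_of_real (ct x) * c (g n x) = g n x"
        using ct(3)[of x] cid[of 0] cid[of "f x"] r0 by (auto simp: g_def r_def)
      ultimately show ?case by simp
    qed
  qed (auto intro: borel_measurable_lebesgueI)
  then have "\<forall>\<^sub>F k in sequentially. dist (L2 (G k)) (L2 (g n)) < e / 2"
    using e by (intro tendstoD) auto
  then obtain k where k: "dist (L2 (G k)) (L2 (g n)) < e / 2" by (auto simp: eventually_sequentially)
  have "dist (L2 (G k)) u < e" using dist_triangle_half_l[OF k] n by (metis dist_commute)
  then show ?thesis using GL Gc Gb by (intro exI[of _ "G k"] exI[of _ r]) (simp add: dist_norm)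
qed

subsection \<open>The Fourier transform on L2\<close>

definition trunc :: "real \<Rightarrow> ('a::euclidean_space \<Rightarrow> complex) \<Rightarrow> 'a \<Rightarrow> complex" where
  "trunc R f = (\<lambda>x. indicator (ball 0 R) x * f x)"

lemma indicator_ball_sq_int: "sq_int (\<lambda>x::'a::euclidean_space. indicator (ball 0 R) x)"
  using integrable_bounded_support(2)[of "\<lambda>x::'a. indicator (ball 0 R) x" 1 R]
  by (auto simp: L12_def indicator_def)

lemma L12_trunc:
  assumes "sq_int f" shows "L12 (trunc R f)"
proof -
  have "sq_int (\<lambda>x. indicator (ball 0 R) x * f x)"
    by (rule sq_int_mult_bdd[OF assms, where K=1]) (auto intro!: borel_measurable_lebesgueI simp: indicator_def)
  moreover have "integrable lebesgue (\<lambda>x. cnj (indicator (ball 0 R) x) * f x)"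
    by (rule sq_int_prod_integrable[OF indicator_ball_sq_int assms])
  moreover have "cnj (indicator (ball 0 R) x) = indicator (ball 0 R) x" for x :: 'a
    by (simp add: indicator_def)
  ultimately show ?thesis by (simp add: L12_def trunc_def)
qed

lemma trunc_tendsto_seq:
  fixes f :: "'a::euclidean_space \<Rightarrow> complex"
  assumes f: "sq_int f" and X: "filterlim X at_top sequentially"
  shows "(\<lambda>n. L2 (trunc (X n) f)) \<longlonglongrightarrow> L2 f"
proof (rule L2_dominated_convergence(3)[OF _ _ f])
  show "trunc (X n) f \<in> borel_measurable lebesgue" for n
    using L12_trunc[OF f] by (auto simp: L12_def sq_int_def)
  show "f \<in> borel_measurable lebesgue" using f by (simp add: sq_int_def)
  show "cmod (trunc (X n) f x) \<le> cmod (f x)" for n x by (simp add: trunc_def indicator_def)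
  show "AE x in lebesgue. (\<lambda>n. trunc (X n) f x) \<longlonglongrightarrow> f x"
  proof (rule AE_I2)
    fix x :: 'a
    have "\<forall>\<^sub>F n in sequentially. norm x < X n" using X by (simp add: filterlim_at_top_dense)
    then have "\<forall>\<^sub>F n in sequentially. trunc (X n) f x = f x"
      by eventually_elim (simp add: trunc_def)
    then show "(\<lambda>n. trunc (X n) f x) \<longlonglongrightarrow> f x" by (rule tendsto_eventually)
  qed
qed

lemma trunc_tendsto: "sq_int f \<Longrightarrow> ((\<lambda>R. L2 (trunc R f)) \<longlongrightarrow> L2 f) at_top"
  by (rule tendsto_at_topI_sequentially) (rule trunc_tendsto_seq)

lemma fourier_add:
  assumes "L12 f" "L12 g" shows "fourier (\<lambda>x. f x + g x) \<xi> = fourier f \<xi> + fourier g \<xi>"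
proof -
  have i: "integrable lebesgue (\<lambda>x. exp (- \<i> * complex_of_real (x \<bullet> \<xi>)) * f x)" if "L12 f" for f
  proof (rule Bochner_Integration.integrable_bound)
    show "integrable lebesgue f" using that by (simp add: L12_def)
    have [measurable]: "(\<lambda>x. exp (- \<i> * complex_of_real (x \<bullet> \<xi>))) \<in> borel_measurable lebesgue" "f \<in> borel_measurable lebesgue"
      using that by (auto intro: borel_measurable_lebesgueI simp: L12_def sq_int_def)
    show "(\<lambda>x. exp (- \<i> * complex_of_real (x \<bullet> \<xi>)) * f x) \<in> borel_measurable lebesgue" by measurable
  qed (simp add: norm_mult)
  show ?thesis unfolding fourier_def
    using Bochner_Integration.integral_add[OF i[OF assms(1)] i[OF assms(2)]] by (simp add: distrib_left)
qed

lemma fourier_cmult: "fourier (\<lambda>x. c * f x) \<xi> = c * fourier f \<xi>"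
  unfolding fourier_def by (simp add: mult.left_commute[of _ c])

lemma L12_add: "L12 f \<Longrightarrow> L12 g \<Longrightarrow> L12 (\<lambda>x. f x + g x)"
  by (simp add: L12_def sq_int_add)
lemma L12_cmult: "L12 f \<Longrightarrow> L12 (\<lambda>x. c * f x)"
  by (simp add: L12_def sq_int_cmult)
lemma L12_cnj: "L12 f \<Longrightarrow> L12 (\<lambda>x. cnj (f x))"
  by (simp add: L12_def sq_int_cnj)
lemma L12_sq: "L12 f \<Longrightarrow> sq_int f" by (simp add: L12_def)

lemma fourier_diff_norm:
  assumes "L12 f" "L12 g"
  shows "norm (L2 (fourier f) - L2 (fourier g)) \<le> norm (L2 f - L2 g)"
proof -
  have m: "L12 (\<lambda>x. -1 * g x)" by (rule L12_cmult[OF assms(2)])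
  have "fourier (\<lambda>x. f x + -1 * g x) = (\<lambda>\<xi>. fourier f \<xi> + -1 * fourier g \<xi>)"
    by (rule ext) (subst fourier_add[OF assms(1) m], subst fourier_cmult, rule refl)
  then have "L2 (fourier f) - L2 (fourier g) = L2 (fourier (\<lambda>x. f x + -1 * g x))"
    using assms by (simp add: L2_diff fourier_contraction(1))
  also have "norm \<dots> \<le> norm (L2 (\<lambda>x. f x + -1 * g x))"
    by (rule fourier_contraction(2)[OF L12_add[OF assms(1) m]])
  also have "L2 (\<lambda>x. f x + -1 * g x) = L2 f - L2 g" using assms by (simp add: L2_diff L12_sq)
  finally show ?thesis .
qed

definition FT :: "'a::euclidean_space l2 \<Rightarrow> 'a l2" where
  "FT u = lim (\<lambda>n. L2 (fourier (trunc (real n) (rep_l2 u))))"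

text \<open>By contractivity, the transforms of any approximating sequence differ by a null sequence
  from those of the truncations in \<open>FT\<close>; the limit is thus independent of the
  sequence.\<close>

lemma FT_limit:
  assumes f: "\<And>n. L12 (f n)" and lim: "(\<lambda>n. L2 (f n)) \<longlonglongrightarrow> u"
  shows "(\<lambda>n. L2 (fourier (f n))) \<longlonglongrightarrow> FT u"
proof -
  define t where "t n = trunc (real n) (rep_l2 u)" for n :: nat
  have t: "L12 (t n)" for n unfolding t_def by (rule L12_trunc[OF sq_int_rep])
  have tl: "(\<lambda>n. L2 (t n)) \<longlonglongrightarrow> u"
    unfolding t_def using trunc_tendsto_seq[OF sq_int_rep filterlim_real_sequentially, of u] by (simp add: L2_rep)
  have "Cauchy (\<lambda>n. L2 (fourier (t n)))"
  proof (rule CauchyI)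
    fix e :: real assume "0 < e"
    then obtain M where "\<And>m n. m \<ge> M \<Longrightarrow> n \<ge> M \<Longrightarrow> norm (L2 (t m) - L2 (t n)) < e"
      using CauchyD[OF LIMSEQ_imp_Cauchy[OF tl]] by blast
    then show "\<exists>M. \<forall>m\<ge>M. \<forall>n\<ge>M. norm (L2 (fourier (t m)) - L2 (fourier (t n))) < e"
      using fourier_diff_norm[OF t t] by (meson le_less_trans)
  qed
  then have 1: "(\<lambda>n. L2 (fourier (t n))) \<longlonglongrightarrow> FT u"
    unfolding FT_def t_def by (simp add: Cauchy_convergent_iff convergent_LIMSEQ_iff)
  have "(\<lambda>n. L2 (fourier (f n)) - L2 (fourier (t n))) \<longlonglongrightarrow> 0"
  proof (rule Lim_null_comparison)
    show "\<forall>\<^sub>F n in sequentially. norm (L2 (fourier (f n)) - L2 (fourier (t n))) \<le> norm (L2 (f n) - L2 (t n))"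
      by (intro always_eventually allI fourier_diff_norm f t)
    have "(\<lambda>n. L2 (f n) - L2 (t n)) \<longlonglongrightarrow> u - u" by (intro tendsto_intros lim tl)
    then show "(\<lambda>n. norm (L2 (f n) - L2 (t n))) \<longlonglongrightarrow> 0" by (simp add: tendsto_norm_zero)
  qed
  from tendsto_add[OF this 1] show ?thesis by simp
qed

lemma FT_L12: "L12 f \<Longrightarrow> FT (L2 f) = L2 (fourier f)"
  using FT_limit[of "\<lambda>n. f" "L2 f"] by (simp add: LIMSEQ_const_iff)

lemma L12_approx:
  "\<exists>f. (\<forall>n. L12 (f n)) \<and> (\<lambda>n::nat. L2 (f n)) \<longlonglongrightarrow> u"
proof (intro exI[of _ "\<lambda>n. trunc (real n) (rep_l2 u)"] conjI allI)
  show "L12 (trunc (real n) (rep_l2 u))" for n by (rule L12_trunc[OF sq_int_rep])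
  show "(\<lambda>n. L2 (trunc (real n) (rep_l2 u))) \<longlonglongrightarrow> u"
    using trunc_tendsto_seq[OF sq_int_rep filterlim_real_sequentially, of u] by (simp add: L2_rep)
qed

lemma FT_add: "FT (u + v) = FT u + FT v"
proof -
  obtain f where f: "\<And>n. L12 (f n)" "(\<lambda>n::nat. L2 (f n)) \<longlonglongrightarrow> u" using L12_approx[of u] by blast
  obtain g where g: "\<And>n. L12 (g n)" "(\<lambda>n::nat. L2 (g n)) \<longlonglongrightarrow> v" using L12_approx[of v] by blast
  have "(\<lambda>n. L2 (\<lambda>x. f n x + g n x)) \<longlonglongrightarrow> u + v"
    using tendsto_add[OF f(2) g(2)] f(1) g(1) by (simp add: L2_add L12_sq)
  then have 1: "(\<lambda>n. L2 (fourier (\<lambda>x. f n x + g n x))) \<longlonglongrightarrow> FT (u + v)"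
    by (intro FT_limit L12_add f g)
  have "L2 (fourier (\<lambda>x. f n x + g n x)) = L2 (fourier (f n)) + L2 (fourier (g n))" for n
  proof -
    have "fourier (\<lambda>x. f n x + g n x) = (\<lambda>\<xi>. fourier (f n) \<xi> + fourier (g n) \<xi>)"
      by (rule ext) (rule fourier_add[OF f(1) g(1)])
    then show ?thesis using f(1) g(1) by (simp add: L2_add fourier_contraction(1))
  qed
  with 1 have "(\<lambda>n. L2 (fourier (f n)) + L2 (fourier (g n))) \<longlonglongrightarrow> FT (u + v)" by simp
  moreover have "(\<lambda>n. L2 (fourier (f n)) + L2 (fourier (g n))) \<longlonglongrightarrow> FT u + FT v"
    by (intro tendsto_add FT_limit f g)
  ultimately show ?thesis by (rule LIMSEQ_unique)
qed

lemma smc_tendsto: "(f \<longlongrightarrow> u) F \<Longrightarrow> ((\<lambda>n. smc c (f n)) \<longlongrightarrow> smc c u) F"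
proof -
  have "bounded_linear (smc c)"
    by (rule bounded_linear_intro[where K="cmod c"]) (auto simp: smc_add_right scaleR_smc smc_smc mult.commute norm_smc)
  then show "(f \<longlongrightarrow> u) F \<Longrightarrow> ((\<lambda>n. smc c (f n)) \<longlongrightarrow> smc c u) F" by (rule bounded_linear.tendsto)
qed

lemma FT_smc: "FT (smc c u) = smc c (FT u)"
proof -
  obtain f where f: "\<And>n. L12 (f n)" "(\<lambda>n::nat. L2 (f n)) \<longlonglongrightarrow> u" using L12_approx[of u] by blast
  have "(\<lambda>n. L2 (\<lambda>x. c * f n x)) \<longlonglongrightarrow> smc c u"
    using smc_tendsto[OF f(2), of c] f(1) by (simp add: L2_smc L12_sq)
  then have 1: "(\<lambda>n. L2 (fourier (\<lambda>x. c * f n x))) \<longlonglongrightarrow> FT (smc c u)"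
    by (intro FT_limit L12_cmult f)
  have "L2 (fourier (\<lambda>x. c * f n x)) = smc c (L2 (fourier (f n)))" for n
    using f(1) by (simp add: L2_smc fourier_contraction(1) fourier_cmult[abs_def])
  with 1 have "(\<lambda>n. smc c (L2 (fourier (f n)))) \<longlonglongrightarrow> FT (smc c u)" by simp
  moreover have "(\<lambda>n. smc c (L2 (fourier (f n)))) \<longlonglongrightarrow> smc c (FT u)"
    by (intro smc_tendsto FT_limit f)
  ultimately show ?thesis by (rule LIMSEQ_unique)
qed

lemma FT_norm_le: "norm (FT u) \<le> norm u"
proof -
  obtain f where f: "\<And>n. L12 (f n)" "(\<lambda>n::nat. L2 (f n)) \<longlonglongrightarrow> u" using L12_approx[of u] by blast
  show ?thesis
    by (rule LIMSEQ_le[OF tendsto_norm[OF FT_limit[OF f]] tendsto_norm[OF f(2)]])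
       (use fourier_contraction(2)[OF f(1)] in auto)
qed

lemma FT_linear: "bounded_linear FT"
  by (rule bounded_linear_intro[where K=1]) (auto simp: FT_add scaleR_smc FT_smc FT_norm_le)

lemma FT_norm: "norm (FT u) = norm u"
proof -
  have "\<exists>f K. L12 f \<and> continuous_on UNIV f \<and> (\<forall>x. cmod (f x) \<le> K) \<and> norm (L2 f - u) < 1 / real (Suc n)" for n
    by (rule cont_bdd_dense) simp
  then obtain f K where f: "\<And>n. L12 (f n)" "\<And>n. continuous_on UNIV (f n)" "\<And>n x. cmod (f n x) \<le> K n"
    "\<And>n. norm (L2 (f n) - u) < 1 / real (Suc n)" by metis
  have l: "(\<lambda>n. L2 (f n)) \<longlonglongrightarrow> u"
  proof (rule LIM_zero_cancel, rule Lim_null_comparison)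
    show "\<forall>\<^sub>F n in sequentially. norm (L2 (f n) - u) \<le> inverse (real (Suc n))"
      using f(4) by (auto simp: inverse_eq_divide intro!: always_eventually less_imp_le)
  qed (rule LIMSEQ_inverse_real_of_nat)
  have "norm (L2 (fourier (f n))) = norm (L2 (f n))" for n
    by (rule fourier_isometry_cont[OF f(1,2,3)])
  then show ?thesis
    using LIMSEQ_unique[OF tendsto_norm[OF FT_limit[OF f(1) l]]] tendsto_norm[OF l] by simp
qed

section \<open>Inverse transform by complex conjugation\<close>

definition Cj :: "'a::euclidean_space l2 \<Rightarrow> 'a l2" where "Cj u = L2 (\<lambda>x. cnj (rep_l2 u x))"

lemma Cj_L2: "sq_int f \<Longrightarrow> Cj (L2 f) = L2 (\<lambda>x. cnj (f x))"
  unfolding Cj_def using rep_L2[of f]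
  by (subst L2_eq_iff) (auto simp: sq_int_cnj sq_int_rep l2eq_def elim: eventually_mono)

lemma Cj_Cj: "Cj (Cj u) = u"
  by (rule L2_cases[of u]) (simp add: Cj_L2 sq_int_cnj)

lemma Cj_norm: "norm (Cj u) = norm u"
  by (rule L2_cases[of u]) (simp add: Cj_L2 norm_L2 sq_int_cnj l2norm_def)

lemma Cj_add: "Cj (u + v) = Cj u + Cj v"
  by (rule L2_cases[of u], rule L2_cases[of v]) (simp add: Cj_L2 L2_add sq_int_cnj sq_int_add)

lemma Cj_smc: "Cj (smc c u) = smc (cnj c) (Cj u)"
  by (rule L2_cases[of u]) (simp add: Cj_L2 L2_smc sq_int_cnj sq_int_cmult)

lemma Cj_linear: "bounded_linear Cj"
  by (rule bounded_linear_intro[where K=1]) (auto simp: Cj_add scaleR_smc Cj_smc Cj_norm)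

definition IFT :: "'a::euclidean_space l2 \<Rightarrow> 'a l2" where "IFT u = Cj (FT (Cj u))"

lemma IFT_linear: "bounded_linear IFT"
  unfolding IFT_def by (intro bounded_linear_compose[OF Cj_linear] bounded_linear_compose[OF FT_linear] Cj_linear)

lemma IFT_norm: "norm (IFT u) = norm u" by (simp add: IFT_def Cj_norm FT_norm)

lemma IFT_smc: "IFT (smc c u) = smc c (IFT u)" by (simp add: IFT_def Cj_smc FT_smc)

lemma ifourier_eq: "ifourier f = (\<lambda>x. cnj (fourier (\<lambda>\<xi>. cnj (f \<xi>)) x))"
  by (rule ext) (rule ifourier_cnj)

lemma ifourier_sq_int: "L12 f \<Longrightarrow> sq_int (ifourier f)"
  unfolding ifourier_eq by (intro sq_int_cnj fourier_contraction(1) L12_cnj)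

lemma IFT_L12: "L12 f \<Longrightarrow> IFT (L2 f) = L2 (ifourier f)"
  unfolding IFT_def ifourier_eq
  by (simp add: Cj_L2 L12_sq FT_L12 L12_cnj fourier_contraction(1))

text \<open>The multiplication formula gives this on integrable functions and density in each
  argument extends it. Combined with the isometry property it yields inversion in L2, bypassing
  pointwise inversion.\<close>

lemma IFT_adj: "cinner (IFT u) v = cinner u (FT v)"
proof -
  have base: "cinner (IFT (L2 f)) (L2 g) = cinner (L2 f) (FT (L2 g))" if fg: "L12 f" "L12 g" for f g :: "'a \<Rightarrow> complex"
  proof -
    obtain f' where f': "f' \<in> borel_measurable borel" "L12 f'" "integrable lborel f'" "L2 f = L2 f'"
      using L12_borel_rep[OF fg(1)] by blast
    obtain g' where g': "g' \<in> borel_measurable borel" "L12 g'" "integrable lborel g'" "L2 g = L2 g'"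
      using L12_borel_rep[OF fg(2)] by blast
    note [measurable] = f'(1) g'(1)
    have cf: "integrable lborel (\<lambda>x. cnj (f' x))" using f'(3) by simp
    have [measurable]: "fourier (\<lambda>x. cnj (f' x)) \<in> borel_measurable borel" "fourier g' \<in> borel_measurable borel"
      by (auto intro!: L12_fourier_meas L12_cnj f' g')
    have "cinner (IFT (L2 f)) (L2 g) = l2inner (ifourier f') g'"
      unfolding f'(4) g'(4) using f' g' by (simp add: IFT_L12 cinner_L2 ifourier_sq_int L12_sq)
    also have "\<dots> = (\<integral>\<xi>. fourier (\<lambda>x. cnj (f' x)) \<xi> * g' \<xi> \<partial>lborel)"
      unfolding l2inner_def ifourier_eq by (subst integral_completion) (auto)
    also have "\<dots> = complex_of_real (cD TYPE('a)) * (\<integral>\<xi>. (\<integral>x. exp (- \<i> * complex_of_real (x \<bullet> \<xi>)) * cnj (f' x) \<partial>lborel) * g' \<xi> \<partial>lborel)"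
      by (subst Bochner_Integration.integral_mult_right_zero[symmetric]) (simp add: fourier_borel mult.assoc)
    also have "\<dots> = complex_of_real (cD TYPE('a)) * (\<integral>x. cnj (f' x) * (\<integral>\<xi>. exp (- \<i> * complex_of_real (\<xi> \<bullet> x)) * g' \<xi> \<partial>lborel) \<partial>lborel)"
      by (simp only: fourier_swap[OF cf g'(3)])
    also have "\<dots> = (\<integral>x. cnj (f' x) * fourier g' x \<partial>lborel)"
      by (subst Bochner_Integration.integral_mult_right_zero[symmetric]) (simp add: fourier_borel mult_ac)
    also have "\<dots> = l2inner f' (fourier g')"
      unfolding l2inner_def by (subst integral_completion) auto
    also have "\<dots> = cinner (L2 f) (FT (L2 g))"
      unfolding f'(4) g'(4) using f' g' by (simp add: FT_L12 cinner_L2 fourier_contraction(1) L12_sq)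
    finally show ?thesis .
  qed
  obtain f where f: "\<And>n. L12 (f n)" "(\<lambda>n::nat. L2 (f n)) \<longlonglongrightarrow> u" using L12_approx[of u] by blast
  obtain g where g: "\<And>n. L12 (g n)" "(\<lambda>n::nat. L2 (g n)) \<longlonglongrightarrow> v" using L12_approx[of v] by blast
  have ctr: "(\<lambda>n. cinner w (a n)) \<longlonglongrightarrow> cinner w b" if "(\<lambda>n::nat. a n) \<longlonglongrightarrow> b" for w and a :: "nat \<Rightarrow> 'a l2" and b
    by (rule bounded_linear.tendsto[OF isCont_cinner_right that])
  have ctl: "(\<lambda>n. cinner (a n) w) \<longlonglongrightarrow> cinner b w" if "(\<lambda>n::nat. a n) \<longlonglongrightarrow> b" for w and a :: "nat \<Rightarrow> 'a l2" and b
    using tendsto_cnj[OF ctr[OF that, of w]] by (simp add: cinner_commute[of _ w, symmetric])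
  have 1: "cinner (IFT (L2 (f n))) v = cinner (L2 (f n)) (FT v)" for n
  proof (rule LIMSEQ_unique)
    show "(\<lambda>k. cinner (IFT (L2 (f n))) (L2 (g k))) \<longlonglongrightarrow> cinner (IFT (L2 (f n))) v" by (rule ctr[OF g(2)])
    have "(\<lambda>k. cinner (L2 (f n)) (FT (L2 (g k)))) \<longlonglongrightarrow> cinner (L2 (f n)) (FT v)"
      by (rule ctr[OF bounded_linear.tendsto[OF FT_linear g(2)]])
    then show "(\<lambda>k. cinner (IFT (L2 (f n))) (L2 (g k))) \<longlonglongrightarrow> cinner (L2 (f n)) (FT v)"
      by (simp add: base f g)
  qed
  show ?thesis
  proof (rule LIMSEQ_unique)
    show "(\<lambda>n. cinner (IFT (L2 (f n))) v) \<longlonglongrightarrow> cinner (IFT u) v"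
      by (rule ctl[OF bounded_linear.tendsto[OF IFT_linear f(2)]])
    show "(\<lambda>n. cinner (IFT (L2 (f n))) v) \<longlonglongrightarrow> cinner u (FT v)"
      unfolding 1 by (rule ctl[OF f(2)])
  qed
qed

lemma isometry_cinner:
  assumes A: "\<And>u v. A (u + v) = A u + A v" "\<And>c u. A (smc c u) = smc c (A u)" "\<And>u. norm (A u) = norm u"
  shows "cinner (A u) (A v) = cinner u v"
proof -
  have re: "Re (cinner (A u) (A v)) = Re (cinner u v)" for u v
  proof -
    have "Re (cinner (A (u + v)) (A (u + v))) = Re (cinner (u + v) (u + v))" by (simp only: cinner_self A(3))
    then have "Re (cinner (A u) (A v)) + Re (cinner (A v) (A u)) = Re (cinner u v) + Re (cinner v u)"
      unfolding A(1) cinner_add_left cinner_add_right by (simp add: cinner_self A(3))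
    moreover have "Re (cinner w z) = Re (cinner z w)" for w z :: "'c::euclidean_space l2"
      by (subst cinner_commute) simp
    ultimately show ?thesis by (metis mult_2 mult_left_cancel zero_neq_numeral)
  qed
  have "Im (cinner (A u) (A v)) = Re (cinner (A (smc \<i> u)) (A v))" by (simp add: A cinner_smc_left)
  also have "\<dots> = Im (cinner u v)" unfolding re by (simp add: cinner_smc_left)
  finally show ?thesis using re by (simp add: complex_eq_iff)
qed

lemma FT_cinner: "cinner (FT u) (FT v) = cinner u v"
  by (rule isometry_cinner) (simp_all add: FT_add FT_smc FT_norm)

lemma IFT_FT: "IFT (FT u) = u"
proof (rule l2_eqI)
  fix w
  have "cinner w (IFT (FT u)) = cnj (cinner (IFT (FT u)) w)" by (rule cinner_commute)
  also have "\<dots> = cinner w u" by (simp add: IFT_adj FT_cinner cinner_commute[symmetric])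
  finally show "cinner w (IFT (FT u)) = cinner w u" .
qed

text \<open>Surjectivity comes from symmetry: conjugating \<open>IFT_FT\<close> exchanges the two
  transforms.\<close>

lemma FT_IFT: "FT (IFT u) = u"
proof -
  have "Cj (FT (Cj (FT (Cj u)))) = Cj u" using IFT_FT[of "Cj u"] by (simp add: IFT_def)
  then show ?thesis unfolding IFT_def by (metis Cj_Cj)
qed

lemma l2norm_tendsto_L2:
  assumes "\<And>t. sq_int (f t)" "sq_int g"
  shows "((\<lambda>t. l2norm (\<lambda>x. f t x - g x)) \<longlongrightarrow> 0) F \<longleftrightarrow> ((\<lambda>t. L2 (f t)) \<longlongrightarrow> L2 g) F"
  by (simp add: l2norm_diff assms tendsto_norm_zero_iff LIM_zero_iff)

text \<open>Every object defined by \<open>SOME\<close> as a limit in L2 norm is read through this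
  lemma: once the classes converge, the choice is not void and represents their limit.
  \<open>F \<noteq> bot\<close> supplies uniqueness.\<close>

lemma L2_choose_limit:
  assumes f: "\<And>t. sq_int (f t)" and lim: "((\<lambda>t. L2 (f t)) \<longlongrightarrow> u) F" and F: "F \<noteq> bot"
  defines "g \<equiv> (SOME g. sq_int g \<and> ((\<lambda>t. l2norm (\<lambda>x. f t x - g x)) \<longlongrightarrow> 0) F)"
  shows "sq_int g" "L2 g = u"
proof -
  have "sq_int (rep_l2 u) \<and> ((\<lambda>t. l2norm (\<lambda>x. f t x - rep_l2 u x)) \<longlongrightarrow> 0) F"
    using lim by (simp add: l2norm_tendsto_L2 f sq_int_rep L2_rep)
  then have g: "sq_int g \<and> ((\<lambda>t. l2norm (\<lambda>x. f t x - g x)) \<longlongrightarrow> 0) F"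
    unfolding g_def by (rule someI[where P="\<lambda>g. sq_int g \<and> ((\<lambda>t. l2norm (\<lambda>x. f t x - g x)) \<longlongrightarrow> 0) F"])
  then show "sq_int g" by simp
  have "((\<lambda>t. L2 (f t)) \<longlongrightarrow> L2 g) F" using g l2norm_tendsto_L2[of f g F, OF f] by blast
  then show "L2 g = u" using tendsto_unique[OF F _ lim] by simp
qed

lemma fourierL2:
  assumes f: "sq_int f"
  shows "sq_int (fourierL2 f)" "L2 (fourierL2 f) = FT (L2 f)"
proof -
  have s: "sq_int (fourier (trunc R f))" for R by (intro fourier_contraction(1) L12_trunc f)
  have "((\<lambda>R. FT (L2 (trunc R f))) \<longlongrightarrow> FT (L2 f)) at_top"
    by (intro bounded_linear.tendsto[OF FT_linear] trunc_tendsto f)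
  then have l: "((\<lambda>R. L2 (fourier (trunc R f))) \<longlongrightarrow> FT (L2 f)) at_top"
    by (simp add: FT_L12 L12_trunc f)
  show "sq_int (fourierL2 f)" "L2 (fourierL2 f) = FT (L2 f)"
    using L2_choose_limit[OF s l] unfolding fourierL2_def trunc_def by simp_all
qed

lemma ifourierL2:
  assumes f: "sq_int f"
  shows "sq_int (ifourierL2 f)" "L2 (ifourierL2 f) = IFT (L2 f)"
proof -
  have s: "sq_int (ifourier (trunc R f))" for R by (intro ifourier_sq_int L12_trunc f)
  have "((\<lambda>R. IFT (L2 (trunc R f))) \<longlongrightarrow> IFT (L2 f)) at_top"
    by (intro bounded_linear.tendsto[OF IFT_linear] trunc_tendsto f)
  then have l: "((\<lambda>R. L2 (ifourier (trunc R f))) \<longlongrightarrow> IFT (L2 f)) at_top"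
    by (simp add: IFT_L12 L12_trunc f)
  show "sq_int (ifourierL2 f)" "L2 (ifourierL2 f) = IFT (L2 f)"
    using L2_choose_limit[OF s l] unfolding ifourierL2_def trunc_def by simp_all
qed

subsection \<open>Free and full evolution\<close>

definition fmult :: "real \<Rightarrow> 'a::euclidean_space \<Rightarrow> complex" where
  "fmult t \<xi> = exp (- \<i> * complex_of_real (t * (norm \<xi>)\<^sup>2))"

lemma fmult_meas [measurable]: "fmult t \<in> borel_measurable borel" unfolding fmult_def by measurable
lemma fmult_measL: "fmult t \<in> borel_measurable lebesgue" by (rule borel_measurable_lebesgueI[OF fmult_meas])
lemma fmult_norm: "cmod (fmult t \<xi>) = 1" by (simp add: fmult_def)
lemma fmult_bddm: "bddm (fmult t)" unfolding bddm_def using fmult_measL fmult_norm by (metis order_refl)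

definition Bev :: "real \<Rightarrow> 'a::euclidean_space l2 \<Rightarrow> 'a l2" where
  "Bev t u = IFT (mulop (fmult t) (FT u))"

lemma free_evol:
  assumes "sq_int f" shows "sq_int (free_evol t f)" "L2 (free_evol t f) = Bev t (L2 f)"
proof -
  have s: "sq_int (\<lambda>\<xi>. fmult t \<xi> * fourierL2 f \<xi>)"
    by (intro sq_int_bddm fmult_bddm fourierL2 assms)
  show "sq_int (free_evol t f)" using ifourierL2(1)[OF s] by (simp add: free_evol_def fmult_def)
  have "L2 (free_evol t f) = IFT (L2 (\<lambda>\<xi>. fmult t \<xi> * fourierL2 f \<xi>))"
    using ifourierL2(2)[OF s] by (simp add: free_evol_def fmult_def)
  also have "\<dots> = Bev t (L2 f)"
    unfolding Bev_def fourierL2(2)[OF assms, symmetric] by (subst mulop_L2) (auto intro: fmult_bddm fourierL2 assms)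
  finally show "L2 (free_evol t f) = Bev t (L2 f)" .
qed

lemma Bev_linear: "bounded_linear (Bev t)"
  unfolding Bev_def by (intro bounded_linear_compose[OF IFT_linear] bounded_linear_compose[OF mulop_linear[OF fmult_bddm]] FT_linear)

lemma Bev_norm: "norm (Bev t u) = norm u"
  unfolding Bev_def by (simp add: IFT_norm FT_norm mulop_unimodular_norm[OF fmult_measL fmult_norm])

lemma Bev_add: "Bev (s + t) u = Bev s (Bev t u)"
proof -
  have "(\<lambda>\<xi>. fmult s \<xi> * fmult t \<xi>) = (fmult (s + t) :: 'a \<Rightarrow> complex)"
    by (rule ext) (simp add: fmult_def exp_add[symmetric] algebra_simps)
  then show ?thesis unfolding Bev_def FT_IFT mulop_mulop[OF fmult_bddm fmult_bddm] by simp
qed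

lemma Bev_0: "Bev 0 u = u"
proof -
  have "fmult 0 = (\<lambda>_::'a. 1)" by (rule ext) (simp add: fmult_def)
  then show ?thesis unfolding Bev_def by (simp add: mulop_1 IFT_FT)
qed

lemma Bev_smc: "Bev t (smc c u) = smc c (Bev t u)"
  unfolding Bev_def by (simp add: FT_smc mulop_smc[OF fmult_bddm] IFT_smc)

lemma Bev_plus: "Bev t (u + v) = Bev t u + Bev t v"
  by (simp add: linear_add bounded_linear.linear[OF Bev_linear])

lemma Bev_inv: "Bev (- t) (Bev t u) = u" "Bev t (Bev (- t) u) = u"
  using Bev_add[of "- t" t u] Bev_add[of t "- t" u] by (simp_all add: Bev_0)

lemma Bev_adj: "cinner (Bev t u) v = cinner u (Bev (- t) v)"
  using isometry_cinner[of "Bev t" u "Bev (- t) v"] by (simp add: Bev_plus Bev_smc Bev_norm Bev_inv)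

lemma Bev_cont: "continuous_on UNIV (\<lambda>t. Bev t u)"
proof (rule continuous_on_sequentiallyI)
  fix s :: "nat \<Rightarrow> real" and a assume s: "s \<longlonglongrightarrow> a"
  have "(\<lambda>n. mulop (fmult (s n)) (FT u)) \<longlonglongrightarrow> mulop (fmult a) (FT u)"
  proof (rule mulop_tendsto[where K=1])
    show "(\<lambda>n. fmult (s n) x) \<longlonglongrightarrow> fmult a x" for x :: 'a unfolding fmult_def by (intro tendsto_intros s)
  qed (simp_all add: fmult_measL fmult_norm)
  then show "(\<lambda>n. Bev (s n) u) \<longlonglongrightarrow> Bev a u"
    unfolding Bev_def by (rule bounded_linear.tendsto[OF IFT_linear])
qed

section \<open>The potential as an instance of the Trotter locale\<close>

definition vmult :: "('a::euclidean_space \<Rightarrow> real) \<Rightarrow> real \<Rightarrow> 'a \<Rightarrow> complex" where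
  "vmult V h x = exp (- \<i> * complex_of_real (h * V x))"

definition Xev :: "('a::euclidean_space \<Rightarrow> real) \<Rightarrow> real \<Rightarrow> 'a l2 \<Rightarrow> 'a l2" where
  "Xev V h = mulop (vmult V h)"

definition Jev :: "('a::euclidean_space \<Rightarrow> real) \<Rightarrow> 'a l2 \<Rightarrow> 'a l2" where
  "Jev V = mulop (\<lambda>x. - \<i> * complex_of_real (V x))"

lemma mulop_uminus: "bddm m \<Longrightarrow> mulop (\<lambda>x. - m x) u = - mulop m u"
  by (simp add: mulop_def L2_uminus sq_int_bddm sq_int_rep)

lemma exp_taylor1: "cmod (exp (- \<i> * complex_of_real \<theta>) - 1 - - \<i> * complex_of_real \<theta>) \<le> \<theta>\<^sup>2"
proof -
  have "cmod (exp (- \<i> * complex_of_real \<theta>) - 1 - - \<i> * complex_of_real \<theta>) \<le> \<bar>- \<theta>\<bar> ^ Suc 1 / fact (Suc 1)"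
    using iexp_approx1[of "- \<theta>" 1] by (simp add: algebra_simps)
  also have "\<dots> \<le> \<theta>\<^sup>2" by (simp add: power2_eq_square abs_mult_self_eq)
  finally show ?thesis .
qed

locale potential =
  fixes V :: "'a::euclidean_space \<Rightarrow> real" and M :: real
  assumes V_meas: "V \<in> borel_measurable lebesgue" and V_le: "\<And>x. \<bar>V x\<bar> \<le> M"
begin

lemma vmult_meas: "vmult V h \<in> borel_measurable lebesgue"
  unfolding vmult_def using V_meas by measurable
lemma vmult_norm: "cmod (vmult V h x) = 1" by (simp add: vmult_def)
lemma vmult_bddm: "bddm (vmult V h)" unfolding bddm_def using vmult_meas vmult_norm by (metis order_refl)

lemma V_bddm: "bddm (\<lambda>x. - \<i> * complex_of_real (V x))"
  unfolding bddm_def using V_meas V_le by (auto intro!: exI[of _ M] simp: norm_mult)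

lemma M_nonneg: "0 \<le> M" using V_le[of undefined] abs_ge_zero order_trans by blast

lemma trotter: "trotter_data Bev (Xev V) (Jev V) M (M\<^sup>2)"
proof (rule trotter_data.intro)
  fix s t :: real and u v :: "'a l2"
  show "bounded_linear (Bev t)" "norm (Bev t u) = norm u" "Bev (s + t) u = Bev s (Bev t u)" "Bev 0 u = u"
    "continuous_on UNIV (\<lambda>t. Bev t u)"
    by (rule Bev_linear Bev_norm Bev_add Bev_0 Bev_cont)+
  show "bounded_linear (Xev V t)" unfolding Xev_def by (rule mulop_linear[OF vmult_bddm])
  show "norm (Xev V t u) = norm u" unfolding Xev_def by (rule mulop_unimodular_norm[OF vmult_meas vmult_norm])
  have "(\<lambda>x. vmult V (- t) x * vmult V t x) = (\<lambda>x. 1)" by (rule ext) (simp add: vmult_def exp_add[symmetric])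
  then show "Xev V (- t) (Xev V t u) = u" unfolding Xev_def by (simp add: mulop_mulop vmult_bddm mulop_1)
  show "bounded_linear (Jev V)" unfolding Jev_def by (rule mulop_linear[OF V_bddm])
  show "norm (Jev V u) \<le> M * norm u" unfolding Jev_def
    by (rule mulop_norm) (use V_bddm V_le in \<open>auto simp: bddm_def norm_mult\<close>)
  have "cinner (Jev V u) v = - cinner u (Jev V v)"
    unfolding Jev_def cinner_mulop[OF V_bddm] cinner_uminus_right[symmetric] mulop_uminus[OF V_bddm, symmetric]
    by simp
  then show "inner (Jev V u) v = - inner u (Jev V v)" by (simp add: inner_l2_def)
  show "0 \<le> M" "0 \<le> M\<^sup>2" using M_nonneg by auto
  show "norm (Xev V t u - u - t *\<^sub>R Jev V u) \<le> M\<^sup>2 * t\<^sup>2 * norm u"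
  proof -
    obtain f where f: "sq_int f" "u = L2 f" by (rule L2_cases)
    \<comment> \<open>The pointwise Taylor remainder of exp(-i t V) has size at most (t V)^2; this
      is the origin of the constant \<open>M\<^sup>2\<close> in the locale.\<close>
    define w where "w x = vmult V t x - 1 - complex_of_real t * (- \<i> * complex_of_real (V x))" for x
    have wm: "w \<in> borel_measurable lebesgue" unfolding w_def using vmult_meas V_meas by measurable
    have wb: "cmod (w x) \<le> M\<^sup>2 * t\<^sup>2" for x
    proof -
      have "cmod (w x) \<le> (t * V x)\<^sup>2" using exp_taylor1[of "t * V x"] by (simp add: w_def vmult_def mult_ac)
      also have "\<dots> = t\<^sup>2 * \<bar>V x\<bar>\<^sup>2" by (simp add: power_mult_distrib)
      also have "\<dots> \<le> t\<^sup>2 * M\<^sup>2" by (intro mult_left_mono power_mono V_le) auto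
      finally show ?thesis by (simp add: mult.commute)
    qed
    have wd: "bddm w" using wm wb by (auto simp: bddm_def)
    have "Xev V t u - u - t *\<^sub>R Jev V u = mulop w u"
      unfolding Xev_def Jev_def f(2) scaleR_smc mulop_L2[OF vmult_bddm f(1)] mulop_L2[OF V_bddm f(1)] mulop_L2[OF wd f(1)]
        L2_smc[OF sq_int_bddm[OF V_bddm f(1)]] L2_diff[OF sq_int_bddm[OF vmult_bddm f(1)] f(1)]
      by (subst L2_diff[OF sq_int_diff[OF sq_int_bddm[OF vmult_bddm f(1)] f(1)] sq_int_cmult[OF sq_int_bddm[OF V_bddm f(1)]]])
         (simp add: w_def algebra_simps)
    then show ?thesis using mulop_norm[OF wm wb, of u] by simp
  qed
qed

sublocale trotter_data Bev "Xev V" "Jev V" M "M\<^sup>2" by (rule trotter)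

lemma schr_iter:
  assumes "sq_int f"
  shows "sq_int (((\<lambda>h. free_evol s (\<lambda>y. exp (- \<i> * complex_of_real (s * V y)) * h y)) ^^ n) f)
    \<and> L2 (((\<lambda>h. free_evol s (\<lambda>y. exp (- \<i> * complex_of_real (s * V y)) * h y)) ^^ n) f) = (step s ^^ n) (L2 f)"
proof (induction n)
  case 0 then show ?case using assms by simp
next
  case (Suc n)
  let ?g = "((\<lambda>h. free_evol s (\<lambda>y. exp (- \<i> * complex_of_real (s * V y)) * h y)) ^^ n) f"
  have g: "sq_int ?g" "L2 ?g = (step s ^^ n) (L2 f)" using Suc by auto
  have s: "sq_int (\<lambda>y. vmult V s y * ?g y)" by (rule sq_int_bddm[OF vmult_bddm g(1)])
  have "L2 (\<lambda>y. vmult V s y * ?g y) = Xev V s (L2 ?g)" unfolding Xev_def mulop_L2[OF vmult_bddm g(1)] ..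
  then have "L2 (free_evol s (\<lambda>y. vmult V s y * ?g y)) = step s (L2 ?g)"
    unfolding free_evol(2)[OF s] step_def by simp
  also have "\<dots> = (step s ^^ Suc n) (L2 f)" by (simp only: funpow.simps comp_apply g(2))
  finally show ?case using free_evol(1)[OF s, of s] by (simp add: vmult_def)
qed

lemma schr_evol:
  assumes f: "sq_int f" shows "sq_int (schr_evol V t f)" "L2 (schr_evol V t f) = U t (L2 f)"
proof -
  let ?I = "\<lambda>n. ((\<lambda>h. free_evol (t / real n) (\<lambda>y. exp (- \<i> * complex_of_real (t / real n * V y)) * h y)) ^^ n) f"
  have s: "sq_int (?I n)" and l: "L2 (?I n) = trot n t (L2 f)" for n
    using schr_iter[OF f, where s="t / real n" and n=n] by (auto simp: trot_def)
  have "(\<lambda>n. L2 (?I n)) \<longlonglongrightarrow> U t (L2 f)" unfolding l by (rule trot_lim)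
  from L2_choose_limit[OF s this]
  show "sq_int (schr_evol V t f)" "L2 (schr_evol V t f) = U t (L2 f)"
    unfolding schr_evol_def by simp_all
qed

text \<open>Convergence is asked for at the given f; Cook's argument will supply it for the
  localized states.\<close>

lemma wave_limit:
  assumes f: "sq_int f"
  shows "((\<lambda>t. U (- t) (Bev t (L2 f))) \<longlongrightarrow> w) at_top \<Longrightarrow> sq_int (wave_minus V f) \<and> L2 (wave_minus V f) = w"
    and "((\<lambda>t. U (- t) (Bev t (L2 f))) \<longlongrightarrow> w) at_bot \<Longrightarrow> sq_int (wave_plus V f) \<and> L2 (wave_plus V f) = w"
proof -
  have s: "sq_int (schr_evol V (- t) (free_evol t f))" for t by (intro schr_evol free_evol f)
  have l: "L2 (schr_evol V (- t) (free_evol t f)) = U (- t) (Bev t (L2 f))" for t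
    by (simp add: schr_evol free_evol f)
  show "((\<lambda>t. U (- t) (Bev t (L2 f))) \<longlongrightarrow> w) at_top \<Longrightarrow> sq_int (wave_minus V f) \<and> L2 (wave_minus V f) = w"
    using L2_choose_limit[where f="\<lambda>t. schr_evol V (- t) (free_evol t f)" and u=w and F=at_top, OF s] unfolding l wave_minus_def by simp
  show "((\<lambda>t. U (- t) (Bev t (L2 f))) \<longlongrightarrow> w) at_bot \<Longrightarrow> sq_int (wave_plus V f) \<and> L2 (wave_plus V f) = w"
    using L2_choose_limit[where f="\<lambda>t. schr_evol V (- t) (free_evol t f)" and u=w and F=at_bot, OF s] unfolding l wave_plus_def by simp
qed

end

subsection \<open>Coherent states\<close>

definition cs :: "('a::euclidean_space \<Rightarrow> complex) \<Rightarrow> 'a \<times> 'a \<Rightarrow> 'a \<Rightarrow> complex" where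
  "cs u z y = exp (\<i> * complex_of_real (snd z \<bullet> (y - fst z))) * u (y - fst z)"

lemma coh_cs: "coh \<eta> \<delta> z = cs (eta_delta \<eta> \<delta>) z"
  by (rule ext) (simp add: coh_def cs_def)

lemma ennreal_sq_eqD: "ennreal (a\<^sup>2) = ennreal (b\<^sup>2) \<Longrightarrow> 0 \<le> a \<Longrightarrow> 0 \<le> b \<Longrightarrow> a = b"
  by (simp add: power2_eq_iff_nonneg)

lemma cs_meas_pair:
  fixes u :: "'a::euclidean_space \<Rightarrow> complex"
  assumes "u \<in> borel_measurable borel"
  shows "(\<lambda>x::('a \<times> 'a) \<times> 'a. cs u (fst x) (snd x)) \<in> borel_measurable borel"
  unfolding cs_def
proof (rule borel_measurable_times)
  show "(\<lambda>x::('a \<times> 'a) \<times> 'a. exp (\<i> * complex_of_real (snd (fst x) \<bullet> (snd x - fst (fst x))))) \<in> borel_measurable borel"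
    by (intro borel_measurable_continuous_onI continuous_intros)
  show "(\<lambda>x::('a \<times> 'a) \<times> 'a. u (snd x - fst (fst x))) \<in> borel_measurable borel"
    by (rule measurable_compose[OF _ assms]) (intro borel_measurable_continuous_onI continuous_intros)
qed

lemma cs_meas: "u \<in> borel_measurable borel \<Longrightarrow> cs u z \<in> borel_measurable borel"
  using measurable_compose[OF _ cs_meas_pair, of "\<lambda>y. (z, y)" borel u]
  by (simp add: borel_measurable_continuous_onI continuous_intros)

lemma cs_sq_int:
  assumes [measurable]: "u \<in> borel_measurable borel" and u: "sq_int u"
  shows "sq_int (cs u z)" "norm (L2 (cs u z)) = norm (L2 u)"
proof -
  note [measurable] = cs_meas[OF assms(1)]
  have "(\<integral>\<^sup>+y. ennreal ((cmod (cs u z y))\<^sup>2) \<partial>lborel) = (\<integral>\<^sup>+y. ennreal ((cmod (u (- fst z + y)))\<^sup>2) \<partial>lborel)"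
    by (simp add: cs_def norm_mult)
  also have "\<dots> = (\<integral>\<^sup>+y. ennreal ((cmod (u y))\<^sup>2) \<partial>lborel)"
    by (rule nn_integral_lborel_translate[of "\<lambda>y. ennreal ((cmod (u y))\<^sup>2)"]) measurable
  finally have e: "(\<integral>\<^sup>+y. ennreal ((cmod (cs u z y))\<^sup>2) \<partial>lborel) = (\<integral>\<^sup>+y. ennreal ((cmod (u y))\<^sup>2) \<partial>lborel)" .
  show s: "sq_int (cs u z)" using u by (simp add: sq_int_iff_nn e)
  show "norm (L2 (cs u z)) = norm (L2 u)"
    by (rule ennreal_sq_eqD) (use e u s in \<open>simp_all add: nn_norm_L2_sq\<close>)
qed

text \<open>The short-time Fourier transform with window u, not yet normalized.\<close>

definition CT :: "('a::euclidean_space \<Rightarrow> complex) \<Rightarrow> 'a l2 \<Rightarrow> 'a \<times> 'a \<Rightarrow> complex" where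
  "CT u w z = cinner (L2 (cs u z)) w"

locale window =
  fixes u :: "'a::euclidean_space \<Rightarrow> complex" and K :: real
  assumes u_meas [measurable]: "u \<in> borel_measurable borel" and u_bd: "\<And>x. cmod (u x) \<le> K"
    and u_sq: "sq_int u"
begin

lemma CT_L2:
  assumes [measurable]: "f \<in> borel_measurable borel" and f: "sq_int f"
  shows "CT u (L2 f) z = (\<integral>y. cnj (cs u z y) * f y \<partial>lborel)"
proof -
  note [measurable] = cs_meas[OF u_meas]
  show ?thesis unfolding CT_def using f
    by (simp add: cinner_L2 cs_sq_int u_sq l2inner_def integral_completion)
qed

lemma CT_meas [measurable]: "CT u w \<in> borel_measurable borel"
proof -
  obtain f where f: "sq_int f" and f' [measurable]: "f \<in> borel_measurable borel" and w: "w = L2 f" by (rule L2_cases)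
  have "CT u w = (\<lambda>z. \<integral>y. cnj (cs u z y) * f y \<partial>lborel)"
    unfolding w by (rule ext) (rule CT_L2[OF _ f], measurable)
  also have "\<dots> \<in> borel_measurable borel"
  proof (rule lborel.borel_measurable_lebesgue_integral)
    have meas: "(\<lambda>x::('a \<times> 'a) \<times> 'a. cnj (cs u (fst x) (snd x)) * f (snd x)) \<in> borel_measurable borel"
      by (intro borel_measurable_times borel_measurable_cnj cs_meas_pair u_meas measurable_compose[OF _ f'])
         (intro borel_measurable_continuous_onI continuous_intros)
    have eqs: "sets (borel \<Otimes>\<^sub>M lborel) = sets (borel :: (('a \<times> 'a) \<times> 'a) measure)"
      unfolding borel_prod[symmetric] by (intro sets_pair_measure_cong) simp_all
    show "(\<lambda>(z, y). cnj (cs u z y) * f y) \<in> borel_measurable (borel \<Otimes>\<^sub>M lborel)"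
      unfolding case_prod_unfold using meas by (subst measurable_cong_sets[OF eqs refl])
  qed
  finally show ?thesis .
qed

text \<open>For fixed position x the dependence on p is, up to a unimodular factor and
  \<open>cD\<close>, the Fourier transform of cnj(u(y - x)) f(y), so Plancherel applies in p.
  Boundedness of u makes this product square-integrable.\<close>

lemma CT_slice:
  assumes [measurable]: "f \<in> borel_measurable borel" and f: "sq_int f"
  shows "(\<integral>\<^sup>+p. ennreal ((cmod (CT u (L2 f) (x, p)))\<^sup>2) \<partial>lborel)
    = ennreal (1 / (cD TYPE('a))\<^sup>2) * (\<integral>\<^sup>+y. ennreal ((cmod (u (y - x)))\<^sup>2) * ennreal ((cmod (f y))\<^sup>2) \<partial>lborel)"
proof -
  define h where "h y = cnj (u (y - x)) * f y" for y
  have [measurable]: "h \<in> borel_measurable borel" unfolding h_def by measurable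
  have sh: "sq_int h" unfolding h_def
  proof (rule sq_int_mult_bdd[OF f])
    show "(\<lambda>y. cnj (u (y - x))) \<in> borel_measurable lebesgue" by (intro borel_measurable_lebesgueI) measurable
    show "cmod (cnj (u (y - x))) \<le> K" for y using u_bd by simp
  qed
  have "cs u (x, 0) = (\<lambda>y. u (y - x))" by (rule ext) (simp add: cs_def)
  then have su: "sq_int (\<lambda>y. u (y - x))" using cs_sq_int(1)[OF u_meas u_sq, of "(x, 0)"] by simp
  have Lh: "L12 h" unfolding L12_def h_def using sh sq_int_prod_integrable[OF su f] by (simp add: h_def[abs_def])
  have [measurable]: "fourier h \<in> borel_measurable borel" by (rule L12_fourier_meas[OF Lh])
  have c: "cD TYPE('a) > 0" by (rule cD_pos)
  have "(cmod (CT u (L2 f) (x, p)))\<^sup>2 = 1 / (cD TYPE('a))\<^sup>2 * (cmod (fourier h p))\<^sup>2" for p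
  proof -
    have "CT u (L2 f) (x, p) = (\<integral>y. exp (\<i> * complex_of_real (p \<bullet> x)) * (exp (- \<i> * complex_of_real (y \<bullet> p)) * h y) \<partial>lborel)"
      unfolding CT_L2[OF assms(1) f]
    proof (intro Bochner_Integration.integral_cong refl)
      fix y
      have "cnj (exp (\<i> * complex_of_real (p \<bullet> (y - x)))) = exp (\<i> * complex_of_real (p \<bullet> x)) * exp (- \<i> * complex_of_real (y \<bullet> p))"
        by (simp add: exp_cnj exp_add[symmetric] inner_diff_right inner_commute algebra_simps)
      then show "cnj (cs u (x, p) y) * f y = exp (\<i> * complex_of_real (p \<bullet> x)) * (exp (- \<i> * complex_of_real (y \<bullet> p)) * h y)"
        by (simp add: cs_def h_def)
    qed
    also have "\<dots> = exp (\<i> * complex_of_real (p \<bullet> x)) * (\<integral>y. exp (- \<i> * complex_of_real (y \<bullet> p)) * h y \<partial>lborel)"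
      by (rule Bochner_Integration.integral_mult_right_zero)
    finally have "cmod (CT u (L2 f) (x, p)) = cmod (\<integral>y. exp (- \<i> * complex_of_real (y \<bullet> p)) * h y \<partial>lborel)"
      by (simp add: norm_mult)
    moreover have "cmod (fourier h p) = cD TYPE('a) * cmod (\<integral>y. exp (- \<i> * complex_of_real (y \<bullet> p)) * h y \<partial>lborel)"
      using c by (simp add: fourier_borel norm_mult)
    ultimately show ?thesis using c by (simp add: power_mult_distrib)
  qed
  then have "(\<integral>\<^sup>+p. ennreal ((cmod (CT u (L2 f) (x, p)))\<^sup>2) \<partial>lborel)
    = ennreal (1 / (cD TYPE('a))\<^sup>2) * (\<integral>\<^sup>+p. ennreal ((cmod (fourier h p))\<^sup>2) \<partial>lborel)"
    by (simp only: ennreal_mult'' zero_le_power2) (simp add: nn_integral_cmult)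
  also have "(\<integral>\<^sup>+p. ennreal ((cmod (fourier h p))\<^sup>2) \<partial>lborel) = ennreal ((norm (FT (L2 h)))\<^sup>2)"
    by (simp add: nn_norm_L2_sq fourier_contraction(1) Lh FT_L12)
  also have "\<dots> = (\<integral>\<^sup>+y. ennreal ((cmod (h y))\<^sup>2) \<partial>lborel)"
    using sh by (simp add: FT_norm nn_norm_L2_sq)
  also have "\<dots> = (\<integral>\<^sup>+y. ennreal ((cmod (u (y - x)))\<^sup>2) * ennreal ((cmod (f y))\<^sup>2) \<partial>lborel)"
    by (simp add: h_def norm_mult power_mult_distrib ennreal_mult)
  finally show ?thesis .
qed

lemma nn_u_reflect: "(\<integral>\<^sup>+x. ennreal ((cmod (u (y - x)))\<^sup>2) \<partial>lborel) = ennreal ((norm (L2 u))\<^sup>2)"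
  using nn_integral_lborel_affine[of "\<lambda>x. ennreal ((cmod (u x))\<^sup>2)" "-1" y]
  by (simp add: nn_norm_L2_sq u_sq)

text \<open>Resolution of the identity: integrating \<open>CT_slice\<close> over x and exchanging
  the order turns the window into its total mass.\<close>

lemma CT_norm_nn:
  "(\<integral>\<^sup>+z. ennreal ((cmod (CT u w z))\<^sup>2) \<partial>lborel) = ennreal (1 / (cD TYPE('a))\<^sup>2 * (norm (L2 u))\<^sup>2 * (norm w)\<^sup>2)"
proof -
  obtain f where f: "sq_int f" and fm [measurable]: "f \<in> borel_measurable borel" and w: "w = L2 f" by (rule L2_cases)
  have "(\<integral>\<^sup>+z. ennreal ((cmod (CT u w z))\<^sup>2) \<partial>lborel) = (\<integral>\<^sup>+x. \<integral>\<^sup>+p. ennreal ((cmod (CT u w (x, p)))\<^sup>2) \<partial>lborel \<partial>lborel)"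
    unfolding lborel_prod[symmetric] by (rule lborel.nn_integral_fst[symmetric]) (simp add: lborel_prod)
  also have "\<dots> = (\<integral>\<^sup>+x. ennreal (1 / (cD TYPE('a))\<^sup>2) * (\<integral>\<^sup>+y. ennreal ((cmod (u (y - x)))\<^sup>2) * ennreal ((cmod (f y))\<^sup>2) \<partial>lborel) \<partial>lborel)"
    unfolding w CT_slice[OF fm f] ..
  also have "\<dots> = ennreal (1 / (cD TYPE('a))\<^sup>2) * (\<integral>\<^sup>+x. \<integral>\<^sup>+y. ennreal ((cmod (u (y - x)))\<^sup>2) * ennreal ((cmod (f y))\<^sup>2) \<partial>lborel \<partial>lborel)"
    by (rule nn_integral_cmult) measurable
  also have "(\<integral>\<^sup>+x. \<integral>\<^sup>+y. ennreal ((cmod (u (y - x)))\<^sup>2) * ennreal ((cmod (f y))\<^sup>2) \<partial>lborel \<partial>lborel)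
     = (\<integral>\<^sup>+y. \<integral>\<^sup>+x. ennreal ((cmod (u (y - x)))\<^sup>2) * ennreal ((cmod (f y))\<^sup>2) \<partial>lborel \<partial>lborel)"
    by (rule lborel_pair.Fubini'[symmetric]) measurable
  also have "\<dots> = (\<integral>\<^sup>+y. ennreal ((norm (L2 u))\<^sup>2) * ennreal ((cmod (f y))\<^sup>2) \<partial>lborel)"
    by (simp add: nn_integral_multc nn_u_reflect)
  also have "\<dots> = ennreal ((norm (L2 u))\<^sup>2) * ennreal ((norm w)\<^sup>2)"
    by (simp add: nn_integral_cmult w nn_norm_L2_sq f)
  finally show ?thesis by (simp only: mult.assoc ennreal_mult' zero_le_power2 zero_le_divide_1_iff)
qed

lemma CT_sq_int: "sq_int (CT u w)"
  by (simp add: sq_int_iff_nn CT_norm_nn)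

lemma CT_add: "CT u (v + w) z = CT u v z + CT u w z" by (simp add: CT_def cinner_add_right)
lemma CT_smc: "CT u (smc c w) z = c * CT u w z" by (simp add: CT_def cinner_smc_right)

text \<open>The factor \<open>cD\<close> has square (2 pi)^(-d) and makes this map an isometry for a
  unit window.\<close>

definition A :: "'a l2 \<Rightarrow> ('a \<times> 'a) l2" where
  "A w = smc (complex_of_real (cD TYPE('a))) (L2 (CT u w))"

lemma A_add: "A (v + w) = A v + A w"
  unfolding A_def by (simp add: smc_add_right[symmetric] L2_add CT_sq_int CT_add[abs_def])

lemma A_smc: "A (smc c w) = smc c (A w)"
  unfolding A_def by (simp add: smc_smc mult.commute L2_smc[symmetric] CT_sq_int CT_smc[abs_def])

lemma A_norm: "norm (A w) = norm (L2 u) * norm w"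
proof (rule ennreal_sq_eqD)
  have c: "cD TYPE('a) > 0" by (rule cD_pos)
  have "ennreal ((norm (L2 (CT u w)))\<^sup>2) = ennreal ((1 / cD TYPE('a) * norm (L2 u) * norm w)\<^sup>2)"
    by (simp add: nn_norm_L2_sq[symmetric] CT_sq_int CT_norm_nn power_mult_distrib power_divide)
  then have "norm (L2 (CT u w)) = 1 / cD TYPE('a) * norm (L2 u) * norm w"
    by (rule ennreal_sq_eqD) (use c in auto)
  then show "ennreal ((norm (A w))\<^sup>2) = ennreal ((norm (L2 u) * norm w)\<^sup>2)"
    using c by (simp add: A_def norm_smc)
qed auto

end

section \<open>Phase-space localization operators\<close>

lemma adjoint_exists:
  fixes A :: "'a::euclidean_space l2 \<Rightarrow> 'b::euclidean_space l2"
  assumes add: "\<And>u v. A (u + v) = A u + A v" and smc: "\<And>c u. A (smc c u) = smc c (A u)"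
    and bd: "\<And>u. norm (A u) \<le> K * norm u"
  shows "\<exists>x. \<forall>v. cinner (A v) g = cinner v x"
proof -
  have scale: "A (r *\<^sub>R v) = r *\<^sub>R A v" for r v
    unfolding scaleR_smc by (rule smc)
  have "bounded_linear (\<lambda>v. inner (A v) g)"
  proof (rule bounded_linear_intro[where K="K * norm g"])
    fix v
    have "norm (inner (A v) g) \<le> norm (A v) * norm g" by (simp add: Cauchy_Schwarz_ineq2)
    also have "\<dots> \<le> K * norm v * norm g" by (intro mult_right_mono bd) simp
    finally show "norm (inner (A v) g) \<le> norm v * (K * norm g)" by (simp add: mult_ac)
  qed (simp_all add: add scale inner_add_left)
  then obtain x where x: "\<And>v. inner (A v) g = inner v x" using riesz_representation by blast
  \<comment> \<open>Riesz gives equality of real parts; replacing v by i v supplies the imaginary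
    parts.\<close>
  have "cinner (A v) g = cinner v x" for v
    unfolding cinner_eq_inner using x[of v] x[of "smc \<i> v"] by (simp add: smc)
  then show ?thesis by blast
qed

lemma mulop_indicator_norm: "E \<in> sets borel \<Longrightarrow> norm (mulop (indicator E) w) \<le> norm w"
  using mulop_norm[of "indicator E" 1 w] by (simp add: borel_measurable_lebesgueI indicator_def)

lemma indicator_bddm: "E \<in> sets borel \<Longrightarrow> bddm (indicator E)"
  unfolding bddm_def by (auto intro!: borel_measurable_lebesgueI exI[of _ 1] simp: indicator_def)

locale unit_window = window +
  assumes u_unit: "norm (L2 u) = 1"
begin

text \<open>The adjoint of \<open>A\<close>, applied after cutting \<open>A w\<close> to E, in weak
  form; \<open>adjoint_exists\<close> justifies the choice.\<close>

definition Pop :: "('a \<times> 'a) set \<Rightarrow> 'a l2 \<Rightarrow> 'a l2" where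
  "Pop E w = (SOME x. \<forall>v. cinner (A v) (mulop (indicator E) (A w)) = cinner v x)"

lemma A_isom: "norm (A w) = norm w" by (simp add: A_norm u_unit)

lemma Pop: "cinner v (Pop E w) = cinner (A v) (mulop (indicator E) (A w))"
proof -
  have "\<exists>x. \<forall>v. cinner (A v) (mulop (indicator E) (A w)) = cinner v x"
    by (rule adjoint_exists[where K=1]) (simp_all add: A_add A_smc A_isom)
  from someI_ex[OF this] show ?thesis unfolding Pop_def by metis
qed

lemma Pop_self_adjoint:
  assumes E: "E \<in> sets borel" shows "cinner v (Pop E w) = cinner (Pop E v) w"
proof -
  have "cinner (Pop E v) w = cnj (cinner (A w) (mulop (indicator E) (A v)))"
    by (subst cinner_commute) (simp add: Pop)
  also have "\<dots> = cinner (mulop (indicator E) (A v)) (A w)" by (rule cinner_commute[symmetric])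
  also have "\<dots> = cinner (A v) (mulop (\<lambda>x. cnj (indicator E x)) (A w))"
    by (rule cinner_mulop[OF indicator_bddm[OF E]])
  also have "(\<lambda>x. cnj (indicator E x)) = (indicator E :: 'a \<times> 'a \<Rightarrow> complex)"
    by (rule ext) (simp add: indicator_def)
  finally show ?thesis by (simp add: Pop)
qed

lemma Pop_UNIV: "Pop UNIV w = w"
proof (rule l2_eqI)
  fix v
  have "(indicator UNIV :: 'a \<times> 'a \<Rightarrow> complex) = (\<lambda>x. 1)" by (rule ext) simp
  then show "cinner v (Pop UNIV w) = cinner v w"
    by (simp add: Pop mulop_1 isometry_cinner[of A] A_add A_smc A_isom)
qed

lemma Pop_Un:
  assumes "E \<in> sets borel" "F \<in> sets borel" "E \<inter> F = {}"
  shows "Pop (E \<union> F) w = Pop E w + Pop F w"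
proof (rule l2_eqI)
  fix v
  obtain f where f: "sq_int f" "A w = L2 f" by (rule L2_cases)
  have "(\<lambda>x. (indicator (E \<union> F) x :: complex) * f x) = (\<lambda>x. indicator E x * f x + indicator F x * f x)"
    using assms(3) by (intro ext) (auto simp: indicator_def)
  then have "mulop (indicator (E \<union> F)) (A w) = mulop (indicator E) (A w) + mulop (indicator F) (A w)"
    using assms f by (simp add: mulop_L2 indicator_bddm L2_add sq_int_bddm)
  then show "cinner v (Pop (E \<union> F) w) = cinner v (Pop E w + Pop F w)"
    by (simp add: Pop cinner_add_right)
qed

text \<open>The adjoint of an isometry is a contraction: test with \<open>Pop E w\<close> itself and
  cancel one factor.\<close>

lemma Pop_norm_le_mulop: "norm (Pop E w) \<le> norm (mulop (indicator E) (A w))"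
proof -
  have "(norm (Pop E w))\<^sup>2 = cmod (cinner (Pop E w) (Pop E w))" by (simp add: cinner_self norm_power)
  also have "\<dots> = cmod (cinner (A (Pop E w)) (mulop (indicator E) (A w)))" unfolding Pop ..
  also have "\<dots> \<le> norm (Pop E w) * norm (mulop (indicator E) (A w))"
    using cmod_cinner_le[of "A (Pop E w)"] by (simp add: A_isom)
  finally have "norm (Pop E w) * norm (Pop E w) \<le> norm (Pop E w) * norm (mulop (indicator E) (A w))"
    by (simp add: power2_eq_square)
  then show ?thesis by (cases "norm (Pop E w) = 0") (auto simp: mult_le_cancel_left)
qed

lemma Pop_norm_le: "E \<in> sets borel \<Longrightarrow> norm (Pop E w) \<le> norm w"
  using order_trans[OF Pop_norm_le_mulop mulop_indicator_norm] by (simp add: A_isom)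

lemma mulop_A_nn:
  assumes [measurable]: "E \<in> sets borel"
  shows "ennreal ((norm (mulop (indicator E) (A w)))\<^sup>2)
    = ennreal ((cD TYPE('a))\<^sup>2) * (\<integral>\<^sup>+z. indicator E z * ennreal ((cmod (CT u w z))\<^sup>2) \<partial>lborel)"
proof -
  let ?g = "\<lambda>z. indicator E z * (complex_of_real (cD TYPE('a)) * CT u w z)"
  have s: "sq_int (\<lambda>z. complex_of_real (cD TYPE('a)) * CT u w z)" by (intro sq_int_cmult CT_sq_int)
  have "mulop (indicator E) (A w) = L2 ?g"
    unfolding A_def using s by (simp add: L2_smc CT_sq_int mulop_L2 indicator_bddm)
  moreover have "sq_int ?g" by (rule sq_int_bddm[OF indicator_bddm s]) measurable
  ultimately have "ennreal ((norm (mulop (indicator E) (A w)))\<^sup>2) = (\<integral>\<^sup>+z. ennreal ((cmod (?g z))\<^sup>2) \<partial>lborel)"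
    by (simp add: nn_norm_L2_sq)
  also have "\<dots> = (\<integral>\<^sup>+z. ennreal ((cD TYPE('a))\<^sup>2) * (indicator E z * ennreal ((cmod (CT u w z))\<^sup>2)) \<partial>lborel)"
    by (intro nn_integral_cong) (simp add: indicator_def norm_mult power_mult_distrib ennreal_mult)
  also have "\<dots> = ennreal ((cD TYPE('a))\<^sup>2) * (\<integral>\<^sup>+z. indicator E z * ennreal ((cmod (CT u w z))\<^sup>2) \<partial>lborel)"
    by (rule nn_integral_cmult) measurable
  finally show ?thesis .
qed

lemma P_delta_Pop:
  assumes ue: "u = eta_delta \<eta> \<delta>" and E [measurable]: "E \<in> sets borel" and psi: "sq_int \<psi>"
  shows "sq_int (P_delta \<eta> \<delta> E \<psi>)" "L2 (P_delta \<eta> \<delta> E \<psi>) = Pop E (L2 \<psi>)"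
proof -
  have c2: "(2 * pi) powr (- real DIM('a)) = cD TYPE('a) * cD TYPE('a)"
    unfolding cD_def by (simp add: powr_add[symmetric])
  have key: "complex_of_real ((2 * pi) powr (- real DIM('a))) *
       (\<integral>z. indicator E z * (l2inner (coh \<eta> \<delta> z) \<psi> * l2inner \<phi> (coh \<eta> \<delta> z)) \<partial>lebesgue)
     = cinner (L2 \<phi>) (Pop E (L2 \<psi>))" if \<phi>: "sq_int \<phi>" for \<phi>
  proof -
    have T1: "l2inner (coh \<eta> \<delta> z) \<psi> = CT u (L2 \<psi>) z" for z
      unfolding CT_def coh_cs ue[symmetric] using psi by (simp add: cinner_L2 cs_sq_int u_sq)
    have T2: "l2inner \<phi> (coh \<eta> \<delta> z) = cnj (CT u (L2 \<phi>) z)" for z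
      unfolding CT_def coh_cs ue[symmetric] using \<phi> by (subst l2inner_cnj) (simp add: cinner_L2 cs_sq_int u_sq)
    have s1: "sq_int (\<lambda>z. indicator E z * CT u (L2 \<psi>) z)" by (rule sq_int_bddm[OF indicator_bddm CT_sq_int]) (rule E)
    have "(\<integral>z. indicator E z * (l2inner (coh \<eta> \<delta> z) \<psi> * l2inner \<phi> (coh \<eta> \<delta> z)) \<partial>lebesgue)
       = l2inner (CT u (L2 \<phi>)) (\<lambda>z. indicator E z * CT u (L2 \<psi>) z)"
      unfolding T1 T2 by (simp add: l2inner_def mult_ac)
    also have "\<dots> = cinner (L2 (CT u (L2 \<phi>))) (mulop (indicator E) (L2 (CT u (L2 \<psi>))))"
      using s1 by (simp add: cinner_L2 CT_sq_int mulop_L2 indicator_bddm E)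
    finally show ?thesis unfolding Pop A_def mulop_smc[OF indicator_bddm[OF E]] cinner_smc_left cinner_smc_right c2 by simp
  qed
  let ?P = "\<lambda>chi. sq_int chi \<and> (\<forall>\<phi>. sq_int \<phi> \<longrightarrow> l2inner \<phi> chi = complex_of_real ((2 * pi) powr (- real DIM('a))) *
       (\<integral>z. indicator E z * (l2inner (coh \<eta> \<delta> z) \<psi> * l2inner \<phi> (coh \<eta> \<delta> z)) \<partial>lebesgue))"
  obtain g where g: "sq_int g" "Pop E (L2 \<psi>) = L2 g" by (rule L2_cases)
  have "?P g" using g key by (simp add: cinner_L2)
  then have P: "?P (P_delta \<eta> \<delta> E \<psi>)" unfolding P_delta_def by (rule someI[where P="?P"])
  then show s: "sq_int (P_delta \<eta> \<delta> E \<psi>)" by simp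
  show "L2 (P_delta \<eta> \<delta> E \<psi>) = Pop E (L2 \<psi>)"
  proof (rule l2_eqI)
    fix w :: "'a l2"
    obtain f where f: "sq_int f" "w = L2 f" by (rule L2_cases)
    show "cinner w (L2 (P_delta \<eta> \<delta> E \<psi>)) = cinner w (Pop E (L2 \<psi>))"
      using P f key[OF f(1)] s by (simp add: cinner_L2)
  qed
qed

end

subsection \<open>Windows with compactly supported Fourier transform\<close>

definition bump :: "('a::euclidean_space \<Rightarrow> complex) \<Rightarrow> real \<Rightarrow> bool" where
  "bump G r \<longleftrightarrow> continuous_on UNIV G \<and> (\<forall>\<xi>. r < norm \<xi> \<longrightarrow> G \<xi> = 0)"

lemma bump_meas: "bump G r \<Longrightarrow> G \<in> borel_measurable borel"
  by (simp add: bump_def borel_measurable_continuous_onI)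

lemma bump_bounded:
  assumes "bump G r" shows "\<exists>K\<ge>0. \<forall>x. cmod (G x) \<le> K"
proof -
  have "bounded (G ` cball 0 r)"
    using assms by (intro compact_imp_bounded compact_continuous_image) (auto simp: bump_def intro: continuous_on_subset)
  then obtain K where K: "K > 0" "\<And>x. x \<in> cball 0 r \<Longrightarrow> cmod (G x) \<le> K" unfolding bounded_pos by blast
  have "cmod (G x) \<le> K" for x
    using K assms by (cases "norm x \<le> r") (auto simp: bump_def)
  then show ?thesis using K by (intro exI[of _ K]) auto
qed

lemma bump_L12: assumes "bump G r" shows "L12 G" "integrable lborel G"
proof -
  obtain K where "\<And>x. cmod (G x) \<le> K" using bump_bounded[OF assms] by blast
  then show "L12 G" "integrable lborel G"
    using integrable_bounded_support[OF bump_meas[OF assms], of K r] assms by (auto simp: bump_def)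
qed

lemma bump_cnj: "bump G r \<Longrightarrow> bump (\<lambda>x. cnj (G x)) r"
  by (auto simp: bump_def intro: continuous_intros)

lemma bump_window:
  assumes "bump G r" shows "\<exists>K. window (ifourier G) K"
proof -
  have c: "L12 (\<lambda>x. cnj (G x))" by (rule bump_L12(1)[OF bump_cnj[OF assms]])
  have m: "(\<lambda>x. cnj (G x)) \<in> borel_measurable borel" by (rule bump_meas[OF bump_cnj[OF assms]])
  show ?thesis
  proof
    show "window (ifourier G) (cD TYPE('a) * (\<integral>x. cmod (cnj (G x)) \<partial>lborel))"
    proof
      show "ifourier G \<in> borel_measurable borel"
        unfolding ifourier_eq using L12_fourier_meas[OF c] by measurable
      show "sq_int (ifourier G)" by (rule ifourier_sq_int[OF bump_L12(1)[OF assms]])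
      show "cmod (ifourier G x) \<le> cD TYPE('a) * (\<integral>x. cmod (cnj (G x)) \<partial>lborel)" for x
        unfolding ifourier_eq using fourier_le[OF m, of x] by simp
    qed
  qed
qed

definition Gdel :: "('a::euclidean_space \<Rightarrow> complex) \<Rightarrow> real \<Rightarrow> 'a \<Rightarrow> complex" where
  "Gdel \<eta> \<delta> p = complex_of_real (\<delta> powr (- real DIM('a) / 2)) * fourier \<eta> ((1 / \<delta>) *\<^sub>R p)"

lemma eta_delta_Gdel: "eta_delta \<eta> \<delta> = ifourier (Gdel \<eta> \<delta>)"
  by (simp add: eta_delta_def Gdel_def[abs_def])

lemma Gdel_bump:
  fixes \<eta> :: "'a::euclidean_space \<Rightarrow> complex"
  assumes "L12 \<eta>" "closure {\<xi>. fourier \<eta> \<xi> \<noteq> 0} \<subseteq> cball 0 1" "0 < \<delta>"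
  shows "bump (Gdel \<eta> \<delta>) \<delta>"
  unfolding bump_def
proof (intro conjI allI impI)
  show "continuous_on UNIV (Gdel \<eta> \<delta>)" unfolding Gdel_def
    by (intro continuous_intros continuous_on_compose2[OF L12_cont[OF assms(1)]]) auto
  fix p :: 'a assume p: "\<delta> < norm p"
  then have "1 < norm p / \<delta>" using assms(3) by (simp add: less_divide_eq)
  moreover have "norm ((1 / \<delta>) *\<^sub>R p) = norm p / \<delta>"
    unfolding norm_scaleR using assms(3) by (simp only: abs_of_pos zero_less_divide_1_iff) simp
  ultimately have "(1 / \<delta>) *\<^sub>R p \<notin> cball 0 1" by (simp only: mem_cball dist_0_norm not_le)
  then have notin: "(1 / \<delta>) *\<^sub>R p \<notin> cball 0 1" .
  have "fourier \<eta> ((1 / \<delta>) *\<^sub>R p) = 0"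
  proof (rule ccontr)
    assume "fourier \<eta> ((1 / \<delta>) *\<^sub>R p) \<noteq> 0"
    then have "(1 / \<delta>) *\<^sub>R p \<in> {\<xi>. fourier \<eta> \<xi> \<noteq> 0}" by (rule CollectI)
    then have "(1 / \<delta>) *\<^sub>R p \<in> cball 0 1" by (rule subsetD[OF order_trans[OF closure_subset assms(2)]])
    with notin show False by (rule notE)
  qed
  then show "Gdel \<eta> \<delta> p = 0" by (simp add: Gdel_def)
qed

lemma Gdel_norm:
  assumes L: "L12 (\<eta> :: 'a::euclidean_space \<Rightarrow> complex)" and supp: "closure {\<xi>. fourier \<eta> \<xi> \<noteq> 0} \<subseteq> cball 0 1" and d: "0 < \<delta>"
  shows "norm (L2 (Gdel \<eta> \<delta>)) = norm (L2 \<eta>)" "norm (L2 (eta_delta \<eta> \<delta>)) = norm (L2 \<eta>)"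
proof -
  note b = Gdel_bump[OF L supp d]
  have [measurable]: "Gdel \<eta> \<delta> \<in> borel_measurable borel" "fourier \<eta> \<in> borel_measurable borel"
    by (auto intro: bump_meas[OF b] L12_fourier_meas[OF L])
  have sG: "sq_int (Gdel \<eta> \<delta>)" by (rule L12_sq[OF bump_L12(1)[OF b]])
  have "ennreal ((norm (L2 (Gdel \<eta> \<delta>)))\<^sup>2) = (\<integral>\<^sup>+p. ennreal ((cmod (Gdel \<eta> \<delta> p))\<^sup>2) \<partial>lborel)"
    by (simp add: nn_norm_L2_sq sG)
  also have "\<dots> = ennreal (\<delta> ^ DIM('a)) * (\<integral>\<^sup>+p. ennreal ((cmod (Gdel \<eta> \<delta> (\<delta> *\<^sub>R p)))\<^sup>2) \<partial>lborel)"
    using nn_integral_lborel_affine[of "\<lambda>p. ennreal ((cmod (Gdel \<eta> \<delta> p))\<^sup>2)" \<delta> 0] d by simp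
  also have "(\<integral>\<^sup>+p. ennreal ((cmod (Gdel \<eta> \<delta> (\<delta> *\<^sub>R p)))\<^sup>2) \<partial>lborel)
     = (\<integral>\<^sup>+p. ennreal (1 / \<delta> ^ DIM('a)) * ennreal ((cmod (fourier \<eta> p))\<^sup>2) \<partial>lborel)"
  proof (rule nn_integral_cong)
    fix p :: 'a
    have "(\<delta> powr (- real DIM('a) / 2))\<^sup>2 = \<delta> powr (- real DIM('a) / 2 + - real DIM('a) / 2)"
      by (simp only: power2_eq_square powr_add)
    also have "- real DIM('a) / 2 + - real DIM('a) / 2 = - real DIM('a)" by simp
    also have "\<delta> powr (- real DIM('a)) = 1 / \<delta> ^ DIM('a)"
      using d by (simp add: powr_minus powr_realpow divide_inverse)
    finally have "(cmod (Gdel \<eta> \<delta> (\<delta> *\<^sub>R p)))\<^sup>2 = 1 / \<delta> ^ DIM('a) * (cmod (fourier \<eta> p))\<^sup>2"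
      using d by (simp add: Gdel_def norm_mult power_mult_distrib)
    then show "ennreal ((cmod (Gdel \<eta> \<delta> (\<delta> *\<^sub>R p)))\<^sup>2) = ennreal (1 / \<delta> ^ DIM('a)) * ennreal ((cmod (fourier \<eta> p))\<^sup>2)"
      using d by (simp only: ennreal_mult' zero_le_divide_1_iff zero_le_power less_imp_le)
  qed
  also have "\<dots> = ennreal (1 / \<delta> ^ DIM('a)) * (\<integral>\<^sup>+p. ennreal ((cmod (fourier \<eta> p))\<^sup>2) \<partial>lborel)"
    by (rule nn_integral_cmult) measurable
  also have "ennreal (\<delta> ^ DIM('a)) * (ennreal (1 / \<delta> ^ DIM('a)) * (\<integral>\<^sup>+p. ennreal ((cmod (fourier \<eta> p))\<^sup>2) \<partial>lborel))
     = (\<integral>\<^sup>+p. ennreal ((cmod (fourier \<eta> p))\<^sup>2) \<partial>lborel)"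
    using d by (simp flip: mult.assoc ennreal_mult)
  also have "\<dots> = ennreal ((norm (FT (L2 \<eta>)))\<^sup>2)"
    by (simp add: nn_norm_L2_sq fourier_contraction(1) L FT_L12)
  finally have "ennreal ((norm (L2 (Gdel \<eta> \<delta>)))\<^sup>2) = ennreal ((norm (L2 \<eta>))\<^sup>2)" by (simp add: FT_norm)
  then show 1: "norm (L2 (Gdel \<eta> \<delta>)) = norm (L2 \<eta>)" by (rule ennreal_sq_eqD) auto
  have "L2 (eta_delta \<eta> \<delta>) = IFT (L2 (Gdel \<eta> \<delta>))"
    unfolding eta_delta_Gdel by (rule IFT_L12[symmetric, OF bump_L12(1)[OF b]])
  then show "norm (L2 (eta_delta \<eta> \<delta>)) = norm (L2 \<eta>)" using 1 by (simp add: IFT_norm)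
qed

text \<open>On the Fourier side a coherent state is the bump translated to p with a phase, and free
  evolution only adds another phase. Compact support survives, so the evolved state is given by a
  genuine integral instead of an L2 limit, which makes pointwise estimates possible.\<close>

lemma Bev_cs_bump:
  fixes G :: "'a::euclidean_space \<Rightarrow> complex"
  assumes G: "bump G r"
  defines "H \<equiv> \<lambda>s x p \<xi>. exp (- \<i> * complex_of_real (s * (norm \<xi>)\<^sup>2)) * (exp (- \<i> * complex_of_real (x \<bullet> \<xi>)) * G (\<xi> - p))"
  shows "\<exists>r'. bump (H s x p) r'" "L2 (cs (ifourier G) (x, p)) = IFT (L2 (H 0 x p))"
    "Bev s (L2 (cs (ifourier G) (x, p))) = L2 (ifourier (H s x p))"
proof -
  have b: "bump (H s x p) (r + norm p)" for s
    unfolding bump_def H_def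
  proof (intro conjI allI impI)
    have Gc: "continuous_on UNIV (\<lambda>\<xi>. G (\<xi> - p))"
      by (rule continuous_on_compose2[of UNIV G]) (use G in \<open>auto simp: bump_def intro: continuous_intros\<close>)
    show "continuous_on UNIV (\<lambda>\<xi>. exp (- \<i> * complex_of_real (s * (norm \<xi>)\<^sup>2)) * (exp (- \<i> * complex_of_real (x \<bullet> \<xi>)) * G (\<xi> - p)))"
      by (intro continuous_intros Gc)
    fix \<xi> :: 'a assume "r + norm p < norm \<xi>"
    then have "r < norm (\<xi> - p)" using norm_triangle_ineq2[of \<xi> p] by linarith
    then show "exp (- \<i> * complex_of_real (s * (norm \<xi>)\<^sup>2)) * (exp (- \<i> * complex_of_real (x \<bullet> \<xi>)) * G (\<xi> - p)) = 0"
      using G by (simp add: bump_def)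
  qed
  then show "\<exists>r'. bump (H s x p) r'" by blast
  have [measurable]: "G \<in> borel_measurable borel" by (rule bump_meas[OF G])
  have "ifourier (H 0 x p) = cs (ifourier G) (x, p)"
  proof
    fix y
    have "(\<integral>\<xi>. exp (\<i> * complex_of_real (y \<bullet> \<xi>)) * H 0 x p \<xi> \<partial>lborel)
       = (\<integral>\<xi>. exp (\<i> * complex_of_real (y \<bullet> (p + \<xi>))) * H 0 x p (p + \<xi>) \<partial>lborel)"
      by (rule integral_lborel_translate[symmetric, of "\<lambda>\<xi>. exp (\<i> * complex_of_real (y \<bullet> \<xi>)) * H 0 x p \<xi>"])
         (simp add: H_def)
    also have "\<dots> = (\<integral>\<xi>. exp (\<i> * complex_of_real (p \<bullet> (y - x))) * (exp (\<i> * complex_of_real ((y - x) \<bullet> \<xi>)) * G \<xi>) \<partial>lborel)"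
    proof (intro Bochner_Integration.integral_cong refl)
      fix \<xi>
      have "exp (\<i> * complex_of_real (y \<bullet> (p + \<xi>))) * exp (- \<i> * complex_of_real (x \<bullet> (p + \<xi>)))
         = exp (\<i> * complex_of_real (p \<bullet> (y - x))) * exp (\<i> * complex_of_real ((y - x) \<bullet> \<xi>))"
        unfolding exp_add[symmetric]
        by (simp add: inner_add_right inner_diff_right inner_diff_left inner_commute algebra_simps)
      then show "exp (\<i> * complex_of_real (y \<bullet> (p + \<xi>))) * H 0 x p (p + \<xi>)
        = exp (\<i> * complex_of_real (p \<bullet> (y - x))) * (exp (\<i> * complex_of_real ((y - x) \<bullet> \<xi>)) * G \<xi>)"
        by (simp add: H_def flip: mult.assoc)
    qed
    also have "\<dots> = exp (\<i> * complex_of_real (p \<bullet> (y - x))) * (\<integral>\<xi>. exp (\<i> * complex_of_real ((y - x) \<bullet> \<xi>)) * G \<xi> \<partial>lborel)"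
      by (rule Bochner_Integration.integral_mult_right_zero)
    finally show "ifourier (H 0 x p) y = cs (ifourier G) (x, p) y"
      unfolding ifourier_def cs_def by (simp add: integral_completion H_def)
  qed
  then show 2: "L2 (cs (ifourier G) (x, p)) = IFT (L2 (H 0 x p))"
    by (simp add: IFT_L12 bump_L12(1)[OF b])
  have "Bev s (L2 (cs (ifourier G) (x, p))) = IFT (L2 (\<lambda>\<xi>. fmult s \<xi> * H 0 x p \<xi>))"
    unfolding Bev_def 2 FT_IFT by (simp add: mulop_L2[OF fmult_bddm] L12_sq bump_L12(1)[OF b])
  also have "(\<lambda>\<xi>. fmult s \<xi> * H 0 x p \<xi>) = H s x p" by (rule ext) (simp add: H_def fmult_def)
  finally show "Bev s (L2 (cs (ifourier G) (x, p))) = L2 (ifourier (H s x p))"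
    by (simp add: IFT_L12 bump_L12(1)[OF b])
qed

subsection \<open>Integrable weights\<close>

lemma integrable_inverse_1_plus_sq: "integrable lborel (\<lambda>x::real. inverse (1 + x\<^sup>2))"
proof -
  let ?f = "\<lambda>x::real. inverse (1 + x\<^sup>2)"
  have "set_integrable lborel {0<..} ?f"
    using integrable_I0i_1_div_plus_square
    by (simp add: interval_lebesgue_integrable_def zero_ereal_def einterval_def greaterThan_def inverse_eq_divide)
  then have i1: "integrable lborel (\<lambda>x. indicator {0<..} x * ?f x)" by (simp add: set_integrable_def)
  have i2: "integrable lborel (\<lambda>x. indicator {0<..} (- x) * ?f (- x))"
    using integrable_lborel_affine[OF i1, of "-1" 0] by simp
  show ?thesis
  proof (rule Bochner_Integration.integrable_bound[OF Bochner_Integration.integrable_add[OF i1 i2]])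
    have "AE x in lborel. x \<noteq> (0::real)" by (rule AE_lborel_singleton)
    then show "AE x in lborel. norm (?f x) \<le> norm (indicator {0<..} x * ?f x + indicator {0<..} (- x) * ?f (- x))"
      by eventually_elim (auto simp: indicator_def)
  qed measurable
qed

text \<open>(1 + |x|)^(2 d) dominates the product of the factors 1 + (x . b)^2, whose inverse is
  integrable coordinate by coordinate.\<close>

lemma integrable_weight: "integrable lborel (\<lambda>x::'a::euclidean_space. inverse ((1 + norm x) ^ (2 * DIM('a))))"
proof (rule Bochner_Integration.integrable_bound)
  show "integrable lborel (\<lambda>x::'a. \<Prod>b\<in>Basis. inverse (1 + (x \<bullet> b)\<^sup>2))"
    by (rule integrable_lborel_prod_Basis[OF integrable_inverse_1_plus_sq]) auto
  show "AE x in lborel. norm (inverse ((1 + norm (x::'a)) ^ (2 * DIM('a)))) \<le> norm (\<Prod>b\<in>Basis. inverse (1 + (x \<bullet> b)\<^sup>2))"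
  proof (rule AE_I2)
    fix x :: 'a
    have "(1 + norm x) ^ (2 * DIM('a)) = (\<Prod>b\<in>(Basis::'a set). (1 + norm x)\<^sup>2)"
      by (simp add: power_mult)
    also have "\<dots> \<ge> (\<Prod>b\<in>Basis. 1 + (x \<bullet> b)\<^sup>2)"
    proof (rule prod_mono, intro conjI)
      fix b :: 'a assume b: "b \<in> Basis"
      have "(x \<bullet> b)\<^sup>2 \<le> (norm x)\<^sup>2" using Basis_le_norm[OF b, of x] by (metis abs_le_square_iff abs_norm_cancel)
      then show "1 + (x \<bullet> b)\<^sup>2 \<le> (1 + norm x)\<^sup>2" by (simp add: power2_sum add_increasing2)
    qed auto
    finally have le: "(\<Prod>b\<in>Basis. 1 + (x \<bullet> b)\<^sup>2) \<le> (1 + norm x) ^ (2 * DIM('a))" .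
    have pos: "0 < (\<Prod>b\<in>Basis. 1 + (x \<bullet> b)\<^sup>2)" by (intro prod_pos) (auto intro: add_pos_nonneg)
    have "inverse ((1 + norm x) ^ (2 * DIM('a))) \<le> inverse (\<Prod>b\<in>Basis. 1 + (x \<bullet> b)\<^sup>2)"
      by (rule le_imp_inverse_le[OF le pos])
    also have "\<dots> = (\<Prod>b\<in>Basis. inverse (1 + (x \<bullet> b)\<^sup>2))" by (rule prod_inversef[symmetric, unfolded comp_def])
    finally show "norm (inverse ((1 + norm x) ^ (2 * DIM('a)))) \<le> norm (\<Prod>b\<in>Basis. inverse (1 + (x \<bullet> b)\<^sup>2))"
      by (simp add: add_nonneg_nonneg abs_of_nonneg prod_nonneg)
  qed
qed simp

subsection \<open>Schwartz functions\<close>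

lemma has_vector_derivative_shift:
  fixes f :: "'a::real_normed_vector \<Rightarrow> 'b::real_normed_vector"
  assumes "\<And>y. ((\<lambda>s. f (y + s *\<^sub>R b)) has_vector_derivative h y) (at 0)"
  shows "((\<lambda>s. f (x + s *\<^sub>R b)) has_vector_derivative h (x + t *\<^sub>R b)) (at t)"
proof -
  have "((\<lambda>s. s - t) has_vector_derivative (1 - 0)) (at t)"
    by (rule has_vector_derivative_diff[OF has_vector_derivative_id has_vector_derivative_const])
  then have 1: "((\<lambda>s. s - t) has_vector_derivative 1) (at t)" by simp
  have 2: "((\<lambda>s. f ((x + t *\<^sub>R b) + s *\<^sub>R b)) has_vector_derivative h (x + t *\<^sub>R b)) (at ((\<lambda>s. s - t) t))"
    using assms[of "x + t *\<^sub>R b"] by simp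
  from vector_diff_chain_at[OF 1 2] show ?thesis by (simp add: comp_def algebra_simps)
qed

lemma has_vector_derivative_quotient:
  fixes f :: "real \<Rightarrow> 'b::real_normed_vector"
  assumes "(f has_vector_derivative d) (at 0)"
  shows "((\<lambda>t. (1 / t) *\<^sub>R (f t - f 0)) \<longlongrightarrow> d) (at 0)"
proof -
  have "((\<lambda>h. norm (f (0 + h) - f 0 - h *\<^sub>R d) / norm h) \<longlongrightarrow> 0) (at 0)"
    using assms by (simp add: has_vector_derivative_def has_derivative_at)
  moreover have "\<forall>\<^sub>F h in at 0. norm (f (0 + h) - f 0 - h *\<^sub>R d) / norm h = norm ((1 / h) *\<^sub>R (f h - f 0) - d)"
  proof (rule eventually_mono[OF eventually_neq_at_within[of "0::real"]])
    fix h :: real assume h: "h \<noteq> 0"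
    then have "(1 / h) *\<^sub>R (f h - f 0) - d = (1 / h) *\<^sub>R (f h - f 0 - h *\<^sub>R d)" by (simp add: scaleR_diff_right)
    then show "norm (f (0 + h) - f 0 - h *\<^sub>R d) / norm h = norm ((1 / h) *\<^sub>R (f h - f 0) - d)" by simp
  qed
  ultimately have "((\<lambda>h. norm ((1 / h) *\<^sub>R (f h - f 0) - d)) \<longlongrightarrow> 0) (at 0)"
    by (rule Lim_transform_eventually)
  then show ?thesis by (simp add: tendsto_norm_zero_iff LIM_zero_iff)
qed

lemma schwartz_decay: "schwartz f \<Longrightarrow> \<exists>C. \<forall>x. (1 + norm x) ^ N * cmod (f x) \<le> C"
proof -
  assume "schwartz f"
  then have "bounded (range (\<lambda>x. (1 + norm x) ^ N *\<^sub>R f x))"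
    unfolding schwartz_def using pderivs.base by blast
  then obtain C where "\<And>x. norm ((1 + norm x) ^ N *\<^sub>R f x) \<le> C" unfolding bounded_iff by auto
  then show ?thesis by (intro exI[of _ C]) simp
qed

lemma schwartz_partial_lipschitz:
  fixes f :: "'a::euclidean_space \<Rightarrow> complex"
  assumes f: "schwartz f" and b: "b \<in> Basis"
  shows "\<exists>K\<ge>0. \<forall>x t. cmod (f (x + t *\<^sub>R b) - f x) \<le> K * \<bar>t\<bar>"
proof -
  define h where "h x = vector_derivative (\<lambda>t. f (x + t *\<^sub>R b)) (at 0)" for x
  have "(\<lambda>t::real. f (x + t *\<^sub>R b)) differentiable (at 0)" for x
    using f pderivs.base[of f] b unfolding schwartz_def by blast
  then have d: "((\<lambda>t. f (x + t *\<^sub>R b)) has_vector_derivative h x) (at 0)" for x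
    unfolding h_def by (simp add: vector_derivative_works[symmetric])
  then have "h \<in> pderivs f" using pderivs.step[OF pderivs.base b] by blast
  then have "bounded (range (\<lambda>x. (1 + norm x) ^ 0 *\<^sub>R h x))" using f unfolding schwartz_def by blast
  then obtain K where K: "\<And>x. cmod (h x) \<le> K" unfolding bounded_iff by auto
  have K0: "0 \<le> K" using norm_ge_zero K order_trans by blast
  have dt: "((\<lambda>t. f (x + t *\<^sub>R b)) has_vector_derivative h (x + t *\<^sub>R b)) (at t)" for x t
    by (rule has_vector_derivative_shift[OF d])
  have pos: "cmod (f (x + t *\<^sub>R b) - f x) \<le> K * t" if t: "0 \<le> t" for x t
  proof (cases "t = 0")
    case False
    then have "0 < t" using t by simp
    then have "norm ((\<lambda>s. f (x + s *\<^sub>R b)) t - (\<lambda>s. f (x + s *\<^sub>R b)) 0) \<le> (\<lambda>s. K * s) t - (\<lambda>s. K * s) 0"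
    proof (rule differentiable_bound_general[where f'="\<lambda>s. h (x + s *\<^sub>R b)" and \<phi>'="\<lambda>s. K"])
      show "continuous_on {0..t} (\<lambda>s. f (x + s *\<^sub>R b))"
        using dt by (intro continuous_at_imp_continuous_on ballI has_vector_derivative_continuous) blast
      show "((\<lambda>s. K * s) has_vector_derivative K) (at s)" for s
        by (auto intro!: derivative_eq_intros simp: has_real_derivative_iff_has_vector_derivative[symmetric])
    qed (use dt K in \<open>auto intro!: continuous_intros\<close>)
    then show ?thesis by simp
  qed simp
  show ?thesis
  proof (intro exI[of _ K] conjI allI K0)
    fix x t
    show "cmod (f (x + t *\<^sub>R b) - f x) \<le> K * \<bar>t\<bar>"
    proof (cases "0 \<le> t")
      case True then show ?thesis using pos by simp
    next
      case False
      then show ?thesis using pos[of "- t" "x + t *\<^sub>R b"] by (simp add: norm_minus_commute)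
    qed
  qed
qed

text \<open>\<open>schwartz\<close> speaks of partial derivatives. They are bounded, so walking from
  x to y along the basis directions gives a global Lipschitz bound.\<close>

lemma schwartz_continuous:
  fixes f :: "'a::euclidean_space \<Rightarrow> complex"
  assumes f: "schwartz f" shows "continuous_on UNIV f"
proof -
  obtain K where K: "\<And>b. b \<in> Basis \<Longrightarrow> 0 \<le> K b" "\<And>b x t. b \<in> Basis \<Longrightarrow> cmod (f (x + t *\<^sub>R b) - f x) \<le> K b * \<bar>t\<bar>"
    using schwartz_partial_lipschitz[OF f] by metis
  have step: "cmod (f (x + (\<Sum>b\<in>S. c b *\<^sub>R b)) - f x) \<le> (\<Sum>b\<in>S. K b * \<bar>c b\<bar>)" if "finite S" "S \<subseteq> Basis" for S x c
    using that
  proof (induction S)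
    case (insert a S)
    let ?y = "x + (\<Sum>b\<in>S. c b *\<^sub>R b)"
    have "f (x + (\<Sum>b\<in>insert a S. c b *\<^sub>R b)) - f x = (f (?y + c a *\<^sub>R a) - f ?y) + (f ?y - f x)"
      using insert by (simp add: algebra_simps)
    then have "cmod (f (x + (\<Sum>b\<in>insert a S. c b *\<^sub>R b)) - f x) \<le> cmod (f (?y + c a *\<^sub>R a) - f ?y) + cmod (f ?y - f x)"
      by (simp only: norm_triangle_ineq)
    also have "\<dots> \<le> K a * \<bar>c a\<bar> + (\<Sum>b\<in>S. K b * \<bar>c b\<bar>)"
      using insert K by (intro add_mono) auto
    finally show ?case using insert by simp
  qed simp
  have lip: "cmod (f y - f x) \<le> (\<Sum>b\<in>Basis. K b) * norm (y - x)" for x y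
  proof -
    have "x + (\<Sum>b\<in>Basis. ((y - x) \<bullet> b) *\<^sub>R b) = y" by (simp add: euclidean_representation)
    then have "cmod (f y - f x) \<le> (\<Sum>b\<in>Basis. K b * \<bar>(y - x) \<bullet> b\<bar>)"
      using step[of Basis x "\<lambda>b. (y - x) \<bullet> b"] by simp
    also have "\<dots> \<le> (\<Sum>b\<in>Basis. K b * norm (y - x))"
      using K by (intro sum_mono mult_left_mono Basis_le_norm) auto
    finally show ?thesis by (simp add: sum_distrib_right)
  qed
  have "(\<Sum>b\<in>Basis. K b) \<ge> 0" using K by (intro sum_nonneg)
  moreover have "dist (f x) (f y) \<le> (\<Sum>b\<in>Basis. K b) * dist x y" for x y
    unfolding dist_norm by (rule lip)
  ultimately have "(\<Sum>b\<in>Basis. K b)-lipschitz_on UNIV f" by (intro lipschitz_onI)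
  then show ?thesis by (rule lipschitz_on_continuous_on)
qed

text \<open>The transforms of these moments are the derivatives of the transform along b. Decay of
  order 2 d + j absorbs the monomial and leaves the integrable weight.\<close>

lemma schwartz_moment:
  fixes f :: "'a::euclidean_space \<Rightarrow> complex"
  assumes f: "schwartz f"
  defines "m \<equiv> \<lambda>b j x. (- \<i> * complex_of_real (x \<bullet> b)) ^ j * f x"
  assumes b: "b \<in> Basis"
  shows "m b j \<in> borel_measurable borel" "integrable lborel (m b j)" "L12 (m b j)"
proof -
  have [measurable]: "f \<in> borel_measurable borel" by (rule borel_measurable_continuous_onI[OF schwartz_continuous[OF f]])
  show mm [measurable]: "m b j \<in> borel_measurable borel" unfolding m_def by measurable
  obtain C where C: "\<And>x. (1 + norm x) ^ (2 * DIM('a) + j) * cmod (f x) \<le> C"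
    using schwartz_decay[OF f] by metis
  have bd: "cmod (m b j x) \<le> C * inverse ((1 + norm x) ^ (2 * DIM('a)))" for x
  proof -
    have p: "0 < (1 + norm x) ^ (2 * DIM('a))" by (simp add: add_pos_nonneg)
    have "\<bar>x \<bullet> b\<bar> ^ j \<le> (1 + norm x) ^ j" using Basis_le_norm[OF b, of x] by (intro power_mono) auto
    then have "cmod (m b j x) \<le> (1 + norm x) ^ j * cmod (f x)"
      by (auto simp: m_def norm_mult norm_power intro!: mult_right_mono)
    moreover have "(1 + norm x) ^ (2 * DIM('a)) * ((1 + norm x) ^ j * cmod (f x)) \<le> C"
      using C[of x] by (simp add: power_add mult.assoc)
    ultimately have "(1 + norm x) ^ (2 * DIM('a)) * cmod (m b j x) \<le> C"
      using p by (meson mult_left_mono less_imp_le order_trans)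
    then show ?thesis using p by (simp add: field_simps)
  qed
  have "integrable lborel (\<lambda>x::'a. C * inverse ((1 + norm x) ^ (2 * DIM('a))))"
    by (intro integrable_mult_right integrable_weight)
  then show i: "integrable lborel (m b j)"
    by (rule Bochner_Integration.integrable_bound) (use bd in \<open>auto intro!: AE_I2 order_trans[OF bd abs_ge_self]\<close>)
  have C0: "0 \<le> C" using C[of 0] by (simp add: order_trans[OF norm_ge_zero])
  have "cmod (m b j x) \<le> C" for x
  proof -
    have "inverse ((1 + norm x) ^ (2 * DIM('a))) \<le> 1" by (intro inverse_le_1_iff[THEN iffD2]) (simp add: one_le_power)
    then show ?thesis using bd[of x] C0 by (meson mult_left_le order_trans)
  qed
  then have "integrable lborel (\<lambda>x. C * cmod (m b j x))" "\<And>x. (cmod (m b j x))\<^sup>2 \<le> C * cmod (m b j x)"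
    using i by (auto simp: power2_eq_square intro: mult_right_mono)
  then have "integrable lborel (\<lambda>x. (cmod (m b j x))\<^sup>2)"
    by - (rule Bochner_Integration.integrable_bound, assumption, auto intro!: AE_I2 order_trans[OF _ abs_ge_self])
  then show "L12 (m b j)" using i borel_measurable_lebesgueI[OF mm]
    by (simp add: L12_def sq_int_def lebesgue_integrable_iff)
qed

subsection \<open>Derivatives of Fourier transforms\<close>

lemma has_vector_derivative_quadratic:
  fixes f :: "real \<Rightarrow> 'b::real_normed_vector"
  assumes "\<And>t. norm (f t - f 0 - t *\<^sub>R d) \<le> C * t\<^sup>2"
  shows "(f has_vector_derivative d) (at 0)"
  unfolding has_vector_derivative_def has_derivative_at
proof (intro conjI bounded_linear_scaleR_left)
  show "(\<lambda>h. norm (f (0 + h) - f 0 - h *\<^sub>R d) / norm h) \<midarrow>0\<rightarrow> 0"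
  proof (rule Lim_null_comparison)
    show "\<forall>\<^sub>F h in at 0. norm (norm (f (0 + h) - f 0 - h *\<^sub>R d) / norm h) \<le> C * \<bar>h\<bar>"
    proof (rule eventually_mono[OF eventually_neq_at_within[of "0::real"]])
      fix h :: real assume h: "h \<noteq> 0"
      have "norm (f h - f 0 - h *\<^sub>R d) \<le> C * \<bar>h\<bar> * \<bar>h\<bar>"
        using assms[of h] by (simp add: power2_eq_square mult.assoc)
      then show "norm (norm (f (0 + h) - f 0 - h *\<^sub>R d) / norm h) \<le> C * \<bar>h\<bar>"
        using h by (simp add: divide_le_eq)
    qed
    show "(\<lambda>h. C * \<bar>h\<bar>) \<midarrow>0\<rightarrow> 0" by (auto intro!: tendsto_eq_intros)
  qed
qed

text \<open>The second moment bounds the Taylor remainder quadratically in t, so differentiation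
  under the integral reduces to \<open>has_vector_derivative_quadratic\<close>.\<close>

lemma fourier_deriv:
  fixes f :: "'a::euclidean_space \<Rightarrow> complex"
  assumes f: "integrable lborel f" and f1: "integrable lborel (\<lambda>x. - \<i> * complex_of_real (x \<bullet> b) * f x)"
    and f2: "integrable lborel (\<lambda>x. (x \<bullet> b)\<^sup>2 * cmod (f x))"
  shows "((\<lambda>t. fourier f (\<xi> + t *\<^sub>R b)) has_vector_derivative fourier (\<lambda>x. - \<i> * complex_of_real (x \<bullet> b) * f x) \<xi>) (at 0)"
proof (rule has_vector_derivative_quadratic)
  fix t :: real
  let ?f1 = "\<lambda>x. - \<i> * complex_of_real (x \<bullet> b) * f x"
  let ?c = "complex_of_real (cD TYPE('a))"
  let ?E = "\<lambda>\<xi> x. exp (- \<i> * complex_of_real (x \<bullet> \<xi>))"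
  have [measurable]: "f \<in> borel_measurable borel" using f by simp
  have i: "integrable lborel (\<lambda>x. ?E \<zeta> x * f x)" for \<zeta> by (rule fourier_integrand_integrable[OF f])
  have i1: "integrable lborel (\<lambda>x. ?E \<xi> x * ?f1 x)" by (rule fourier_integrand_integrable[OF f1])
  have "fourier f (\<xi> + t *\<^sub>R b) - fourier f (\<xi> + 0 *\<^sub>R b) - t *\<^sub>R fourier ?f1 \<xi>
    = ?c * ((\<integral>x. ?E (\<xi> + t *\<^sub>R b) x * f x \<partial>lborel) - (\<integral>x. ?E \<xi> x * f x \<partial>lborel) - complex_of_real t * (\<integral>x. ?E \<xi> x * ?f1 x \<partial>lborel))"
    by (simp add: fourier_borel scaleR_conv_of_real algebra_simps)
  also have "\<dots> = ?c * (\<integral>x. ?E (\<xi> + t *\<^sub>R b) x * f x - ?E \<xi> x * f x - complex_of_real t * (?E \<xi> x * ?f1 x) \<partial>lborel)"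
  proof -
    have "(\<integral>x. ?E (\<xi> + t *\<^sub>R b) x * f x - ?E \<xi> x * f x - complex_of_real t * (?E \<xi> x * ?f1 x) \<partial>lborel)
      = (\<integral>x. ?E (\<xi> + t *\<^sub>R b) x * f x - ?E \<xi> x * f x \<partial>lborel) - (\<integral>x. complex_of_real t * (?E \<xi> x * ?f1 x) \<partial>lborel)"
      by (rule Bochner_Integration.integral_diff[OF Bochner_Integration.integrable_diff[OF i i] integrable_mult_right[OF i1]])
    also have "(\<integral>x. ?E (\<xi> + t *\<^sub>R b) x * f x - ?E \<xi> x * f x \<partial>lborel) = (\<integral>x. ?E (\<xi> + t *\<^sub>R b) x * f x \<partial>lborel) - (\<integral>x. ?E \<xi> x * f x \<partial>lborel)"
      by (rule Bochner_Integration.integral_diff[OF i i])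
    also have "(\<integral>x. complex_of_real t * (?E \<xi> x * ?f1 x) \<partial>lborel) = complex_of_real t * (\<integral>x. ?E \<xi> x * ?f1 x \<partial>lborel)"
      by (rule Bochner_Integration.integral_mult_right_zero)
    finally show ?thesis by simp
  qed
  finally have "norm (fourier f (\<xi> + t *\<^sub>R b) - fourier f (\<xi> + 0 *\<^sub>R b) - t *\<^sub>R fourier ?f1 \<xi>)
    = cD TYPE('a) * cmod (\<integral>x. ?E (\<xi> + t *\<^sub>R b) x * f x - ?E \<xi> x * f x - complex_of_real t * (?E \<xi> x * ?f1 x) \<partial>lborel)"
    using cD_pos[where 'a='a] by (simp only: norm_mult norm_of_real abs_of_pos)
  also have "\<dots> \<le> cD TYPE('a) * (\<integral>x. t\<^sup>2 * ((x \<bullet> b)\<^sup>2 * cmod (f x)) \<partial>lborel)"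
  proof (intro mult_left_mono less_imp_le[OF cD_pos] Bochner_Integration.integral_norm_bound_integral)
    show "integrable lborel (\<lambda>x. ?E (\<xi> + t *\<^sub>R b) x * f x - ?E \<xi> x * f x - complex_of_real t * (?E \<xi> x * ?f1 x))"
      by (intro Bochner_Integration.integrable_diff integrable_mult_right i i1)
    show "integrable lborel (\<lambda>x. t\<^sup>2 * ((x \<bullet> b)\<^sup>2 * cmod (f x)))" by (intro integrable_mult_right f2)
    fix x
    have "?E (\<xi> + t *\<^sub>R b) x = ?E \<xi> x * exp (- \<i> * complex_of_real (t * (x \<bullet> b)))"
      by (simp add: exp_add[symmetric] inner_add_right algebra_simps)
    then have "?E (\<xi> + t *\<^sub>R b) x * f x - ?E \<xi> x * f x - complex_of_real t * (?E \<xi> x * ?f1 x)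
      = ?E \<xi> x * f x * (exp (- \<i> * complex_of_real (t * (x \<bullet> b))) - 1 - - \<i> * complex_of_real (t * (x \<bullet> b)))"
      by (simp add: algebra_simps)
    then have "norm (?E (\<xi> + t *\<^sub>R b) x * f x - ?E \<xi> x * f x - complex_of_real t * (?E \<xi> x * ?f1 x))
      = cmod (f x) * cmod (exp (- \<i> * complex_of_real (t * (x \<bullet> b))) - 1 - - \<i> * complex_of_real (t * (x \<bullet> b)))"
      by (simp only: norm_mult) simp
    also have "\<dots> \<le> cmod (f x) * (t * (x \<bullet> b))\<^sup>2"
      by (intro mult_left_mono exp_taylor1) simp
    also have "\<dots> = t\<^sup>2 * ((x \<bullet> b)\<^sup>2 * cmod (f x))" by (simp add: power_mult_distrib)
    finally show "norm (?E (\<xi> + t *\<^sub>R b) x * f x - ?E \<xi> x * f x - complex_of_real t * (?E \<xi> x * ?f1 x)) \<le> t\<^sup>2 * ((x \<bullet> b)\<^sup>2 * cmod (f x))" .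
  qed
  also have "\<dots> = cD TYPE('a) * (\<integral>x. (x \<bullet> b)\<^sup>2 * cmod (f x) \<partial>lborel) * t\<^sup>2" by simp
  finally show "norm (fourier f (\<xi> + t *\<^sub>R b) - fourier f (\<xi> + 0 *\<^sub>R b) - t *\<^sub>R fourier ?f1 \<xi>)
     \<le> cD TYPE('a) * (\<integral>x. (x \<bullet> b)\<^sup>2 * cmod (f x) \<partial>lborel) * t\<^sup>2" .
qed

text \<open>Smoothness is recorded along a single direction, as a sequence of iterated derivatives
  with a common support ball; repeated integration by parts along b consumes it in this
  form.\<close>

definition smooth_bump :: "'a::euclidean_space \<Rightarrow> real \<Rightarrow> (nat \<Rightarrow> 'a \<Rightarrow> complex) \<Rightarrow> bool" where
  "smooth_bump b r g \<longleftrightarrow> (\<forall>j. bump (g j) r) \<and>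
     (\<forall>j q. ((\<lambda>t. g j (q + t *\<^sub>R b)) has_vector_derivative g (Suc j) q) (at 0))"

lemma has_vector_derivative_locally_zero:
  assumes e: "0 < e" "\<And>t. \<bar>t\<bar> < e \<Longrightarrow> f t = 0"
  shows "(f has_vector_derivative 0) (at 0)"
proof (rule has_vector_derivative_transform_within_open[of "\<lambda>_. 0" 0 0 "{-e<..<e}"])
  show "((\<lambda>_. 0) has_vector_derivative 0) (at 0)" by (auto intro: derivative_eq_intros)
qed (use e in auto)

lemma outside_ball_locally:
  assumes q: "r < norm (q::'a::euclidean_space)" and b: "b \<in> Basis" and t: "\<bar>t\<bar> < norm q - r"
  shows "r < norm (q + t *\<^sub>R b)"
proof -
  have "norm q \<le> norm (q + t *\<^sub>R b) + norm (t *\<^sub>R b)" using norm_triangle_ineq4[of "q + t *\<^sub>R b" "t *\<^sub>R b"] by simp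
  then show ?thesis using t b by simp
qed

text \<open>The iterated derivatives of the transform are transforms of the moments. They vanish
  outside the ball by induction, because the exterior of the ball is open.\<close>

lemma schwartz_smooth_bump:
  fixes f :: "'a::euclidean_space \<Rightarrow> complex"
  assumes f: "schwartz f" and supp: "closure {\<xi>. fourier f \<xi> \<noteq> 0} \<subseteq> cball 0 1" and b: "b \<in> Basis"
  shows "\<exists>g. smooth_bump b 1 g \<and> g 0 = fourier f"
proof -
  define m where "m j x = (- \<i> * complex_of_real (x \<bullet> b)) ^ j * f x" for j x
  have mm: "m j \<in> borel_measurable borel" "integrable lborel (m j)" "L12 (m j)" for j
    using schwartz_moment[OF f b, of j] unfolding m_def by auto
  have mS: "m (Suc j) = (\<lambda>x. - \<i> * complex_of_real (x \<bullet> b) * m j x)" for j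
    by (rule ext) (simp add: m_def)
  have der: "((\<lambda>t. fourier (m j) (\<xi> + t *\<^sub>R b)) has_vector_derivative fourier (m (Suc j)) \<xi>) (at 0)" for j \<xi>
    unfolding mS
  proof (rule fourier_deriv)
    show "integrable lborel (\<lambda>x. - \<i> * complex_of_real (x \<bullet> b) * m j x)" using mm(2)[of "Suc j"] unfolding mS .
    have "integrable lborel (\<lambda>x. cmod (m (Suc (Suc j)) x))" by (intro integrable_norm mm)
    moreover have "cmod (m (Suc (Suc j)) x) = (x \<bullet> b)\<^sup>2 * cmod (m j x)" for x
    proof -
      have "cmod (m (Suc (Suc j)) x) = \<bar>x \<bullet> b\<bar> * (\<bar>x \<bullet> b\<bar> * cmod (m j x))" by (simp add: mS norm_mult)
      then show ?thesis by (simp only: mult.assoc[symmetric] power2_eq_square[symmetric] power2_abs)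
    qed
    ultimately show "integrable lborel (\<lambda>x. (x \<bullet> b)\<^sup>2 * cmod (m j x))" by simp
  qed (rule mm)
  have zero: "fourier (m j) \<xi> = 0" if "1 < norm \<xi>" for j \<xi>
    using that
  proof (induction j arbitrary: \<xi>)
    case 0
    have "fourier f \<xi> = 0"
    proof (rule ccontr)
      assume "fourier f \<xi> \<noteq> 0"
      then have "\<xi> \<in> {\<xi>. fourier f \<xi> \<noteq> 0}" by (rule CollectI)
      then have "\<xi> \<in> cball 0 1" by (rule subsetD[OF order_trans[OF closure_subset supp]])
      with 0 show False by simp
    qed
    then show ?case by (simp add: m_def)
  next
    case (Suc j)
    have "((\<lambda>t. fourier (m j) (\<xi> + t *\<^sub>R b)) has_vector_derivative 0) (at 0)"
      by (rule has_vector_derivative_locally_zero[of "norm \<xi> - 1"])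
         (use Suc outside_ball_locally[of 1 \<xi> b] b in auto)
    then show ?case using der[of j \<xi>] vector_derivative_unique_at by blast
  qed
  have "m 0 = f" by (rule ext) (simp add: m_def)
  moreover have "smooth_bump b 1 (\<lambda>j. fourier (m j))"
    unfolding smooth_bump_def bump_def using L12_cont[OF mm(3)] zero der by auto
  ultimately show ?thesis by (intro exI[of _ "\<lambda>j. fourier (m j)"]) simp
qed

lemma smooth_bump_dilate:
  assumes g: "smooth_bump b 1 g" and d: "0 < \<delta>"
  shows "smooth_bump b \<delta> (\<lambda>j q. complex_of_real (c * (1 / \<delta>) ^ j) * g j ((1 / \<delta>) *\<^sub>R q))"
  unfolding smooth_bump_def bump_def
proof (intro conjI allI impI)
  fix j
  have "continuous_on UNIV (g j)" using g by (simp add: smooth_bump_def bump_def)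
  then have "continuous_on UNIV (\<lambda>q. g j ((1 / \<delta>) *\<^sub>R q))"
    by (rule continuous_on_compose2) (auto intro: continuous_intros)
  then show "continuous_on UNIV (\<lambda>q. complex_of_real (c * (1 / \<delta>) ^ j) * g j ((1 / \<delta>) *\<^sub>R q))"
    by (rule continuous_on_mult_left)
next
  fix j and q :: 'a assume "\<delta> < norm q"
  then have "1 < norm q / \<delta>" using d by (simp add: less_divide_eq)
  also have "norm q / \<delta> = norm ((1 / \<delta>) *\<^sub>R q)" using d by simp
  finally have "1 < norm ((1 / \<delta>) *\<^sub>R q)" .
  then show "complex_of_real (c * (1 / \<delta>) ^ j) * g j ((1 / \<delta>) *\<^sub>R q) = 0"
    using g by (simp add: smooth_bump_def bump_def)
next
  fix j q
  have "((\<lambda>t. g j ((1 / \<delta>) *\<^sub>R q + t *\<^sub>R b)) has_vector_derivative g (Suc j) ((1 / \<delta>) *\<^sub>R q)) (at ((\<lambda>t. t / \<delta>) 0))"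
    using g by (simp add: smooth_bump_def)
  moreover have "((\<lambda>t. t / \<delta>) has_vector_derivative 1 / \<delta>) (at 0)"
    using d by (auto simp: has_real_derivative_iff_has_vector_derivative[symmetric] intro!: derivative_eq_intros)
  ultimately have "((\<lambda>t. g j ((1 / \<delta>) *\<^sub>R q + t *\<^sub>R b)) \<circ> (\<lambda>t. t / \<delta>) has_vector_derivative (1 / \<delta>) *\<^sub>R g (Suc j) ((1 / \<delta>) *\<^sub>R q)) (at 0)"
    using vector_diff_chain_at by blast
  then have "((\<lambda>t. g j ((1 / \<delta>) *\<^sub>R (q + t *\<^sub>R b))) has_vector_derivative (1 / \<delta>) *\<^sub>R g (Suc j) ((1 / \<delta>) *\<^sub>R q)) (at 0)"
    by (simp add: comp_def scaleR_add_right)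
  then have "((\<lambda>t. complex_of_real (c * (1 / \<delta>) ^ j) * g j ((1 / \<delta>) *\<^sub>R (q + t *\<^sub>R b))) has_vector_derivative
     complex_of_real (c * (1 / \<delta>) ^ j) * ((1 / \<delta>) *\<^sub>R g (Suc j) ((1 / \<delta>) *\<^sub>R q))) (at 0)"
    by (rule has_vector_derivative_mult_right)
  then show "((\<lambda>t. complex_of_real (c * (1 / \<delta>) ^ j) * g j ((1 / \<delta>) *\<^sub>R (q + t *\<^sub>R b))) has_vector_derivative
     complex_of_real (c * (1 / \<delta>) ^ Suc j) * g (Suc j) ((1 / \<delta>) *\<^sub>R q)) (at 0)"
    by (simp add: scaleR_conv_of_real mult_ac)
qed

subsection \<open>Nonstationary phase\<close>

text \<open>Difference quotients have integral zero by translation invariance, and dominated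
  convergence carries this over to the derivative.\<close>

lemma integral_directional_derivative_zero:
  fixes F F' :: "'a::euclidean_space \<Rightarrow> complex"
  assumes Fc: "continuous_on UNIV F" and F'm [measurable]: "F' \<in> borel_measurable borel"
    and F0: "\<And>q. r < norm q \<Longrightarrow> F q = 0" and F': "\<And>q. cmod (F' q) \<le> K" and b: "b \<in> Basis"
    and d: "\<And>q. ((\<lambda>t. F (q + t *\<^sub>R b)) has_vector_derivative F' q) (at 0)"
  shows "(\<integral>q. F' q \<partial>lborel) = 0"
proof -
  have K0: "0 \<le> K" using norm_ge_zero F' order_trans by blast
  have bF: "bump F r" using Fc F0 by (simp add: bump_def)
  have [measurable]: "F \<in> borel_measurable borel" by (rule bump_meas[OF bF])
  have Fi: "integrable lborel F" by (rule bump_L12(2)[OF bF])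
  have dt: "((\<lambda>t. F (x + t *\<^sub>R b)) has_vector_derivative F' (x + t *\<^sub>R b)) (at t)" for x t
    by (rule has_vector_derivative_shift[OF d])
  have lip: "cmod (F (x + t *\<^sub>R b) - F x) \<le> K * t" if t: "0 < t" for x t
  proof -
    have "norm ((\<lambda>s. F (x + s *\<^sub>R b)) t - (\<lambda>s. F (x + s *\<^sub>R b)) 0) \<le> (\<lambda>s. K * s) t - (\<lambda>s. K * s) 0"
    proof (rule differentiable_bound_general[where f'="\<lambda>s. F' (x + s *\<^sub>R b)" and \<phi>'="\<lambda>s. K", OF t])
      show "continuous_on {0..t} (\<lambda>s. F (x + s *\<^sub>R b))"
        using dt by (intro continuous_at_imp_continuous_on ballI has_vector_derivative_continuous) blast
      show "((\<lambda>s. K * s) has_vector_derivative K) (at s)" for s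
        by (auto intro!: derivative_eq_intros simp: has_real_derivative_iff_has_vector_derivative[symmetric])
    qed (use dt F' in \<open>auto intro!: continuous_intros\<close>)
    then show ?thesis by simp
  qed
  define h where "h n = inverse (real (Suc n))" for n
  have h0: "0 < h n" "h n \<le> 1" for n by (auto simp: h_def inverse_le_1_iff)
  have hl: "h \<longlonglongrightarrow> 0" unfolding h_def[abs_def] by (rule LIMSEQ_inverse_real_of_nat)
  define D where "D n q = (1 / h n) *\<^sub>R (F (q + h n *\<^sub>R b) - F q)" for n q
  have [measurable]: "D n \<in> borel_measurable borel" for n unfolding D_def by measurable
  have Fi2: "integrable lborel (\<lambda>q. F (q + h n *\<^sub>R b))" for n
    using integrable_lborel_affine[OF Fi, of 1 "h n *\<^sub>R b"] by (simp add: add.commute)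
  have D0: "(\<integral>q. D n q \<partial>lborel) = 0" for n
  proof -
    have "(\<integral>q. F (q + h n *\<^sub>R b) \<partial>lborel) = (\<integral>q. F q \<partial>lborel)"
      using integral_lborel_translate[of F "h n *\<^sub>R b"] by (simp add: add.commute)
    then show ?thesis unfolding D_def by (simp add: Fi Fi2)
  qed
  have "(\<lambda>n. \<integral>q. D n q \<partial>lborel) \<longlonglongrightarrow> (\<integral>q. F' q \<partial>lborel)"
  \<comment> \<open>The increments are at most 1, so all quotients vanish outside radius r +
    1.\<close>
  proof (rule integral_dominated_convergence[where w="\<lambda>q. K * indicator (cball 0 (r + 1)) q"])
    show "integrable lborel (\<lambda>q::'a. K * indicator (cball 0 (r + 1)) q)"
      by (intro integrable_mult_right integrable_real_indicator emeasure_bounded_finite) auto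
    show "AE q in lborel. (\<lambda>n. D n q) \<longlonglongrightarrow> F' q"
    proof (rule AE_I2)
      fix q
      have "((\<lambda>t. (1 / t) *\<^sub>R (F (q + t *\<^sub>R b) - F (q + 0 *\<^sub>R b))) \<longlongrightarrow> F' q) (at 0)"
        by (rule has_vector_derivative_quotient[OF d])
      moreover have "filterlim h (at 0) sequentially"
        using hl h0 by (auto simp: filterlim_at intro!: always_eventually less_imp_neq[symmetric])
      ultimately show "(\<lambda>n. D n q) \<longlonglongrightarrow> F' q"
        unfolding D_def using filterlim_compose by fastforce
    qed
    show "AE q in lborel. norm (D n q) \<le> K * indicator (cball 0 (r + 1)) q" for n
    proof (rule AE_I2)
      fix q
      show "norm (D n q) \<le> K * indicator (cball 0 (r + 1)) q"
      proof (cases "norm q \<le> r + 1")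
        case True
        then show ?thesis using lip[OF h0(1), of q n] h0[of n] by (simp add: D_def divide_le_eq)
      next
        case False
        then have "r < norm q" "r < norm (q + h n *\<^sub>R b)"
          using h0[of n] b outside_ball_locally[of r q b "h n"] by auto
        then show ?thesis using F0 K0 by (simp add: D_def)
      qed
    qed
  qed measurable
  then show ?thesis unfolding D0 using LIMSEQ_unique tendsto_const by blast
qed

section \<open>Oscillatory integrals with quadratic phase\<close>

definition osc :: "'a::euclidean_space \<Rightarrow> real \<Rightarrow> 'a \<Rightarrow> complex" where
  "osc w s q = exp (\<i> * complex_of_real (w \<bullet> q - s * (norm q)\<^sup>2))"

lemma osc_meas [measurable]: "osc w s \<in> borel_measurable borel" unfolding osc_def by measurable
lemma osc_norm: "cmod (osc w s q) = 1" by (simp add: osc_def)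
lemma osc_cont: "continuous_on UNIV (osc w s)" unfolding osc_def by (intro continuous_intros)

text \<open>For sigma = s / (w . b), this is the derivative of the phase along b divided by its
  value w . b at q = 0.\<close>

definition den :: "'a::euclidean_space \<Rightarrow> real \<Rightarrow> 'a \<Rightarrow> real" where "den b \<sigma> q = 1 - 2 * \<sigma> * (q \<bullet> b)"

text \<open>The derivative along b of osc, g j and den^(-(k+1)) multiplied together has integral
  zero. Differentiating the phase cancels one power of den, differentiating g raises j, and
  differentiating the power of den produces 2 sigma (k+1). The family I j k is thus closed under
  integration by parts.\<close>

lemma nonstationary_step:
  fixes b :: "'a::euclidean_space"
  assumes g: "smooth_bump b r g" and b: "b \<in> Basis" and r: "0 < r"
    and lam: "w \<bullet> b \<noteq> 0" and s: "8 * r * \<bar>s\<bar> \<le> \<bar>w \<bullet> b\<bar>"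
  defines "\<sigma> \<equiv> s / (w \<bullet> b)"
  defines "I \<equiv> \<lambda>j k. \<integral>q. osc w s q * (g j q * complex_of_real (inverse (den b \<sigma> q) ^ k)) \<partial>lborel"
  shows "cmod (I j k) \<le> 2 ^ k * (\<integral>q. cmod (g j q) \<partial>lborel)"
    and "\<i> * complex_of_real (w \<bullet> b) * I j k + I (Suc j) (Suc k) + complex_of_real (2 * \<sigma> * real (Suc k)) * I j (Suc (Suc k)) = 0"
proof -
  have bb: "b \<bullet> b = 1" using b by (simp add: inner_Basis)
  have \<sigma>r: "8 * r * \<bar>\<sigma>\<bar> \<le> 1" using s lam by (simp add: \<sigma>_def abs_divide divide_le_eq)
  have gb: "bump (g j) r" for j using g by (simp add: smooth_bump_def)
  have [measurable]: "g j \<in> borel_measurable borel" for j by (rule bump_meas[OF gb])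
  have [measurable]: "den b \<sigma> \<in> borel_measurable borel" unfolding den_def by measurable
  \<comment> \<open>The hypothesis on s keeps den at least 1/2 up to twice the support radius.
    Points where den could vanish stay away from the support of every \<open>g j\<close>, so the
    product is continuous and differentiable everywhere.\<close>
  have den: "1/2 \<le> den b \<sigma> q" if "norm q \<le> 2 * r" for q
  proof -
    have "\<bar>2 * \<sigma> * (q \<bullet> b)\<bar> \<le> 2 * \<bar>\<sigma>\<bar> * (2 * r)"
      unfolding abs_mult using Basis_le_norm[OF b, of q] that by (intro mult_mono) auto
    also have "\<dots> = (8 * r * \<bar>\<sigma>\<bar>) / 2" by simp
    also have "\<dots> \<le> 1/2" using \<sigma>r by (rule divide_right_mono) simp
    finally show ?thesis unfolding den_def by linarith
  qed
  have inv: "inverse (den b \<sigma> q) ^ k \<le> 2 ^ k" "0 \<le> inverse (den b \<sigma> q) ^ k" if "norm q \<le> 2 * r" for q k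
  proof -
    have "inverse (den b \<sigma> q) \<le> inverse (1/2)" "0 \<le> inverse (den b \<sigma> q)"
      using den[OF that] by (intro le_imp_inverse_le, auto)
    then show "inverse (den b \<sigma> q) ^ k \<le> 2 ^ k" "0 \<le> inverse (den b \<sigma> q) ^ k"
      using power_mono[of "inverse (den b \<sigma> q)" 2 k] by auto
  qed
  have trm: "cmod (g j q * complex_of_real (inverse (den b \<sigma> q) ^ k)) \<le> 2 ^ k * cmod (g j q)" for j k q
  proof (cases "norm q \<le> r")
    case True
    then have "norm q \<le> 2 * r" using r by simp
    from inv[OF this, of k] have "\<bar>inverse (den b \<sigma> q) ^ k\<bar> \<le> 2 ^ k" by simp
    then have "cmod (g j q) * \<bar>inverse (den b \<sigma> q) ^ k\<bar> \<le> cmod (g j q) * 2 ^ k" by (rule mult_left_mono) simp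
    then show ?thesis by (simp only: norm_mult norm_of_real mult.commute)
  next
    case False
    then show ?thesis using gb[of j] by (simp add: bump_def)
  qed
  have gi: "integrable lborel (\<lambda>q. cmod (g j q))" for j by (intro integrable_norm bump_L12(2)[OF gb])
  have int: "integrable lborel (\<lambda>q. osc w s q * (g j q * complex_of_real (inverse (den b \<sigma> q) ^ k)))" for j k
    by (rule Bochner_Integration.integrable_bound[OF integrable_mult_right[OF gi[of j], of "2 ^ k"]])
       (use trm[of j _ k] in \<open>auto simp: norm_mult osc_norm\<close>)
  have "cmod (I j k) \<le> (\<integral>q. cmod (osc w s q * (g j q * complex_of_real (inverse (den b \<sigma> q) ^ k))) \<partial>lborel)"
    unfolding I_def by (rule integral_norm_bound)
  also have "\<dots> \<le> (\<integral>q. 2 ^ k * cmod (g j q) \<partial>lborel)"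
  proof (rule integral_mono)
    show "integrable lborel (\<lambda>q. cmod (osc w s q * (g j q * complex_of_real (inverse (den b \<sigma> q) ^ k))))"
      by (intro integrable_norm int)
    show "integrable lborel (\<lambda>q. 2 ^ k * cmod (g j q))" by (intro integrable_mult_right gi)
    show "cmod (osc w s q * (g j q * complex_of_real (inverse (den b \<sigma> q) ^ k))) \<le> 2 ^ k * cmod (g j q)" for q
      using trm[of j q k] by (simp only: norm_mult osc_norm mult_1)
  qed
  finally show "cmod (I j k) \<le> 2 ^ k * (\<integral>q. cmod (g j q) \<partial>lborel)" by simp
  define F where "F q = osc w s q * (g j q * complex_of_real (inverse (den b \<sigma> q) ^ Suc k))" for q
  define F' where "F' q = \<i> * complex_of_real (w \<bullet> b) * (osc w s q * (g j q * complex_of_real (inverse (den b \<sigma> q) ^ k)))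
     + osc w s q * (g (Suc j) q * complex_of_real (inverse (den b \<sigma> q) ^ Suc k))
     + complex_of_real (2 * \<sigma> * real (Suc k)) * (osc w s q * (g j q * complex_of_real (inverse (den b \<sigma> q) ^ Suc (Suc k))))" for q
  have F0: "F q = 0" "F' q = 0" if "r < norm q" for q
    using that gb[of j] gb[of "Suc j"] by (auto simp: F_def F'_def bump_def)
  have Fder: "((\<lambda>t. F (q + t *\<^sub>R b)) has_vector_derivative F' q) (at 0)" for q
  proof (cases "norm q \<le> 2 * r")
    case False
    then have "r < norm q" using r by simp
    then have "((\<lambda>t. F (q + t *\<^sub>R b)) has_vector_derivative 0) (at 0)"
      by (intro has_vector_derivative_locally_zero[of "norm q - r"] F0 outside_ball_locally[OF _ b]) auto
    then show ?thesis using F0(2)[OF \<open>r < norm q\<close>] by simp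
  next
    case True
    from den[OF True] have dn: "den b \<sigma> q \<noteq> 0" by auto
    have qn: "(norm (q + t *\<^sub>R b))\<^sup>2 = (norm q)\<^sup>2 + 2 * t * (q \<bullet> b) + t\<^sup>2" for t
      unfolding power2_norm_eq_inner by (simp add: inner_add_left inner_add_right bb inner_commute power2_eq_square)
    have ph: "w \<bullet> (q + t *\<^sub>R b) - s * (norm (q + t *\<^sub>R b))\<^sup>2 = (w \<bullet> q - s * (norm q)\<^sup>2) + t * (w \<bullet> b - 2 * s * (q \<bullet> b)) - s * t\<^sup>2" for t
      unfolding qn by (simp add: inner_add_right algebra_simps)
    have lamden: "w \<bullet> b - 2 * s * (q \<bullet> b) = (w \<bullet> b) * den b \<sigma> q"
      using lam by (simp add: den_def \<sigma>_def field_simps)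
    have d1: "((\<lambda>t. osc w s (q + t *\<^sub>R b)) has_vector_derivative \<i> * complex_of_real ((w \<bullet> b) * den b \<sigma> q) * osc w s q) (at 0)"
    proof -
      have "((\<lambda>z. exp (\<i> * (complex_of_real (w \<bullet> q - s * (norm q)\<^sup>2) + z * complex_of_real (w \<bullet> b - 2 * s * (q \<bullet> b)) - complex_of_real s * z\<^sup>2)))
         has_field_derivative \<i> * complex_of_real (w \<bullet> b - 2 * s * (q \<bullet> b)) * osc w s q) (at (complex_of_real 0))"
        by (auto intro!: derivative_eq_intros simp: osc_def)
      from has_vector_derivative_real_field[OF this]
      show ?thesis unfolding lamden osc_def ph by simp
    qed
    have d2: "((\<lambda>t. g j (q + t *\<^sub>R b)) has_vector_derivative g (Suc j) q) (at 0)"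
      using g by (simp add: smooth_bump_def)
    have dt: "den b \<sigma> (q + t *\<^sub>R b) = den b \<sigma> q - 2 * \<sigma> * t" for t
      by (simp add: den_def inner_add_left bb algebra_simps)
    have "((\<lambda>t. inverse (den b \<sigma> (q + t *\<^sub>R b)) ^ Suc k) has_real_derivative
       real (Suc k) * (2 * \<sigma>) * inverse (den b \<sigma> q) ^ Suc (Suc k)) (at 0)"
      unfolding dt
      by (rule derivative_eq_intros refl | use dn in \<open>simp add: power2_eq_square mult_ac\<close>)+
    then have d3: "((\<lambda>t. complex_of_real (inverse (den b \<sigma> (q + t *\<^sub>R b)) ^ Suc k)) has_vector_derivative
       complex_of_real (real (Suc k) * (2 * \<sigma>) * inverse (den b \<sigma> q) ^ Suc (Suc k))) (at 0)"
      by (rule has_vector_derivative_of_real)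
    have "((\<lambda>t. F (q + t *\<^sub>R b)) has_vector_derivative
       osc w s (q + 0 *\<^sub>R b) * (g j (q + 0 *\<^sub>R b) * complex_of_real (real (Suc k) * (2 * \<sigma>) * inverse (den b \<sigma> q) ^ Suc (Suc k))
          + g (Suc j) q * complex_of_real (inverse (den b \<sigma> (q + 0 *\<^sub>R b)) ^ Suc k))
       + \<i> * complex_of_real ((w \<bullet> b) * den b \<sigma> q) * osc w s q * (g j (q + 0 *\<^sub>R b) * complex_of_real (inverse (den b \<sigma> (q + 0 *\<^sub>R b)) ^ Suc k))) (at 0)"
      unfolding F_def by (intro has_vector_derivative_mult d1 d2 d3)
    moreover have "complex_of_real (den b \<sigma> q) * complex_of_real (inverse (den b \<sigma> q) ^ Suc k) = complex_of_real (inverse (den b \<sigma> q) ^ k)"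
    proof -
      have "den b \<sigma> q * inverse (den b \<sigma> q) ^ Suc k = inverse (den b \<sigma> q) ^ k" using dn by simp
      then show ?thesis by (simp only: of_real_mult[symmetric])
    qed
    then have e: "\<i> * complex_of_real ((w \<bullet> b) * den b \<sigma> q) * osc w s q * (g j q * complex_of_real (inverse (den b \<sigma> q) ^ Suc k))
      = \<i> * complex_of_real (w \<bullet> b) * (osc w s q * (g j q * complex_of_real (inverse (den b \<sigma> q) ^ k)))"
      by (simp only: of_real_mult mult_ac)
    ultimately show ?thesis unfolding F'_def scaleR_zero_left add_0_right e
      by (simp only: of_real_mult distrib_left mult_ac add_ac)
  qed
  have Fc: "continuous_on UNIV F"
  proof -
    have "isCont F q" for q
    proof (cases "norm q < 2 * r")
      case True
      have "den b \<sigma> q \<noteq> 0" using den[of q] True by auto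
      moreover have "isCont (g j) q" "isCont (osc w s) q"
        using gb[of j] osc_cont by (auto simp: bump_def continuous_on_eq_continuous_at)
      ultimately show ?thesis unfolding F_def den_def by (intro continuous_intros) auto
    next
      case False
      have "\<forall>\<^sub>F x in nhds q. x \<in> {x. r < norm x}"
        using False r by (intro eventually_nhds_in_open open_Collect_less continuous_intros) auto
      then have "\<forall>\<^sub>F x in nhds q. F x = 0" by eventually_elim (simp add: F0)
      then show ?thesis by (subst isCont_cong[where g="\<lambda>_. 0"]) auto
    qed
    then show ?thesis by (simp add: continuous_at_imp_continuous_on)
  qed
  have F'm [measurable]: "F' \<in> borel_measurable borel" unfolding F'_def by measurable
  obtain B where B: "\<And>j q. j \<in> {j, Suc j} \<Longrightarrow> cmod (g j q) \<le> B j"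
    using bump_bounded[OF gb] by metis
  have F'b: "cmod (F' q) \<le> \<bar>w \<bullet> b\<bar> * (2 ^ k * B j) + 2 ^ Suc k * B (Suc j) + \<bar>2 * \<sigma> * real (Suc k)\<bar> * (2 ^ Suc (Suc k) * B j)" for q
  proof -
    have t: "cmod (osc w s q * (g i q * complex_of_real (inverse (den b \<sigma> q) ^ l))) \<le> 2 ^ l * B i" for i l
    proof -
      have "cmod (osc w s q * (g i q * complex_of_real (inverse (den b \<sigma> q) ^ l))) \<le> 2 ^ l * cmod (g i q)"
        using trm[of i q l] by (simp only: norm_mult osc_norm mult_1)
      also have "\<dots> \<le> 2 ^ l * B i" using B[of i q] by (intro mult_left_mono) auto
      finally show ?thesis .
    qed
    have "cmod (F' q) \<le> cmod (\<i> * complex_of_real (w \<bullet> b) * (osc w s q * (g j q * complex_of_real (inverse (den b \<sigma> q) ^ k))))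
      + cmod (osc w s q * (g (Suc j) q * complex_of_real (inverse (den b \<sigma> q) ^ Suc k)))
      + cmod (complex_of_real (2 * \<sigma> * real (Suc k)) * (osc w s q * (g j q * complex_of_real (inverse (den b \<sigma> q) ^ Suc (Suc k)))))"
      unfolding F'_def by (intro norm_triangle_le add_mono order_refl norm_triangle_ineq)
    also have "\<dots> = \<bar>w \<bullet> b\<bar> * cmod (osc w s q * (g j q * complex_of_real (inverse (den b \<sigma> q) ^ k)))
      + cmod (osc w s q * (g (Suc j) q * complex_of_real (inverse (den b \<sigma> q) ^ Suc k)))
      + \<bar>2 * \<sigma> * real (Suc k)\<bar> * cmod (osc w s q * (g j q * complex_of_real (inverse (den b \<sigma> q) ^ Suc (Suc k))))"
      by (simp only: norm_mult[of "\<i> * complex_of_real (w \<bullet> b)"] norm_mult[of "complex_of_real (2 * \<sigma> * real (Suc k))"] norm_mult[of \<i>] norm_ii norm_of_real mult_1)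
    also have "\<dots> \<le> \<bar>w \<bullet> b\<bar> * (2 ^ k * B j) + 2 ^ Suc k * B (Suc j) + \<bar>2 * \<sigma> * real (Suc k)\<bar> * (2 ^ Suc (Suc k) * B j)"
      by (intro add_mono mult_left_mono t abs_ge_zero)
    finally show ?thesis .
  qed
  have "(\<integral>q. F' q \<partial>lborel) = 0"
    by (rule integral_directional_derivative_zero[OF Fc F'm F0(1) F'b b Fder])
  moreover have "(\<integral>q. F' q \<partial>lborel) = \<i> * complex_of_real (w \<bullet> b) * I j k + I (Suc j) (Suc k) + complex_of_real (2 * \<sigma> * real (Suc k)) * I j (Suc (Suc k))"
    unfolding F'_def I_def
    by (subst Bochner_Integration.integral_add, (intro Bochner_Integration.integrable_add integrable_mult_right int)+)
       (subst Bochner_Integration.integral_add, (intro integrable_mult_right int)+, simp only: Bochner_Integration.integral_mult_right_zero)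
  ultimately show "\<i> * complex_of_real (w \<bullet> b) * I j k + I (Suc j) (Suc k) + complex_of_real (2 * \<sigma> * real (Suc k)) * I j (Suc (Suc k)) = 0"
    by simp
qed

text \<open>Induction on N with j and k arbitrary, since each gain of a factor 1 / |w . b| raises j
  or k.\<close>

lemma nonstationary_direction:
  fixes b :: "'a::euclidean_space"
  assumes g: "smooth_bump b r g" and b: "b \<in> Basis" and r: "0 < r"
  shows "\<exists>C\<ge>0. \<forall>w s. w \<bullet> b \<noteq> 0 \<and> 8 * r * \<bar>s\<bar> \<le> \<bar>w \<bullet> b\<bar> \<longrightarrow>
     cmod (\<integral>q. osc w s q * (g j q * complex_of_real (inverse (den b (s / (w \<bullet> b)) q) ^ k)) \<partial>lborel) \<le> C / \<bar>w \<bullet> b\<bar> ^ N"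
proof (induction N arbitrary: j k)
  case 0
  show ?case
    by (intro exI[of _ "2 ^ k * (\<integral>q. cmod (g j q) \<partial>lborel)"])
       (use nonstationary_step(1)[OF g b r] in auto)
next
  case (Suc N)
  let ?I = "\<lambda>w s j k. \<integral>q. osc w s q * (g j q * complex_of_real (inverse (den b (s / (w \<bullet> b)) q) ^ k)) \<partial>lborel"
  obtain C1 where C1: "C1 \<ge> 0" "\<And>w s. w \<bullet> b \<noteq> 0 \<Longrightarrow> 8 * r * \<bar>s\<bar> \<le> \<bar>w \<bullet> b\<bar> \<Longrightarrow> cmod (?I w s (Suc j) (Suc k)) \<le> C1 / \<bar>w \<bullet> b\<bar> ^ N"
    using Suc.IH[of "Suc j" "Suc k"] by blast
  obtain C2 where C2: "C2 \<ge> 0" "\<And>w s. w \<bullet> b \<noteq> 0 \<Longrightarrow> 8 * r * \<bar>s\<bar> \<le> \<bar>w \<bullet> b\<bar> \<Longrightarrow> cmod (?I w s j (Suc (Suc k))) \<le> C2 / \<bar>w \<bullet> b\<bar> ^ N"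
    using Suc.IH[of j "Suc (Suc k)"] by blast
  \<comment> \<open>The weight of \<open>C2\<close> bounds |2 sigma| (k+1): in the admissible range
    |2 sigma| is at most 1 / (4 r).\<close>
  define C where "C = C1 + real (Suc k) / (4 * r) * C2"
  show ?case
  proof (intro exI[of _ C] conjI allI impI)
    show "0 \<le> C" using C1 C2 r by (simp add: C_def)
    fix w s assume a: "w \<bullet> b \<noteq> 0 \<and> 8 * r * \<bar>s\<bar> \<le> \<bar>w \<bullet> b\<bar>"
    define \<sigma> where "\<sigma> = s / (w \<bullet> b)"
    define L where "L = \<bar>w \<bullet> b\<bar>"
    have L: "0 < L" using a by (simp add: L_def)
    have \<sigma>: "\<bar>2 * \<sigma>\<bar> \<le> 1 / (4 * r)" using a r L by (simp add: \<sigma>_def abs_mult abs_divide field_simps)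
    have "\<i> * complex_of_real (w \<bullet> b) * ?I w s j k = - (?I w s (Suc j) (Suc k) + complex_of_real (2 * \<sigma> * real (Suc k)) * ?I w s j (Suc (Suc k)))"
    proof -
      have abs: "X + Y + Z = 0 \<Longrightarrow> X = - (Y + Z)" for X Y Z :: complex by (simp only: eq_neg_iff_add_eq_0 add.assoc)
      show ?thesis unfolding \<sigma>_def by (rule abs, rule nonstationary_step(2)[OF g b r]) (use a in auto)
    qed
    then have "cmod (\<i> * complex_of_real (w \<bullet> b) * ?I w s j k) \<le> cmod (?I w s (Suc j) (Suc k)) + cmod (complex_of_real (2 * \<sigma> * real (Suc k)) * ?I w s j (Suc (Suc k)))"
      by (simp only: norm_minus_cancel norm_triangle_ineq)
    then have "L * cmod (?I w s j k) \<le> cmod (?I w s (Suc j) (Suc k)) + \<bar>2 * \<sigma>\<bar> * real (Suc k) * cmod (?I w s j (Suc (Suc k)))"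
      by (simp only: norm_mult norm_ii norm_of_real mult_1 abs_mult abs_of_nat L_def)
    also have "\<dots> \<le> C1 / L ^ N + 1 / (4 * r) * real (Suc k) * (C2 / L ^ N)"
      unfolding L_def using a r C2 by (intro add_mono mult_mono C1 C2 \<sigma> mult_nonneg_nonneg) auto
    also have "\<dots> = C / L ^ N" using L r by (simp add: C_def field_simps)
    finally have "cmod (?I w s j k) \<le> C / L ^ N / L" using L by (simp only: pos_le_divide_eq mult.commute[of _ L])
    also have "C / L ^ N / L = C / L ^ Suc N" by (simp add: mult.commute)
    finally show "cmod (?I w s j k) \<le> C / \<bar>w \<bullet> b\<bar> ^ Suc N" unfolding L_def .
  qed
qed

text \<open>Some coordinate of w has size at least norm w / DIM. Integrating by parts along it costs
  a factor DIM in the condition on s and DIM^N in the constant.\<close>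

lemma nonstationary_phase:
  fixes G :: "'a::euclidean_space \<Rightarrow> complex"
  assumes g: "\<And>b. b \<in> Basis \<Longrightarrow> \<exists>g. smooth_bump b r g \<and> g 0 = G" and r: "0 < r"
  shows "\<exists>C\<ge>0. \<forall>w s. w \<noteq> 0 \<and> 8 * r * real DIM('a) * \<bar>s\<bar> \<le> norm w \<longrightarrow>
     cmod (\<integral>q. osc w s q * G q \<partial>lborel) \<le> C / norm w ^ N"
proof -
  have "\<exists>C\<ge>0. \<forall>w s. w \<bullet> b \<noteq> 0 \<and> 8 * r * \<bar>s\<bar> \<le> \<bar>w \<bullet> b\<bar> \<longrightarrow> cmod (\<integral>q. osc w s q * G q \<partial>lborel) \<le> C / \<bar>w \<bullet> b\<bar> ^ N"
    if b: "b \<in> Basis" for b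
  proof -
    obtain g where "smooth_bump b r g" "g 0 = G" using g[OF b] by blast
    then show ?thesis using nonstationary_direction[of b r g 0 0 N] b r by simp
  qed
  then have "\<forall>b\<in>Basis. \<exists>C. 0 \<le> C \<and> (\<forall>w s. w \<bullet> b \<noteq> 0 \<and> 8 * r * \<bar>s\<bar> \<le> \<bar>w \<bullet> b\<bar> \<longrightarrow> cmod (\<integral>q. osc w s q * G q \<partial>lborel) \<le> C / \<bar>w \<bullet> b\<bar> ^ N)"
    by blast
  from bchoice[OF this] obtain C where "\<forall>b\<in>Basis. 0 \<le> C b \<and> (\<forall>w s. w \<bullet> b \<noteq> 0 \<and> 8 * r * \<bar>s\<bar> \<le> \<bar>w \<bullet> b\<bar> \<longrightarrow> cmod (\<integral>q. osc w s q * G q \<partial>lborel) \<le> C b / \<bar>w \<bullet> b\<bar> ^ N)"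
    by blast
  then have C: "\<And>b. b \<in> Basis \<Longrightarrow> 0 \<le> C b"
    "\<And>b w s. b \<in> Basis \<Longrightarrow> w \<bullet> b \<noteq> 0 \<Longrightarrow> 8 * r * \<bar>s\<bar> \<le> \<bar>w \<bullet> b\<bar> \<Longrightarrow> cmod (\<integral>q. osc w s q * G q \<partial>lborel) \<le> C b / \<bar>w \<bullet> b\<bar> ^ N"
    by blast+
  define D where "D = real DIM('a)"
  have D: "0 < D" by (simp add: D_def)
  define C' where "C' = (\<Sum>b\<in>Basis. C b) * D ^ N"
  show ?thesis
  proof (intro exI[of _ C'] conjI allI impI)
    show "0 \<le> C'" using C(1) D by (simp add: C'_def sum_nonneg)
    fix w :: 'a and s assume a: "w \<noteq> 0 \<and> 8 * r * real DIM('a) * \<bar>s\<bar> \<le> norm w"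
    then have w: "0 < norm w" by simp
    have "\<exists>b\<in>Basis. norm w / D \<le> \<bar>w \<bullet> b\<bar>"
    proof (rule ccontr)
      assume "\<not> (\<exists>b\<in>Basis. norm w / D \<le> \<bar>w \<bullet> b\<bar>)"
      then have "(\<Sum>b\<in>Basis. \<bar>w \<bullet> b\<bar>) < (\<Sum>b\<in>(Basis::'a set). norm w / D)" by (intro sum_strict_mono) auto
      also have "\<dots> = norm w" using D by (simp add: D_def)
      finally show False using norm_le_l1[of w] by simp
    qed
    then obtain b where b: "b \<in> Basis" "norm w / D \<le> \<bar>w \<bullet> b\<bar>" by blast
    have pos: "0 < norm w / D" using w D by simp
    have "8 * r * \<bar>s\<bar> \<le> norm w / D" using a D by (simp add: D_def field_simps)
    then have "cmod (\<integral>q. osc w s q * G q \<partial>lborel) \<le> C b / \<bar>w \<bullet> b\<bar> ^ N"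
      using b pos by (intro C(2)) auto
    also have "\<dots> \<le> C b / (norm w / D) ^ N"
      using C(1)[OF b(1)] b pos by (intro divide_left_mono power_mono mult_pos_pos zero_less_power) auto
    also have "\<dots> = C b * D ^ N / norm w ^ N" by (simp add: power_divide)
    also have "\<dots> \<le> C' / norm w ^ N"
      unfolding C'_def using C(1) b D by (intro divide_right_mono mult_right_mono member_le_sum) auto
    finally show "cmod (\<integral>q. osc w s q * G q \<partial>lborel) \<le> C' / norm w ^ N" .
  qed
qed

subsection \<open>Tensor products\<close>

lemma cD_prod: "cD TYPE('a::euclidean_space \<times> 'b::euclidean_space) = cD TYPE('a) * cD TYPE('b)"
  unfolding cD_def by (simp add: powr_add[symmetric] add_divide_distrib diff_divide_distrib)

lemma integral_tensor:
  fixes f :: "'a::euclidean_space \<Rightarrow> complex" and g :: "'b::euclidean_space \<Rightarrow> complex"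
  assumes f: "integrable lborel f" and g: "integrable lborel g"
  shows "(\<integral>x. f (fst x) * g (snd x) \<partial>lborel) = (\<integral>x. f x \<partial>lborel) * (\<integral>x. g x \<partial>lborel)"
proof -
  have i: "integrable (lborel \<Otimes>\<^sub>M lborel) (\<lambda>x. f (fst x) * g (snd x))"
    using integrable_pair_mult[OF f g] by (simp add: case_prod_unfold)
  have "(\<integral>x. f (fst x) * g (snd x) \<partial>lborel) = (\<integral>x. f (fst x) * g (snd x) \<partial>(lborel \<Otimes>\<^sub>M lborel))"
    by (simp add: lborel_prod)
  also have "\<dots> = (\<integral>x. (\<integral>y. f x * g y \<partial>lborel) \<partial>lborel)"
    using lborel_pair.integral_fst'[OF i] by simp
  also have "\<dots> = (\<integral>x. f x \<partial>lborel) * (\<integral>x. g x \<partial>lborel)" by simp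
  finally show ?thesis .
qed

lemma borel_measurable_fst_comp: "f \<in> borel_measurable borel \<Longrightarrow> (\<lambda>x::'a::euclidean_space \<times> 'b::euclidean_space. f (fst x)) \<in> borel_measurable borel"
  by (rule measurable_compose[where N=borel]) (intro borel_measurable_continuous_onI continuous_intros)

lemma borel_measurable_snd_comp: "f \<in> borel_measurable borel \<Longrightarrow> (\<lambda>x::'a::euclidean_space \<times> 'b::euclidean_space. f (snd x)) \<in> borel_measurable borel"
  by (rule measurable_compose[where N=borel]) (intro borel_measurable_continuous_onI continuous_intros)

lemma tensor_meas:
  fixes f :: "'a::euclidean_space \<Rightarrow> complex" and g :: "'b::euclidean_space \<Rightarrow> complex"
  shows "f \<in> borel_measurable borel \<Longrightarrow> g \<in> borel_measurable borel \<Longrightarrow> tensor f g \<in> borel_measurable borel"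
  unfolding tensor_def[abs_def] by (intro borel_measurable_times borel_measurable_fst_comp borel_measurable_snd_comp)

lemma integrable_tensor:
  fixes f :: "'a::euclidean_space \<Rightarrow> complex" and g :: "'b::euclidean_space \<Rightarrow> complex"
  assumes f: "integrable lborel f" and g: "integrable lborel g"
  shows "integrable lborel (tensor f g)"
  using integrable_pair_mult[OF f g] by (simp add: lborel_prod tensor_def[abs_def] case_prod_unfold)

lemma fourier_tensor:
  fixes f :: "'a::euclidean_space \<Rightarrow> complex" and g :: "'b::euclidean_space \<Rightarrow> complex"
  assumes f: "integrable lborel f" and g: "integrable lborel g"
  shows "fourier (tensor f g) = tensor (fourier f) (fourier g)"
proof
  fix \<xi>
  have m: "f \<in> borel_measurable borel" "g \<in> borel_measurable borel" using f g by simp_all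
  have e: "exp (- \<i> * complex_of_real (x \<bullet> \<xi>)) * tensor f g x
    = (exp (- \<i> * complex_of_real (fst x \<bullet> fst \<xi>)) * f (fst x)) * (exp (- \<i> * complex_of_real (snd x \<bullet> snd \<xi>)) * g (snd x))" for x
    by (simp add: tensor_def inner_prod_def distrib_left exp_add[symmetric] exp_add mult_ac)
  have "(\<integral>x. exp (- \<i> * complex_of_real (x \<bullet> \<xi>)) * tensor f g x \<partial>lborel)
    = (\<integral>x. exp (- \<i> * complex_of_real (x \<bullet> fst \<xi>)) * f x \<partial>lborel) * (\<integral>x. exp (- \<i> * complex_of_real (x \<bullet> snd \<xi>)) * g x \<partial>lborel)"
    unfolding e by (rule integral_tensor[OF fourier_integrand_integrable[OF f] fourier_integrand_integrable[OF g]])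
  then show "fourier (tensor f g) \<xi> = tensor (fourier f) (fourier g) \<xi>"
    unfolding fourier_borel[OF tensor_meas[OF m]] tensor_def[of "fourier f"] fourier_borel[OF m(1)] fourier_borel[OF m(2)] cD_prod
    by simp
qed

lemma tensor_cnj: "(\<lambda>x. cnj (tensor f g x)) = tensor (\<lambda>x. cnj (f x)) (\<lambda>x. cnj (g x))"
  by (rule ext) (simp add: tensor_def)

lemma ifourier_tensor:
  fixes f :: "'a::euclidean_space \<Rightarrow> complex" and g :: "'b::euclidean_space \<Rightarrow> complex"
  assumes f: "integrable lborel f" and g: "integrable lborel g"
  shows "ifourier (tensor f g) = tensor (ifourier f) (ifourier g)"
  unfolding ifourier_eq tensor_cnj using f g
  by (subst fourier_tensor) (simp_all add: tensor_def[abs_def])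

lemma bump_tensor:
  fixes f :: "'a::euclidean_space \<Rightarrow> complex" and g :: "'b::euclidean_space \<Rightarrow> complex"
  assumes "bump f r" "bump g r'" shows "bump (tensor f g) (r + r')"
  unfolding bump_def
proof (intro conjI allI impI)
  have "continuous_on UNIV (\<lambda>x::'a \<times> 'b. f (fst x))"
    by (rule continuous_on_compose2[of UNIV f]) (use assms in \<open>auto simp: bump_def intro: continuous_intros\<close>)
  moreover have "continuous_on UNIV (\<lambda>x::'a \<times> 'b. g (snd x))"
    by (rule continuous_on_compose2[of UNIV g]) (use assms in \<open>auto simp: bump_def intro: continuous_intros\<close>)
  ultimately show "continuous_on UNIV (tensor f g)" unfolding tensor_def[abs_def] by (rule continuous_on_mult)
  fix \<xi> :: "'a \<times> 'b" assume "r + r' < norm \<xi>"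
  moreover have "norm \<xi> \<le> norm (fst \<xi>) + norm (snd \<xi>)" using norm_Pair_le[of "fst \<xi>" "snd \<xi>"] by simp
  ultimately have "r < norm (fst \<xi>) \<or> r' < norm (snd \<xi>)" by linarith
  then show "tensor f g \<xi> = 0" using assms by (auto simp: tensor_def bump_def)
qed

subsection \<open>Freely evolved coherent states\<close>

text \<open>Momentum-space wave function, at time s, of the coherent state at (x, p) whose window
  has transform G; \<open>Est\<close> is the same state in position space.\<close>

definition Hst :: "('a::euclidean_space \<Rightarrow> complex) \<Rightarrow> real \<Rightarrow> 'a \<Rightarrow> 'a \<Rightarrow> 'a \<Rightarrow> complex" where
  "Hst G s x p \<xi> = exp (- \<i> * complex_of_real (s * (norm \<xi>)\<^sup>2)) * (exp (- \<i> * complex_of_real (x \<bullet> \<xi>)) * G (\<xi> - p))"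

definition Est :: "('a::euclidean_space \<Rightarrow> complex) \<Rightarrow> real \<Rightarrow> 'a \<Rightarrow> 'a \<Rightarrow> 'a \<Rightarrow> complex" where
  "Est G s x p = ifourier (Hst G s x p)"

lemma Hst_bump: "bump G r \<Longrightarrow> \<exists>r'. bump (Hst G s x p) r'"
  using Bev_cs_bump(1)[of G r] unfolding Hst_def[abs_def] .

lemma Est_Bev: "bump G r \<Longrightarrow> Bev s (L2 (cs (ifourier G) (x, p))) = L2 (Est G s x p)"
  using Bev_cs_bump(3)[of G r] unfolding Est_def Hst_def[abs_def] .

lemma Est_sq: "bump G r \<Longrightarrow> sq_int (Est G s x p)"
  unfolding Est_def using Hst_bump bump_L12(1) ifourier_sq_int by blast

lemma Est_meas: "bump G r \<Longrightarrow> Est G s x p \<in> borel_measurable borel"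
proof -
  assume "bump G r"
  then obtain r' where "bump (Hst G s x p) r'" using Hst_bump by blast
  then obtain K where "window (ifourier (Hst G s x p)) K" using bump_window by blast
  then show ?thesis unfolding Est_def by (rule window.u_meas)
qed

text \<open>Kinetic energy is additive over parallel and perpendicular momenta, so the evolved state
  remains a product.\<close>

lemma Hst_tensor: "Hst (tensor F G) s x p = tensor (Hst F s (fst x) (fst p)) (Hst G s (snd x) (snd p))"
proof
  fix \<xi> :: "'a \<times> 'b"
  have n: "(norm \<xi>)\<^sup>2 = (norm (fst \<xi>))\<^sup>2 + (norm (snd \<xi>))\<^sup>2"
    by (simp add: power2_norm_eq_inner inner_prod_def)
  show "Hst (tensor F G) s x p \<xi> = tensor (Hst F s (fst x) (fst p)) (Hst G s (snd x) (snd p)) \<xi>"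
  proof -
    have e1: "- \<i> * complex_of_real (s * ((norm (fst \<xi>))\<^sup>2 + (norm (snd \<xi>))\<^sup>2))
      = - \<i> * complex_of_real (s * (norm (fst \<xi>))\<^sup>2) + - \<i> * complex_of_real (s * (norm (snd \<xi>))\<^sup>2)"
      by (simp add: algebra_simps)
    have e2: "- \<i> * complex_of_real (x \<bullet> \<xi>) = - \<i> * complex_of_real (fst x \<bullet> fst \<xi>) + - \<i> * complex_of_real (snd x \<bullet> snd \<xi>)"
      by (simp add: inner_prod_def algebra_simps)
    show ?thesis unfolding Hst_def tensor_def n e1 e2 exp_add by (simp only: mult_ac fst_diff snd_diff)
  qed
qed

lemma Est_tensor:
  assumes F: "bump F r" and G: "bump G r'"
  shows "Est (tensor F G) s x p = tensor (Est F s (fst x) (fst p)) (Est G s (snd x) (snd p))"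
proof -
  obtain r1 r2 where b: "bump (Hst F s (fst x) (fst p)) r1" "bump (Hst G s (snd x) (snd p)) r2"
    using Hst_bump[OF F] Hst_bump[OF G] by blast
  show ?thesis unfolding Est_def Hst_tensor by (rule ifourier_tensor[OF bump_L12(2)[OF b(1)] bump_L12(2)[OF b(2)]])
qed

text \<open>Shifting the momentum variable by p moves the classical displacement 2 s p into the
  linear part of the phase; what else depends on p is a unimodular constant.\<close>

lemma Est_osc:
  fixes G :: "'a::euclidean_space \<Rightarrow> complex"
  assumes G: "bump G r"
  shows "cmod (Est G s x p y) = cD TYPE('a) * cmod (\<integral>q. osc (y - x - (2 * s) *\<^sub>R p) s q * G q \<partial>lborel)"
proof -
  have [measurable]: "G \<in> borel_measurable borel" by (rule bump_meas[OF G])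
  have [measurable]: "Hst G s x p \<in> borel_measurable borel" unfolding Hst_def[abs_def] by measurable
  have "(\<integral>\<xi>. exp (\<i> * complex_of_real (y \<bullet> \<xi>)) * Hst G s x p \<xi> \<partial>lborel)
    = (\<integral>\<xi>. exp (\<i> * complex_of_real (y \<bullet> (p + \<xi>))) * Hst G s x p (p + \<xi>) \<partial>lborel)"
    by (rule integral_lborel_translate[symmetric, of "\<lambda>\<xi>. exp (\<i> * complex_of_real (y \<bullet> \<xi>)) * Hst G s x p \<xi>"]) measurable
  also have "\<dots> = (\<integral>q. exp (\<i> * complex_of_real ((y - x) \<bullet> p - s * (norm p)\<^sup>2)) * (osc (y - x - (2 * s) *\<^sub>R p) s q * G q) \<partial>lborel)"
  proof (intro Bochner_Integration.integral_cong refl)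
    fix q
    have n: "(norm (p + q))\<^sup>2 = (norm p)\<^sup>2 + 2 * (p \<bullet> q) + (norm q)\<^sup>2"
      unfolding power2_norm_eq_inner by (simp add: inner_add_left inner_add_right inner_commute)
    have "\<i> * complex_of_real (y \<bullet> (p + q)) + - \<i> * complex_of_real (s * (norm (p + q))\<^sup>2) + - \<i> * complex_of_real (x \<bullet> (p + q))
      = \<i> * complex_of_real (y \<bullet> (p + q) - s * (norm (p + q))\<^sup>2 - x \<bullet> (p + q))"
      by (simp add: algebra_simps)
    also have "y \<bullet> (p + q) - s * (norm (p + q))\<^sup>2 - x \<bullet> (p + q)
      = ((y - x) \<bullet> p - s * (norm p)\<^sup>2) + ((y - x - (2 * s) *\<^sub>R p) \<bullet> q - s * (norm q)\<^sup>2)"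
      unfolding n by (simp add: inner_add_right inner_diff_left algebra_simps)
    finally have "exp (\<i> * complex_of_real (y \<bullet> (p + q))) * exp (- \<i> * complex_of_real (s * (norm (p + q))\<^sup>2)) * exp (- \<i> * complex_of_real (x \<bullet> (p + q)))
      = exp (\<i> * complex_of_real ((y - x) \<bullet> p - s * (norm p)\<^sup>2)) * osc (y - x - (2 * s) *\<^sub>R p) s q"
      unfolding osc_def exp_add[symmetric] by (simp only: of_real_add distrib_left)
    then show "exp (\<i> * complex_of_real (y \<bullet> (p + q))) * Hst G s x p (p + q)
      = exp (\<i> * complex_of_real ((y - x) \<bullet> p - s * (norm p)\<^sup>2)) * (osc (y - x - (2 * s) *\<^sub>R p) s q * G q)"
      unfolding Hst_def by (simp only: mult.assoc[symmetric] add_diff_cancel_left')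
  qed
  also have "\<dots> = exp (\<i> * complex_of_real ((y - x) \<bullet> p - s * (norm p)\<^sup>2)) * (\<integral>q. osc (y - x - (2 * s) *\<^sub>R p) s q * G q \<partial>lborel)"
    by (rule Bochner_Integration.integral_mult_right_zero)
  finally have "cmod (\<integral>\<xi>. exp (\<i> * complex_of_real (y \<bullet> \<xi>)) * Hst G s x p \<xi> \<partial>lborel) = cmod (\<integral>q. osc (y - x - (2 * s) *\<^sub>R p) s q * G q \<partial>lborel)"
    by (simp only: norm_mult norm_exp_i_times mult_1)
  moreover have "Est G s x p y = complex_of_real (cD TYPE('a)) * (\<integral>\<xi>. exp (\<i> * complex_of_real (y \<bullet> \<xi>)) * Hst G s x p \<xi> \<partial>lborel)"
    unfolding Est_def ifourier_def cD_def by (subst integral_completion) measurable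
  ultimately show ?thesis using cD_pos[where 'a='a] by (simp only: norm_mult norm_of_real abs_of_pos)
qed

text \<open>For s (x . p) >= 0 the two terms of x + 2 s p do not cancel: with a = |x| + 2 |s| |p|,
  the squared norm of the sum is at least a^2 / 2.\<close>

lemma outgoing_distance:
  fixes x p y :: "'a::real_inner"
  assumes y: "norm y \<le> R" and x: "5 * R \<le> norm x" and xp: "0 \<le> s * (x \<bullet> p)"
  shows "(norm x + 2 * \<bar>s\<bar> * norm p) / 2 \<le> norm (y - x - (2 * s) *\<^sub>R p)"
proof -
  define a where "a = norm x + 2 * \<bar>s\<bar> * norm p"
  have R: "0 \<le> R" using y norm_ge_zero order_trans by blast
  have a: "5 * R \<le> a" "0 \<le> a" using x by (auto simp: a_def add_nonneg_nonneg intro: add_increasing2)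
  \<comment> \<open>The constant 5 is chosen here: R <= a / 5 gives (a / 2 + R)^2 <= 0.49 a^2, just
    below a^2 / 2, so a loss of |y| <= R still leaves a / 2.\<close>
  have "(a / 2 + R)\<^sup>2 \<le> (a / 2 + a / 5)\<^sup>2" using a R by (intro power_mono) auto
  also have "\<dots> \<le> a\<^sup>2 / 2" by (simp add: power2_eq_square field_simps)
  also have "a\<^sup>2 / 2 \<le> (norm x)\<^sup>2 + (2 * \<bar>s\<bar> * norm p)\<^sup>2"
    using zero_le_power2[of "norm x - 2 * \<bar>s\<bar> * norm p"] unfolding a_def power2_sum power2_diff by simp
  also have "\<dots> \<le> (norm (x + (2 * s) *\<^sub>R p))\<^sup>2"
  proof -
    have "(norm (x + (2 * s) *\<^sub>R p))\<^sup>2 = (norm x)\<^sup>2 + 4 * (s * (x \<bullet> p)) + 4 * s\<^sup>2 * (norm p)\<^sup>2"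
      unfolding power2_norm_eq_inner by (simp add: inner_add_left inner_add_right inner_commute power2_eq_square)
    moreover have "(2 * \<bar>s\<bar> * norm p)\<^sup>2 = 4 * s\<^sup>2 * (norm p)\<^sup>2" by (simp add: power_mult_distrib)
    ultimately show ?thesis using xp by simp
  qed
  finally have "a / 2 + R \<le> norm (x + (2 * s) *\<^sub>R p)" by (rule power2_le_imp_le) simp
  also have "\<dots> \<le> norm (y - x - (2 * s) *\<^sub>R p) + norm y"
    using norm_triangle_ineq4[of y "y - x - (2 * s) *\<^sub>R p"] by (simp add: algebra_simps)
  finally show ?thesis using y unfolding a_def by linarith
qed

definition wt :: "'a::euclidean_space \<Rightarrow> real" where "wt x = inverse ((1 + norm x) ^ (2 * DIM('a)))"

lemma wt_meas [measurable]: "wt \<in> borel_measurable borel" unfolding wt_def by measurable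
lemma wt_nonneg: "0 \<le> wt x" by (simp add: wt_def)
lemma wt_integrable: "integrable lborel (wt :: 'a::euclidean_space \<Rightarrow> real)"
  unfolding wt_def[abs_def] by (rule integrable_weight)

text \<open>Away from 0, norm x is comparable to 1 + norm x; half of the exponent is then given up
  to land on \<open>wt\<close>.\<close>

lemma inverse_power_le_wt:
  fixes x :: "'a::euclidean_space"
  assumes x: "c < norm x" and c: "0 < c"
  shows "inverse (norm x ^ (4 * DIM('a))) \<le> ((1 + c) / c) ^ (4 * DIM('a)) * wt x"
proof -
  have p: "0 < norm x" using x c by linarith
  have "(1 + norm x) * c \<le> norm x * (1 + c)" using x by (simp add: algebra_simps)
  then have "(1 + norm x) \<le> norm x * ((1 + c) / c)" using c by (simp add: field_simps)
  then have "(1 + norm x) ^ (4 * DIM('a)) \<le> (norm x * ((1 + c) / c)) ^ (4 * DIM('a))" by (intro power_mono) auto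
  moreover have "(1 + norm x) ^ (2 * DIM('a)) \<le> (1 + norm x) ^ (4 * DIM('a))" by (intro power_increasing) auto
  ultimately have le: "(1 + norm x) ^ (2 * DIM('a)) \<le> norm x ^ (4 * DIM('a)) * ((1 + c) / c) ^ (4 * DIM('a))"
    by (simp only: power_mult_distrib)
  have q: "0 < norm x ^ (4 * DIM('a))" "0 < (1 + norm x) ^ (2 * DIM('a))"
    using p by (auto intro!: zero_less_power add_pos_nonneg)
  have "inverse B \<le> K * inverse A" if "A \<le> B * K" "0 < A" "0 < B" for A B K :: real
    using that by (simp add: field_simps)
  from this[OF le q(2,1)] show ?thesis unfolding wt_def .
qed

text \<open>The exponent 4 * DIM leaves, after splitting the decay between position, momentum and time,
  integrable weights in x and p and the factor s^(-2 DIM) for the norm.\<close>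

lemma Est_outgoing_bound:
  fixes G :: "'b::euclidean_space \<Rightarrow> complex"
  assumes sm: "\<And>b. b \<in> Basis \<Longrightarrow> \<exists>g. smooth_bump b r g \<and> g 0 = G" and r: "0 < r"
    and m: "8 * r * real DIM('b) \<le> m" and m0: "0 < m" and R: "0 \<le> R"
  shows "\<exists>C\<ge>0. \<forall>s x p y. s \<noteq> 0 \<and> norm y \<le> R \<and> max 1 (5 * R) < norm x \<and> m < norm p \<and> 0 \<le> s * (x \<bullet> p)
     \<longrightarrow> (cmod (Est G s x p y))\<^sup>2 \<le> C * inverse (\<bar>s\<bar> ^ (4 * DIM('b))) * wt x * wt p"
proof -
  define N where "N = 4 * DIM('b)"
  obtain b :: 'b where b: "b \<in> Basis" using nonempty_Basis by blast
  obtain g where "smooth_bump b r g" "g 0 = G" using sm[OF b] by blast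
  then have G: "bump G r" by (auto simp: smooth_bump_def)
  obtain C where C: "0 \<le> C" "\<And>w s. w \<noteq> 0 \<Longrightarrow> 8 * r * real DIM('b) * \<bar>s\<bar> \<le> norm w \<Longrightarrow>
     cmod (\<integral>q. osc w s q * G q \<partial>lborel) \<le> C / norm w ^ N"
    using nonstationary_phase[OF sm r, of N] by blast
  \<comment> \<open>Origin of the factors: the square contains 2^N because norm w is only bounded by
    d / 2 from below; the other 2^N compares norm x > 1 with 1 + norm x, and ((1 + m) / m)^N does
    the same for norm p > m.\<close>
  define C' where "C' = (cD TYPE('b) * C * 2 ^ N)\<^sup>2 * 2 ^ N * ((1 + m) / m) ^ N"
  show ?thesis
  proof (intro exI[of _ C'] conjI allI impI)
    show "0 \<le> C'" using m0 by (simp add: C'_def)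
    fix s :: real and x p y :: 'b assume a: "s \<noteq> 0 \<and> norm y \<le> R \<and> max 1 (5 * R) < norm x \<and> m < norm p \<and> 0 \<le> s * (x \<bullet> (p :: 'b))"
    define w where "w = y - x - (2 * s) *\<^sub>R p"
    define d where "d = norm x + 2 * \<bar>s\<bar> * norm p"
    have s: "0 < \<bar>s\<bar>" using a by simp
    have px: "0 < norm x" "1 < norm x" and pp: "0 < norm p" using a m0 by auto
    have wd: "d / 2 \<le> norm w" unfolding d_def w_def using a by (intro outgoing_distance) auto
    have d0: "0 < d" unfolding d_def using px by (simp add: add_pos_nonneg)
    have w0: "w \<noteq> 0" using wd d0 by auto
    \<comment> \<open>Momentum above \<open>m\<close> turns the smallness of r into the
      admissibility condition of \<open>nonstationary_phase\<close>, since norm w >= d / 2 >= |s|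
      |p|.\<close>
    have "8 * r * real DIM('b) * \<bar>s\<bar> \<le> m * \<bar>s\<bar>" using m by (rule mult_right_mono) simp
    also have "\<dots> \<le> norm p * \<bar>s\<bar>" using a by (intro mult_right_mono) auto
    also have "\<dots> \<le> d / 2" using px by (simp add: d_def)
    finally have "cmod (\<integral>q. osc w s q * G q \<partial>lborel) \<le> C / norm w ^ N" using wd by (intro C(2) w0) auto
    also have "\<dots> \<le> C / (d / 2) ^ N"
      using C(1) wd d0 by (intro divide_left_mono power_mono mult_pos_pos zero_less_power) auto
    finally have "cmod (Est G s x p y) \<le> cD TYPE('b) * (C / (d / 2) ^ N)"
      unfolding Est_osc[OF G] w_def using cD_pos[where 'a='b] by (intro mult_left_mono) auto
    then have "(cmod (Est G s x p y))\<^sup>2 \<le> (cD TYPE('b) * (C / (d / 2) ^ N))\<^sup>2" by (intro power_mono) auto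
    also have "\<dots> = (cD TYPE('b) * C * 2 ^ N)\<^sup>2 * inverse (d ^ N * d ^ N)"
      by (simp add: power_divide power2_eq_square field_simps)
    also have "\<dots> \<le> (cD TYPE('b) * C * 2 ^ N)\<^sup>2 * inverse (norm x ^ N * (\<bar>s\<bar> * norm p) ^ N)"
    proof (intro mult_left_mono le_imp_inverse_le mult_mono power_mono)
      show "norm x \<le> d" using s pp by (simp add: d_def)
      show "\<bar>s\<bar> * norm p \<le> d" using px s pp by (simp add: d_def add_increasing)
      show "0 < norm x ^ N * (\<bar>s\<bar> * norm p) ^ N" using px s pp by simp
    qed (use d0 in auto)
    also have "\<dots> = (cD TYPE('b) * C * 2 ^ N)\<^sup>2 * (inverse (\<bar>s\<bar> ^ N) * (inverse (norm x ^ N) * inverse (norm p ^ N)))"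
      by (simp add: power_mult_distrib)
    also have "\<dots> \<le> (cD TYPE('b) * C * 2 ^ N)\<^sup>2 * (inverse (\<bar>s\<bar> ^ N) * ((((1 + 1) / 1) ^ N * wt x) * (((1 + m) / m) ^ N * wt p)))"
    proof (intro mult_left_mono mult_mono)
      show "inverse (norm x ^ N) \<le> ((1 + 1) / 1) ^ N * wt x" unfolding N_def by (rule inverse_power_le_wt) (use px in auto)
      show "inverse (norm p ^ N) \<le> ((1 + m) / m) ^ N * wt p" unfolding N_def by (rule inverse_power_le_wt) (use a m0 in auto)
      show "0 \<le> ((1 + 1) / 1) ^ N * wt x" using wt_nonneg[of x] by simp
    qed auto
    also have "\<dots> = C' * inverse (\<bar>s\<bar> ^ N) * wt x * wt p" by (simp add: C'_def mult_ac)
    finally show "(cmod (Est G s x p y))\<^sup>2 \<le> C' * inverse (\<bar>s\<bar> ^ (4 * DIM('b))) * wt x * wt p" unfolding N_def .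
  qed
qed

subsection \<open>Partial inner products\<close>

lemma borel_lborel_pair: "f \<in> borel_measurable borel \<Longrightarrow> f \<in> borel_measurable (lborel \<Otimes>\<^sub>M lborel)"
  by (simp add: lborel_prod)

lemma borel_slice:
  fixes f :: "'a::euclidean_space \<times> 'b::euclidean_space \<Rightarrow> 'c::topological_space"
  assumes "f \<in> borel_measurable borel"
  shows "(\<lambda>y. f (x, y)) \<in> borel_measurable borel" "(\<lambda>x. f (x, y)) \<in> borel_measurable borel"
  by (rule measurable_compose[OF _ assms], intro borel_measurable_continuous_onI continuous_intros)+

text \<open>Pairing with the perpendicular factor e first leaves a function of the parallel variable
  alone. Slices of g are square-integrable only almost everywhere, so the Cauchy-Schwarz bound is an
  AE statement.\<close>

lemma partial_inner_product:
  fixes e :: "'b::euclidean_space \<Rightarrow> complex" and g :: "'a::euclidean_space \<times> 'b \<Rightarrow> complex"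
  assumes em [measurable]: "e \<in> borel_measurable borel" and e: "sq_int e"
    and gm [measurable]: "g \<in> borel_measurable borel" and g: "sq_int g"
  defines "a \<equiv> \<lambda>y. \<integral>z. cnj (e z) * g (y, z) \<partial>lborel"
  shows "a \<in> borel_measurable borel" "sq_int a" "norm (L2 a) \<le> norm (L2 e) * norm (L2 g)"
    and "\<And>d. d \<in> borel_measurable borel \<Longrightarrow> sq_int (tensor d e) \<Longrightarrow> l2inner (tensor d e) g = l2inner d a"
proof -
  have "(\<lambda>x. cnj (e (snd x)) * g x) \<in> borel_measurable borel"
    by (intro borel_measurable_times borel_measurable_cnj borel_measurable_snd_comp em gm)
  from borel_lborel_pair[OF this]
  have "(\<lambda>(y, z). cnj (e z) * g (y, z)) \<in> borel_measurable (lborel \<Otimes>\<^sub>M lborel)"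
    by (simp add: case_prod_unfold)
  from lborel.borel_measurable_lebesgue_integral[OF this]
  show am [measurable]: "a \<in> borel_measurable borel" by (simp add: a_def)
  note sl [measurable] = borel_slice(1)[OF gm]
  have tot: "(\<integral>\<^sup>+y. \<integral>\<^sup>+z. ennreal ((cmod (g (y, z)))\<^sup>2) \<partial>lborel \<partial>lborel) = ennreal ((norm (L2 g))\<^sup>2)"
  proof -
    have "(\<integral>\<^sup>+y. \<integral>\<^sup>+z. ennreal ((cmod (g (y, z)))\<^sup>2) \<partial>lborel \<partial>lborel) = (\<integral>\<^sup>+x. ennreal ((cmod (g x))\<^sup>2) \<partial>(lborel \<Otimes>\<^sub>M lborel))"
      by (rule lborel.nn_integral_fst) (rule borel_lborel_pair, measurable)
    then show ?thesis by (simp add: lborel_prod nn_norm_L2_sq g)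
  qed
  have mm: "(\<lambda>y. \<integral>\<^sup>+z. ennreal ((cmod (g (y, z)))\<^sup>2) \<partial>lborel) \<in> borel_measurable lborel"
  proof (rule lborel.borel_measurable_nn_integral)
    have "(\<lambda>x. ennreal ((cmod (g x))\<^sup>2)) \<in> borel_measurable borel" by measurable
    from borel_lborel_pair[OF this] show "(\<lambda>(y, z). ennreal ((cmod (g (y, z)))\<^sup>2)) \<in> borel_measurable (lborel \<Otimes>\<^sub>M lborel)"
      by (simp add: case_prod_unfold)
  qed
  have fin: "AE y in lborel. (\<integral>\<^sup>+z. ennreal ((cmod (g (y, z)))\<^sup>2) \<partial>lborel) \<noteq> \<infinity>"
    by (rule nn_integral_PInf_AE[OF mm]) (simp add: tot)
  have pt: "AE y in lborel. ennreal ((cmod (a y))\<^sup>2) \<le> ennreal ((norm (L2 e))\<^sup>2) * (\<integral>\<^sup>+z. ennreal ((cmod (g (y, z)))\<^sup>2) \<partial>lborel)"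
    using fin
  proof eventually_elim
    case (elim y)
    have s: "sq_int (\<lambda>z. g (y, z))" using elim by (subst sq_int_iff_nn) (auto simp: less_top)
    have "a y = cinner (L2 e) (L2 (\<lambda>z. g (y, z)))"
      unfolding a_def using e s by (simp add: cinner_L2 l2inner_def integral_completion)
    then have "cmod (a y) \<le> norm (L2 e) * norm (L2 (\<lambda>z. g (y, z)))" by (simp add: cmod_cinner_le)
    then have "(cmod (a y))\<^sup>2 \<le> (norm (L2 e))\<^sup>2 * (norm (L2 (\<lambda>z. g (y, z))))\<^sup>2"
      unfolding power_mult_distrib[symmetric] by (intro power_mono) auto
    then have "ennreal ((cmod (a y))\<^sup>2) \<le> ennreal ((norm (L2 e))\<^sup>2 * (norm (L2 (\<lambda>z. g (y, z))))\<^sup>2)" by (rule ennreal_leI)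
    then show ?case by (simp only: ennreal_mult' zero_le_power2 nn_norm_L2_sq[OF s sl])
  qed
  have "(\<integral>\<^sup>+y. ennreal ((cmod (a y))\<^sup>2) \<partial>lborel)
     \<le> (\<integral>\<^sup>+y. ennreal ((norm (L2 e))\<^sup>2) * (\<integral>\<^sup>+z. ennreal ((cmod (g (y, z)))\<^sup>2) \<partial>lborel) \<partial>lborel)"
    by (rule nn_integral_mono_AE[OF pt])
  also have "\<dots> = ennreal ((norm (L2 e))\<^sup>2) * ennreal ((norm (L2 g))\<^sup>2)"
    by (subst nn_integral_cmult[OF mm]) (simp add: tot)
  finally have le: "(\<integral>\<^sup>+y. ennreal ((cmod (a y))\<^sup>2) \<partial>lborel) \<le> ennreal ((norm (L2 e) * norm (L2 g))\<^sup>2)"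
    by (simp add: power_mult_distrib ennreal_mult)
  show sa: "sq_int a" using le by (subst sq_int_iff_nn[OF am]) (auto intro: le_less_trans)
  have "ennreal ((norm (L2 a))\<^sup>2) \<le> ennreal ((norm (L2 e) * norm (L2 g))\<^sup>2)"
    using le by (simp only: nn_norm_L2_sq[OF sa am])
  then have "(norm (L2 a))\<^sup>2 \<le> (norm (L2 e) * norm (L2 g))\<^sup>2" by (subst (asm) ennreal_le_iff) auto
  then show "norm (L2 a) \<le> norm (L2 e) * norm (L2 g)" by (rule power2_le_imp_le) simp
  fix d :: "'a \<Rightarrow> complex" assume dm [measurable]: "d \<in> borel_measurable borel" and d: "sq_int (tensor d e)"
  have tm: "(\<lambda>x. cnj (tensor d e x) * g x) \<in> borel_measurable borel"
    by (intro borel_measurable_times borel_measurable_cnj tensor_meas dm em gm)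
  have "integrable lborel (\<lambda>x. cnj (tensor d e x) * g x)"
    using sq_int_prod_integrable[OF d g] lebesgue_integrable_iff[OF tm] by simp
  then have i: "integrable (lborel \<Otimes>\<^sub>M lborel) (\<lambda>x. cnj (tensor d e x) * g x)" by (simp add: lborel_prod)
  have "l2inner (tensor d e) g = (\<integral>x. cnj (tensor d e x) * g x \<partial>(lborel \<Otimes>\<^sub>M lborel))"
    unfolding l2inner_def lborel_prod using tm by (simp add: integral_completion)
  also have "\<dots> = (\<integral>y. (\<integral>z. cnj (d y) * (cnj (e z) * g (y, z)) \<partial>lborel) \<partial>lborel)"
    using lborel_pair.integral_fst'[OF i] by (simp add: tensor_def mult.assoc)
  also have "\<dots> = (\<integral>y. cnj (d y) * a y \<partial>lborel)"
    unfolding a_def by (simp only: Bochner_Integration.integral_mult_right_zero)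
  also have "\<dots> = l2inner d a" unfolding l2inner_def by (simp add: integral_completion)
  finally show "l2inner (tensor d e) g = l2inner d a" .
qed

text \<open>Tonelli in the order that \<open>sector_slice_bound\<close> requires: the parallel
  phase-space point innermost, perpendicular position and momentum outside.\<close>

lemma nn_integral_phase_space:
  fixes f :: "('a::euclidean_space \<times> 'b::euclidean_space) \<times> ('a \<times> 'b) \<Rightarrow> ennreal"
  assumes f: "f \<in> borel_measurable borel"
  shows "(\<integral>\<^sup>+z. f z \<partial>lborel) = (\<integral>\<^sup>+x. \<integral>\<^sup>+p. \<integral>\<^sup>+\<zeta>. f ((fst \<zeta>, x), (snd \<zeta>, p)) \<partial>lborel \<partial>lborel \<partial>lborel)"
proof -
  have cm: "(\<lambda>x. f (h x)) \<in> borel_measurable borel" if "continuous_on UNIV h" for h :: "'c::euclidean_space \<Rightarrow> ('a \<times> 'b) \<times> ('a \<times> 'b)"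
    by (rule measurable_compose[OF borel_measurable_continuous_onI[OF that] f])
  have "(\<integral>\<^sup>+z. f z \<partial>lborel) = (\<integral>\<^sup>+x. \<integral>\<^sup>+p. f (x, p) \<partial>lborel \<partial>lborel)"
    using lborel.nn_integral_fst[OF borel_lborel_pair[OF f]] by (simp add: lborel_prod)
  also have "\<dots> = (\<integral>\<^sup>+x2. \<integral>\<^sup>+x1. \<integral>\<^sup>+p. f ((x1, x2), p) \<partial>lborel \<partial>lborel \<partial>lborel)"
  proof -
    have "(\<lambda>x. \<integral>\<^sup>+p. f (x, p) \<partial>lborel) \<in> borel_measurable lborel"
      using borel_lborel_pair[OF f] by (intro lborel.borel_measurable_nn_integral) (simp add: case_prod_unfold)
    then have "(\<lambda>x. \<integral>\<^sup>+p. f (x, p) \<partial>lborel) \<in> borel_measurable (lborel \<Otimes>\<^sub>M lborel)" by (simp add: lborel_prod)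
    from lborel_pair.nn_integral_snd[OF this] show ?thesis by (simp add: lborel_prod)
  qed
  also have "\<dots> = (\<integral>\<^sup>+x2. \<integral>\<^sup>+x1. \<integral>\<^sup>+p2. \<integral>\<^sup>+p1. f ((x1, x2), (p1, p2)) \<partial>lborel \<partial>lborel \<partial>lborel \<partial>lborel)"
  proof (intro nn_integral_cong)
    fix x2 :: 'b and x1 :: 'a
    have "(\<lambda>p. f ((x1, x2), p)) \<in> borel_measurable (lborel \<Otimes>\<^sub>M lborel)"
      by (rule borel_lborel_pair, rule cm, intro continuous_intros)
    from lborel_pair.nn_integral_snd[OF this]
    show "(\<integral>\<^sup>+p. f ((x1, x2), p) \<partial>lborel) = (\<integral>\<^sup>+p2. \<integral>\<^sup>+p1. f ((x1, x2), (p1, p2)) \<partial>lborel \<partial>lborel)"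
      by (simp add: lborel_prod)
  qed
  also have "\<dots> = (\<integral>\<^sup>+x2. \<integral>\<^sup>+p2. \<integral>\<^sup>+x1. \<integral>\<^sup>+p1. f ((x1, x2), (p1, p2)) \<partial>lborel \<partial>lborel \<partial>lborel \<partial>lborel)"
  proof (intro nn_integral_cong)
    fix x2 :: 'b
    have "(\<lambda>x::('a \<times> 'b) \<times> 'a. f ((fst (fst x), x2), (snd x, snd (fst x)))) \<in> borel_measurable (lborel \<Otimes>\<^sub>M lborel)"
      by (rule borel_lborel_pair, rule cm, intro continuous_intros)
    then have "(\<lambda>y::'a \<times> 'b. \<integral>\<^sup>+p1. f ((fst y, x2), (p1, snd y)) \<partial>lborel) \<in> borel_measurable lborel"
      by (intro lborel.borel_measurable_nn_integral) (simp add: case_prod_unfold)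
    then have "(\<lambda>(x1, p2). \<integral>\<^sup>+p1. f ((x1, x2), (p1, p2)) \<partial>lborel) \<in> borel_measurable (lborel \<Otimes>\<^sub>M lborel)"
      by (simp add: lborel_prod case_prod_unfold)
    from lborel_pair.Fubini'[OF this]
    show "(\<integral>\<^sup>+x1. \<integral>\<^sup>+p2. \<integral>\<^sup>+p1. f ((x1, x2), (p1, p2)) \<partial>lborel \<partial>lborel \<partial>lborel)
      = (\<integral>\<^sup>+p2. \<integral>\<^sup>+x1. \<integral>\<^sup>+p1. f ((x1, x2), (p1, p2)) \<partial>lborel \<partial>lborel \<partial>lborel)" by simp
  qed
  also have "\<dots> = (\<integral>\<^sup>+x. \<integral>\<^sup>+p. \<integral>\<^sup>+\<zeta>. f ((fst \<zeta>, x), (snd \<zeta>, p)) \<partial>lborel \<partial>lborel \<partial>lborel)"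
  proof (intro nn_integral_cong)
    fix x2 p2 :: 'b
    have "(\<lambda>\<zeta>::'a \<times> 'a. f ((fst \<zeta>, x2), (snd \<zeta>, p2))) \<in> borel_measurable (lborel \<Otimes>\<^sub>M lborel)"
      by (rule borel_lborel_pair, rule cm, intro continuous_intros)
    from lborel.nn_integral_fst[OF this]
    show "(\<integral>\<^sup>+x1. \<integral>\<^sup>+p1. f ((x1, x2), (p1, p2)) \<partial>lborel \<partial>lborel) = (\<integral>\<^sup>+\<zeta>. f ((fst \<zeta>, x2), (snd \<zeta>, p2)) \<partial>lborel)"
      by (simp add: lborel_prod)
  qed
  finally show ?thesis .
qed

subsection \<open>Hilbert-Schmidt bound\<close>

definition slab :: "real \<Rightarrow> 'a::euclidean_space \<times> 'b::euclidean_space \<Rightarrow> complex" where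
  "slab R = indicator {y. norm (snd y) \<le> R}"

lemma slab_set: "{y::'a::euclidean_space \<times> 'b::euclidean_space. norm (snd y) \<le> R} \<in> sets borel"
  by (intro borel_closed closed_Collect_le continuous_intros)

lemma slab_bddm: "bddm (slab R)"
  unfolding slab_def by (rule indicator_bddm[OF slab_set])

text \<open>The sign of s selects outgoing (s > 0) or incoming (s < 0) points: in the perpendicular
  variable, free motion from time 0 to s never comes closer to the origin than its starting point.
  Points with x . p = 0 belong to both.\<close>

definition sector :: "real \<Rightarrow> real \<Rightarrow> real \<Rightarrow> (('a::euclidean_space \<times> 'b::euclidean_space) \<times> ('a \<times> 'b)) set" where
  "sector n m s = {z. n < norm (snd (fst z)) \<and> m < norm (snd (snd z)) \<and> 0 \<le> s * (snd (fst z) \<bullet> snd (snd z))}"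

text \<open>The parallel variables are integrated out by the resolution of the identity in dimension k,
  so only the perpendicular coherent states have to be square-summable over the region.\<close>

lemma sector_slice_bound:
  fixes F :: "'a::euclidean_space \<Rightarrow> complex" and G :: "'b::euclidean_space \<Rightarrow> complex"
  assumes F: "bump F r1" and G: "bump G r2"
  shows "(\<integral>\<^sup>+\<zeta>. ennreal ((cmod (CT (ifourier (tensor F G)) (Bev (- s) (mulop (slab R) v)) ((fst \<zeta>, x), (snd \<zeta>, p))))\<^sup>2) \<partial>lborel)
    \<le> ennreal (1 / (cD TYPE('a))\<^sup>2 * (norm (L2 (ifourier F)))\<^sup>2 * (norm v)\<^sup>2)
       * (\<integral>\<^sup>+y. indicator (cball 0 R) y * ennreal ((cmod (Est G s x p y))\<^sup>2) \<partial>lborel)"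
proof -
  obtain g where g: "sq_int g" and gm [measurable]: "g \<in> borel_measurable borel" and v: "v = L2 g" by (rule L2_cases)
  note FG = bump_tensor[OF F G]
  obtain K where "window (ifourier F) K" using bump_window[OF F] by blast
  then interpret W: window "ifourier F" K .
  \<comment> \<open>The slab constrains the perpendicular variable alone, so its cutoff can be moved
    entirely to this factor.\<close>
  define e where "e y = indicator (cball 0 R) y * Est G s x p y" for y
  have em [measurable]: "e \<in> borel_measurable borel"
    unfolding e_def by (intro borel_measurable_times borel_measurable_indicator Est_meas[OF G]) auto
  have se: "sq_int e" unfolding e_def by (rule sq_int_bddm[OF indicator_bddm Est_sq[OF G]]) simp
  define a where "a y = (\<integral>z. cnj (e z) * g (y, z) \<partial>lborel)" for y
  note pip = partial_inner_product[OF em se gm g, folded a_def]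
  \<comment> \<open>Moving the evolution onto the coherent state, factoring it and pairing the
    perpendicular factor leaves a transform in the parallel dimension of one function
    \<open>a\<close>, independent of \<open>\<zeta>\<close> and evolved isometrically.\<close>
  have pt: "CT (ifourier (tensor F G)) (Bev (- s) (mulop (slab R) v)) ((fst \<zeta>, x), (snd \<zeta>, p)) = CT (ifourier F) (Bev (- s) (L2 a)) \<zeta>" for \<zeta>
  proof -
    let ?d = "Est F s (fst \<zeta>) (snd \<zeta>)"
    have t: "Est (tensor F G) s (fst \<zeta>, x) (snd \<zeta>, p) = tensor ?d (Est G s x p)"
      using Est_tensor[OF F G, of s "(fst \<zeta>, x)" "(snd \<zeta>, p)"] by simp
    have st: "sq_int (tensor ?d (Est G s x p))" using Est_sq[OF FG, of s "(fst \<zeta>, x)" "(snd \<zeta>, p)"] unfolding t .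
    have te: "tensor ?d e = (\<lambda>y. slab R y * tensor ?d (Est G s x p) y)"
      by (rule ext) (auto simp: tensor_def e_def slab_def indicator_def)
    have ste: "sq_int (tensor ?d e)" unfolding te by (rule sq_int_bddm[OF slab_bddm st])
    have "CT (ifourier (tensor F G)) (Bev (- s) (mulop (slab R) v)) ((fst \<zeta>, x), (snd \<zeta>, p))
      = cinner (L2 (tensor ?d (Est G s x p))) (mulop (slab R) v)"
      unfolding CT_def using Bev_adj[of s _ "mulop (slab R) v"] Est_Bev[OF FG, of s "(fst \<zeta>, x)" "(snd \<zeta>, p)"] t by metis
    also have "\<dots> = l2inner (tensor ?d (Est G s x p)) (\<lambda>y. slab R y * g y)"
      unfolding v by (simp add: mulop_L2 slab_bddm g cinner_L2 st sq_int_bddm[OF slab_bddm g])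
    also have "\<dots> = l2inner (tensor ?d e) g"
      unfolding l2inner_def te by (intro Bochner_Integration.integral_cong) (auto simp: slab_def indicator_def)
    also have "\<dots> = l2inner ?d a" by (rule pip(4)[OF Est_meas[OF F] ste])
    also have "\<dots> = cinner (Bev s (L2 (cs (ifourier F) \<zeta>))) (L2 a)"
      using Est_Bev[OF F, of s "fst \<zeta>" "snd \<zeta>"] by (simp add: cinner_L2 Est_sq[OF F] pip(2))
    also have "\<dots> = CT (ifourier F) (Bev (- s) (L2 a)) \<zeta>" unfolding CT_def by (rule Bev_adj)
    finally show ?thesis .
  qed
  have "(\<integral>\<^sup>+\<zeta>. ennreal ((cmod (CT (ifourier (tensor F G)) (Bev (- s) (mulop (slab R) v)) ((fst \<zeta>, x), (snd \<zeta>, p))))\<^sup>2) \<partial>lborel)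
    = ennreal (1 / (cD TYPE('a))\<^sup>2 * (norm (L2 (ifourier F)))\<^sup>2 * (norm (L2 a))\<^sup>2)"
    unfolding pt by (simp add: W.CT_norm_nn Bev_norm)
  also have "\<dots> \<le> ennreal (1 / (cD TYPE('a))\<^sup>2 * (norm (L2 (ifourier F)))\<^sup>2 * (norm (L2 e) * norm v)\<^sup>2)"
    unfolding v by (intro ennreal_leI mult_left_mono power_mono pip(3)) auto
  also have "\<dots> = ennreal (1 / (cD TYPE('a))\<^sup>2 * (norm (L2 (ifourier F)))\<^sup>2 * (norm v)\<^sup>2 * (norm (L2 e))\<^sup>2)"
    by (simp add: power_mult_distrib mult_ac)
  also have "\<dots> = ennreal (1 / (cD TYPE('a))\<^sup>2 * (norm (L2 (ifourier F)))\<^sup>2 * (norm v)\<^sup>2) * ennreal ((norm (L2 e))\<^sup>2)"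
    by (rule ennreal_mult') simp
  also have "ennreal ((norm (L2 e))\<^sup>2) = (\<integral>\<^sup>+y. indicator (cball 0 R) y * ennreal ((cmod (Est G s x p y))\<^sup>2) \<partial>lborel)"
    unfolding nn_norm_L2_sq[OF se em, symmetric]
    by (intro nn_integral_cong) (auto simp: e_def indicator_def)
  finally show ?thesis .
qed

text \<open>Integrating the slice bound over perpendicular x and p leaves the tail of
  \<open>wt\<close> beyond n in position and its full integral in momentum. The tail tends to 0 and
  hence so does \<open>\<tau>\<close>, uniformly in E, s and v.\<close>

lemma sector_estimate:
  fixes F :: "'a::euclidean_space \<Rightarrow> complex" and G :: "'b::euclidean_space \<Rightarrow> complex"
  assumes F: "bump F r1" and sm: "\<And>b. b \<in> Basis \<Longrightarrow> \<exists>g. smooth_bump b r g \<and> g 0 = G" and r: "0 < r"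
    and m: "8 * r * real DIM('b) \<le> m" and m0: "0 < m" and R: "0 \<le> R"
    and uw: "unit_window (ifourier (tensor F G)) K"
  shows "\<exists>\<tau> n0. \<tau> \<longlonglongrightarrow> 0 \<and> (\<forall>n. 0 \<le> \<tau> n) \<and> (\<forall>n\<ge>n0. \<forall>s E v. s \<noteq> 0 \<and> E \<in> sets borel \<and> E \<subseteq> sector (real n) m s \<longrightarrow>
     norm (mulop (indicator E) (window.A (ifourier (tensor F G)) (Bev (- s) (mulop (slab R) v)))) \<le> \<tau> n * inverse (\<bar>s\<bar> ^ (2 * DIM('b))) * norm v)"
proof -
  let ?u = "ifourier (tensor F G)"
  interpret U: unit_window ?u K by (rule uw)
  obtain b :: 'b where b: "b \<in> Basis" using nonempty_Basis by blast
  obtain g where "smooth_bump b r g" "g 0 = G" using sm[OF b] by blast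
  then have G: "bump G r" by (auto simp: smooth_bump_def)
  obtain C where C: "0 \<le> C" and Cb: "\<And>s x p y. s \<noteq> 0 \<Longrightarrow> norm y \<le> R \<Longrightarrow> max 1 (5 * R) < norm x \<Longrightarrow> m < norm p \<Longrightarrow> 0 \<le> s * (x \<bullet> p)
     \<Longrightarrow> (cmod (Est G s x p y))\<^sup>2 \<le> C * inverse (\<bar>s\<bar> ^ (4 * DIM('b))) * wt x * wt p"
    using Est_outgoing_bound[OF sm r m m0 R] by blast
  \<comment> \<open>Beyond \<open>n0\<close> the position condition of the pointwise bound holds on
    the whole sector.\<close>
  obtain n0 :: nat where n0: "max 1 (5 * R) \<le> real n0" using real_arch_simple by blast
  define vol where "vol = measure lborel (cball (0::'b) R)"
  have vol: "emeasure lborel (cball (0::'b) R) = ennreal vol"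
    unfolding vol_def by (rule emeasure_eq_ennreal_measure) (use emeasure_bounded_finite[of "cball (0::'b) R"] in simp)
  have vol0: "0 \<le> vol" by (simp add: vol_def)
  define Q where "Q = 1 / (cD TYPE('a))\<^sup>2 * (norm (L2 (ifourier F)))\<^sup>2 * (vol * C)"
  have Q0: "0 \<le> Q" using vol0 C by (simp add: Q_def)
  define T where "T n = (\<integral>x. indicator {x. real n < norm x} x * wt x \<partial>(lborel :: 'b measure))" for n :: nat
  have Tm: "{x::'b. real n < norm x} \<in> sets borel" for n :: nat by measurable
  have Ti: "integrable lborel (\<lambda>x::'b. indicator {x. real n < norm x} x * wt x)" for n :: nat
    using integrable_mult_indicator[OF _ wt_integrable, of "{x::'b. real n < norm x}"] Tm by simp
  have T0: "0 \<le> T n" for n unfolding T_def by (intro Bochner_Integration.integral_nonneg) (simp add: wt_nonneg)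
  have Tnn: "(\<integral>\<^sup>+x. ennreal (indicator {x. real n < norm x} x * wt (x::'b)) \<partial>lborel) = ennreal (T n)" for n
    unfolding T_def by (rule nn_integral_eq_integral[OF Ti]) (simp add: wt_nonneg)
  have Tlim: "T \<longlonglongrightarrow> 0"
  proof -
    have "T \<longlonglongrightarrow> (\<integral>x. 0 \<partial>(lborel :: 'b measure))"
      unfolding T_def
    proof (rule integral_dominated_convergence[where w=wt])
      show "AE x in lborel. (\<lambda>n. indicator {x. real n < norm x} x * wt (x::'b)) \<longlonglongrightarrow> 0"
      proof (rule AE_I2)
        fix x :: 'b
        obtain N :: nat where "norm x \<le> real N" using real_arch_simple by blast
        then have "\<forall>n\<ge>N. indicator {x. real n < norm x} x * wt x = 0" by (auto simp: indicator_def)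
        then show "(\<lambda>n. indicator {x. real n < norm x} x * wt x) \<longlonglongrightarrow> 0"
          by (intro tendsto_eventually) (auto simp: eventually_sequentially)
      qed
      show "AE x in lborel. norm (indicator {x. real n < norm x} x * wt (x::'b)) \<le> wt x" for n :: nat
        by (auto simp: indicator_def wt_nonneg)
    qed (use wt_integrable Tm in auto)
    then show ?thesis by simp
  qed
  define W0 where "W0 = (\<integral>p. wt (p::'b) \<partial>lborel)"
  have W0: "0 \<le> W0" unfolding W0_def by (intro Bochner_Integration.integral_nonneg wt_nonneg)
  have W0nn: "(\<integral>\<^sup>+p. ennreal (wt (p::'b)) \<partial>lborel) = ennreal W0"
    unfolding W0_def by (rule nn_integral_eq_integral[OF wt_integrable]) (simp add: wt_nonneg)
  define c where "c = cD TYPE('a \<times> 'b)"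
  have c0: "0 < c" unfolding c_def by (rule cD_pos)
  define \<tau> where "\<tau> n = c * sqrt (Q * W0 * T n)" for n
  have "\<tau> \<longlonglongrightarrow> c * sqrt (Q * W0 * 0)" unfolding \<tau>_def[abs_def] by (intro tendsto_intros Tlim)
  then have \<tau>lim: "\<tau> \<longlonglongrightarrow> 0" by simp
  have \<tau>0: "0 \<le> \<tau> n" for n using c0 Q0 W0 T0 by (simp add: \<tau>_def)
  have main: "norm (mulop (indicator E) (U.A (Bev (- s) (mulop (slab R) v)))) \<le> \<tau> n * inverse (\<bar>s\<bar> ^ (2 * DIM('b))) * norm v"
    if n: "n0 \<le> n" and s: "s \<noteq> 0" and E [measurable]: "E \<in> sets borel" and Es: "E \<subseteq> sector (real n) m s" for n s E v
  proof -
    \<comment> \<open>The pointwise bound is for squares; this is the square root of its time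
      factor.\<close>
    define S where "S = inverse (\<bar>s\<bar> ^ (2 * DIM('b)))"
    have SS: "inverse (\<bar>s\<bar> ^ (4 * DIM('b))) = S * S"
    proof -
      have "\<bar>s\<bar> ^ (4 * DIM('b)) = \<bar>s\<bar> ^ (2 * DIM('b)) * \<bar>s\<bar> ^ (2 * DIM('b))" by (simp add: power_add[symmetric])
      then show ?thesis by (simp add: S_def)
    qed
    have S0: "0 \<le> S" by (simp add: S_def)
    let ?w = "Bev (- s) (mulop (slab R) v)"
    define B where "B = Q * (S * S) * (norm v)\<^sup>2"
    have B0: "0 \<le> B" using Q0 S0 by (simp add: B_def)
    have fm: "(\<lambda>z. indicator E z * ennreal ((cmod (CT ?u ?w z))\<^sup>2)) \<in> borel_measurable borel" by measurable
    have slice: "(\<integral>\<^sup>+\<zeta>. indicator E ((fst \<zeta>, x), (snd \<zeta>, p)) * ennreal ((cmod (CT ?u ?w ((fst \<zeta>, x), (snd \<zeta>, p))))\<^sup>2) \<partial>lborel)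
       \<le> ennreal (B * (indicator {x. real n < norm x} x * wt x)) * ennreal (wt p)" for x p :: 'b
    proof (cases "real n < norm x \<and> m < norm p \<and> 0 \<le> s * (x \<bullet> p)")
      case True
      have x1: "max 1 (5 * R) < norm x" using True n n0 by linarith
      have "(\<integral>\<^sup>+y. indicator (cball 0 R) y * ennreal ((cmod (Est G s x p y))\<^sup>2) \<partial>lborel)
        \<le> (\<integral>\<^sup>+y. ennreal (C * (S * S) * wt x * wt p) * indicator (cball (0::'b) R) y \<partial>lborel)"
      proof (rule nn_integral_mono)
        fix y
        show "indicator (cball 0 R) y * ennreal ((cmod (Est G s x p y))\<^sup>2) \<le> ennreal (C * (S * S) * wt x * wt p) * indicator (cball 0 R) y"
        proof (cases "norm y \<le> R")
          case True
          then show ?thesis using Cb[OF s True x1] \<open>real n < norm x \<and> m < norm p \<and> 0 \<le> s * (x \<bullet> p)\<close>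
            by (simp add: SS ennreal_leI)
        qed (simp add: indicator_def)
      qed
      also have "\<dots> = ennreal (C * (S * S) * wt x * wt p) * emeasure lborel (cball (0::'b) R)"
        by (rule nn_integral_cmult_indicator) simp
      also have "\<dots> = ennreal (C * (S * S) * wt x * wt p * vol)"
        unfolding vol using C S0 wt_nonneg[of x] wt_nonneg[of p] by (simp add: ennreal_mult'' vol0)
      finally have eb: "(\<integral>\<^sup>+y. indicator (cball 0 R) y * ennreal ((cmod (Est G s x p y))\<^sup>2) \<partial>lborel) \<le> ennreal (C * (S * S) * wt x * wt p * vol)" .
      have "(\<integral>\<^sup>+\<zeta>. indicator E ((fst \<zeta>, x), (snd \<zeta>, p)) * ennreal ((cmod (CT ?u ?w ((fst \<zeta>, x), (snd \<zeta>, p))))\<^sup>2) \<partial>lborel)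
        \<le> (\<integral>\<^sup>+\<zeta>. ennreal ((cmod (CT ?u ?w ((fst \<zeta>, x), (snd \<zeta>, p))))\<^sup>2) \<partial>lborel)"
        by (intro nn_integral_mono) (simp add: indicator_def)
      also have "\<dots> \<le> ennreal (1 / (cD TYPE('a))\<^sup>2 * (norm (L2 (ifourier F)))\<^sup>2 * (norm v)\<^sup>2)
         * (\<integral>\<^sup>+y. indicator (cball 0 R) y * ennreal ((cmod (Est G s x p y))\<^sup>2) \<partial>lborel)"
        by (rule sector_slice_bound[OF F G])
      also have "\<dots> \<le> ennreal (1 / (cD TYPE('a))\<^sup>2 * (norm (L2 (ifourier F)))\<^sup>2 * (norm v)\<^sup>2) * ennreal (C * (S * S) * wt x * wt p * vol)"
        by (intro mult_left_mono eb) simp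
      also have "\<dots> = ennreal (1 / (cD TYPE('a))\<^sup>2 * (norm (L2 (ifourier F)))\<^sup>2 * (norm v)\<^sup>2 * (C * (S * S) * wt x * wt p * vol))"
        by (rule ennreal_mult'[symmetric]) simp
      also have "\<dots> = ennreal (B * (indicator {x. real n < norm x} x * wt x) * wt p)"
        using True by (intro arg_cong[of _ _ ennreal]) (simp add: B_def Q_def mult_ac)
      also have "\<dots> = ennreal (B * (indicator {x. real n < norm x} x * wt x)) * ennreal (wt p)"
        by (rule ennreal_mult'') (rule wt_nonneg)
      finally show ?thesis .
    next
      case False
      then have "((a, x), (b, p)) \<notin> E" for a b using Es by (auto simp: sector_def)
      then show ?thesis by simp
    qed
    have "(\<integral>\<^sup>+z. indicator E z * ennreal ((cmod (CT ?u ?w z))\<^sup>2) \<partial>lborel)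
      \<le> (\<integral>\<^sup>+x. \<integral>\<^sup>+p. ennreal (B * (indicator {x. real n < norm x} (x::'b) * wt x)) * ennreal (wt (p::'b)) \<partial>lborel \<partial>lborel)"
      unfolding nn_integral_phase_space[OF fm] by (intro nn_integral_mono slice)
    also have "\<dots> = (\<integral>\<^sup>+x. ennreal B * ennreal (indicator {x. real n < norm x} (x::'b) * wt x) * ennreal W0 \<partial>lborel)"
      by (simp add: nn_integral_cmult W0nn ennreal_mult' B0)
    also have "\<dots> = ennreal B * ennreal (T n) * ennreal W0"
      using Tm[of n] by (simp add: nn_integral_multc nn_integral_cmult Tnn)
    also have "\<dots> = ennreal (B * T n * W0)" using B0 T0 W0 by (simp add: ennreal_mult'')
    finally have "ennreal ((norm (mulop (indicator E) (U.A ?w)))\<^sup>2) \<le> ennreal (c\<^sup>2) * ennreal (B * T n * W0)"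
      unfolding U.mulop_A_nn[OF E] c_def by (rule mult_left_mono) simp
    also have "\<dots> = ennreal (c\<^sup>2 * (B * T n * W0))" by (rule ennreal_mult'[symmetric]) simp
    also have "c\<^sup>2 * (B * T n * W0) = (\<tau> n * S * norm v)\<^sup>2"
      using Q0 W0 T0[of n] by (simp add: \<tau>_def B_def power_mult_distrib power2_eq_square)
    finally have "(norm (mulop (indicator E) (U.A ?w)))\<^sup>2 \<le> (\<tau> n * S * norm v)\<^sup>2" by (subst (asm) ennreal_le_iff) auto
    then have "norm (mulop (indicator E) (U.A ?w)) \<le> \<tau> n * S * norm v"
      by (rule power2_le_imp_le) (use \<tau>0 S0 in simp)
    then show ?thesis unfolding S_def .
  qed
  show ?thesis by (intro exI[of _ \<tau>] exI[of _ n0] conjI allI impI \<tau>lim \<tau>0) (use main in blast)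
qed

subsection \<open>Cook's argument\<close>

context trotter_data
begin

lemma U_lin: "bounded_linear (U t)"
proof (rule bounded_linear_intro[where K=1])
  fix u v :: 'h and r :: real
  have "(\<lambda>n. trot n t (u + v)) \<longlonglongrightarrow> U t u + U t v"
    using tendsto_add[OF trot_lim[of t u] trot_lim[of t v]] by (simp add: linear_add[OF bounded_linear.linear[OF trot_lin]])
  then show "U t (u + v) = U t u + U t v" using trot_lim LIMSEQ_unique by blast
  have "(\<lambda>n. trot n t (r *\<^sub>R u)) \<longlonglongrightarrow> r *\<^sub>R U t u"
    using tendsto_scaleR[OF tendsto_const trot_lim[of t u]] by (simp add: linear_scale[OF bounded_linear.linear[OF trot_lin]])
  then show "U t (r *\<^sub>R u) = r *\<^sub>R U t u" using trot_lim LIMSEQ_unique by blast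
qed (simp add: U_norm)

text \<open>\<open>- c / r\<close> is a primitive of the majorant c / r^2, and it increases to
  0.\<close>

lemma cook_tail:
  assumes e: "0 < e" and bd: "\<And>s. e \<le> s \<Longrightarrow> norm (J (B s w)) \<le> c / s\<^sup>2" and c: "0 \<le> c" and st: "e \<le> s" "s \<le> t"
  shows "norm (U (- t) (B t w) - U (- s) (B s w)) \<le> c / s"
proof (cases "s = t")
  case True then show ?thesis using c e st by simp
next
  case False
  have "norm (U (- t) (B t w) - U (- s) (B s w)) \<le> (- c / t) - (- c / s)"
  proof (rule cook_bound[where \<phi>="\<lambda>r. - c / r" and \<phi>'="\<lambda>r. c / r\<^sup>2"])
    show "0 \<le> s" "s < t" using e st False by auto
    show "continuous_on {s..t} (\<lambda>r. - c / r)" using e st by (intro continuous_intros) auto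
    fix r assume r: "s < r" "r < t"
    show "((\<lambda>r. - c / r) has_vector_derivative c / r\<^sup>2) (at r)"
      using r e st by (auto intro!: derivative_eq_intros simp: has_real_derivative_iff_has_vector_derivative[symmetric] power2_eq_square)
    show "norm (J (B r w)) \<le> c / r\<^sup>2" using r st by (intro bd) auto
  qed
  also have "\<dots> \<le> c / s" using c e st by simp
  finally show ?thesis .
qed

text \<open>Near time 0 the crude bound on \<open>J\<close> is enough: the increment is at most M
  norm w per unit of time.\<close>

lemma cook_initial:
  assumes "0 < e"
  shows "norm (U (- e) (B e w) - w) \<le> M * norm w * e"
proof -
  have "norm (U (- e) (B e w) - U (- 0) (B 0 w)) \<le> (M * norm w) * e - (M * norm w) * 0"
  proof (rule cook_bound[where \<phi>="\<lambda>r. (M * norm w) * r" and \<phi>'="\<lambda>r. M * norm w"])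
    show "((\<lambda>r. (M * norm w) * r) has_vector_derivative M * norm w) (at r)" for r
      by (auto intro!: derivative_eq_intros simp: has_real_derivative_iff_has_vector_derivative[symmetric])
    show "norm (J (B r w)) \<le> M * norm w" for r using J_bd[of "B r w"] by (simp add: B_norm)
  qed (use assms in \<open>auto intro!: continuous_intros\<close>)
  then show ?thesis by (simp add: U_0 B_0)
qed

text \<open>The time axis is split at e: the initial stretch costs M norm w e, the tail c / e.
  Convergence is first obtained along the integers and the tail bound extends it to real t. The
  second claim covers all finite times because the last part of the theorem compares evolutions at
  prescribed times.\<close>

lemma cook_limit:
  assumes e: "0 < e" and bd: "\<And>s. e \<le> s \<Longrightarrow> norm (J (B s w)) \<le> c / s\<^sup>2" and c: "0 \<le> c"
  shows "\<exists>l. ((\<lambda>t. U (- t) (B t w)) \<longlongrightarrow> l) at_top \<and> norm (l - w) \<le> M * norm w * e + c / e"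
    and "\<And>t. 0 \<le> t \<Longrightarrow> norm (U (- t) (B t w) - w) \<le> M * norm w * e + c / e"
proof -
  define \<Omega> where "\<Omega> t = U (- t) (B t w)" for t
  have tail: "norm (\<Omega> t - \<Omega> s) \<le> c / s" if "e \<le> s" "s \<le> t" for s t
    unfolding \<Omega>_def by (rule cook_tail[OF e bd c that])
  obtain N0 :: nat where N0: "e \<le> real N0" using real_arch_simple by blast
  have small: "\<exists>N\<ge>N0. c / real N < d" if "0 < d" for d
  proof -
    obtain N1 :: nat where "c / d < real N1" using reals_Archimedean2 by blast
    then have "c / d < real (max N1 N0)" "0 < real (max N1 N0)" using N0 e by linarith+
    then have "c / real (max N1 N0) < d" using that by (simp add: field_simps)
    then show ?thesis by (intro exI[of _ "max N1 N0"]) auto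
  qed
  have "Cauchy (\<lambda>n. \<Omega> (real n))"
  proof (rule CauchyI)
    fix d :: real assume "0 < d"
    then obtain N where N: "N0 \<le> N" "c / real N < d / 2" using small[of "d / 2"] by auto
    have eN: "e \<le> real N" using N0 N by linarith
    show "\<exists>M. \<forall>m\<ge>M. \<forall>n\<ge>M. norm (\<Omega> (real m) - \<Omega> (real n)) < d"
    proof (intro exI allI impI)
      fix m n assume "N \<le> m" "N \<le> n"
      then have "norm (\<Omega> (real m) - \<Omega> (real N)) \<le> c / real N" "norm (\<Omega> (real n) - \<Omega> (real N)) \<le> c / real N"
        using eN by (auto intro!: tail)
      moreover have "norm (\<Omega> (real m) - \<Omega> (real n)) \<le> norm (\<Omega> (real m) - \<Omega> (real N)) + norm (\<Omega> (real n) - \<Omega> (real N))"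
        using norm_triangle_ineq4[of "\<Omega> (real m) - \<Omega> (real N)" "\<Omega> (real n) - \<Omega> (real N)"] by simp
      ultimately show "norm (\<Omega> (real m) - \<Omega> (real n)) < d" using N(2) by linarith
    qed
  qed
  then obtain l where l: "(\<lambda>n. \<Omega> (real n)) \<longlonglongrightarrow> l" using Cauchy_convergent convergent_def by blast
  have dist: "norm (\<Omega> t - l) \<le> c / t" if t: "e \<le> t" for t
  proof (rule LIMSEQ_le_const2)
    show "(\<lambda>n. norm (\<Omega> t - \<Omega> (real n))) \<longlonglongrightarrow> norm (\<Omega> t - l)" by (intro tendsto_intros l)
    obtain k :: nat where "t \<le> real k" using real_arch_simple by blast
    then have "norm (\<Omega> t - \<Omega> (real n)) \<le> c / t" if "k \<le> n" for n
      using tail[OF t, of "real n"] that by (simp add: norm_minus_commute order_trans[of t "real k" "real n"])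
    then show "\<exists>N. \<forall>n\<ge>N. norm (\<Omega> t - \<Omega> (real n)) \<le> c / t" by blast
  qed
  have lim: "(\<Omega> \<longlongrightarrow> l) at_top"
  proof (rule LIM_zero_cancel, rule Lim_null_comparison)
    show "\<forall>\<^sub>F t in at_top. norm (\<Omega> t - l) \<le> c / t" using eventually_ge_at_top[of e] by eventually_elim (rule dist)
    show "((\<lambda>t. c / t) \<longlongrightarrow> 0) at_top" by (rule tendsto_divide_0[OF tendsto_const]) (rule filterlim_at_top_imp_at_infinity[OF filterlim_ident])
  qed
  have init: "norm (\<Omega> e - w) \<le> M * norm w * e" unfolding \<Omega>_def by (rule cook_initial[OF e])
  have "norm (l - w) \<le> norm (\<Omega> e - w) + norm (\<Omega> e - l)"
    using norm_triangle_ineq4[of "\<Omega> e - w" "\<Omega> e - l"] by simp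
  then have "norm (l - w) \<le> M * norm w * e + c / e" using init dist[of e] by simp
  then show "\<exists>l. ((\<lambda>t. U (- t) (B t w)) \<longlongrightarrow> l) at_top \<and> norm (l - w) \<le> M * norm w * e + c / e"
    using lim unfolding \<Omega>_def[abs_def] by blast
  fix t :: real assume t: "0 \<le> t"
  have "norm (\<Omega> t - w) \<le> M * norm w * e + c / e"
  proof (cases "e \<le> t")
    case True
    have "norm (\<Omega> t - w) \<le> norm (\<Omega> t - \<Omega> e) + norm (\<Omega> e - w)"
      using norm_triangle_ineq[of "\<Omega> t - \<Omega> e" "\<Omega> e - w"] by simp
    then show ?thesis using init tail[OF order_refl True] by simp
  next
    case False
    show ?thesis
    proof (cases "t = 0")
      case True then show ?thesis using e c M0 by (simp add: \<Omega>_def U_0 B_0)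
    next
      case False
      then have "norm (\<Omega> t - w) \<le> M * norm w * t" unfolding \<Omega>_def using t by (intro cook_initial) auto
      also have "\<dots> \<le> M * norm w * e" using \<open>\<not> e \<le> t\<close> M0 by (intro mult_left_mono) auto
      finally show ?thesis using c e by (simp add: add_increasing2)
    qed
  qed
  then show "norm (U (- t) (B t w) - w) \<le> M * norm w * e + c / e" unfolding \<Omega>_def .
qed

text \<open>The majorant s^(-2 D) is singular at 0, so the cut e is fixed first, with M e <= d / 2,
  and only then is n taken large. Beyond e the majorant is at most e^(-(2 D - 2)) / s^2, the form
  required by \<open>cook_limit\<close>. The threshold does not depend on w.\<close>

lemma wave_uniform:
  assumes a: "a \<longlonglongrightarrow> 0" "\<And>n. 0 \<le> a n" and D: "1 \<le> D"
    and d: "0 < d"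
  shows "\<exists>N. \<forall>n\<ge>N. \<forall>w. norm w \<le> 1 \<and> (\<forall>s>0. norm (J (B s w)) \<le> a n * inverse (s ^ (2 * D))) \<longrightarrow>
     (\<exists>l. ((\<lambda>t. U (- t) (B t w)) \<longlongrightarrow> l) at_top \<and> norm (l - w) \<le> d) \<and> (\<forall>t\<ge>0. norm (U (- t) (B t w) - w) \<le> d)"
proof -
  define e where "e = d / (2 * (M + 1))"
  have e: "0 < e" using d M0 by (simp add: e_def)
  have Me: "M * e \<le> d / 2" using d M0 by (simp add: e_def field_simps)
  define c where "c n = a n * inverse (e ^ (2 * D - 2))" for n
  have "(\<lambda>n. c n / e) \<longlonglongrightarrow> 0 * inverse (e ^ (2 * D - 2)) / e"
    unfolding c_def using e by (intro tendsto_intros a) auto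
  then have "(\<lambda>n. c n / e) \<longlonglongrightarrow> 0" by simp
  then have "\<forall>\<^sub>F n in sequentially. c n / e < d / 2" using d by (intro order_tendstoD(2)) auto
  then obtain N where N: "\<And>n. n \<ge> N \<Longrightarrow> c n / e < d / 2" by (auto simp: eventually_sequentially)
  show ?thesis
  proof (intro exI allI impI)
    fix n w assume n: "N \<le> n" and w: "norm w \<le> 1 \<and> (\<forall>s>0. norm (J (B s w)) \<le> a n * inverse (s ^ (2 * D)))"
    have c0: "0 \<le> c n" using a(2) e by (simp add: c_def)
    have bd: "norm (J (B s w)) \<le> c n / s\<^sup>2" if s: "e \<le> s" for s
    proof -
      have s0: "0 < s" using s e by simp
      have "2 * D = 2 + (2 * D - 2)" using D by simp
      then have "s ^ (2 * D) = s\<^sup>2 * s ^ (2 * D - 2)" by (metis power_add)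
      then have "inverse (s ^ (2 * D)) = inverse (s ^ (2 * D - 2)) / s\<^sup>2" by (simp add: divide_inverse)
      also have "\<dots> \<le> inverse (e ^ (2 * D - 2)) / s\<^sup>2"
        using e s s0 by (intro divide_right_mono le_imp_inverse_le power_mono) auto
      finally have "a n * inverse (s ^ (2 * D)) \<le> a n * (inverse (e ^ (2 * D - 2)) / s\<^sup>2)"
        using a(2) by (rule mult_left_mono)
      then show ?thesis using w s0 by (simp add: c_def) (meson order_trans)
    qed
    have "M * norm w * e \<le> M * 1 * e" using w M0 e by (intro mult_right_mono mult_left_mono) auto
    then have "M * norm w * e \<le> M * e" by (simp only: mult_1_right)
    then have tot: "M * norm w * e + c n / e \<le> d" using Me N[OF n] by linarith
    show "(\<exists>l. ((\<lambda>t. U (- t) (B t w)) \<longlongrightarrow> l) at_top \<and> norm (l - w) \<le> d) \<and> (\<forall>t\<ge>0. norm (U (- t) (B t w) - w) \<le> d)"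
      using cook_limit[OF e bd c0] tot by (meson order_trans)
  qed
qed

end

text \<open>Adjoint form of the Hilbert-Schmidt bound: testing the left side with itself moves the
  cutoff, the evolution and \<open>A\<close> to the other argument, where \<open>bd\<close> applies,
  and one factor cancels.\<close>

lemma (in unit_window) local_decay:
  fixes v :: "'a l2"
  assumes E: "E \<in> sets borel" and b: "bddm \<chi>0" and real: "\<And>x. cnj (\<chi>0 x) = \<chi>0 x"
    and bd: "\<And>v. norm (mulop (indicator E) (A (Bev (- s) (mulop \<chi>0 v)))) \<le> c * norm v"
  shows "norm (mulop \<chi>0 (Bev s (Pop E w))) \<le> c * norm w"
proof -
  define g where "g = mulop \<chi>0 (Bev s (Pop E w))"
  have ind: "(\<lambda>x. cnj (indicator E x)) = (indicator E :: 'a \<times> 'a \<Rightarrow> complex)" by (rule ext) (simp add: indicator_def)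
  have "cinner g g = cinner (mulop (\<lambda>x. cnj (\<chi>0 x)) g) (Bev s (Pop E w))"
    unfolding cinner_mulop[OF bddm_cnj[OF b]] by (simp add: g_def)
  also have "\<dots> = cinner (Bev (- s) (mulop \<chi>0 g)) (Pop E w)"
    unfolding real using Bev_adj[of "- s" "mulop \<chi>0 g" "Pop E w"] by simp
  also have "\<dots> = cinner (mulop (indicator E) (A (Bev (- s) (mulop \<chi>0 g)))) (A w)"
    unfolding Pop cinner_mulop[OF indicator_bddm[OF E]] ind ..
  finally have "(norm g)\<^sup>2 = cmod (cinner (mulop (indicator E) (A (Bev (- s) (mulop \<chi>0 g)))) (A w))"
    unfolding cinner_self by (metis norm_of_real abs_of_nonneg zero_le_power2)
  also have "\<dots> \<le> norm (mulop (indicator E) (A (Bev (- s) (mulop \<chi>0 g)))) * norm (A w)" by (rule cmod_cinner_le)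
  also have "\<dots> \<le> (c * norm g) * norm w" unfolding A_isom by (intro mult_right_mono bd) simp
  finally have "norm g * norm g \<le> norm g * (c * norm w)" by (simp add: power2_eq_square mult_ac)
  moreover have "0 \<le> c * norm w"
  proof (cases "w = 0")
    case False
    have "0 \<le> c * norm w" using bd[of w] norm_ge_zero order_trans by blast
    then show ?thesis .
  qed simp
  ultimately have "norm g \<le> c * norm w" by (cases "norm g = 0") (auto simp: mult_le_cancel_left)
  then show ?thesis unfolding g_def .
qed

subsection \<open>Scattering of outgoing and incoming states\<close>

context unit_window
begin

lemma Pop_add: "Pop E (v + w) = Pop E v + Pop E w" if "E \<in> sets borel"
  by (rule l2_eqI) (simp add: Pop A_add mulop_add[OF indicator_bddm[OF that]] cinner_add_right)

lemma Pop_diff: "Pop E (v - w) = Pop E v - Pop E w" if "E \<in> sets borel"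
  using Pop_add[OF that, of "v - w" w] by simp

end

lemma Bev_diff: "Bev t (u - v) = Bev t u - Bev t v"
  using Bev_plus[of t "u - v" v] by simp

definition in_sector :: "(('a::euclidean_space \<times> 'b::euclidean_space) \<times> ('a \<times> 'b)) set \<Rightarrow> real \<Rightarrow> real \<Rightarrow> real \<Rightarrow> bool" where
  "in_sector E n m s \<longleftrightarrow> E \<in> sets borel \<and> E \<subseteq> sector n m s"

text \<open>Collects what the scattering argument takes from potential and window. The sector bound
  is wanted for every width R: \<open>decay\<close> uses R = r0, while
  \<open>incoming_free_decay\<close> uses slabs of arbitrary width.\<close>

locale scattering = P: potential V M + W: unit_window u Ku
  for V :: "'a::euclidean_space \<times> 'b::euclidean_space \<Rightarrow> real" and M :: real
    and u :: "'a \<times> 'b \<Rightarrow> complex" and Ku :: real +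
  fixes r0 m :: real
  assumes V_slab: "\<And>x. V x \<noteq> 0 \<Longrightarrow> norm (snd x) \<le> r0" and r0: "0 \<le> r0"
    and sector_bound: "\<And>R. 0 \<le> R \<Longrightarrow> \<exists>\<tau> n0. \<tau> \<longlonglongrightarrow> 0 \<and> (\<forall>n. 0 \<le> \<tau> n) \<and> (\<forall>n\<ge>n0. \<forall>s E v. s \<noteq> 0 \<and> in_sector E (real n) m s \<longrightarrow>
     norm (mulop (indicator E) (window.A u (Bev (- s) (mulop (slab R) v)))) \<le> \<tau> n * inverse (\<bar>s\<bar> ^ (2 * DIM('b))) * norm v)"
begin

lemma J_slab: "norm (Jev V w) \<le> M * norm (mulop (slab r0) w)"
proof -
  have "(\<lambda>x. - \<i> * complex_of_real (V x) * slab r0 x) = (\<lambda>x. - \<i> * complex_of_real (V x))"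
    using V_slab by (intro ext) (auto simp: slab_def indicator_def)
  then have "Jev V w = Jev V (mulop (slab r0) w)"
    unfolding Jev_def by (simp only: mulop_mulop[OF P.V_bddm slab_bddm])
  then show ?thesis using P.J_bd[of "mulop (slab r0) w"] by simp
qed

lemma decay:
  "\<exists>a n0. a \<longlonglongrightarrow> 0 \<and> (\<forall>n. 0 \<le> a n) \<and> (\<forall>n\<ge>n0. \<forall>s E w. s \<noteq> 0 \<and> in_sector E (real n) m s \<and> norm w \<le> 1 \<longrightarrow>
     norm (Jev V (Bev s (W.Pop E w))) \<le> a n * inverse (\<bar>s\<bar> ^ (2 * DIM('b))))"
proof -
  obtain \<tau> n0 where t: "\<tau> \<longlonglongrightarrow> 0" "\<And>n. 0 \<le> \<tau> n" and b: "\<And>n s E v. n0 \<le> n \<Longrightarrow> s \<noteq> 0 \<Longrightarrow> in_sector E (real n) m s \<Longrightarrow>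
     norm (mulop (indicator E) (W.A (Bev (- s) (mulop (slab r0) v)))) \<le> \<tau> n * inverse (\<bar>s\<bar> ^ (2 * DIM('b))) * norm v"
    using sector_bound[OF r0] by blast
  have real: "cnj (slab r0 x) = slab r0 x" for x :: "'a \<times> 'b" by (simp add: slab_def indicator_def)
  have "(\<lambda>n. M * \<tau> n) \<longlonglongrightarrow> M * 0" by (intro tendsto_intros t)
  moreover have "norm (Jev V (Bev s (W.Pop E w))) \<le> M * \<tau> n * inverse (\<bar>s\<bar> ^ (2 * DIM('b)))"
    if h: "n0 \<le> n" "s \<noteq> 0" "in_sector E (real n) m s" "norm w \<le> 1" for n s E w
  proof -
    have "norm (mulop (slab r0) (Bev s (W.Pop E w))) \<le> \<tau> n * inverse (\<bar>s\<bar> ^ (2 * DIM('b))) * norm w"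
      using h(3) by (intro W.local_decay[OF _ slab_bddm real b[OF h(1-3)]]) (simp add: in_sector_def)
    also have "\<dots> \<le> \<tau> n * inverse (\<bar>s\<bar> ^ (2 * DIM('b))) * 1"
      using h t by (intro mult_left_mono) auto
    finally have "M * norm (mulop (slab r0) (Bev s (W.Pop E w))) \<le> M * (\<tau> n * inverse (\<bar>s\<bar> ^ (2 * DIM('b))) * 1)"
      using P.M_nonneg by (rule mult_left_mono)
    then show ?thesis using J_slab[of "Bev s (W.Pop E w)"] by (simp add: mult.assoc)
  qed
  ultimately show ?thesis using t P.M_nonneg
    by (intro exI[of _ "\<lambda>n. M * \<tau> n"] exI[of _ n0]) auto
qed

lemma outgoing_wave:
  assumes d: "0 < d"
  shows "\<exists>N. \<forall>n\<ge>N. \<forall>E w. (\<forall>s>0. in_sector E (real n) m s) \<and> norm w \<le> 1 \<longrightarrow>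
     (\<exists>l. ((\<lambda>t. P.U (- t) (Bev t (W.Pop E w))) \<longlongrightarrow> l) at_top \<and> norm (l - W.Pop E w) \<le> d)"
proof -
  obtain a n0 where a: "a \<longlonglongrightarrow> 0" "\<And>n. 0 \<le> a n" and b: "\<And>n s E w. n0 \<le> n \<Longrightarrow> s \<noteq> 0 \<Longrightarrow> in_sector E (real n) m s \<Longrightarrow> norm w \<le> 1 \<Longrightarrow>
     norm (Jev V (Bev s (W.Pop E w))) \<le> a n * inverse (\<bar>s\<bar> ^ (2 * DIM('b)))"
    using decay by blast
  have D: "1 \<le> DIM('b)" by (simp add: Suc_leI)
  obtain N where N: "\<And>n w. n \<ge> N \<Longrightarrow> norm w \<le> 1 \<Longrightarrow> (\<And>s. s > 0 \<Longrightarrow> norm (Jev V (Bev s w)) \<le> a n * inverse (s ^ (2 * DIM('b)))) \<Longrightarrow>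
     \<exists>l. ((\<lambda>t. P.U (- t) (Bev t w)) \<longlongrightarrow> l) at_top \<and> norm (l - w) \<le> d"
    using P.wave_uniform[OF a D d] by blast
  show ?thesis
  proof (intro exI[of _ "max N n0"] allI impI)
    fix n w and E :: "(('a \<times> 'b) \<times> ('a \<times> 'b)) set" assume n: "max N n0 \<le> n" and h: "(\<forall>s>0. in_sector E (real n) m s) \<and> norm (w :: ('a \<times> 'b) l2) \<le> 1"
    have Em: "E \<in> sets borel" using h zero_less_one unfolding in_sector_def by blast
    have "norm (Jev V (Bev s (W.Pop E w))) \<le> a n * inverse (s ^ (2 * DIM('b)))" if "s > 0" for s
      using b[of n s E w] h n that by simp
    moreover have "norm (W.Pop E w) \<le> 1" using W.Pop_norm_le[OF Em, of w] h by linarith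
    ultimately show "\<exists>l. ((\<lambda>t. P.U (- t) (Bev t (W.Pop E w))) \<longlongrightarrow> l) at_top \<and> norm (l - W.Pop E w) \<le> d"
      using n by (intro N) auto
  qed
qed

text \<open>The outgoing argument in the time-reversed instance \<open>P.neg\<close>, transported to
  \<open>at_bot\<close>. The bound at finite times feeds \<open>incoming_vanishes\<close>.\<close>

lemma incoming_wave:
  assumes d: "0 < d"
  shows "\<exists>N. \<forall>n\<ge>N. \<forall>E w. (\<forall>s<0. in_sector E (real n) m s) \<and> norm w \<le> 1 \<longrightarrow>
     (\<exists>l. ((\<lambda>t. P.U (- t) (Bev t (W.Pop E w))) \<longlongrightarrow> l) at_bot \<and> norm (l - W.Pop E w) \<le> d)
     \<and> (\<forall>t\<ge>0. norm (P.U t (Bev (- t) (W.Pop E w)) - W.Pop E w) \<le> d)"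
proof -
  obtain a n0 where a: "a \<longlonglongrightarrow> 0" "\<And>n. 0 \<le> a n" and b: "\<And>n s E w. n0 \<le> n \<Longrightarrow> s \<noteq> 0 \<Longrightarrow> in_sector E (real n) m s \<Longrightarrow> norm w \<le> 1 \<Longrightarrow>
     norm (Jev V (Bev s (W.Pop E w))) \<le> a n * inverse (\<bar>s\<bar> ^ (2 * DIM('b)))"
    using decay by blast
  have D: "1 \<le> DIM('b)" by (simp add: Suc_leI)
  obtain N where N: "\<And>n w. n \<ge> N \<Longrightarrow> norm w \<le> 1 \<Longrightarrow> (\<And>s. s > 0 \<Longrightarrow> norm (Jev V (Bev (- s) w)) \<le> a n * inverse (s ^ (2 * DIM('b)))) \<Longrightarrow>
     (\<exists>l. ((\<lambda>t. P.U t (Bev (- t) w)) \<longlongrightarrow> l) at_top \<and> norm (l - w) \<le> d) \<and> (\<forall>t\<ge>0. norm (P.U t (Bev (- t) w) - w) \<le> d)"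
    using trotter_data.wave_uniform[OF P.neg a D d] unfolding P.neg_U minus_minus norm_minus_cancel by blast
  show ?thesis
  proof (intro exI[of _ "max N n0"] allI impI)
    fix n w and E :: "(('a \<times> 'b) \<times> ('a \<times> 'b)) set" assume n: "max N n0 \<le> n" and h: "(\<forall>s<0. in_sector E (real n) m s) \<and> norm (w :: ('a \<times> 'b) l2) \<le> 1"
    have "in_sector E (real n) m (- 1)" using h by simp
    then have Em: "E \<in> sets borel" by (simp add: in_sector_def)
    have "norm (Jev V (Bev (- s) (W.Pop E w))) \<le> a n * inverse (s ^ (2 * DIM('b)))" if "s > 0" for s
      using b[of n "- s" E w] h n that by simp
    moreover have "norm (W.Pop E w) \<le> 1" using W.Pop_norm_le[OF Em, of w] h by linarith
    ultimately have "(\<exists>l. ((\<lambda>t. P.U t (Bev (- t) (W.Pop E w))) \<longlongrightarrow> l) at_top \<and> norm (l - W.Pop E w) \<le> d)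
       \<and> (\<forall>t\<ge>0. norm (P.U t (Bev (- t) (W.Pop E w)) - W.Pop E w) \<le> d)"
      using n by (intro N) auto
    then show "(\<exists>l. ((\<lambda>t. P.U (- t) (Bev t (W.Pop E w))) \<longlongrightarrow> l) at_bot \<and> norm (l - W.Pop E w) \<le> d)
       \<and> (\<forall>t\<ge>0. norm (P.U t (Bev (- t) (W.Pop E w)) - W.Pop E w) \<le> d)"
      unfolding at_bot_mirror filterlim_filtermap by simp
  qed
qed

text \<open>Small times are handled by strong continuity of the free evolution, since the
  Hilbert-Schmidt bound degenerates as s tends to 0.\<close>

lemma incoming_free_decay:
  fixes \<psi> :: "('a \<times> 'b) l2"
  assumes d: "0 < d" and Es: "\<And>n s. s < 0 \<Longrightarrow> in_sector (E n) (real n) m s"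
  shows "\<exists>N. \<forall>n\<ge>N. \<forall>t\<ge>0. norm (W.Pop (E n) (Bev t \<psi>)) \<le> d"
proof -
  have Em: "E n \<in> sets borel" for n using Es[of "- 1" n] by (simp add: in_sector_def)
  \<comment> \<open>Each of the two cases below collects two errors smaller than d / 3.\<close>
  define d' where "d' = d / 3"
  have d': "0 < d'" using d by (simp add: d'_def)
  \<comment> \<open>\<open>sector_bound\<close> concerns states behind a slab cutoff, so
    \<open>\<psi>\<close> is approximated by its restriction to a wide slab.\<close>
  have "(\<lambda>k. mulop (slab (real k)) \<psi>) \<longlonglongrightarrow> mulop (\<lambda>x. 1) \<psi>"
  proof (rule mulop_tendsto[where K=1])
    show "slab (real k) \<in> borel_measurable lebesgue" for k using slab_bddm unfolding bddm_def by blast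
    show "cmod (slab (real k) x) \<le> 1" for k and x :: "'a \<times> 'b" by (simp add: slab_def indicator_def)
    fix x :: "'a \<times> 'b"
    obtain k0 :: nat where "norm (snd x) \<le> real k0" using real_arch_simple by blast
    then have "\<forall>k\<ge>k0. slab (real k) x = 1" by (auto simp: slab_def indicator_def)
    then show "(\<lambda>k. slab (real k) x) \<longlonglongrightarrow> 1" by (intro tendsto_eventually) (auto simp: eventually_sequentially)
  qed simp
  then have "\<forall>\<^sub>F k in sequentially. dist (mulop (slab (real k)) \<psi>) \<psi> < d'"
    unfolding mulop_1 using d' by (rule tendstoD)
  then obtain k where "dist (mulop (slab (real k)) \<psi>) \<psi> < d'" by (auto simp: eventually_sequentially)
  then have R: "norm (\<psi> - mulop (slab (real k)) \<psi>) < d'" by (simp add: dist_norm norm_minus_commute)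
  have "isCont (\<lambda>t. Bev t \<psi>) 0" using Bev_cont[of \<psi>] by (simp add: continuous_on_eq_continuous_at)
  then obtain \<epsilon> where \<epsilon>: "0 < \<epsilon>" "\<And>t. dist t 0 < \<epsilon> \<Longrightarrow> dist (Bev t \<psi>) (Bev 0 \<psi>) < d'"
    unfolding continuous_at_eps_delta using d' by blast
  have "(\<lambda>n. mulop (indicator (E n)) (W.A \<psi>)) \<longlonglongrightarrow> mulop (\<lambda>x. 0) (W.A \<psi>)"
  proof (rule mulop_tendsto[where K=1])
    show "(indicator (E n) :: _ \<Rightarrow> complex) \<in> borel_measurable lebesgue" for n
      using indicator_bddm[OF Em[of n]] unfolding bddm_def by blast
    show "cmod (indicator (E n) x) \<le> 1" for n x by (simp add: indicator_def)
    fix x :: "('a \<times> 'b) \<times> ('a \<times> 'b)"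
    obtain k0 :: nat where "norm (snd (fst x)) \<le> real k0" using real_arch_simple by blast
    \<comment> \<open>A fixed phase-space point lies outside \<open>E n\<close> once n reaches its
      perpendicular distance, so the indicators tend to 0 pointwise.\<close>
    then have "\<forall>n\<ge>k0. indicator (E n) x = (0 :: complex)"
      using Es[of "-1"] by (force simp: in_sector_def sector_def indicator_def)
    then show "(\<lambda>n. indicator (E n) x :: complex) \<longlonglongrightarrow> 0" by (intro tendsto_eventually) (auto simp: eventually_sequentially)
  qed simp
  moreover have "mulop (\<lambda>x. 0) (W.A \<psi>) = 0" by (simp add: mulop_def L2_zero)
  ultimately have "\<forall>\<^sub>F n in sequentially. norm (mulop (indicator (E n)) (W.A \<psi>)) < d'"
    using d' by (intro order_tendstoD(2)[OF tendsto_norm_zero]) auto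
  then obtain N1 where N1: "\<And>n. N1 \<le> n \<Longrightarrow> norm (mulop (indicator (E n)) (W.A \<psi>)) < d'" by (auto simp: eventually_sequentially)
  obtain \<tau> n0 where t: "\<tau> \<longlonglongrightarrow> 0" "\<And>n. 0 \<le> \<tau> n" and b: "\<And>n s E v. n0 \<le> n \<Longrightarrow> s \<noteq> 0 \<Longrightarrow> in_sector E (real n) m s \<Longrightarrow>
     norm (mulop (indicator E) (W.A (Bev (- s) (mulop (slab (real k)) v)))) \<le> \<tau> n * inverse (\<bar>s\<bar> ^ (2 * DIM('b))) * norm v"
    using sector_bound[OF of_nat_0_le_iff[of k]] by blast
  have "(\<lambda>n. \<tau> n * inverse (\<epsilon> ^ (2 * DIM('b))) * norm \<psi>) \<longlonglongrightarrow> 0 * inverse (\<epsilon> ^ (2 * DIM('b))) * norm \<psi>"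
    by (intro tendsto_intros t)
  then have "\<forall>\<^sub>F n in sequentially. \<tau> n * inverse (\<epsilon> ^ (2 * DIM('b))) * norm \<psi> < d'"
    using d' by (intro order_tendstoD(2)) auto
  then obtain N2 where N2: "\<And>n. N2 \<le> n \<Longrightarrow> \<tau> n * inverse (\<epsilon> ^ (2 * DIM('b))) * norm \<psi> < d'" by (auto simp: eventually_sequentially)
  show ?thesis
  proof (intro exI[of _ "max n0 (max N1 N2)"] allI impI)
    fix n :: nat and t :: real assume n: "max n0 (max N1 N2) \<le> n" and t0: "0 \<le> t"
    show "norm (W.Pop (E n) (Bev t \<psi>)) \<le> d"
    proof (cases "t < \<epsilon>")
      case True
      then have "norm (Bev t \<psi> - \<psi>) < d'" using \<epsilon>(2)[of t] t0 by (simp add: dist_norm Bev_0)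
      then have 1: "norm (W.Pop (E n) (Bev t \<psi>) - W.Pop (E n) \<psi>) < d'"
        using W.Pop_norm_le[OF Em, of n "Bev t \<psi> - \<psi>"] by (simp add: W.Pop_diff[OF Em])
      have 2: "norm (W.Pop (E n) \<psi>) < d'" using W.Pop_norm_le_mulop[of "E n" \<psi>] N1[of n] n by simp
      have "norm (W.Pop (E n) (Bev t \<psi>)) \<le> norm (W.Pop (E n) (Bev t \<psi>) - W.Pop (E n) \<psi>) + norm (W.Pop (E n) \<psi>)"
        using norm_triangle_ineq[of "W.Pop (E n) (Bev t \<psi>) - W.Pop (E n) \<psi>" "W.Pop (E n) \<psi>"] by simp
      also have "\<dots> \<le> d" using 1 2 d unfolding d'_def by linarith
      finally show ?thesis .
    next
      case False
      then have tp: "0 < t" using \<epsilon> by linarith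
      let ?\<chi> = "mulop (slab (real k)) \<psi>"
      have "norm (mulop (indicator (E n)) (W.A (Bev t ?\<chi>))) \<le> \<tau> n * inverse (t ^ (2 * DIM('b))) * norm \<psi>"
        using b[of n "- t" "E n" \<psi>] n tp Es[of "- t" n] by simp
      also have "\<dots> \<le> \<tau> n * inverse (\<epsilon> ^ (2 * DIM('b))) * norm \<psi>"
        using False \<epsilon> t(2)[of n] by (intro mult_right_mono mult_left_mono le_imp_inverse_le power_mono) auto
      also have "\<dots> < d'" using N2 n by simp
      finally have 1: "norm (W.Pop (E n) (Bev t ?\<chi>)) < d'" using W.Pop_norm_le_mulop[of "E n" "Bev t ?\<chi>"] by linarith
      have 2: "norm (W.Pop (E n) (Bev t \<psi>) - W.Pop (E n) (Bev t ?\<chi>)) < d'"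
        using W.Pop_norm_le[OF Em, of n "Bev t (\<psi> - ?\<chi>)"] R
        by (simp add: W.Pop_diff[OF Em, symmetric] Bev_diff[symmetric] Bev_norm)
      have "norm (W.Pop (E n) (Bev t \<psi>)) \<le> norm (W.Pop (E n) (Bev t \<psi>) - W.Pop (E n) (Bev t ?\<chi>)) + norm (W.Pop (E n) (Bev t ?\<chi>))"
        using norm_triangle_ineq[of "W.Pop (E n) (Bev t \<psi>) - W.Pop (E n) (Bev t ?\<chi>)" "W.Pop (E n) (Bev t ?\<chi>)"] by simp
      also have "\<dots> \<le> d" using 1 2 d unfolding d'_def by linarith
      finally show ?thesis .
    qed
  qed
qed

text \<open>Let g = P U(t) psi. P is self-adjoint but need not be a projection, so (norm g)^2 = <h,
  U(t) psi> with h = P g. By \<open>incoming_wave\<close>, h is close to U(t) B(-t) h uniformly in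
  t. Since U(t) is isometric and B(-t) has adjoint B(t), what remains is <g, P B(t) psi>, which
  \<open>incoming_free_decay\<close> makes small.\<close>

lemma incoming_vanishes:
  assumes Es: "\<And>n s. s < 0 \<Longrightarrow> in_sector (E n) (real n) m s"
    and t: "\<And>n. 0 < t n" and \<psi>: "norm \<psi> = 1"
  shows "(\<lambda>n. norm (W.Pop (E n) (P.U (t n) \<psi>))) \<longlonglongrightarrow> 0"
proof (rule LIMSEQ_I)
  fix e :: real assume e: "0 < e"
  \<comment> \<open>Two errors of size d then bound (norm g)^2 by e^2 / 2.\<close>
  define d where "d = e\<^sup>2 / 4"
  have d: "0 < d" using e by (simp add: d_def)
  have Em: "E n \<in> sets borel" for n using Es[of "- 1" n] by (simp add: in_sector_def)
  obtain N1 where N1: "\<And>n w s. N1 \<le> n \<Longrightarrow> norm w \<le> 1 \<Longrightarrow> 0 \<le> s \<Longrightarrow> norm (P.U s (Bev (- s) (W.Pop (E n) w)) - W.Pop (E n) w) \<le> d"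
    using incoming_wave[OF d] Es by blast
  obtain N2 where N2: "\<And>n s. N2 \<le> n \<Longrightarrow> 0 \<le> s \<Longrightarrow> norm (W.Pop (E n) (Bev s \<psi>)) \<le> d"
    using incoming_free_decay[OF d Es, of \<psi>] by blast
  show "\<exists>no. \<forall>n\<ge>no. norm (norm (W.Pop (E n) (P.U (t n) \<psi>)) - 0) < e"
  proof (intro exI[of _ "max N1 N2"] allI impI)
    fix n assume n: "max N1 N2 \<le> n"
    define T where "T = t n"
    have T: "0 \<le> T" using t[of n] by (simp add: T_def)
    define g where "g = W.Pop (E n) (P.U T \<psi>)"
    define h where "h = W.Pop (E n) g"
    have g1: "norm g \<le> 1" unfolding g_def using W.Pop_norm_le[OF Em, of n "P.U T \<psi>"] by (simp add: P.U_norm \<psi>)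
    have c1: "norm (P.U T (Bev (- T) h) - h) \<le> d" unfolding h_def using N1 n g1 T by simp
    have "(norm g)\<^sup>2 = inner g g" by (rule power2_norm_eq_inner)
    also have "\<dots> = inner h (P.U T \<psi>)"
      unfolding h_def inner_l2_def W.Pop_self_adjoint[OF Em, symmetric] by (simp add: g_def)
    also have "\<dots> = inner (P.U T (Bev (- T) h)) (P.U T \<psi>) - inner (P.U T (Bev (- T) h) - h) (P.U T \<psi>)"
      by (simp add: inner_diff_left)
    also have "inner (P.U T (Bev (- T) h)) (P.U T \<psi>) = inner (Bev (- T) h) \<psi>"
      by (rule P.isometry_inner[OF P.U_lin P.U_norm])
    also have "\<dots> = inner h (Bev T \<psi>)" using P.B_adj[of "- T" h \<psi>] by simp
    also have "\<dots> = inner g (W.Pop (E n) (Bev T \<psi>))"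
      unfolding h_def inner_l2_def W.Pop_self_adjoint[OF Em] ..
    finally have eq: "(norm g)\<^sup>2 = inner g (W.Pop (E n) (Bev T \<psi>)) - inner (P.U T (Bev (- T) h) - h) (P.U T \<psi>)" .
    have "inner g (W.Pop (E n) (Bev T \<psi>)) \<le> norm g * norm (W.Pop (E n) (Bev T \<psi>))" by (rule norm_cauchy_schwarz)
    also have "\<dots> \<le> 1 * d" using g1 N2[of n T] n T d by (intro mult_mono) auto
    finally have i1: "inner g (W.Pop (E n) (Bev T \<psi>)) \<le> d" by simp
    have "\<bar>inner (P.U T (Bev (- T) h) - h) (P.U T \<psi>)\<bar> \<le> norm (P.U T (Bev (- T) h) - h) * norm (P.U T \<psi>)"
      by (rule Cauchy_Schwarz_ineq2)
    then have i2: "\<bar>inner (P.U T (Bev (- T) h) - h) (P.U T \<psi>)\<bar> \<le> d" using c1 by (simp add: P.U_norm \<psi>)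
    have "(norm g)\<^sup>2 \<le> 2 * d" using eq i1 i2 by linarith
    also have "\<dots> < e\<^sup>2" using e by (simp add: d_def)
    finally have "norm g < e" using e by (simp add: power_less_imp_less_base)
    then show "norm (norm (W.Pop (E n) (P.U (t n) \<psi>)) - 0) < e" by (simp add: g_def T_def)
  qed
qed

end

subsection \<open>The tensor window\<close>

lemma tensor_norm:
  fixes f :: "'a::euclidean_space \<Rightarrow> complex" and g :: "'b::euclidean_space \<Rightarrow> complex"
  assumes fm [measurable]: "f \<in> borel_measurable borel" and gm [measurable]: "g \<in> borel_measurable borel"
    and f: "sq_int f" and g: "sq_int g"
  shows "sq_int (tensor f g)" "norm (L2 (tensor f g)) = norm (L2 f) * norm (L2 g)"
proof -
  note tm = tensor_meas[OF fm gm]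
  have "(\<lambda>x. ennreal ((cmod (tensor f g x))\<^sup>2)) \<in> borel_measurable borel" using tm by measurable
  note pm = borel_lborel_pair[OF this]
  have "(\<integral>\<^sup>+x. ennreal ((cmod (tensor f g x))\<^sup>2) \<partial>lborel)
     = (\<integral>\<^sup>+x. \<integral>\<^sup>+y. ennreal ((cmod (f x))\<^sup>2) * ennreal ((cmod (g y))\<^sup>2) \<partial>lborel \<partial>lborel)"
    using lborel.nn_integral_fst[OF pm] by (simp add: lborel_prod tensor_def norm_mult power_mult_distrib ennreal_mult)
  also have "\<dots> = ennreal ((norm (L2 f))\<^sup>2) * ennreal ((norm (L2 g))\<^sup>2)"
    by (simp add: nn_integral_cmult nn_integral_multc nn_norm_L2_sq f g)
  finally have e: "(\<integral>\<^sup>+x. ennreal ((cmod (tensor f g x))\<^sup>2) \<partial>lborel) = ennreal ((norm (L2 f) * norm (L2 g))\<^sup>2)"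
    by (simp add: power_mult_distrib ennreal_mult)
  show s: "sq_int (tensor f g)" by (subst sq_int_iff_nn[OF tm]) (simp add: e)
  show "norm (L2 (tensor f g)) = norm (L2 f) * norm (L2 g)"
    by (rule ennreal_sq_eqD) (use e nn_norm_L2_sq[OF s tm] in simp_all)
qed

lemma schwartz_L12:
  fixes f :: "'a::euclidean_space \<Rightarrow> complex"
  assumes "schwartz f" shows "f \<in> borel_measurable borel" "integrable lborel f" "L12 f"
proof -
  obtain b :: 'a where "b \<in> Basis" using nonempty_Basis by blast
  from schwartz_moment[OF assms this, of 0] show "f \<in> borel_measurable borel" "integrable lborel f" "L12 f" by simp_all
qed

lemma L12_tensor:
  fixes f :: "'a::euclidean_space \<Rightarrow> complex" and g :: "'b::euclidean_space \<Rightarrow> complex"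
  assumes f: "schwartz f" and g: "schwartz g"
  shows "L12 (tensor f g)"
proof -
  note f' = schwartz_L12[OF f] and g' = schwartz_L12[OF g]
  have "integrable lebesgue (tensor f g)"
    using integrable_tensor[OF f'(2) g'(2)] lebesgue_integrable_iff[OF tensor_meas[OF f'(1) g'(1)]] by simp
  then show ?thesis unfolding L12_def
    using tensor_norm(1)[OF f'(1) g'(1) L12_sq[OF f'(3)] L12_sq[OF g'(3)]] by simp
qed

lemma Gdel_tensor:
  fixes f :: "'a::euclidean_space \<Rightarrow> complex" and g :: "'b::euclidean_space \<Rightarrow> complex"
  assumes f: "integrable lborel f" and g: "integrable lborel g"
  shows "Gdel (tensor f g) \<delta> = tensor (Gdel f \<delta>) (Gdel g \<delta>)"
proof
  fix p :: "'a \<times> 'b"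
  have "- real DIM('a \<times> 'b) / 2 = - real DIM('a) / 2 + - real DIM('b) / 2"
    by (simp add: add_divide_distrib diff_divide_distrib)
  then have "\<delta> powr (- real DIM('a \<times> 'b) / 2) = \<delta> powr (- real DIM('a) / 2) * \<delta> powr (- real DIM('b) / 2)"
    by (simp only: powr_add)
  then show "Gdel (tensor f g) \<delta> p = tensor (Gdel f \<delta>) (Gdel g \<delta>) p"
    unfolding Gdel_def fourier_tensor[OF f g] tensor_def by simp
qed

lemma fourier_nonzero:
  assumes "L12 f" "norm (L2 f) \<noteq> 0" shows "\<exists>\<xi>. fourier f \<xi> \<noteq> 0"
proof (rule ccontr)
  assume "\<not> (\<exists>\<xi>. fourier f \<xi> \<noteq> 0)"
  then have "fourier f = (\<lambda>\<xi>. 0)" by auto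
  then have "FT (L2 f) = 0" using FT_L12[OF assms(1)] by (simp add: L2_zero)
  then show False using FT_norm[of "L2 f"] assms(2) by simp
qed

text \<open>The support hypothesis concerns the product. Pairing a point of one factor with a fixed
  point where the other transform is nonzero puts both coordinates in the unit ball; such a point
  exists because a nonzero class has a nonzero transform.\<close>

lemma fourier_support_factors:
  fixes f :: "'a::euclidean_space \<Rightarrow> complex" and g :: "'b::euclidean_space \<Rightarrow> complex"
  assumes f: "schwartz f" "norm (L2 f) \<noteq> 0" and g: "schwartz g" "norm (L2 g) \<noteq> 0"
    and supp: "closure {\<xi>. fourier (tensor f g) \<xi> \<noteq> 0} \<subseteq> cball 0 1"
  shows "closure {\<xi>. fourier f \<xi> \<noteq> 0} \<subseteq> cball 0 1" "closure {\<xi>. fourier g \<xi> \<noteq> 0} \<subseteq> cball 0 1"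
proof -
  note f' = schwartz_L12[OF f(1)] and g' = schwartz_L12[OF g(1)]
  obtain \<alpha> where \<alpha>: "fourier f \<alpha> \<noteq> 0" using fourier_nonzero[OF f'(3) f(2)] by blast
  obtain \<beta> where \<beta>: "fourier g \<beta> \<noteq> 0" using fourier_nonzero[OF g'(3) g(2)] by blast
  have in_supp: "norm (x, y) \<le> 1" if "fourier f x \<noteq> 0" "fourier g y \<noteq> 0" for x y
  proof -
    have "(x, y) \<in> {\<xi>. fourier (tensor f g) \<xi> \<noteq> 0}"
      using that by (simp add: fourier_tensor[OF f'(2) g'(2)] tensor_def)
    then have "(x, y) \<in> cball 0 1" by (rule subsetD[OF order_trans[OF closure_subset supp]])
    then show ?thesis by simp
  qed
  show "closure {\<xi>. fourier f \<xi> \<noteq> 0} \<subseteq> cball 0 1"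
  proof (rule closure_minimal[OF _ closed_cball], rule subsetI)
    fix x assume "x \<in> {\<xi>. fourier f \<xi> \<noteq> 0}"
    then have "norm (x, \<beta>) \<le> 1" using in_supp \<beta> by simp
    then show "x \<in> cball 0 1" using norm_fst_le[of x \<beta>] by simp
  qed
  show "closure {\<xi>. fourier g \<xi> \<noteq> 0} \<subseteq> cball 0 1"
  proof (rule closure_minimal[OF _ closed_cball], rule subsetI)
    fix y assume "y \<in> {\<xi>. fourier g \<xi> \<noteq> 0}"
    then have "norm (\<alpha>, y) \<le> 1" using in_supp \<alpha> by simp
    then show "y \<in> cball 0 1" using norm_snd_le[of y \<alpha>] by simp
  qed
qed

text \<open>The scaled transform of the perpendicular window is the smooth bump of radius
  \<open>\<delta>\<close> for nonstationary phase, and the condition relating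
  \<open>\<delta>\<close> to \<open>m\<close> excludes stationary points on far sectors.\<close>

lemma tensor_scattering:
  fixes V :: "'a::euclidean_space \<times> 'b::euclidean_space \<Rightarrow> real"
    and f :: "'a \<Rightarrow> complex" and g :: "'b \<Rightarrow> complex"
  assumes V: "V \<in> borel_measurable lebesgue" "\<And>x. \<bar>V x\<bar> \<le> M" "\<And>x. V x \<noteq> 0 \<Longrightarrow> norm (snd x) \<le> r0" and r0: "0 \<le> r0"
    and f: "schwartz f" "norm (L2 f) = 1" and g: "schwartz g" "norm (L2 g) = 1"
    and supp: "closure {\<xi>. fourier (tensor f g) \<xi> \<noteq> 0} \<subseteq> cball 0 1"
    and \<delta>: "0 < \<delta>" "8 * \<delta> * real DIM('b) \<le> m" and m: "0 < m"
  shows "\<exists>Ku. scattering V M (eta_delta (tensor f g) \<delta>) Ku r0 m"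
proof -
  note f' = schwartz_L12[OF f(1)] and g' = schwartz_L12[OF g(1)]
  have L: "L12 (tensor f g)" by (rule L12_tensor[OF f(1) g(1)])
  have fs: "closure {\<xi>. fourier f \<xi> \<noteq> 0} \<subseteq> cball 0 1" and gs: "closure {\<xi>. fourier g \<xi> \<noteq> 0} \<subseteq> cball 0 1"
    using fourier_support_factors[OF f(1) _ g(1) _ supp] f(2) g(2) by auto
  have e: "eta_delta (tensor f g) \<delta> = ifourier (tensor (Gdel f \<delta>) (Gdel g \<delta>))"
    unfolding eta_delta_Gdel Gdel_tensor[OF f'(2) g'(2)] ..
  obtain Ku where Ku: "window (eta_delta (tensor f g) \<delta>) Ku"
    using bump_window[OF Gdel_bump[OF L supp \<delta>(1)]] unfolding eta_delta_Gdel by blast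
  have n: "norm (L2 (eta_delta (tensor f g) \<delta>)) = 1"
    using Gdel_norm(2)[OF L supp \<delta>(1)] tensor_norm(2)[OF f'(1) g'(1) L12_sq[OF f'(3)] L12_sq[OF g'(3)]] f(2) g(2) by simp
  have uw: "unit_window (eta_delta (tensor f g) \<delta>) Ku"
    using Ku n by (simp add: unit_window_def unit_window_axioms_def)
  have sm: "\<exists>g'. smooth_bump b \<delta> g' \<and> g' 0 = Gdel g \<delta>" if b: "b \<in> Basis" for b
  proof -
    obtain h where h: "smooth_bump b 1 h" "h 0 = fourier g" using schwartz_smooth_bump[OF g(1) gs b] by blast
    show ?thesis
      using smooth_bump_dilate[OF h(1) \<delta>(1), of "\<delta> powr (- real DIM('b) / 2)"] h(2)
      by (intro exI conjI) (assumption, simp add: Gdel_def[abs_def])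
  qed
  have "scattering V M (eta_delta (tensor f g) \<delta>) Ku r0 m"
  proof (intro scattering.intro scattering_axioms.intro)
    show "potential V M" using V by unfold_locales
    show "unit_window (eta_delta (tensor f g) \<delta>) Ku" by (rule uw)
    fix R :: real assume R: "0 \<le> R"
    show "\<exists>\<tau> n0. \<tau> \<longlonglongrightarrow> 0 \<and> (\<forall>n. 0 \<le> \<tau> n) \<and> (\<forall>n\<ge>n0. \<forall>s E v. s \<noteq> 0 \<and> in_sector E (real n) m s \<longrightarrow>
     norm (mulop (indicator E) (window.A (eta_delta (tensor f g) \<delta>) (Bev (- s) (mulop (slab R) v)))) \<le> \<tau> n * inverse (\<bar>s\<bar> ^ (2 * DIM('b))) * norm v)"
      unfolding e in_sector_def by (rule sector_estimate[OF Gdel_bump[OF f'(3) fs \<delta>(1)] sm \<delta>(1) \<delta>(2) m R uw[unfolded e]])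
  qed (use V r0 in auto)
  then show ?thesis by blast
qed

section \<open>Phase-space regions and assembly of the theorem\<close>

lemma W_borel:
  "(W_far n m :: (('a::euclidean_space \<times> 'b::euclidean_space) \<times> ('a \<times> 'b)) set) \<in> sets borel" "(W_sur n m :: (('a::euclidean_space \<times> 'b::euclidean_space) \<times> ('a \<times> 'b)) set) \<in> sets borel"
  "(W_out n m :: (('a::euclidean_space \<times> 'b::euclidean_space) \<times> ('a \<times> 'b)) set) \<in> sets borel" "(W_in n m :: (('a::euclidean_space \<times> 'b::euclidean_space) \<times> ('a \<times> 'b)) set) \<in> sets borel"
proof -
  have far: "open (W_far n m :: (('a::euclidean_space \<times> 'b::euclidean_space) \<times> ('a \<times> 'b)) set)"
    unfolding W_far_def by (intro open_Collect_conj open_Collect_less continuous_intros)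
  then show f: "(W_far n m :: (('a \<times> 'b) \<times> ('a \<times> 'b)) set) \<in> sets borel" by (rule borel_open)
  then show "(W_sur n m :: (('a \<times> 'b) \<times> ('a \<times> 'b)) set) \<in> sets borel" unfolding W_sur_def by auto
  have "closed {z :: ('a \<times> 'b) \<times> ('a \<times> 'b). 0 \<le> snd (fst z) \<bullet> snd (snd z)}"
    by (intro closed_Collect_le continuous_intros)
  then have "W_far n m \<inter> {z :: ('a \<times> 'b) \<times> ('a \<times> 'b). 0 \<le> snd (fst z) \<bullet> snd (snd z)} \<in> sets borel"
    by (rule sets.Int[OF f borel_closed])
  then show "(W_out n m :: (('a \<times> 'b) \<times> ('a \<times> 'b)) set) \<in> sets borel" unfolding W_out_def Int_def by simp
  have "open {z :: ('a \<times> 'b) \<times> ('a \<times> 'b). snd (fst z) \<bullet> snd (snd z) < 0}"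
    by (intro open_Collect_less continuous_intros)
  then have "W_far n m \<inter> {z :: ('a \<times> 'b) \<times> ('a \<times> 'b). snd (fst z) \<bullet> snd (snd z) < 0} \<in> sets borel"
    by (rule sets.Int[OF f borel_open])
  then show "(W_in n m :: (('a \<times> 'b) \<times> ('a \<times> 'b)) set) \<in> sets borel" unfolding W_in_def Int_def by simp
qed

text \<open>One set serves all s of a given sign, which lets the limits in time be taken for a fixed
  localized state.\<close>

lemma W_sector: "0 < s \<Longrightarrow> in_sector (W_out n m) (real n) m s" "s < 0 \<Longrightarrow> in_sector (W_in n m) (real n) m s"
proof -
  assume "0 < s"
  then have "W_out n m \<subseteq> sector (real n) m s"
    by (auto simp: W_out_def W_far_def sector_def mult_nonneg_nonneg)
  then show "in_sector (W_out n m) (real n) m s" unfolding in_sector_def using W_borel(3) by blast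
next
  assume "s < 0"
  then have "W_in n m \<subseteq> sector (real n) m s"
    by (auto simp: W_in_def W_far_def sector_def mult_nonpos_nonpos)
  then show "in_sector (W_in n m) (real n) m s" unfolding in_sector_def using W_borel(4) by blast
qed

lemma LIMSEQ_norm_zeroI:
  fixes f :: "nat \<Rightarrow> real"
  assumes "\<And>d. 0 < d \<Longrightarrow> \<exists>N. \<forall>n\<ge>N. 0 \<le> f n \<and> f n \<le> d" shows "f \<longlonglongrightarrow> 0"
proof (rule LIMSEQ_I)
  fix e :: real assume "0 < e"
  then obtain N where "\<And>n. N \<le> n \<Longrightarrow> 0 \<le> f n \<and> f n \<le> e / 2" using assms[of "e / 2"] by auto
  then show "\<exists>no. \<forall>n\<ge>no. norm (f n - 0) < e" using \<open>0 < e\<close> by (intro exI[of _ N]) fastforce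
qed

theorem mainTheorem2:
  fixes V :: "(real^('k::finite)) \<times> (real^('m::finite)) \<Rightarrow> real"
    and r0 :: real
    and etaPar :: "real^'k \<Rightarrow> complex"
    and etaPerp :: "real^'m \<Rightarrow> complex"
    and m :: real
  assumes V_meas: "V \<in> borel_measurable lebesgue"
    and V_bdd: "bounded (range V)"
    and r0_pos: "r0 > 0"
    and V_supp: "closure {x. V x \<noteq> 0} \<subseteq> {x. norm (snd x) \<le> r0}"
    and etaPar_S: "schwartz etaPar" and etaPerp_S: "schwartz etaPerp"
    and etaPar_norm: "l2norm etaPar = 1" and etaPerp_norm: "l2norm etaPerp = 1"
    and eta_supp: "closure {\<xi>. fourier (tensor etaPar etaPerp) \<xi> \<noteq> 0} \<subseteq> cball 0 1"
    and m_pos: "m > 0"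
  shows "\<exists>\<delta>0>0. \<forall>\<phi> :: nat \<Rightarrow> (real^'k) \<times> (real^'m) \<Rightarrow> complex.
           (\<forall>n. sq_int (\<phi> n) \<and> l2norm (\<phi> n) = 1) \<longrightarrow>
           (\<forall>\<delta>. 0 < \<delta> \<and> \<delta> < \<delta>0 \<longrightarrow>
             (let \<eta> = tensor etaPar etaPerp;
                  out = (\<lambda>n. P_delta \<eta> \<delta> (W_out n m) (\<phi> n));
                  inn = (\<lambda>n. P_delta \<eta> \<delta> (W_in n m) (\<phi> n));
                  sur = (\<lambda>n. P_delta \<eta> \<delta> (W_sur n m) (\<phi> n))
              in (\<forall>n. l2eq (\<phi> n) (\<lambda>x. out n x + inn n x + sur n x)) \<and>
                 (\<forall>n. l2eq (P_delta \<eta> \<delta> (W_far n m) (\<phi> n)) (\<lambda>x. out n x + inn n x)) \<and>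
                 (\<lambda>n. l2norm (\<lambda>x. wave_minus V (out n) x - out n x)) \<longlonglongrightarrow> 0 \<and>
                 (\<lambda>n. l2norm (\<lambda>x. wave_plus V (inn n) x - inn n x)) \<longlonglongrightarrow> 0 \<and>
                 (\<forall>\<psi> t. sq_int \<psi> \<and> (\<forall>n. t n > 0) \<and>
                        (\<forall>n. l2eq (\<phi> n) (schr_evol V (t n) \<psi>)) \<longrightarrow>
                        (\<lambda>n. l2norm (inn n)) \<longlonglongrightarrow> 0)))"
proof -
  \<comment> \<open>Below this value \<open>8 * \<delta> * DIM <= m\<close> holds in the
    perpendicular dimension; the choice is made before the sequence of states is given.\<close>
  define \<delta>0 where "\<delta>0 = m / (8 * real DIM(real^'m))"
  have D: "0 < real DIM(real^'m)" by simp
  have \<delta>0: "0 < \<delta>0" unfolding \<delta>0_def using m_pos D by (intro divide_pos_pos) auto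
  obtain M where M: "\<And>x. \<bar>V x\<bar> \<le> M" using V_bdd unfolding bounded_iff by auto
  have Vs: "norm (snd x) \<le> r0" if "V x \<noteq> 0" for x
    using that V_supp closure_subset[of "{x. V x \<noteq> 0}"] by (metis (mono_tags, lifting) mem_Collect_eq subsetD)
  have nf: "norm (L2 etaPar) = 1" and ng: "norm (L2 etaPerp) = 1"
    using etaPar_norm etaPerp_norm L12_sq[OF schwartz_L12(3)[OF etaPar_S]] L12_sq[OF schwartz_L12(3)[OF etaPerp_S]]
    by (simp_all add: norm_L2)
  define \<eta> where "\<eta> = tensor etaPar etaPerp"
  show ?thesis
    unfolding Let_def \<eta>_def[symmetric]
  proof (rule exI[of _ \<delta>0], rule conjI[OF \<delta>0], rule allI, rule impI, rule allI, rule impI, intro conjI)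
    fix \<phi> :: "nat \<Rightarrow> (real^'k) \<times> (real^'m) \<Rightarrow> complex" and \<delta> :: real
    assume \<phi>: "\<forall>n. sq_int (\<phi> n) \<and> l2norm (\<phi> n) = 1" and \<delta>: "0 < \<delta> \<and> \<delta> < \<delta>0"
    have "8 * d * D' \<le> m" if "0 < D'" "d < m / (8 * D')" for d D' :: real
      using that by (simp add: field_simps)
    from this[OF D] have "8 * \<delta> * real DIM(real^'m) \<le> m" using \<delta> unfolding \<delta>0_def by blast
    then obtain Ku where sc: "scattering V M (eta_delta \<eta> \<delta>) Ku r0 m"
      using tensor_scattering[OF V_meas M Vs _ etaPar_S nf etaPerp_S ng eta_supp _ _ m_pos] \<delta> r0_pos
      unfolding \<eta>_def by auto
    interpret S: scattering V M "eta_delta \<eta> \<delta>" Ku r0 m by (rule sc)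
    note Pd = S.W.P_delta_Pop[OF refl]
    define out where "out n = P_delta \<eta> \<delta> (W_out n m) (\<phi> n)" for n
    define inn where "inn n = P_delta \<eta> \<delta> (W_in n m) (\<phi> n)" for n
    define sur where "sur n = P_delta \<eta> \<delta> (W_sur n m) (\<phi> n)" for n
    have s\<phi>: "sq_int (\<phi> n)" and n\<phi>: "norm (L2 (\<phi> n)) = 1" for n using \<phi> by (auto simp: norm_L2)
    have so: "sq_int (out n)" "L2 (out n) = S.W.Pop (W_out n m) (L2 (\<phi> n))" for n
      unfolding out_def by (rule Pd[OF W_borel(3) s\<phi>])+
    have si: "sq_int (inn n)" "L2 (inn n) = S.W.Pop (W_in n m) (L2 (\<phi> n))" for n
      unfolding inn_def by (rule Pd[OF W_borel(4) s\<phi>])+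
    have ss: "sq_int (sur n)" "L2 (sur n) = S.W.Pop (W_sur n m) (L2 (\<phi> n))" for n
      unfolding sur_def by (rule Pd[OF W_borel(2) s\<phi>])+
    have far: "S.W.Pop (W_far n m) w = S.W.Pop (W_out n m) w + S.W.Pop (W_in n m) w" for n w
    proof -
      have u: "W_far n m = W_out n m \<union> W_in n m" "W_out n m \<inter> W_in n m = {}"
        by (auto simp: W_out_def W_in_def)
      show ?thesis unfolding u(1) by (rule S.W.Pop_Un[OF W_borel(3) W_borel(4) u(2)])
    qed
    have all: "w = S.W.Pop (W_out n m) w + S.W.Pop (W_in n m) w + S.W.Pop (W_sur n m) w" for n w
    proof -
      have u: "W_far n m \<union> W_sur n m = UNIV" "W_far n m \<inter> W_sur n m = {}" by (auto simp: W_sur_def)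
      show ?thesis using S.W.Pop_Un[OF W_borel(1) W_borel(2) u(2), of w] unfolding u(1) S.W.Pop_UNIV far by simp
    qed
    show "\<forall>n. l2eq (\<phi> n) (\<lambda>x. P_delta \<eta> \<delta> (W_out n m) (\<phi> n) x + P_delta \<eta> \<delta> (W_in n m) (\<phi> n) x + P_delta \<eta> \<delta> (W_sur n m) (\<phi> n) x)"
      unfolding out_def[symmetric] inn_def[symmetric] sur_def[symmetric]
    proof
      fix n
      have "L2 (\<lambda>x. out n x + inn n x + sur n x) = L2 (out n) + L2 (inn n) + L2 (sur n)"
        by (simp add: L2_add sq_int_add so(1) si(1) ss(1))
      then have "L2 (\<phi> n) = L2 (\<lambda>x. out n x + inn n x + sur n x)"
        unfolding so si ss using all by metis
      then show "l2eq (\<phi> n) (\<lambda>x. out n x + inn n x + sur n x)"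
        by (simp add: L2_eq_iff s\<phi> sq_int_add so(1) si(1) ss(1))
    qed
    show "\<forall>n. l2eq (P_delta \<eta> \<delta> (W_far n m) (\<phi> n)) (\<lambda>x. P_delta \<eta> \<delta> (W_out n m) (\<phi> n) x + P_delta \<eta> \<delta> (W_in n m) (\<phi> n) x)"
      unfolding out_def[symmetric] inn_def[symmetric]
    proof
      fix n
      have "L2 (\<lambda>x. out n x + inn n x) = L2 (out n) + L2 (inn n)" by (simp add: L2_add so(1) si(1))
      then have "L2 (P_delta \<eta> \<delta> (W_far n m) (\<phi> n)) = L2 (\<lambda>x. out n x + inn n x)"
        unfolding so si Pd(2)[OF W_borel(1) s\<phi>] far by simp
      then show "l2eq (P_delta \<eta> \<delta> (W_far n m) (\<phi> n)) (\<lambda>x. out n x + inn n x)"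
        by (simp add: L2_eq_iff Pd(1)[OF W_borel(1) s\<phi>] sq_int_add so(1) si(1))
    qed
    show "(\<lambda>n. l2norm (\<lambda>x. wave_minus V (P_delta \<eta> \<delta> (W_out n m) (\<phi> n)) x - P_delta \<eta> \<delta> (W_out n m) (\<phi> n) x)) \<longlonglongrightarrow> 0"
      unfolding out_def[symmetric]
    proof (rule LIMSEQ_norm_zeroI)
      fix d :: real assume "0 < d"
      from S.outgoing_wave[OF this] obtain N where N: "\<And>n E w. N \<le> n \<Longrightarrow> (\<And>s. s > 0 \<Longrightarrow> in_sector E (real n) m s) \<Longrightarrow> norm w \<le> 1 \<Longrightarrow>
         \<exists>l. ((\<lambda>t. S.P.U (- t) (Bev t (S.W.Pop E w))) \<longlongrightarrow> l) at_top \<and> norm (l - S.W.Pop E w) \<le> d"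
        by blast
      show "\<exists>N. \<forall>n\<ge>N. 0 \<le> l2norm (\<lambda>x. wave_minus V (out n) x - out n x) \<and> l2norm (\<lambda>x. wave_minus V (out n) x - out n x) \<le> d"
      proof (intro exI[of _ N] allI impI)
        fix n assume "N \<le> n"
        then obtain l where l: "((\<lambda>t. S.P.U (- t) (Bev t (L2 (out n)))) \<longlongrightarrow> l) at_top" "norm (l - L2 (out n)) \<le> d"
          using N[of n "W_out n m" "L2 (\<phi> n)"] W_sector(1) n\<phi> unfolding so(2) by auto
        from S.P.wave_limit(1)[OF so(1) l(1)]
        have "l2norm (\<lambda>x. wave_minus V (out n) x - out n x) = norm (l - L2 (out n))" by (simp add: l2norm_diff so(1))
        then show "0 \<le> l2norm (\<lambda>x. wave_minus V (out n) x - out n x) \<and> l2norm (\<lambda>x. wave_minus V (out n) x - out n x) \<le> d"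
          using l(2) by simp
      qed
    qed
    show "(\<lambda>n. l2norm (\<lambda>x. wave_plus V (P_delta \<eta> \<delta> (W_in n m) (\<phi> n)) x - P_delta \<eta> \<delta> (W_in n m) (\<phi> n) x)) \<longlonglongrightarrow> 0"
      unfolding inn_def[symmetric]
    proof (rule LIMSEQ_norm_zeroI)
      fix d :: real assume "0 < d"
      from S.incoming_wave[OF this] obtain N where N: "\<And>n E w. N \<le> n \<Longrightarrow> (\<And>s. s < 0 \<Longrightarrow> in_sector E (real n) m s) \<Longrightarrow> norm w \<le> 1 \<Longrightarrow>
         \<exists>l. ((\<lambda>t. S.P.U (- t) (Bev t (S.W.Pop E w))) \<longlongrightarrow> l) at_bot \<and> norm (l - S.W.Pop E w) \<le> d"
        by blast
      show "\<exists>N. \<forall>n\<ge>N. 0 \<le> l2norm (\<lambda>x. wave_plus V (inn n) x - inn n x) \<and> l2norm (\<lambda>x. wave_plus V (inn n) x - inn n x) \<le> d"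
      proof (intro exI[of _ N] allI impI)
        fix n assume "N \<le> n"
        then obtain l where l: "((\<lambda>t. S.P.U (- t) (Bev t (L2 (inn n)))) \<longlongrightarrow> l) at_bot" "norm (l - L2 (inn n)) \<le> d"
          using N[of n "W_in n m" "L2 (\<phi> n)"] W_sector(2) n\<phi> unfolding si(2) by auto
        from S.P.wave_limit(2)[OF si(1) l(1)]
        have "l2norm (\<lambda>x. wave_plus V (inn n) x - inn n x) = norm (l - L2 (inn n))" by (simp add: l2norm_diff si(1))
        then show "0 \<le> l2norm (\<lambda>x. wave_plus V (inn n) x - inn n x) \<and> l2norm (\<lambda>x. wave_plus V (inn n) x - inn n x) \<le> d"
          using l(2) by simp
      qed
    qed
    show "\<forall>\<psi> t. sq_int \<psi> \<and> (\<forall>n. 0 < t n) \<and> (\<forall>n. l2eq (\<phi> n) (schr_evol V (t n) \<psi>)) \<longrightarrow>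
       (\<lambda>n. l2norm (P_delta \<eta> \<delta> (W_in n m) (\<phi> n))) \<longlonglongrightarrow> 0"
    proof (intro allI impI)
    fix \<psi> t assume h: "sq_int \<psi> \<and> (\<forall>n. 0 < t n) \<and> (\<forall>n. l2eq (\<phi> n) (schr_evol V (t n) \<psi>))"
    have U: "L2 (\<phi> n) = S.P.U (t n) (L2 \<psi>)" for n
      using h S.P.schr_evol[of \<psi> "t n"] L2_eq_iff[OF s\<phi>] by metis
    \<comment> \<open>The full evolution is isometric, so the unit norm of the state at index 0
      passes to the initial state.\<close>
    have "norm (L2 \<psi>) = 1" using n\<phi>[of 0] unfolding U S.P.U_norm .
    then have "(\<lambda>n. norm (S.W.Pop (W_in n m) (S.P.U (t n) (L2 \<psi>)))) \<longlonglongrightarrow> 0"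
      using h by (intro S.incoming_vanishes W_sector(2)) auto
    then show "(\<lambda>n. l2norm (P_delta \<eta> \<delta> (W_in n m) (\<phi> n))) \<longlonglongrightarrow> 0"
      unfolding inn_def[symmetric] by (simp add: norm_L2[symmetric] si U)
    qed
  qed
qed

end
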